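(* Let $k$ be an algebraically closed field and let $E_1^m,E_2^m,E_3^m,E_4^m$ ($m\ge 0$), $M$, $M'$ be the exceptional representations of the quiver $Q_1$ described in the context. The full exceptional collections in $Rep_k(Q_1)$, up to isomorphism, are ($m\in\mathbb N=\{0,1,2,\dots\}$): $(E_1^{m+1},E_1^m,M)$, $(E_1^{m+1},E_4^m,E_1^m)$, $(E_1^{m+1},M,E_4^m)$; $(E_1^0,E_2^0,M)$, $(E_1^0,E_3^0,E_2^0)$, $(E_1^0,M,E_3^0)$; $(E_2^m,E_2^{m+1},M)$, $(E_2^m,E_3^{m+1},E_2^{m+1})$, $(E_2^m,M,E_3^{m+1})$; $(E_3^m,E_2^m,E_3^{m+1})$, $(E_3^m,E_3^{m+1},M')$, $(E_3^m,M',E_2^m)$; $(E_4^{m+1},E_4^m,M')$, $(E_4^{m+1},E_1^{m+1},E_4^m)$, $(E_4^{m+1},M',E_1^{m+1})$; $(E_4^0,E_1^0,E_3^0)$, $(E_4^0,E_3^0,M')$, $(E_4^0,M',E_1^0)$; $(M,E_3^m,E_3^{m+1})$, $(M,E_4^{m+1},E_4^m)$, $(M,E_4^0,E_3^0)$; $(M',E_1^{m+1},E_1^m)$, $(M',E_2^m,E_2^{m+1})$, $(M',E_1^0,E_2^0)$.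
   Context: $Q_1$ is the quiver with vertices $b,mid,e$ and arrows $b\to e$, $b\to mid$, $mid\to e$; $Rep_k(Q_1)$ is its category of finite-dimensional $k$-representations. An exceptional collection in $Rep_k(Q_1)$ is a sequence $(A_0,\dots,A_n)$ of exceptional objects ($\mathrm{Hom}(A_i,A_i)=k$, $\mathrm{Ext}^p(A_i,A_i)=0$ for $p\ne0$) of $Rep_k(Q_1)$ with $\mathrm{Ext}^p(A_i,A_j)=0$ for all $p\ge0$ and $i>j$; it is full if it generates $D^b(Rep_k(Q_1))$ as a triangulated category. A representation is given by spaces $(V_b,V_{mid},V_e)$ and maps $(V_b\to V_e, V_b\to V_{mid}, V_{mid}\to V_e)$: $E_1^m$: $(k^{m+1},k^m,k^m)$, $(\pi_+^m,\pi_-^m,\mathrm{Id})$; $E_2^m$: $(k^{m},k^{m+1},k^{m+1})$, $(j_+^m,j_-^m,\mathrm{Id})$; $E_3^m$: $(k^{m},k^{m},k^{m+1})$, $(j_+^m,\mathrm{Id},j_-^m)$; $E_4^m$: $(k^{m+1},k^{m+1},k^{m})$, $(\pi_+^m,\mathrm{Id},\pi_-^m)$; $M$: $(0,k,0)$, zero maps; $M'$: $(k,0,k)$, $(\mathrm{Id},0,0)$. Here $\pi_+^m(a_1,\dots,a_{m+1})=(a_1,\dots,a_m)$, $\pi_-^m(a_1,\dots,a_{m+1})=(a_2,\dots,a_{m+1})$, $j_+^m(a_1,\dots,a_m)=(a_1,\dots,a_m,0)$, $j_-^m(a_1,\dots,a_m)=(0,a_1,\dots,a_m)$ (zero maps for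 $m=0$). *)

theory Defs
  imports
    "HOL-Computational_Algebra.Polynomial"
    "Jordan_Normal_Form.Matrix"
begin

section \<open>Finite-dimensional representations of the quiver\<close>

datatype vertex = Vb | Vmid | Ve

datatype arrow = BE | BM | ME

fun src :: "arrow \<Rightarrow> vertex" where
  "src BE = Vb" | "src BM = Vb" | "src ME = Vmid"

fun tgt :: "arrow \<Rightarrow> vertex" where
  "tgt BE = Ve" | "tgt BM = Vmid" | "tgt ME = Ve"

text \<open>
  The space at a vertex \<open>v\<close> is the coordinate space \<open>carrier_vec (rdim V v)\<close> and linear maps are
  matrices. Every finite-dimensional representation is isomorphic to one of these.
\<close>

record 'k rep =
  rdim :: "vertex \<Rightarrow> nat"
  rmap :: "arrow \<Rightarrow> 'k mat"

type_synonym 'k mor = "vertex \<Rightarrow> 'k mat"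

definition is_rep :: "'k::field rep \<Rightarrow> bool" where
  "is_rep V \<longleftrightarrow> (\<forall>a. rmap V a \<in> carrier_mat (rdim V (tgt a)) (rdim V (src a)))"

definition rhom :: "'k::field rep \<Rightarrow> 'k rep \<Rightarrow> 'k mor set" where
  "rhom V W = {f. (\<forall>v. f v \<in> carrier_mat (rdim W v) (rdim V v)) \<and>
                  (\<forall>a. f (tgt a) * rmap V a = rmap W a * f (src a))}"

definition mid :: "'k::field rep \<Rightarrow> 'k mor" where
  "mid V = (\<lambda>v. 1\<^sub>m (rdim V v))"

definition mzero :: "'k::field rep \<Rightarrow> 'k rep \<Rightarrow> 'k mor" where
  "mzero V W = (\<lambda>v. 0\<^sub>m (rdim W v) (rdim V v))"

definition mcomp :: "'k::field mor \<Rightarrow> 'k mor \<Rightarrow> 'k mor" (infixl "\<star>" 70) where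
  "g \<star> f = (\<lambda>v. g v * f v)"

definition mscale :: "'k::field \<Rightarrow> 'k mor \<Rightarrow> 'k mor" where
  "mscale c f = (\<lambda>v. c \<cdot>\<^sub>m f v)"

definition rep_iso :: "'k::field rep \<Rightarrow> 'k rep \<Rightarrow> bool" where
  "rep_iso V W \<longleftrightarrow> is_rep V \<and> is_rep W \<and>
     (\<exists>f\<in>rhom V W. \<exists>g\<in>rhom W V. g \<star> f = mid V \<and> f \<star> g = mid W)"

definition rzero :: "'k::field rep" where
  "rzero = \<lparr>rdim = (\<lambda>_. 0), rmap = (\<lambda>_. 0\<^sub>m 0 0)\<rparr>"

definition rsum :: "'k::field rep \<Rightarrow> 'k rep \<Rightarrow> 'k rep" where
  "rsum V W = \<lparr>rdim = (\<lambda>v. rdim V v + rdim W v),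
     rmap = (\<lambda>a. four_block_mat
        (rmap V a) (0\<^sub>m (rdim V (tgt a)) (rdim W (src a)))
        (0\<^sub>m (rdim W (tgt a)) (rdim V (src a))) (rmap W a))\<rparr>"


section \<open>Ext groups and exceptional collections\<close>

definition msurj :: "'k::field rep \<Rightarrow> 'k rep \<Rightarrow> 'k mor \<Rightarrow> bool" where
  "msurj V W f \<longleftrightarrow>
     (\<forall>v. \<forall>y\<in>carrier_vec (rdim W v). \<exists>x\<in>carrier_vec (rdim V v). y = f v *\<^sub>v x)"

definition mexact :: "'k::field rep \<Rightarrow> 'k rep \<Rightarrow> 'k rep \<Rightarrow> 'k mor \<Rightarrow> 'k mor \<Rightarrow> bool" where
  "mexact U V W f g \<longleftrightarrow>
     (\<forall>v. \<forall>x\<in>carrier_vec (rdim V v).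
        g v *\<^sub>v x = 0\<^sub>v (rdim W v) \<longleftrightarrow> (\<exists>y\<in>carrier_vec (rdim U v). x = f v *\<^sub>v y))"

definition projective :: "'k::field rep \<Rightarrow> bool" where
  "projective P \<longleftrightarrow> is_rep P \<and>
     (\<forall>V W. \<forall>g\<in>rhom V W. \<forall>h\<in>rhom P W.
        is_rep V \<longrightarrow> is_rep W \<longrightarrow> msurj V W g \<longrightarrow> (\<exists>l\<in>rhom P V. g \<star> l = h))"

definition projective_resolution ::
  "'k::field rep \<Rightarrow> (nat \<Rightarrow> 'k rep) \<Rightarrow> (nat \<Rightarrow> 'k mor) \<Rightarrow> 'k mor \<Rightarrow> bool" where
  "projective_resolution A P d e \<longleftrightarrow>
     (\<forall>n. projective (P n)) \<and>
     (\<forall>n. d n \<in> rhom (P (Suc n)) (P n)) \<and>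
     e \<in> rhom (P 0) A \<and> msurj (P 0) A e \<and>
     mexact (P 1) (P 0) A (d 0) e \<and>
     (\<forall>n. mexact (P (Suc (Suc n))) (P (Suc n)) (P n) (d (Suc n)) (d n))"

definition ext_cocycles ::
  "(nat \<Rightarrow> 'k::field rep) \<Rightarrow> (nat \<Rightarrow> 'k mor) \<Rightarrow> 'k rep \<Rightarrow> nat \<Rightarrow> 'k mor set" where
  "ext_cocycles P d B p = {f \<in> rhom (P p) B. f \<star> d p = mzero (P (Suc p)) B}"

fun ext_coboundaries ::
  "(nat \<Rightarrow> 'k::field rep) \<Rightarrow> (nat \<Rightarrow> 'k mor) \<Rightarrow> 'k rep \<Rightarrow> nat \<Rightarrow> 'k mor set" where
  "ext_coboundaries P d B 0 = {mzero (P 0) B}"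
| "ext_coboundaries P d B (Suc p) = {g \<star> d p | g. g \<in> rhom (P p) B}"

text \<open>
  Vanishing of \<open>Ext^p(A,B)\<close>, the \<open>p\<close>-th cohomology of \<open>Hom(P,B)\<close> for a projective
  resolution \<open>P\<close> of \<open>A\<close>; by the comparison theorem the choice of \<open>P\<close> is immaterial.
  For \<open>p = 0\<close> this says that \<open>Hom(A,B) = 0\<close>.
\<close>

definition ext_vanishes :: "nat \<Rightarrow> 'k::field rep \<Rightarrow> 'k rep \<Rightarrow> bool" where
  "ext_vanishes p A B \<longleftrightarrow>
     (\<exists>P d e. projective_resolution A P d e \<and> ext_cocycles P d B p = ext_coboundaries P d B p)"

text \<open>\<open>Hom(A,A) = k\<close> means that \<open>c \<mapsto> c \<cdot> id\<close> identifies \<open>k\<close> with the endomorphisms of \<open>A\<close>.\<close>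

definition exceptional :: "'k::field rep \<Rightarrow> bool" where
  "exceptional A \<longleftrightarrow> is_rep A \<and>
     bij_betw (\<lambda>c. mscale c (mid A)) UNIV (rhom A A) \<and>
     (\<forall>p. p \<noteq> 0 \<longrightarrow> ext_vanishes p A A)"

definition exceptional_collection :: "'k::field rep list \<Rightarrow> bool" where
  "exceptional_collection As \<longleftrightarrow> As \<noteq> [] \<and>
     (\<forall>A\<in>set As. exceptional A) \<and>
     (\<forall>i j p. j < i \<longrightarrow> i < length As \<longrightarrow> ext_vanishes p (As ! i) (As ! j))"


section \<open>The bounded derived category\<close>

text \<open>Cochain complexes: the differential \<open>df X n\<close> goes from \<open>ob X n\<close> to \<open>ob X (n + 1)\<close>.\<close>

record 'k cpx =
  ob :: "int \<Rightarrow> 'k rep"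
  df :: "int \<Rightarrow> 'k mor"

type_synonym 'k cmor = "int \<Rightarrow> 'k mor"

definition bcomplex :: "'k::field cpx \<Rightarrow> bool" where
  "bcomplex X \<longleftrightarrow>
     (\<forall>n. is_rep (ob X n)) \<and>
     (\<forall>n. df X n \<in> rhom (ob X n) (ob X (n + 1))) \<and>
     (\<forall>n. df X (n + 1) \<star> df X n = mzero (ob X n) (ob X (n + 2))) \<and>
     (\<exists>N. \<forall>n. \<bar>n\<bar> > N \<longrightarrow> (\<forall>v. rdim (ob X n) v = 0))"

definition chain_maps :: "'k::field cpx \<Rightarrow> 'k cpx \<Rightarrow> 'k cmor set" where
  "chain_maps X Y = {f. (\<forall>n. f n \<in> rhom (ob X n) (ob Y n)) \<and>
                        (\<forall>n. f (n + 1) \<star> df X n = df Y n \<star> f n)}"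

definition cid :: "'k::field cpx \<Rightarrow> 'k cmor" where
  "cid X = (\<lambda>n. mid (ob X n))"

definition ccomp :: "'k::field cmor \<Rightarrow> 'k cmor \<Rightarrow> 'k cmor" (infixl "\<star>\<^sub>c" 70) where
  "g \<star>\<^sub>c f = (\<lambda>n. g n \<star> f n)"

definition homotopic :: "'k::field cpx \<Rightarrow> 'k cpx \<Rightarrow> 'k cmor \<Rightarrow> 'k cmor \<Rightarrow> bool" where
  "homotopic X Y f g \<longleftrightarrow>
     (\<exists>h. (\<forall>n. h n \<in> rhom (ob X n) (ob Y (n - 1))) \<and>
          (\<forall>n v. f n v = g n v + ((df Y (n - 1) \<star> h n) v + (h (n + 1) \<star> df X n) v)))"

definition cocycles :: "'k::field cpx \<Rightarrow> int \<Rightarrow> vertex \<Rightarrow> 'k vec set" where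
  "cocycles X n v =
     {x \<in> carrier_vec (rdim (ob X n) v). df X n v *\<^sub>v x = 0\<^sub>v (rdim (ob X (n + 1)) v)}"

definition coboundaries :: "'k::field cpx \<Rightarrow> int \<Rightarrow> vertex \<Rightarrow> 'k vec set" where
  "coboundaries X n v = (\<lambda>x. df X (n - 1) v *\<^sub>v x) ` carrier_vec (rdim (ob X (n - 1)) v)"

text \<open>
  The two conjuncts are injectivity and surjectivity of the map induced by \<open>f\<close> on the quotients
  \<open>cocycles / coboundaries\<close>. An isomorphism of representations is a morphism that is bijective
  at every vertex.
\<close>

definition quasi_isos :: "'k::field cpx \<Rightarrow> 'k cpx \<Rightarrow> 'k cmor set" where
  "quasi_isos X Y = {f \<in> chain_maps X Y. \<forall>n v.
     (\<forall>x\<in>cocycles X n v. f n v *\<^sub>v x \<in> coboundaries Y n v \<longrightarrow> x \<in> coboundaries X n v) \<and>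
     (\<forall>y\<in>cocycles Y n v. \<exists>x\<in>cocycles X n v. y - f n v *\<^sub>v x \<in> coboundaries Y n v)}"

text \<open>
  Morphisms \<open>X \<rightarrow> Y\<close> of the derived category are classes of roofs \<open>X \<leftarrow> Z \<rightarrow> Y\<close>, written
  \<open>(Z, s, f)\<close>, whose left leg \<open>s\<close> is a quasi-isomorphism: the calculus of fractions in the
  homotopy category of bounded complexes.
\<close>

type_synonym 'k roof = "'k cpx \<times> 'k cmor \<times> 'k cmor"

definition roofs :: "'k::field cpx \<Rightarrow> 'k cpx \<Rightarrow> 'k roof set" where
  "roofs X Y = {(Z, s, f). bcomplex Z \<and> s \<in> quasi_isos Z X \<and> f \<in> chain_maps Z Y}"

fun roof_eq :: "'k::field cpx \<Rightarrow> 'k cpx \<Rightarrow> 'k roof \<Rightarrow> 'k roof \<Rightarrow> bool" where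
  "roof_eq X Y (Z, s, f) (Z', s', f') \<longleftrightarrow>
     (\<exists>W. \<exists>a\<in>chain_maps W Z. \<exists>b\<in>chain_maps W Z'. bcomplex W \<and>
        s \<star>\<^sub>c a \<in> quasi_isos W X \<and>
        homotopic W X (s \<star>\<^sub>c a) (s' \<star>\<^sub>c b) \<and>
        homotopic W Y (f \<star>\<^sub>c a) (f' \<star>\<^sub>c b))"

text \<open>
  \<open>roof_comp Y \<phi> \<psi> \<chi>\<close>: the roof \<open>\<chi>\<close> represents \<open>\<psi>\<close> after \<open>\<phi>\<close>, where \<open>\<phi>\<close> ends at \<open>Y\<close> and
  \<open>\<psi>\<close> starts at \<open>Y\<close>. Such a \<open>\<chi>\<close> exists and is unique up to \<open>roof_eq\<close>.
\<close>

fun roof_comp :: "'k::field cpx \<Rightarrow> 'k roof \<Rightarrow> 'k roof \<Rightarrow> 'k roof \<Rightarrow> bool" where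
  "roof_comp Y (Z, s, f) (W, t, g) \<chi> \<longleftrightarrow>
     (\<exists>V. \<exists>u\<in>quasi_isos V Z. \<exists>w\<in>chain_maps V W. bcomplex V \<and>
        homotopic V Y (f \<star>\<^sub>c u) (t \<star>\<^sub>c w) \<and>
        \<chi> = (V, s \<star>\<^sub>c u, g \<star>\<^sub>c w))"

definition roof_id :: "'k::field cpx \<Rightarrow> 'k roof" where
  "roof_id X = (X, cid X, cid X)"

definition derived_iso :: "'k::field cpx \<Rightarrow> 'k cpx \<Rightarrow> bool" where
  "derived_iso X Y \<longleftrightarrow> bcomplex X \<and> bcomplex Y \<and>
     (\<exists>\<phi>\<in>roofs X Y. \<exists>\<psi>\<in>roofs Y X.
        (\<exists>\<chi>. roof_comp Y \<phi> \<psi> \<chi> \<and> roof_eq X X \<chi> (roof_id X)) \<and>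
        (\<exists>\<chi>. roof_comp X \<psi> \<phi> \<chi> \<and> roof_eq Y Y \<chi> (roof_id Y)))"

definition shift :: "int \<Rightarrow> 'k::field cpx \<Rightarrow> 'k cpx" where
  "shift p X = \<lparr>ob = (\<lambda>n. ob X (n + p)),
     df = (\<lambda>n. if even p then df X (n + p) else mscale (- 1) (df X (n + p)))\<rparr>"

text \<open>Degree \<open>n\<close> of the mapping cone of \<open>f : X \<rightarrow> Y\<close> is \<open>X (n + 1) \<oplus> Y n\<close>.\<close>

definition mapping_cone :: "'k::field cpx \<Rightarrow> 'k cpx \<Rightarrow> 'k cmor \<Rightarrow> 'k cpx" where
  "mapping_cone X Y f = \<lparr>ob = (\<lambda>n. rsum (ob X (n + 1)) (ob Y n)),
     df = (\<lambda>n v. four_block_mat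
        (mscale (- 1) (df X (n + 1)) v) (0\<^sub>m (rdim (ob X (n + 2)) v) (rdim (ob Y n) v))
        (f (n + 1) v) (df Y n v))\<rparr>"

text \<open>
  There is a distinguished triangle \<open>X \<rightarrow> Y \<rightarrow> Z \<rightarrow> X[1]\<close>, that is, one isomorphic in the derived
  category to the triangle of a mapping cone. Since only the existence of the three arrows is
  claimed, they can be transported along the isomorphisms of the objects.
\<close>

definition dist_triangle :: "'k::field cpx \<Rightarrow> 'k cpx \<Rightarrow> 'k cpx \<Rightarrow> bool" where
  "dist_triangle X Y Z \<longleftrightarrow>
     (\<exists>X' Y'. \<exists>f\<in>chain_maps X' Y'. bcomplex X' \<and> bcomplex Y' \<and>
        derived_iso X' X \<and> derived_iso Y' Y \<and> derived_iso (mapping_cone X' Y' f) Z)"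

definition stalk :: "'k::field rep \<Rightarrow> 'k cpx" where
  "stalk A = (let C = (\<lambda>n::int. if n = 0 then A else rzero)
              in \<lparr>ob = C, df = (\<lambda>n. mzero (C n) (C (n + 1)))\<rparr>)"

text \<open>
  Strictly full triangulated subcategories, given by their classes of objects. Closure under the
  third vertex of a triangle gives closure under the other two by rotation.
\<close>

definition triangulated_subcategory :: "'k::field cpx set \<Rightarrow> bool" where
  "triangulated_subcategory S \<longleftrightarrow>
     S \<subseteq> Collect bcomplex \<and>
     stalk rzero \<in> S \<and>
     (\<forall>X\<in>S. \<forall>Y. derived_iso X Y \<longrightarrow> Y \<in> S) \<and>
     (\<forall>X\<in>S. \<forall>p. shift p X \<in> S) \<and>
     (\<forall>X\<in>S. \<forall>Y\<in>S. \<forall>Z. dist_triangle X Y Z \<longrightarrow> Z \<in> S)"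

definition full_exceptional_collection :: "'k::field rep list \<Rightarrow> bool" where
  "full_exceptional_collection As \<longleftrightarrow> exceptional_collection As \<and>
     (\<forall>S. triangulated_subcategory S \<longrightarrow> stalk ` set As \<subseteq> S \<longrightarrow> S = Collect bcomplex)"


section \<open>The exceptional representations\<close>

text \<open>\<open>mk_rep (p, q, r) (x, y, z)\<close> has spaces \<open>(V_b, V_mid, V_e) = (k^p, k^q, k^r)\<close> and maps
  \<open>(V_b \<rightarrow> V_e, V_b \<rightarrow> V_mid, V_mid \<rightarrow> V_e) = (x, y, z)\<close>.\<close>

fun mk_rep :: "nat \<times> nat \<times> nat \<Rightarrow> 'k mat \<times> 'k mat \<times> 'k mat \<Rightarrow> 'k rep" where
  "mk_rep (p, q, r) (x, y, z) =
     \<lparr>rdim = case_vertex p q r, rmap = case_arrow x y z\<rparr>"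

definition pi_plus :: "nat \<Rightarrow> 'k::field mat" where
  "pi_plus m = mat m (m + 1) (\<lambda>(i, j). if j = i then 1 else 0)"

definition pi_minus :: "nat \<Rightarrow> 'k::field mat" where
  "pi_minus m = mat m (m + 1) (\<lambda>(i, j). if j = i + 1 then 1 else 0)"

definition j_plus :: "nat \<Rightarrow> 'k::field mat" where
  "j_plus m = mat (m + 1) m (\<lambda>(i, j). if i = j then 1 else 0)"

definition j_minus :: "nat \<Rightarrow> 'k::field mat" where
  "j_minus m = mat (m + 1) m (\<lambda>(i, j). if i = j + 1 then 1 else 0)"

definition E1 :: "nat \<Rightarrow> 'k::field rep" where
  "E1 m = mk_rep (m + 1, m, m) (pi_plus m, pi_minus m, 1\<^sub>m m)"

definition E2 :: "nat \<Rightarrow> 'k::field rep" where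
  "E2 m = mk_rep (m, m + 1, m + 1) (j_plus m, j_minus m, 1\<^sub>m (m + 1))"

definition E3 :: "nat \<Rightarrow> 'k::field rep" where
  "E3 m = mk_rep (m, m, m + 1) (j_plus m, 1\<^sub>m m, j_minus m)"

definition E4 :: "nat \<Rightarrow> 'k::field rep" where
  "E4 m = mk_rep (m + 1, m + 1, m) (pi_plus m, 1\<^sub>m (m + 1), pi_minus m)"

definition M :: "'k::field rep" where
  "M = mk_rep (0, 1, 0) (0\<^sub>m 0 0, 0\<^sub>m 1 0, 0\<^sub>m 0 1)"

definition M' :: "'k::field rep" where
  "M' = mk_rep (1, 0, 1) (1\<^sub>m 1, 0\<^sub>m 0 1, 0\<^sub>m 1 0)"

end

theory Submission
  imports Defs "Jordan_Normal_Form.Char_Poly" "Jordan_Normal_Form.VS_Connect"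
begin

text \<open>
  The path algebra is hereditary: every representation has a projective resolution of length one.
  Consequently \<open>Hom(A,B)\<close> and \<open>Ext^1(A,B)\<close> are the kernel and the cokernel of a single linear map,
  which sends a family \<open>f\<close> of linear maps \<open>A_v \<rightarrow> B_v\<close> to the commutators \<open>f A_a - B_a f\<close> over the arrows
  \<open>a\<close>, the higher Ext groups vanish, and \<open>dim Hom - dim Ext^1\<close> is the Euler form of the dimension
  vectors (\<open>all_ext_vanish_iff\<close>, \<open>ext_free_iff_euler_zero\<close>, \<open>ext_free_iff_euler_one\<close>).

  An exceptional \<open>A\<close> therefore has a dimension vector with \<open>q(b,m,e) = 1\<close>, where the quadratic form is
  \<open>x^2 + x y + y^2\<close> in \<open>x = b - m\<close>, \<open>y = m - e\<close>. The six solutions \<open>(x,y)\<close> give four families, which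
  are those of \<open>E_1, ..., E_4\<close>, and two families with \<open>b = e\<close>. Rigidity, \<open>Ext^1(A,A) = 0\<close>, says that all
  families of matrices over the arrows are commutators, and a matrix \<open>T\<close> all of whose deformations have the form \<open>F T - T G\<close> has
  maximal rank (\<open>max_rank_of_commutators\<close>). In the first four families one of the maps through the
  middle vertex is thus invertible, which leaves, up to duality, a pair of \<open>n \<times> (n+1)\<close> matrices; all
  nonzero members of the pencil that it spans are surjective, and by Kronecker's theorem such a pencil is equivalent to
  \<open>(\<pi>\<^sub>+, \<pi>\<^sub>-)\<close> (\<open>pencil_normal_form\<close>). In the two families with \<open>b = e\<close> an explicit endomorphism
  must be a scalar, and this allows only \<open>M\<close> and \<open>M'\<close> (\<open>exceptional_classification\<close>).

  For listed representations \<open>X\<close>, \<open>Y\<close> the vanishing of the Euler form on \<open>(X,Y)\<close> already implies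
  \<open>Hom(X,Y) = 0\<close>, hence that all \<open>Ext^p(X,Y)\<close> are zero (\<open>all_ext_vanish_labels\<close>). So exceptional
  collections correspond to lists with vanishing Euler form below the diagonal. Their Gram matrix is
  unitriangular, so at most three members fit into the rank three Grothendieck group
  (\<open>orthogonal_length_le\<close>). A full collection has at least three: every linear form on dimension vectors
  gives, through the Euler characteristic, a triangulated subcategory of the complexes on which it
  vanishes (\<open>linear_form_subcategory\<close>). The triples with vanishing Euler form are the listed ones
  (\<open>orthogonal_listed\<close>).

  Conversely each listed triple generates. Let \<open>R\<close> be the representation with dimension vector \<open>(1,1,1)\<close>
  in which only the long arrow acts by zero. Short exact sequences with \<open>R\<close> connect all \<open>E_1^m\<close> and
  \<open>E_2^m\<close> with each other, and likewise all \<open>E_3^m\<close> and \<open>E_4^m\<close>; short exact sequences with \<open>M\<close> or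
  \<open>M'\<close> connect the two chains. A listed triple generates \<open>R\<close>, a member of a chain, and \<open>M\<close> or \<open>M'\<close>, hence
  the simple representations (\<open>generation\<close>), and these generate every bounded complex
  (\<open>simples_generate\<close>).
\<close>

section \<open>Finite systems of linear equations\<close>

text \<open>
  Gaussian elimination: an equation with a nonzero coefficient at \<open>i0\<close> expresses \<open>x i0\<close> by the other
  unknowns, which removes one equation and one unknown.
\<close>

lemma homogeneous_system_nontrivial:
  fixes a :: "'j \<Rightarrow> 'i \<Rightarrow> 'k::field"
  assumes "finite J" "finite I" "card J < card I"
  shows "\<exists>x. (\<exists>i\<in>I. x i \<noteq> 0) \<and> (\<forall>j\<in>J. (\<Sum>i\<in>I. a j i * x i) = 0)"
  using assms
proof (induction J arbitrary: I a rule: finite_induct)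
  case empty
  then obtain i where "i \<in> I" by fastforce
  then show ?case by (intro exI[of _ "\<lambda>_. 1"]) auto
next
  case (insert j J)
  show ?case
  proof (cases "\<forall>i\<in>I. a j i = 0")
    case True
    have "card J < card I" using insert by simp
    from insert.IH[OF insert.prems(1) this, of a] obtain x where
      x: "\<exists>i\<in>I. x i \<noteq> 0" "\<forall>j'\<in>J. (\<Sum>i\<in>I. a j' i * x i) = 0" by blast
    have "(\<Sum>i\<in>I. a j i * x i) = 0" by (rule sum.neutral) (use True in simp)
    with x show ?thesis by blast
  next
    case False
    then obtain i0 where i0: "i0 \<in> I" "a j i0 \<noteq> 0" by auto
    define b where "b j' i = a j' i - a j' i0 * a j i / a j i0" for j' i
    have "card J < card (I - {i0})" using insert i0 by (auto simp: card_Diff_singleton)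
    from insert.IH[OF _ this, of b] insert.prems obtain x where
      x: "\<exists>i\<in>I - {i0}. x i \<noteq> 0" "\<And>j'. j' \<in> J \<Longrightarrow> (\<Sum>i\<in>I - {i0}. b j' i * x i) = 0" by auto
    define s where "s = (\<Sum>i\<in>I - {i0}. a j i * x i)"
    define y where "y = x(i0 := - s / a j i0)"
    have split: "(\<Sum>i\<in>I. a j' i * y i) = (\<Sum>i\<in>I - {i0}. a j' i * x i) - a j' i0 * s / a j i0" for j'
    proof -
      have "(\<Sum>i\<in>I. a j' i * y i) = a j' i0 * y i0 + (\<Sum>i\<in>I - {i0}. a j' i * y i)"
        using i0 insert.prems by (simp add: sum.remove)
      also have "(\<Sum>i\<in>I - {i0}. a j' i * y i) = (\<Sum>i\<in>I - {i0}. a j' i * x i)"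
        by (rule sum.cong) (auto simp: y_def)
      finally show ?thesis by (simp add: y_def)
    qed
    have "(\<Sum>i\<in>I. a j' i * y i) = 0" if "j' \<in> J" for j'
    proof -
      have "0 = (\<Sum>i\<in>I - {i0}. b j' i * x i)" using x(2)[OF that] by simp
      also have "\<dots> = (\<Sum>i\<in>I - {i0}. a j' i * x i - (a j' i0 / a j i0) * (a j i * x i))"
        by (rule sum.cong) (auto simp: b_def field_simps)
      also have "\<dots> = (\<Sum>i\<in>I - {i0}. a j' i * x i) - (a j' i0 / a j i0) * s"
        by (simp add: sum_subtractf s_def sum_distrib_left)
      finally show ?thesis by (simp add: split)
    qed
    moreover have "(\<Sum>i\<in>I. a j i * y i) = 0" using i0 by (simp add: split s_def)
    moreover have "\<exists>i\<in>I. y i \<noteq> 0" using x(1) by (auto simp: y_def)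
    ultimately show ?thesis by auto
  qed
qed

lemma injective_system_card_le:
  fixes a :: "'j \<Rightarrow> 'i \<Rightarrow> 'k::field"
  assumes "finite I" "finite J"
    and "\<And>x. (\<And>j. j \<in> J \<Longrightarrow> (\<Sum>i\<in>I. a j i * x i) = 0) \<Longrightarrow> (\<And>i. i \<in> I \<Longrightarrow> x i = 0)"
  shows "card I \<le> card J"
proof (rule ccontr)
  assume "\<not> card I \<le> card J"
  then obtain x i where "i \<in> I" "x i \<noteq> 0" "\<forall>j\<in>J. (\<Sum>i\<in>I. a j i * x i) = 0"
    using homogeneous_system_nontrivial[OF assms(2,1), of a] by auto
  then show False using assms(3)[of x i] by blast
qed

text \<open>
  A nontrivial solution \<open>y\<close> of the transposed system is a linear relation between the equations;
  every solvable right-hand side satisfies it, whereas a unit vector in the support of \<open>y\<close> does not.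
\<close>

lemma surjective_system_card_le:
  fixes a :: "'j \<Rightarrow> 'i \<Rightarrow> 'k::field"
  assumes fin: "finite I" "finite J"
    and surj: "\<And>b. \<exists>x. \<forall>j\<in>J. (\<Sum>i\<in>I. a j i * x i) = b j"
  shows "card J \<le> card I"
proof (rule ccontr)
  assume "\<not> card J \<le> card I"
  with homogeneous_system_nontrivial[of I J "\<lambda>i j. a j i"] fin obtain y j0 where
    y: "j0 \<in> J" "y j0 \<noteq> 0" "\<And>i. i \<in> I \<Longrightarrow> (\<Sum>j\<in>J. a j i * y j) = 0" by auto
  obtain x where x: "\<And>j. j \<in> J \<Longrightarrow> (\<Sum>i\<in>I. a j i * x i) = (if j = j0 then 1 else 0)"
    using surj[of "\<lambda>j. if j = j0 then 1 else 0"] by auto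
  have "y j0 = (\<Sum>j\<in>J. y j * (if j = j0 then 1 else 0))"
    using y(1) fin by (simp add: if_distrib[of "\<lambda>t. _ * t"] cong: if_cong)
  also have "\<dots> = (\<Sum>j\<in>J. \<Sum>i\<in>I. y j * (a j i * x i))"
    by (rule sum.cong) (simp_all add: x flip: sum_distrib_left)
  also have "\<dots> = (\<Sum>i\<in>I. (\<Sum>j\<in>J. a j i * y j) * x i)"
    by (subst sum.swap) (simp add: sum_distrib_right mult.assoc mult.left_commute)
  also have "\<dots> = 0" using y(3) by simp
  finally show False using y(2) by simp
qed

text \<open>
  The right-hand side becomes the coefficient of one more unknown. The enlarged homogeneous system has
  a nontrivial solution, and injectivity of the original one makes the new unknown nonzero in it.
\<close>

lemma injective_system_surjective:
  fixes a :: "'j \<Rightarrow> 'i \<Rightarrow> 'k::field"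
  assumes fin: "finite I" "finite J" and card: "card J \<le> card I"
    and inj: "\<And>x. (\<And>j. j \<in> J \<Longrightarrow> (\<Sum>i\<in>I. a j i * x i) = 0) \<Longrightarrow> (\<And>i. i \<in> I \<Longrightarrow> x i = 0)"
  shows "\<exists>x. \<forall>j\<in>J. (\<Sum>i\<in>I. a j i * x i) = b j"
proof -
  define I' where "I' = insert None (Some ` I)"
  have sum': "(\<Sum>i\<in>I'. g i) = g None + (\<Sum>i\<in>I. g (Some i))" for g :: "'i option \<Rightarrow> 'k"
    unfolding I'_def using fin by (subst sum.insert) (auto simp: sum.reindex)
  have "card I' = Suc (card I)" unfolding I'_def using fin by (subst card_insert_disjoint) (auto simp: card_image)
  then have "card J < card I'" "finite I'" using card fin by (auto simp: I'_def)
  from homogeneous_system_nontrivial[OF fin(2) this(2,1), of "\<lambda>j i. case i of None \<Rightarrow> - b j | Some i \<Rightarrow> a j i"]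
  obtain x where x: "\<exists>i\<in>I'. x i \<noteq> 0" "\<forall>j\<in>J. (\<Sum>i\<in>I'. (case i of None \<Rightarrow> - b j | Some i \<Rightarrow> a j i) * x i) = 0"
    by blast
  then have x2: "- b j * x None + (\<Sum>i\<in>I. a j i * x (Some i)) = 0" if "j \<in> J" for j
    using that by (simp add: sum')
  have "x None \<noteq> 0"
  proof
    assume 0: "x None = 0"
    have "\<And>i. i \<in> I \<Longrightarrow> x (Some i) = 0" by (rule inj) (use x2 0 in auto)
    with x(1) 0 show False by (auto simp: I'_def)
  qed
  then have "(\<Sum>i\<in>I. a j i * (x (Some i) / x None)) = b j" if "j \<in> J" for j
    using x2[OF that] by (simp add: sum_divide_distrib[symmetric] field_simps)
  then show ?thesis by (intro exI[of _ "\<lambda>i. x (Some i) / x None"]) blast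
qed

text \<open>
  The equation that prescribes \<open>x i0\<close> kills the kernel, and it can be satisfied by adding a multiple of
  \<open>z\<close> to a solution. So the enlarged system is injective, and it is surjective exactly if the original
  one is; for an injective system surjectivity is a matter of counting.
\<close>

lemma one_dim_kernel_system:
  fixes a :: "'j \<Rightarrow> 'i \<Rightarrow> 'k::field"
  assumes fin: "finite I" "finite J" and i0: "i0 \<in> I" "z i0 \<noteq> 0"
    and z: "\<And>j. j \<in> J \<Longrightarrow> (\<Sum>i\<in>I. a j i * z i) = 0"
    and ker: "\<And>x. (\<And>j. j \<in> J \<Longrightarrow> (\<Sum>i\<in>I. a j i * x i) = 0) \<Longrightarrow> \<exists>c. \<forall>i\<in>I. x i = c * z i"
  shows "card I = Suc (card J) \<longleftrightarrow> (\<forall>b. \<exists>x. \<forall>j\<in>J. (\<Sum>i\<in>I. a j i * x i) = b j)" (is "?L \<longleftrightarrow> ?R")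
proof -
  define J' where "J' = insert None (Some ` J)"
  define a' where "a' j i = (case j of None \<Rightarrow> (if i = i0 then 1 else 0) | Some j \<Rightarrow> a j i)" for j i
  have fJ': "finite J'" and cJ': "card J' = Suc (card J)"
    unfolding J'_def using fin by (auto simp: card_insert_if card_image)
  have none: "(\<Sum>i\<in>I. a' None i * x i) = x i0" for x
    using i0 fin by (simp add: a'_def if_distrib[of "\<lambda>t. t * _"] cong: if_cong)
  have some: "(\<Sum>i\<in>I. a' (Some j) i * x i) = (\<Sum>i\<in>I. a j i * x i)" for x j by (simp add: a'_def)
  have inj: "x i = 0" if x: "\<And>j. j \<in> J' \<Longrightarrow> (\<Sum>i\<in>I. a' j i * x i) = 0" and i: "i \<in> I" for x i
  proof -
    have "(\<Sum>i\<in>I. a j i * x i) = 0" if "j \<in> J" for j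
      using x[of "Some j"] that by (simp add: J'_def some)
    from ker[OF this] obtain c where c: "\<And>i. i \<in> I \<Longrightarrow> x i = c * z i" by blast
    have "x i0 = 0" using x[of None] by (simp add: none J'_def)
    with c i0 have "c = 0" by auto
    with c i show ?thesis by simp
  qed
  show ?thesis
  proof
    assume ?L
    show ?R
    proof
      fix b
      have "\<exists>x. \<forall>j\<in>J'. (\<Sum>i\<in>I. a' j i * x i) = (case j of None \<Rightarrow> 0 | Some j \<Rightarrow> b j)"
      proof (rule injective_system_surjective[of I J' a'])
        show "x i = 0" if "\<And>j. j \<in> J' \<Longrightarrow> (\<Sum>i\<in>I. a' j i * x i) = 0" "i \<in> I" for x i
          using that by (rule inj)
      qed (use fin fJ' cJ' \<open>?L\<close> in auto)
      then obtain x where "\<forall>j\<in>J'. (\<Sum>i\<in>I. a' j i * x i) = (case j of None \<Rightarrow> 0 | Some j \<Rightarrow> b j)" ..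
      then show "\<exists>x. \<forall>j\<in>J. (\<Sum>i\<in>I. a j i * x i) = b j" unfolding J'_def by (intro exI[of _ x]) (simp add: some)
    qed
  next
    assume R: ?R
    have "card I \<le> card J'"
    proof (rule injective_system_card_le[of I J' a'])
      show "x i = 0" if "\<And>j. j \<in> J' \<Longrightarrow> (\<Sum>i\<in>I. a' j i * x i) = 0" "i \<in> I" for x i
        using that by (rule inj)
    qed (use fin fJ' in auto)
    moreover have "card J' \<le> card I"
    proof (rule surjective_system_card_le[of I J' a'])
      fix b
      obtain x where x: "\<And>j. j \<in> J \<Longrightarrow> (\<Sum>i\<in>I. a j i * x i) = b (Some j)" using R[rule_format, of "\<lambda>j. b (Some j)"] by blast
      define y where "y i = x i + (b None - x i0) / z i0 * z i" for i
      have "(\<Sum>i\<in>I. a j i * y i) = b (Some j)" if "j \<in> J" for j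
      proof -
        have "(\<Sum>i\<in>I. a j i * y i) = (\<Sum>i\<in>I. a j i * x i) + (b None - x i0) / z i0 * (\<Sum>i\<in>I. a j i * z i)"
          unfolding y_def sum_distrib_left sum.distrib[symmetric] by (rule sum.cong) (simp_all add: algebra_simps)
        then show ?thesis using x z that by simp
      qed
      moreover have "y i0 = b None" using i0 by (simp add: y_def)
      ultimately show "\<exists>x. \<forall>j\<in>J'. (\<Sum>i\<in>I. a' j i * x i) = b j"
        unfolding J'_def by (intro exI[of _ y]) (simp add: none some)
    qed (use fin fJ' in auto)
    ultimately show ?L using cJ' by simp
  qed
qed

section \<open>Surjective matrices and block matrices\<close>

lemma eq_mat_by_vec:
  fixes A B :: "'k::field mat"
  assumes A: "A \<in> carrier_mat n m" and B: "B \<in> carrier_mat n m"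
    and eq: "\<And>x. x \<in> carrier_vec m \<Longrightarrow> A *\<^sub>v x = B *\<^sub>v x"
  shows "A = B"
proof (rule eq_matI)
  fix i j assume "i < dim_row B" "j < dim_col B"
  then have ij: "i < n" "j < m" using B by auto
  have "(A *\<^sub>v unit_vec m j) $ i = (B *\<^sub>v unit_vec m j) $ i" using eq by simp
  then show "A $$ (i, j) = B $$ (i, j)" using A B ij by simp
qed (use A B in auto)

lemma vec_eq_of_minus_zero:
  fixes v w :: "'k::field vec"
  assumes "v - w = 0\<^sub>v n" "v \<in> carrier_vec n" "w \<in> carrier_vec n"
  shows "v = w"
proof (rule eq_vecI)
  fix i assume "i < dim_vec w"
  then have i: "i < n" using assms by simp
  have "(v - w) $ i = 0" unfolding assms(1) using i by simp
  moreover have "(v - w) $ i = v $ i - w $ i" using i assms(2,3) by simp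
  ultimately show "v $ i = w $ i" by simp
qed (use assms in auto)

lemma surjective_mat_section:
  fixes E :: "'k::field mat"
  assumes E: "E \<in> carrier_mat m n"
    and surj: "\<And>y. y \<in> carrier_vec m \<Longrightarrow> \<exists>x\<in>carrier_vec n. y = E *\<^sub>v x"
  obtains S where "S \<in> carrier_mat n m" "E * S = 1\<^sub>m m"
proof -
  have "\<forall>j. \<exists>x. x \<in> carrier_vec n \<and> unit_vec m j = E *\<^sub>v x" using surj by (metis unit_vec_carrier)
  then obtain s where s: "\<And>j. s j \<in> carrier_vec n" "\<And>j. unit_vec m j = E *\<^sub>v s j" by metis
  define S where "S = mat_of_cols n (map s [0..<m])"
  have S: "S \<in> carrier_mat n m" unfolding S_def by (rule mat_of_cols_carrier(1)[of n "map s [0..<m]", simplified])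
  have "E * S = 1\<^sub>m m"
  proof (rule mat_col_eqI)
    fix i assume "i < dim_col (1\<^sub>m m :: 'k mat)"
    then have i: "i < m" by simp
    have "col S i = s i" unfolding S_def using i s(1) by (subst col_mat_of_cols) auto
    then show "col (E * S) i = col (1\<^sub>m m) i" using E S i s by (simp add: col_mult2[OF E S i])
  qed (use E S in auto)
  with S show thesis using that by blast
qed

text \<open>
  With a section \<open>S\<close> of \<open>E\<close>, the vector \<open>x - S (E x)\<close> lies in the kernel of \<open>E\<close>, so \<open>W\<close> and \<open>W S E\<close> agree.
\<close>

lemma factor_through_surjective_mat:
  fixes E W :: "'k::field mat"
  assumes E: "E \<in> carrier_mat m n" and W: "W \<in> carrier_mat p n"
    and surj: "\<And>y. y \<in> carrier_vec m \<Longrightarrow> \<exists>x\<in>carrier_vec n. y = E *\<^sub>v x"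
    and ker: "\<And>x. x \<in> carrier_vec n \<Longrightarrow> E *\<^sub>v x = 0\<^sub>v m \<Longrightarrow> W *\<^sub>v x = 0\<^sub>v p"
  obtains F where "F \<in> carrier_mat p m" "W = F * E"
proof -
  obtain S where S: "S \<in> carrier_mat n m" "E * S = 1\<^sub>m m" using surjective_mat_section[OF E surj] .
  have "W = (W * S) * E"
  proof (rule eq_mat_by_vec[OF W])
    fix x :: "'k vec" assume x: "x \<in> carrier_vec n"
    define z where "z = x - S *\<^sub>v (E *\<^sub>v x)"
    have c: "S *\<^sub>v (E *\<^sub>v x) \<in> carrier_vec n" "E *\<^sub>v x \<in> carrier_vec m" using S E x by auto
    have "E *\<^sub>v z = E *\<^sub>v x - E *\<^sub>v (S *\<^sub>v (E *\<^sub>v x))" unfolding z_def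
      by (rule mult_minus_distrib_mat_vec[OF E x c(1)])
    also have "E *\<^sub>v (S *\<^sub>v (E *\<^sub>v x)) = E *\<^sub>v x" using S E c by (simp flip: assoc_mult_mat_vec[OF E S(1) c(2)])
    finally have "E *\<^sub>v z = 0\<^sub>v m" using c by simp
    then have "W *\<^sub>v z = 0\<^sub>v p" using ker x c by (simp add: z_def)
    then have "W *\<^sub>v x - W *\<^sub>v (S *\<^sub>v (E *\<^sub>v x)) = 0\<^sub>v p"
      by (simp add: z_def mult_minus_distrib_mat_vec[OF W x c(1)])
    moreover have "W *\<^sub>v x \<in> carrier_vec p" "W *\<^sub>v (S *\<^sub>v (E *\<^sub>v x)) \<in> carrier_vec p" using W c x by auto
    ultimately have "W *\<^sub>v x = W *\<^sub>v (S *\<^sub>v (E *\<^sub>v x))" by (rule vec_eq_of_minus_zero)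
    then show "W *\<^sub>v x = W * S * E *\<^sub>v x"
      using W S E x c assoc_mult_mat_vec[of "W * S" p m E n x] assoc_mult_mat_vec[of W p n S m "E *\<^sub>v x"] by simp
  qed (use W S E in auto)
  then show thesis using that[of "W * S"] W S by auto
qed

text \<open>
  A linear map out of a direct sum is a horizontal concatenation of matrices, one into a direct sum a
  vertical one. \<open>four_block_mat\<close> prescribes both decompositions at the same time, while morphisms out of and
  into an extension call for only one of them.
\<close>

definition hcat :: "'a mat \<Rightarrow> 'a mat \<Rightarrow> 'a mat" where
  "hcat A B = mat (dim_row A) (dim_col A + dim_col B)
     (\<lambda>(i, j). if j < dim_col A then A $$ (i, j) else B $$ (i, j - dim_col A))"

definition vcat :: "'a mat \<Rightarrow> 'a mat \<Rightarrow> 'a mat" where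
  "vcat A B = mat (dim_row A + dim_row B) (dim_col A)
     (\<lambda>(i, j). if i < dim_row A then A $$ (i, j) else B $$ (i - dim_row A, j))"

lemma hcat_dim[simp]: "dim_row (hcat A B) = dim_row A" "dim_col (hcat A B) = dim_col A + dim_col B"
  and vcat_dim[simp]: "dim_row (vcat A B) = dim_row A + dim_row B" "dim_col (vcat A B) = dim_col A"
  by (auto simp: hcat_def vcat_def)

lemma hcat_carrier[simp, intro]:
  "A \<in> carrier_mat n p \<Longrightarrow> B \<in> carrier_mat n q \<Longrightarrow> hcat A B \<in> carrier_mat n (p + q)"
  and vcat_carrier[simp, intro]:
  "A \<in> carrier_mat p n \<Longrightarrow> B \<in> carrier_mat q n \<Longrightarrow> vcat A B \<in> carrier_mat (p + q) n"
  by (auto intro!: carrier_matI)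

lemma hcat_mult_vcat:
  fixes A :: "'k::field mat"
  assumes "A \<in> carrier_mat n p" "B \<in> carrier_mat n q" "C \<in> carrier_mat p m" "D \<in> carrier_mat q m"
  shows "hcat A B * vcat C D = A * C + B * D"
proof (rule eq_matI)
  fix i j assume "i < dim_row (A * C + B * D)" "j < dim_col (A * C + B * D)"
  then have ij: "i < n" "j < m" using assms by auto
  have "row (hcat A B) i = row A i @\<^sub>v row B i" using assms ij by (intro eq_vecI) (auto simp: hcat_def)
  moreover have "col (vcat C D) j = col C j @\<^sub>v col D j" using assms ij by (intro eq_vecI) (auto simp: vcat_def)
  moreover have "(row A i @\<^sub>v row B i) \<bullet> (col C j @\<^sub>v col D j) = row A i \<bullet> col C j + row B i \<bullet> col D j"
    by (rule scalar_prod_append[of _ p _ q]) (use assms in auto)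
  ultimately show "(hcat A B * vcat C D) $$ (i, j) = (A * C + B * D) $$ (i, j)" using assms ij by simp
qed (use assms in auto)

lemma mult_hcat:
  fixes A :: "'k::field mat"
  assumes "P \<in> carrier_mat r n" "A \<in> carrier_mat n p" "B \<in> carrier_mat n q"
  shows "P * hcat A B = hcat (P * A) (P * B)"
proof (rule eq_matI)
  fix i j assume "i < dim_row (hcat (P * A) (P * B))" "j < dim_col (hcat (P * A) (P * B))"
  then have ij: "i < r" "j < p + q" using assms by auto
  have "col (hcat A B) j = (if j < p then col A j else col B (j - p))"
    using assms ij by (intro eq_vecI) (auto simp: hcat_def)
  then show "(P * hcat A B) $$ (i, j) = hcat (P * A) (P * B) $$ (i, j)" using assms ij by (auto simp: hcat_def)
qed (use assms in auto)

lemma vcat_mult: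
  fixes A :: "'k::field mat"
  assumes "P \<in> carrier_mat n r" "A \<in> carrier_mat p n" "B \<in> carrier_mat q n"
  shows "vcat A B * P = vcat (A * P) (B * P)"
proof (rule eq_matI)
  fix i j assume "i < dim_row (vcat (A * P) (B * P))" "j < dim_col (vcat (A * P) (B * P))"
  then have ij: "j < r" "i < p + q" using assms by auto
  have "row (vcat A B) i = (if i < p then row A i else row B (i - p))"
    using assms ij by (intro eq_vecI) (auto simp: vcat_def)
  then show "(vcat A B * P) $$ (i, j) = vcat (A * P) (B * P) $$ (i, j)" using assms ij by (auto simp: vcat_def)
qed (use assms in auto)

lemma hcat_eq_iff:
  assumes "A \<in> carrier_mat n p" "B \<in> carrier_mat n q" "A' \<in> carrier_mat n p" "B' \<in> carrier_mat n q"
  shows "hcat A B = hcat A' B' \<longleftrightarrow> A = A' \<and> B = B'"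
proof
  assume eq: "hcat A B = hcat A' B'"
  have "A $$ (i, j) = A' $$ (i, j)" if "i < n" "j < p" for i j
    using assms that arg_cong[OF eq, of "\<lambda>X. X $$ (i, j)"] by (auto simp: hcat_def)
  moreover have "B $$ (i, j) = B' $$ (i, j)" if "i < n" "j < q" for i j
    using assms that arg_cong[OF eq, of "\<lambda>X. X $$ (i, p + j)"] by (auto simp: hcat_def)
  ultimately show "A = A' \<and> B = B'" using assms by (intro conjI eq_matI) auto
qed simp

lemma vcat_eq_iff:
  assumes "A \<in> carrier_mat p n" "B \<in> carrier_mat q n" "A' \<in> carrier_mat p n" "B' \<in> carrier_mat q n"
  shows "vcat A B = vcat A' B' \<longleftrightarrow> A = A' \<and> B = B'"
proof
  assume eq: "vcat A B = vcat A' B'"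
  have "A $$ (i, j) = A' $$ (i, j)" if "i < p" "j < n" for i j
    using assms that arg_cong[OF eq, of "\<lambda>X. X $$ (i, j)"] by (auto simp: vcat_def)
  moreover have "B $$ (i, j) = B' $$ (i, j)" if "i < q" "j < n" for i j
    using assms that arg_cong[OF eq, of "\<lambda>X. X $$ (p + i, j)"] by (auto simp: vcat_def)
  ultimately show "A = A' \<and> B = B'" using assms by (intro conjI eq_matI) auto
qed simp

lemma split_cols:
  assumes "X \<in> carrier_mat n (p + q)"
  obtains A B where "A \<in> carrier_mat n p" "B \<in> carrier_mat n q" "X = hcat A B"
proof
  show "X = hcat (mat n p (\<lambda>(i, j). X $$ (i, j))) (mat n q (\<lambda>(i, j). X $$ (i, p + j)))"
    using assms by (intro eq_matI) (auto simp: hcat_def)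
qed auto

lemma split_rows:
  assumes "X \<in> carrier_mat (p + q) n"
  obtains A B where "A \<in> carrier_mat p n" "B \<in> carrier_mat q n" "X = vcat A B"
proof
  show "X = vcat (mat p n (\<lambda>(i, j). X $$ (i, j))) (mat q n (\<lambda>(i, j). X $$ (p + i, j)))"
    using assms by (intro eq_matI) (auto simp: vcat_def)
qed auto

lemma vcat_add:
  fixes A :: "'k::field mat"
  assumes "A \<in> carrier_mat p n" "B \<in> carrier_mat q n" "A' \<in> carrier_mat p n" "B' \<in> carrier_mat q n"
  shows "vcat A B + vcat A' B' = vcat (A + A') (B + B')"
  using assms by (intro eq_matI) (auto simp: vcat_def)

lemma hcat_mult_append_vec:
  fixes A :: "'k::field mat"
  assumes "A \<in> carrier_mat n p" "B \<in> carrier_mat n q" "x \<in> carrier_vec p" "y \<in> carrier_vec q"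
  shows "hcat A B *\<^sub>v (x @\<^sub>v y) = A *\<^sub>v x + B *\<^sub>v y"
proof (rule eq_vecI)
  fix i assume "i < dim_vec (A *\<^sub>v x + B *\<^sub>v y)"
  then have i: "i < n" using assms by auto
  have "row (hcat A B) i = row A i @\<^sub>v row B i" using assms i by (intro eq_vecI) (auto simp: hcat_def)
  moreover have "(row A i @\<^sub>v row B i) \<bullet> (x @\<^sub>v y) = row A i \<bullet> x + row B i \<bullet> y"
    by (rule scalar_prod_append[of _ p _ q]) (use assms in auto)
  ultimately show "(hcat A B *\<^sub>v (x @\<^sub>v y)) $ i = (A *\<^sub>v x + B *\<^sub>v y) $ i" using assms i by simp
qed (use assms in auto)

lemma vcat_mult_vec:
  fixes A :: "'k::field mat"
  assumes "A \<in> carrier_mat p n" "B \<in> carrier_mat q n" "x \<in> carrier_vec n"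
  shows "vcat A B *\<^sub>v x = (A *\<^sub>v x) @\<^sub>v (B *\<^sub>v x)"
proof (rule eq_vecI)
  fix i assume "i < dim_vec ((A *\<^sub>v x) @\<^sub>v (B *\<^sub>v x))"
  then have i: "i < p + q" using assms by auto
  have "row (vcat A B) i = (if i < p then row A i else row B (i - p))"
    using assms i by (intro eq_vecI) (auto simp: vcat_def)
  then show "(vcat A B *\<^sub>v x) $ i = ((A *\<^sub>v x) @\<^sub>v (B *\<^sub>v x)) $ i" using assms i by auto
qed (use assms in auto)

lemma split_vec:
  assumes "x \<in> carrier_vec (p + q)"
  obtains y z where "y \<in> carrier_vec p" "z \<in> carrier_vec q" "x = y @\<^sub>v z"
proof
  show "x = vec p (\<lambda>i. x $ i) @\<^sub>v vec q (\<lambda>i. x $ (p + i))" using assms by (intro eq_vecI) auto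
qed auto

lemma four_block_mat_eq_hcat:
  assumes "A \<in> carrier_mat n p" "B \<in> carrier_mat n q" "C \<in> carrier_mat m p" "D \<in> carrier_mat m q"
  shows "four_block_mat A B C D = hcat (vcat A C) (vcat B D)"
  using assms by (intro eq_matI) (auto simp: hcat_def vcat_def)

text \<open>
  The arithmetic of matrices is stated with conditions on dimensions in place of membership in
  \<open>carrier_mat\<close>: the simplifier can discharge these from the dimensions of the factors, and no
  intermediate dimension has to be guessed.
\<close>

lemma mat_assoc: "dim_col A = dim_row B \<Longrightarrow> dim_col B = dim_row C \<Longrightarrow> A * B * C = A * (B * C)"
  for A :: "'k::field mat" by (rule assoc_mult_mat) (auto intro: carrier_matI)
lemma mat_add_mult: "dim_col A = dim_row C \<Longrightarrow> dim_col B = dim_row C \<Longrightarrow> dim_row A = dim_row B \<Longrightarrow>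
    (A + B) * C = A * C + B * C"
  for A :: "'k::field mat" by (rule add_mult_distrib_mat) (auto intro: carrier_matI)
lemma mat_mult_add: "dim_col C = dim_row A \<Longrightarrow> dim_row A = dim_row B \<Longrightarrow> dim_col A = dim_col B \<Longrightarrow>
    C * (A + B) = C * A + C * B"
  for A :: "'k::field mat" by (rule mult_add_distrib_mat) (auto intro: carrier_matI)
lemma mat_minus_mult: "dim_col A = dim_row C \<Longrightarrow> dim_col B = dim_row C \<Longrightarrow> dim_row A = dim_row B \<Longrightarrow>
    (A - B) * C = A * C - B * C"
  for A :: "'k::field mat" by (rule minus_mult_distrib_mat) (auto intro: carrier_matI)
lemma mat_mult_minus: "dim_col C = dim_row A \<Longrightarrow> dim_row A = dim_row B \<Longrightarrow> dim_col A = dim_col B \<Longrightarrow>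
    C * (A - B) = C * A - C * B"
  for A :: "'k::field mat" by (rule mult_minus_distrib_mat) (auto intro: carrier_matI)
lemma mat_zero_mult: "dim_row A = m \<Longrightarrow> 0\<^sub>m n m * A = 0\<^sub>m n (dim_col A)"
  and mat_mult_zero: "dim_col A = m \<Longrightarrow> A * 0\<^sub>m m n = 0\<^sub>m (dim_row A) n"
  for A :: "'k::field mat" by (auto intro!: left_mult_zero_mat right_mult_zero_mat carrier_matI)
lemma mat_one_mult: "dim_row A = n \<Longrightarrow> 1\<^sub>m n * A = A"
  and mat_mult_one: "dim_col A = n \<Longrightarrow> A * 1\<^sub>m n = A"
  for A :: "'k::field mat" by (auto intro!: left_mult_one_mat right_mult_one_mat carrier_matI)

lemmas mat_dist = mat_add_mult mat_mult_add mat_minus_mult mat_mult_minus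
  mat_zero_mult mat_mult_zero mat_one_mult mat_mult_one

lemma zero_mat_mult_vec: "x \<in> carrier_vec n \<Longrightarrow> 0\<^sub>m m n *\<^sub>v x = 0\<^sub>v m"
  for x :: "'k::field vec" by (rule eq_vecI) auto

lemma mat_cancel_surjective:
  fixes E :: "'k::field mat"
  assumes E: "E \<in> carrier_mat m n"
    and surj: "\<And>y. y \<in> carrier_vec m \<Longrightarrow> \<exists>x\<in>carrier_vec n. y = E *\<^sub>v x"
    and "X \<in> carrier_mat p m" "Y \<in> carrier_mat p m" "X * E = Y * E"
  shows "X = Y"
proof -
  obtain S where S: "S \<in> carrier_mat n m" "E * S = 1\<^sub>m m" using surjective_mat_section[OF E surj] .
  have "X = X * (E * S)" using assms(3) S by simp
  also have "\<dots> = X * E * S" using assms(1,3) S by simp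
  also have "\<dots> = Y * (E * S)" using assms(1,4,5) S by simp
  also have "\<dots> = Y" using assms(4) S by simp
  finally show ?thesis .
qed

section \<open>Morphisms and extensions of representations\<close>

lemma all_vertex: "(\<forall>v. P v) \<longleftrightarrow> P Vb \<and> P Vmid \<and> P Ve" by (metis vertex.exhaust)
lemma all_arrow: "(\<forall>a. P a) \<longleftrightarrow> P BE \<and> P BM \<and> P ME" by (metis arrow.exhaust)

definition mor_family :: "'k::field rep \<Rightarrow> 'k rep \<Rightarrow> 'k mor set" where
  "mor_family V W = {f. \<forall>v. f v \<in> carrier_mat (rdim W v) (rdim V v)}"

definition arrow_family :: "'k::field rep \<Rightarrow> 'k rep \<Rightarrow> (arrow \<Rightarrow> 'k mat) set" where
  "arrow_family V W = {C. \<forall>a. C a \<in> carrier_mat (rdim W (tgt a)) (rdim V (src a))}"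

text \<open>
  The cokernel of the map from vertexwise families to commutators vanishes. This is \<open>Ext^1(A,B) = 0\<close> in
  terms of linear algebra: a family over the arrows is an extension of \<open>A\<close> by \<open>B\<close> on the direct sum of
  the spaces, and a solution \<open>f\<close> splits it.
\<close>

definition ext_free :: "'k::field rep \<Rightarrow> 'k rep \<Rightarrow> bool" where
  "ext_free A B \<longleftrightarrow> (\<forall>C\<in>arrow_family A B. \<exists>f\<in>mor_family A B.
     \<forall>a. C a = f (tgt a) * rmap A a - rmap B a * f (src a))"

lemma mor_familyD: "f \<in> mor_family V W \<Longrightarrow> f v \<in> carrier_mat (rdim W v) (rdim V v)"
  by (simp add: mor_family_def)
lemma arrow_familyD: "C \<in> arrow_family V W \<Longrightarrow> C a \<in> carrier_mat (rdim W (tgt a)) (rdim V (src a))"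
  by (simp add: arrow_family_def)
lemma is_repD: "is_rep V \<Longrightarrow> rmap V a \<in> carrier_mat (rdim V (tgt a)) (rdim V (src a))"
  by (simp add: is_rep_def)
lemma rep_dims[simp]: "is_rep V \<Longrightarrow> dim_row (rmap V a) = rdim V (tgt a)"
  "is_rep V \<Longrightarrow> dim_col (rmap V a) = rdim V (src a)"
  using is_repD[of V a] by auto
lemma rhomD: "f \<in> rhom V W \<Longrightarrow> f v \<in> carrier_mat (rdim W v) (rdim V v)"
  and rhom_comm: "f \<in> rhom V W \<Longrightarrow> f (tgt a) * rmap V a = rmap W a * f (src a)"
  by (auto simp: rhom_def)
lemma rhomI: "(\<And>v. f v \<in> carrier_mat (rdim W v) (rdim V v)) \<Longrightarrow>
    (\<And>a. f (tgt a) * rmap V a = rmap W a * f (src a)) \<Longrightarrow> f \<in> rhom V W"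
  by (auto simp: rhom_def)

lemma rhom_comp:
  assumes "is_rep U" "is_rep V" "is_rep W" "f \<in> rhom U V" "g \<in> rhom V W"
  shows "g \<star> f \<in> rhom U W"
proof (rule rhomI)
  fix v show "(g \<star> f) v \<in> carrier_mat (rdim W v) (rdim U v)"
    using rhomD[OF assms(4), of v] rhomD[OF assms(5), of v] by (simp add: mcomp_def)
next
  fix a
  note c = rhomD[OF assms(4), of "tgt a"] rhomD[OF assms(5), of "tgt a"] rhomD[OF assms(4), of "src a"]
    rhomD[OF assms(5), of "src a"] is_repD[OF assms(1), of a] is_repD[OF assms(2), of a] is_repD[OF assms(3), of a]
  have "g (tgt a) * f (tgt a) * rmap U a = g (tgt a) * (rmap V a * f (src a))"
    using c by (simp add: mat_assoc rhom_comm[OF assms(4)])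
  also have "\<dots> = g (tgt a) * rmap V a * f (src a)" using c by (simp add: mat_assoc)
  also have "\<dots> = rmap W a * (g (src a) * f (src a))" using c by (simp add: mat_assoc rhom_comm[OF assms(5)])
  finally show "(g \<star> f) (tgt a) * rmap U a = rmap W a * (g \<star> f) (src a)" by (simp add: mcomp_def)
qed

lemma mzero_rhom: "is_rep V \<Longrightarrow> is_rep W \<Longrightarrow> mzero V W \<in> rhom V W"
  by (rule rhomI) (auto simp: mzero_def mat_dist)

lemma mid_rhom: "is_rep V \<Longrightarrow> mid V \<in> rhom V V"
  by (rule rhomI) (auto simp: mid_def mat_dist)

text \<open>
  The extension of \<open>A\<close> by \<open>B\<close> with cocycle \<open>C\<close>: it contains \<open>B\<close> and has the quotient \<open>A\<close>.
\<close>

definition ext_rep :: "'k::field rep \<Rightarrow> (arrow \<Rightarrow> 'k mat) \<Rightarrow> 'k rep \<Rightarrow> 'k rep" where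
  "ext_rep B C A = \<lparr>rdim = \<lambda>v. rdim B v + rdim A v,
     rmap = \<lambda>a. hcat (vcat (rmap B a) (0\<^sub>m (rdim A (tgt a)) (rdim B (src a)))) (vcat (C a) (rmap A a))\<rparr>"

lemma rdim_ext_rep[simp]: "rdim (ext_rep B C A) v = rdim B v + rdim A v"
  by (simp add: ext_rep_def)

lemma ext_rep_is_rep:
  assumes "is_rep A" "is_rep B" "C \<in> arrow_family A B"
  shows "is_rep (ext_rep B C A)"
  using assms by (auto simp: is_rep_def ext_rep_def arrow_family_def intro!: hcat_carrier vcat_carrier)

lemma rhom_from_ext_rep:
  assumes A: "is_rep A" and B: "is_rep B" and C: "C \<in> arrow_family A B" and W: "is_rep W"
    and f: "f1 \<in> mor_family B W" "f2 \<in> mor_family A W"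
  shows "(\<lambda>v. hcat (f1 v) (f2 v)) \<in> rhom (ext_rep B C A) W \<longleftrightarrow>
    f1 \<in> rhom B W \<and> (\<forall>a. f1 (tgt a) * C a + f2 (tgt a) * rmap A a = rmap W a * f2 (src a))"
proof -
  have eq: "hcat (f1 (tgt a)) (f2 (tgt a)) * rmap (ext_rep B C A) a = rmap W a * hcat (f1 (src a)) (f2 (src a)) \<longleftrightarrow>
      f1 (tgt a) * rmap B a = rmap W a * f1 (src a) \<and>
      f1 (tgt a) * C a + f2 (tgt a) * rmap A a = rmap W a * f2 (src a)" for a
  proof -
    note c = mor_familyD[OF f(1), of "tgt a"] mor_familyD[OF f(1), of "src a"] mor_familyD[OF f(2), of "tgt a"]
      mor_familyD[OF f(2), of "src a"] is_repD[OF A, of a] is_repD[OF B, of a] is_repD[OF W, of a] arrow_familyD[OF C, of a]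
    have "hcat (f1 (tgt a)) (f2 (tgt a)) * rmap (ext_rep B C A) a =
        hcat (f1 (tgt a) * rmap B a) (f1 (tgt a) * C a + f2 (tgt a) * rmap A a)"
      unfolding ext_rep_def
      by (simp, subst mult_hcat[of _ "rdim W (tgt a)" "rdim B (tgt a) + rdim A (tgt a)" _ "rdim B (src a)" _ "rdim A (src a)"])
        (use c in \<open>auto simp: hcat_mult_vcat[of _ "rdim W (tgt a)" "rdim B (tgt a)" _ "rdim A (tgt a)"] mat_dist\<close>)
    moreover have "rmap W a * hcat (f1 (src a)) (f2 (src a)) = hcat (rmap W a * f1 (src a)) (rmap W a * f2 (src a))"
      by (rule mult_hcat) (use c in auto)
    ultimately show ?thesis using c
      by (simp add: hcat_eq_iff[of _ "rdim W (tgt a)" "rdim B (src a)" _ "rdim A (src a)"])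
  qed
  show ?thesis using f by (auto simp: rhom_def mor_family_def eq hcat_carrier)
qed

lemma rhom_to_ext_rep:
  assumes A: "is_rep A" and B: "is_rep B" and C: "C \<in> arrow_family A B" and Q: "is_rep Q"
    and f: "f1 \<in> mor_family Q B" "f2 \<in> mor_family Q A"
  shows "(\<lambda>v. vcat (f1 v) (f2 v)) \<in> rhom Q (ext_rep B C A) \<longleftrightarrow>
    f2 \<in> rhom Q A \<and> (\<forall>a. f1 (tgt a) * rmap Q a = rmap B a * f1 (src a) + C a * f2 (src a))"
proof -
  have eq: "vcat (f1 (tgt a)) (f2 (tgt a)) * rmap Q a = rmap (ext_rep B C A) a * vcat (f1 (src a)) (f2 (src a)) \<longleftrightarrow>
      f2 (tgt a) * rmap Q a = rmap A a * f2 (src a) \<and>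
      f1 (tgt a) * rmap Q a = rmap B a * f1 (src a) + C a * f2 (src a)" for a
  proof -
    note c = mor_familyD[OF f(1), of "tgt a"] mor_familyD[OF f(1), of "src a"] mor_familyD[OF f(2), of "tgt a"]
      mor_familyD[OF f(2), of "src a"] is_repD[OF A, of a] is_repD[OF B, of a] is_repD[OF Q, of a] arrow_familyD[OF C, of a]
    have "rmap (ext_rep B C A) a * vcat (f1 (src a)) (f2 (src a)) =
       vcat (rmap B a) (0\<^sub>m (rdim A (tgt a)) (rdim B (src a))) * f1 (src a) + vcat (C a) (rmap A a) * f2 (src a)"
      unfolding ext_rep_def
      by (simp, rule hcat_mult_vcat[of _ "rdim B (tgt a) + rdim A (tgt a)" "rdim B (src a)" _ "rdim A (src a)" _ "rdim Q (src a)"])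
        (use c in auto)
    also have "\<dots> = vcat (rmap B a * f1 (src a) + C a * f2 (src a)) (rmap A a * f2 (src a))"
      using c by (simp add: vcat_mult[of _ _ "rdim Q (src a)" _ "rdim B (tgt a)" _ "rdim A (tgt a)"] mat_dist
          vcat_add[of _ "rdim B (tgt a)" "rdim Q (src a)" _ "rdim A (tgt a)"])
    finally have r: "rmap (ext_rep B C A) a * vcat (f1 (src a)) (f2 (src a)) = \<dots>" .
    have l: "vcat (f1 (tgt a)) (f2 (tgt a)) * rmap Q a = vcat (f1 (tgt a) * rmap Q a) (f2 (tgt a) * rmap Q a)"
      by (rule vcat_mult) (use c in auto)
    show ?thesis unfolding l r using c
      by (subst vcat_eq_iff[of _ "rdim B (tgt a)" "rdim Q (src a)" _ "rdim A (tgt a)"]) auto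
  qed
  show ?thesis using f by (auto simp: rhom_def mor_family_def eq vcat_carrier)
qed

lemma mor_family_split_cols:
  assumes "f \<in> mor_family (ext_rep B C A) W"
  obtains f1 f2 where "f1 \<in> mor_family B W" "f2 \<in> mor_family A W" "f = (\<lambda>v. hcat (f1 v) (f2 v))"
proof -
  have "\<exists>X Y. X \<in> carrier_mat (rdim W v) (rdim B v) \<and> Y \<in> carrier_mat (rdim W v) (rdim A v) \<and> f v = hcat X Y" for v
    using mor_familyD[OF assms, of v] split_cols[of "f v" "rdim W v" "rdim B v" "rdim A v"] by (metis rdim_ext_rep)
  then show thesis using that by (simp add: mor_family_def) metis
qed

lemma mor_family_split_rows:
  assumes "f \<in> mor_family Q (ext_rep B C A)"
  obtains f1 f2 where "f1 \<in> mor_family Q B" "f2 \<in> mor_family Q A" "f = (\<lambda>v. vcat (f1 v) (f2 v))"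
proof -
  have "\<exists>X Y. X \<in> carrier_mat (rdim B v) (rdim Q v) \<and> Y \<in> carrier_mat (rdim A v) (rdim Q v) \<and> f v = vcat X Y" for v
    using mor_familyD[OF assms, of v] split_rows[of "f v" "rdim B v" "rdim A v" "rdim Q v"] by (metis rdim_ext_rep)
  then show thesis using that by (simp add: mor_family_def) metis
qed

lemma rhom_mor_family: "f \<in> rhom V W \<Longrightarrow> f \<in> mor_family V W"
  by (auto simp: rhom_def mor_family_def)

lemma ext_rep_projection:
  assumes "is_rep A" "is_rep B" "C \<in> arrow_family A B"
  shows "(\<lambda>v. hcat (0\<^sub>m (rdim A v) (rdim B v)) (1\<^sub>m (rdim A v))) \<in> rhom (ext_rep B C A) A" (is "?g \<in> _")
    and "msurj (ext_rep B C A) A (\<lambda>v. hcat (0\<^sub>m (rdim A v) (rdim B v)) (1\<^sub>m (rdim A v)))"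
proof -
  have [simp]: "dim_row (C a) = rdim B (tgt a)" "dim_col (C a) = rdim A (src a)" for a
    using arrow_familyD[OF assms(3), of a] by auto
  show "?g \<in> rhom (ext_rep B C A) A"
    by (subst rhom_from_ext_rep) (use assms is_repD[OF assms(1)] in
      \<open>auto simp: mor_family_def mat_dist intro!: rhomI\<close>)
  show "msurj (ext_rep B C A) A ?g" unfolding msurj_def
  proof (intro allI ballI)
    fix v and y :: "'a vec" assume y: "y \<in> carrier_vec (rdim A v)"
    have "?g v *\<^sub>v (0\<^sub>v (rdim B v) @\<^sub>v y) = y"
      using y by (subst hcat_mult_append_vec[of _ "rdim A v" "rdim B v" _ "rdim A v"]) auto
    then show "\<exists>x\<in>carrier_vec (rdim (ext_rep B C A) v). y = ?g v *\<^sub>v x"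
      using y by (intro bexI[of _ "0\<^sub>v (rdim B v) @\<^sub>v y"]) auto
  qed
qed

lemma mexact_comp_zero:
  assumes "mexact U V W f g" "f v \<in> carrier_mat (rdim V v) (rdim U v)" "g v \<in> carrier_mat (rdim W v) (rdim V v)"
  shows "g v * f v = 0\<^sub>m (rdim W v) (rdim U v)"
proof (rule eq_mat_by_vec)
  fix x :: "'a vec" assume x: "x \<in> carrier_vec (rdim U v)"
  then have "f v *\<^sub>v x \<in> carrier_vec (rdim V v)" using assms by auto
  then have "g v *\<^sub>v (f v *\<^sub>v x) = 0\<^sub>v (rdim W v)" using assms(1) x unfolding mexact_def by blast
  then show "g v * f v *\<^sub>v x = 0\<^sub>m (rdim W v) (rdim U v) *\<^sub>v x"
    using assms(2,3) x
    by (simp add: assoc_mult_mat_vec[of _ "rdim W v" "rdim V v" _ "rdim U v"]) (auto intro!: eq_vecI)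
qed (use assms in auto)

text \<open>
  Let \<open>C\<close> be a cocycle and \<open>e : P 0 \<rightarrow> A\<close> the augmentation of a resolution. Projectivity lifts \<open>e\<close> to the
  extension with cocycle \<open>C\<close>; the \<open>B\<close>-component \<open>l1\<close> of the lift splits the pullback of \<open>C\<close> to \<open>P 0\<close>. Its
  restriction to \<open>P 1\<close> is a cocycle of the Hom complex, hence of the form \<open>u d\<close>. Then \<open>l1 - u\<close> vanishes on
  the kernel of \<open>e\<close> and descends to the family that splits \<open>C\<close>.
\<close>

lemma ext_free_of_ext_vanishes:
  assumes A: "is_rep A" and B: "is_rep B" and van: "ext_vanishes 1 A B"
  shows "ext_free A B"
  unfolding ext_free_def
proof
  fix C assume C: "C \<in> arrow_family A B"
  obtain P d e where res: "projective_resolution A P d e" and coc: "ext_cocycles P d B 1 = ext_coboundaries P d B 1"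
    using van by (auto simp: ext_vanishes_def)
  have P: "projective (P 0)" "\<And>n. is_rep (P n)" and d: "\<And>n. d n \<in> rhom (P (Suc n)) (P n)"
    and e: "e \<in> rhom (P 0) A" "msurj (P 0) A e" and ex0: "mexact (P 1) (P 0) A (d 0) e"
    and ex1: "mexact (P (Suc (Suc 0))) (P (Suc 0)) (P 0) (d (Suc 0)) (d 0)"
    using res by (auto simp: projective_resolution_def projective_def)
  note dc = rhomD[OF d[of 0]] rhomD[OF e(1)]
  define X where "X = ext_rep B C A"
  have X: "is_rep X" unfolding X_def by (rule ext_rep_is_rep[OF A B C])
  obtain l where l: "l \<in> rhom (P 0) X" "(\<lambda>v. hcat (0\<^sub>m (rdim A v) (rdim B v)) (1\<^sub>m (rdim A v))) \<star> l = e"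
    using P(1) e(1) X A ext_rep_projection[OF A B C] unfolding projective_def X_def by blast
  obtain l1 l2 where l12: "l1 \<in> mor_family (P 0) B" "l2 \<in> mor_family (P 0) A" "l = (\<lambda>v. vcat (l1 v) (l2 v))"
    using mor_family_split_rows rhom_mor_family[OF l(1)] unfolding X_def by metis
  have "l2 = e"
  proof
    fix v
    have "e v = hcat (0\<^sub>m (rdim A v) (rdim B v)) (1\<^sub>m (rdim A v)) * vcat (l1 v) (l2 v)"
      using l(2) l12(3) by (auto simp: mcomp_def)
    also have "\<dots> = l2 v"
      using mor_familyD[OF l12(1), of v] mor_familyD[OF l12(2), of v]
      by (subst hcat_mult_vcat[of _ "rdim A v" "rdim B v" _ "rdim A v"]) (auto simp: mat_dist)
    finally show "l2 v = e v" by simp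
  qed
  then have l1: "l1 (tgt a) * rmap (P 0) a = rmap B a * l1 (src a) + C a * e (src a)" for a
    using rhom_to_ext_rep[OF A B C P(2) l12(1,2)] l(1) l12(3) by (simp add: X_def)
  note l1c = mor_familyD[OF l12(1)]
  have ed: "e v * d 0 v = 0\<^sub>m (rdim A v) (rdim (P 1) v)" for v
    using mexact_comp_zero[OF ex0] dc by simp
  define h where "h = l1 \<star> d 0"
  have hc: "h v \<in> carrier_mat (rdim B v) (rdim (P 1) v)" for v
    using l1c[of v] dc(1)[of v] by (simp add: h_def mcomp_def)
  have "h \<in> rhom (P 1) B"
  proof (rule rhomI[OF hc])
    fix a
    note c = l1c[of "tgt a"] l1c[of "src a"] dc(1)[of "tgt a"] dc(1)[of "src a"] is_repD[OF P(2), of 1 a] is_repD[OF P(2), of 0 a]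
      is_repD[OF B, of a] arrow_familyD[OF C, of a] dc(2)[of "src a"]
    have "h (tgt a) * rmap (P 1) a = l1 (tgt a) * (d 0 (tgt a) * rmap (P 1) a)"
      using c by (simp add: h_def mcomp_def mat_assoc)
    also have "\<dots> = l1 (tgt a) * rmap (P 0) a * d 0 (src a)"
      using c rhom_comm[OF d[of 0], of a] by (simp add: mat_assoc)
    also have "\<dots> = (rmap B a * l1 (src a) + C a * e (src a)) * d 0 (src a)" by (simp add: l1)
    also have "\<dots> = rmap B a * (l1 (src a) * d 0 (src a)) + C a * (e (src a) * d 0 (src a))"
      using c by (simp add: mat_dist mat_assoc)
    also have "\<dots> = rmap B a * h (src a)" using c by (simp add: ed mat_dist h_def mcomp_def)
    finally show "h (tgt a) * rmap (P 1) a = rmap B a * h (src a)" .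
  qed
  moreover have "h \<star> d 1 = mzero (P (Suc 1)) B"
  proof
    fix v
    note c = l1c[of v] dc(1)[of v] rhomD[OF d[of 1], of v]
    have "d 0 v * d 1 v = 0\<^sub>m (rdim (P 0) v) (rdim (P (Suc 1)) v)"
      using mexact_comp_zero[OF ex1] c by simp
    then show "(h \<star> d 1) v = mzero (P (Suc 1)) B v"
      using c by (simp add: h_def mcomp_def mat_assoc mat_dist mzero_def)
  qed
  ultimately have "h \<in> ext_cocycles P d B 1" by (simp add: ext_cocycles_def)
  then obtain u where u: "u \<in> rhom (P 0) B" "h = u \<star> d 0" using coc by auto
  define w where "w v = l1 v - u v" for v
  have wc: "w v \<in> carrier_mat (rdim B v) (rdim (P 0) v)" for v
    using l1c[of v] rhomD[OF u(1), of v] by (simp add: w_def minus_carrier_mat)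
  have wd: "w v * d 0 v = 0\<^sub>m (rdim B v) (rdim (P 1) v)" for v
  proof -
    have "l1 v * d 0 v = u v * d 0 v" using fun_cong[OF u(2), of v] by (simp add: h_def mcomp_def)
    then show ?thesis using l1c[of v] rhomD[OF u(1), of v] dc(1)[of v] by (simp add: w_def mat_dist)
  qed
  have esurj: "\<exists>x\<in>carrier_vec (rdim (P 0) v). y = e v *\<^sub>v x" if "y \<in> carrier_vec (rdim A v)" for v y
    using e(2) that by (auto simp: msurj_def)
  have "\<exists>F. F \<in> carrier_mat (rdim B v) (rdim A v) \<and> w v = F * e v" for v
  proof (rule factor_through_surjective_mat[OF dc(2)[of v] wc[of v] esurj])
    fix x :: "'a vec" assume x: "x \<in> carrier_vec (rdim (P 0) v)" "e v *\<^sub>v x = 0\<^sub>v (rdim A v)"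
    then obtain y where y: "y \<in> carrier_vec (rdim (P 1) v)" "x = d 0 v *\<^sub>v y"
      using ex0 by (auto simp: mexact_def)
    then have "w v *\<^sub>v x = w v * d 0 v *\<^sub>v y"
      using wc[of v] dc(1)[of v] by (simp add: assoc_mult_mat_vec[of _ "rdim B v" "rdim (P 0) v" _ "rdim (P 1) v"])
    then show "w v *\<^sub>v x = 0\<^sub>v (rdim B v)" using y by (simp add: wd zero_mat_mult_vec)
  qed auto
  then obtain f where f: "\<And>v. f v \<in> carrier_mat (rdim B v) (rdim A v)" "\<And>v. w v = f v * e v" by metis
  show "\<exists>f\<in>mor_family A B. \<forall>a. C a = f (tgt a) * rmap A a - rmap B a * f (src a)"
  proof (intro bexI[of _ f] allI)
    show "f \<in> mor_family A B" using f(1) by (simp add: mor_family_def)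
    fix a
    note c = l1c[of "tgt a"] l1c[of "src a"] is_repD[OF P(2), of 0 a] f(1)[of "tgt a"] f(1)[of "src a"]
      is_repD[OF B, of a] is_repD[OF A, of a] arrow_familyD[OF C, of a] dc(2)[of "src a"] dc(2)[of "tgt a"]
      rhomD[OF u(1), of "tgt a"] rhomD[OF u(1), of "src a"]
    have "f (tgt a) * rmap A a * e (src a) = f (tgt a) * (e (tgt a) * rmap (P 0) a)"
      using c rhom_comm[OF e(1), of a] by (simp add: mat_assoc)
    also have "\<dots> = w (tgt a) * rmap (P 0) a" using c by (simp add: f(2) mat_assoc)
    also have "\<dots> = l1 (tgt a) * rmap (P 0) a - rmap B a * u (src a)"
      using c rhom_comm[OF u(1), of a] by (simp add: w_def mat_dist)
    also have "\<dots> = rmap B a * l1 (src a) + C a * e (src a) - rmap B a * u (src a)" by (simp add: l1)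
    also have "\<dots> = rmap B a * w (src a) + C a * e (src a)"
      using c by (intro eq_matI) (auto simp: w_def mat_dist)
    also have "\<dots> = (rmap B a * f (src a) + C a) * e (src a)"
      using c by (simp add: f(2) mat_dist mat_assoc)
    finally have "f (tgt a) * rmap A a = rmap B a * f (src a) + C a"
      by (rule mat_cancel_surjective[OF dc(2)[of "src a"] esurj, rotated 3]) (use c in auto)
    then show "C a = f (tgt a) * rmap A a - rmap B a * f (src a)" using c by (intro eq_matI) auto
  qed
qed

section \<open>The standard projective resolution and the Ext groups\<close>

text \<open>
  One copy of the projective at the target of \<open>a\<close> for every arrow \<open>a\<close> and every basis vector of \<open>A\<close> at the
  source of \<open>a\<close>. The space at \<open>Ve\<close> has three blocks: the image of the space at \<open>Vmid\<close>, and the generators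
  that belong to the arrows \<open>BE\<close> and \<open>ME\<close>.
\<close>

definition syz :: "'k::field rep \<Rightarrow> 'k rep" where
  "syz A = mk_rep (0, rdim A Vb, rdim A Vb + (rdim A Vb + rdim A Vmid))
     (0\<^sub>m (rdim A Vb + (rdim A Vb + rdim A Vmid)) 0, 0\<^sub>m (rdim A Vb) 0,
      vcat (1\<^sub>m (rdim A Vb)) (0\<^sub>m (rdim A Vb + rdim A Vmid) (rdim A Vb)))"

text \<open>
  The universal cocycle: it sends a basis vector at the source of \<open>a\<close> to the generator of the syzygy that
  belongs to \<open>a\<close> and this vector.
\<close>

fun cover_cocycle :: "'k::field rep \<Rightarrow> arrow \<Rightarrow> 'k mat" where
  "cover_cocycle A BE = vcat (0\<^sub>m (rdim A Vb) (rdim A Vb)) (vcat (1\<^sub>m (rdim A Vb)) (0\<^sub>m (rdim A Vmid) (rdim A Vb)))"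
| "cover_cocycle A BM = 1\<^sub>m (rdim A Vb)"
| "cover_cocycle A ME = vcat (0\<^sub>m (rdim A Vb) (rdim A Vmid)) (vcat (0\<^sub>m (rdim A Vb) (rdim A Vmid)) (1\<^sub>m (rdim A Vmid)))"

text \<open>
  This is the sum of the projectives at the vertices, one copy for each basis vector of \<open>A\<close>. As an
  extension of \<open>A\<close> by the syzygy it comes with its short exact sequence, and morphisms out of it are
  described by \<open>rhom_from_ext_rep\<close>.
\<close>

definition cover :: "'k::field rep \<Rightarrow> 'k rep" where
  "cover A = ext_rep (syz A) (cover_cocycle A) A"

lemma syz_dims[simp]: "rdim (syz A) Vb = 0" "rdim (syz A) Vmid = rdim A Vb"
    "rdim (syz A) Ve = rdim A Vb + (rdim A Vb + rdim A Vmid)"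
  and syz_maps: "rmap (syz A) BE = 0\<^sub>m (rdim A Vb + (rdim A Vb + rdim A Vmid)) 0" "rmap (syz A) BM = 0\<^sub>m (rdim A Vb) 0"
    "rmap (syz A) ME = vcat (1\<^sub>m (rdim A Vb)) (0\<^sub>m (rdim A Vb + rdim A Vmid) (rdim A Vb))"
  by (simp_all add: syz_def)

lemma syz_is_rep: "is_rep (syz A)"
  by (auto simp: is_rep_def all_arrow syz_maps)

lemma cover_cocycle_family: "cover_cocycle A \<in> arrow_family A (syz A)"
  by (auto simp: arrow_family_def all_arrow)

lemma cover_is_rep: "is_rep A \<Longrightarrow> is_rep (cover A)"
  unfolding cover_def by (rule ext_rep_is_rep[OF _ syz_is_rep cover_cocycle_family])

lemma eq_mat_no_cols: "X \<in> carrier_mat n 0 \<Longrightarrow> Y \<in> carrier_mat n 0 \<Longrightarrow> X = Y"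
  by (intro eq_matI) auto

lemma eq_mat_no_rows: "X \<in> carrier_mat 0 n \<Longrightarrow> Y \<in> carrier_mat 0 n \<Longrightarrow> X = Y"
  by (intro eq_matI) auto

lemma hcat_mult_first:
  fixes X :: "'k::field mat"
  assumes "X \<in> carrier_mat n p" "Y \<in> carrier_mat n q"
  shows "hcat X Y * vcat (1\<^sub>m p) (0\<^sub>m q p) = X"
proof -
  have "hcat X Y * vcat (1\<^sub>m p) (0\<^sub>m q p) = X * 1\<^sub>m p + Y * 0\<^sub>m q p" by (rule hcat_mult_vcat[OF assms]) auto
  then show ?thesis using assms by simp
qed

lemma hcat_mult_second:
  fixes X :: "'k::field mat"
  assumes "X \<in> carrier_mat n p" "Y \<in> carrier_mat n q"
  shows "hcat X Y * vcat (0\<^sub>m p q) (1\<^sub>m q) = Y"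
proof -
  have "hcat X Y * vcat (0\<^sub>m p q) (1\<^sub>m q) = X * 0\<^sub>m p q + Y * 1\<^sub>m q" by (rule hcat_mult_vcat[OF assms]) auto
  then show ?thesis using assms by simp
qed

lemma msurj_lift:
  assumes "g \<in> rhom V W" "msurj V W g" "H \<in> carrier_mat (rdim W v) n"
  obtains L where "L \<in> carrier_mat (rdim V v) n" "g v * L = H"
proof -
  have g: "g v \<in> carrier_mat (rdim W v) (rdim V v)" by (rule rhomD[OF assms(1)])
  have surj: "\<And>y. y \<in> carrier_vec (rdim W v) \<Longrightarrow> \<exists>x\<in>carrier_vec (rdim V v). y = g v *\<^sub>v x"
    using assms(2) by (auto simp: msurj_def)
  obtain S where S: "S \<in> carrier_mat (rdim V v) (rdim W v)" "g v * S = 1\<^sub>m (rdim W v)"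
    using surjective_mat_section[OF g surj] .
  have "g v * (S * H) = (g v * S) * H" using g S(1) assms(3) by (simp add: mat_assoc)
  also have "\<dots> = H" using assms(3) by (simp add: S(2))
  finally show thesis using that[of "S * H"] S assms(3) by auto
qed

text \<open>
  A morphism from the syzygy is determined freely by the images of the generators: an arbitrary matrix at
  \<open>Vmid\<close> and the other two blocks at \<open>Ve\<close>; the first block at \<open>Ve\<close> is forced.
\<close>

lemma projective_syz: "projective (syz A)"
  unfolding projective_def
proof (intro conjI allI ballI impI)
  show "is_rep (syz A)" by (rule syz_is_rep)
  fix V W :: "'a rep" and g h
  assume g: "g \<in> rhom V W" and h: "h \<in> rhom (syz A) W" and V: "is_rep V" and W: "is_rep W" and s: "msurj V W g"
  let ?b = "rdim A Vb" let ?m = "rdim A Vmid"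
  have hm: "h Vmid \<in> carrier_mat (rdim W Vmid) ?b" using rhomD[OF h, of Vmid] by simp
  have he: "h Ve \<in> carrier_mat (rdim W Ve) (?b + (?b + ?m))" using rhomD[OF h, of Ve] by simp
  obtain p q where pq: "p \<in> carrier_mat (rdim W Ve) ?b" "q \<in> carrier_mat (rdim W Ve) (?b + ?m)" "h Ve = hcat p q"
    using split_cols[OF he] .
  have "h Ve * rmap (syz A) ME = p"
    unfolding syz_maps pq(3) by (rule hcat_mult_first[OF pq(1,2)])
  then have p: "p = rmap W ME * h Vmid" using rhom_comm[OF h, of ME] by simp
  obtain Lm where Lm: "Lm \<in> carrier_mat (rdim V Vmid) ?b" "g Vmid * Lm = h Vmid" using msurj_lift[OF g s hm] .
  obtain Lq where Lq: "Lq \<in> carrier_mat (rdim V Ve) (?b + ?m)" "g Ve * Lq = q" using msurj_lift[OF g s pq(2)] .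
  define l where "l = case_vertex (0\<^sub>m (rdim V Vb) 0) Lm (hcat (rmap V ME * Lm) Lq)"
  have VM: "rmap V ME * Lm \<in> carrier_mat (rdim V Ve) ?b" using is_repD[OF V, of ME] Lm by simp
  have lc: "l v \<in> carrier_mat (rdim V v) (rdim (syz A) v)" for v
    by (cases v) (use Lm Lq VM in \<open>auto simp: l_def\<close>)
  show "\<exists>l\<in>rhom (syz A) V. g \<star> l = h"
  proof (intro bexI[of _ l] ext)
    fix v
    show "(g \<star> l) v = h v"
    proof (cases v)
      case Vb
      then show ?thesis using rhomD[OF g, of Vb] rhomD[OF h, of Vb] lc[of Vb]
        by (intro eq_mat_no_cols[of _ "rdim W Vb"]) (auto simp: mcomp_def)
    next
      case Vmid then show ?thesis using Lm by (simp add: mcomp_def l_def)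
    next
      case Ve
      have "g Ve * (rmap V ME * Lm) = g Ve * rmap V ME * Lm"
        using rhomD[OF g, of Ve] is_repD[OF V, of ME] Lm by simp
      also have "\<dots> = rmap W ME * (g Vmid * Lm)"
        using rhom_comm[OF g, of ME] rhomD[OF g, of Vmid] is_repD[OF W, of ME] Lm by simp
      finally have "g Ve * (rmap V ME * Lm) = p" using Lm p by simp
      then show ?thesis using Ve Lq pq(3) rhomD[OF g, of Ve]
        by (simp add: mcomp_def l_def mult_hcat[OF _ VM Lq(1)])
    qed
  next
    show "l \<in> rhom (syz A) V"
    proof (rule rhomI[OF lc])
      fix a
      show "l (tgt a) * rmap (syz A) a = rmap V a * l (src a)"
      proof (cases a)
        case ME
        have "hcat (rmap V ME * Lm) Lq * vcat (1\<^sub>m ?b) (0\<^sub>m (?b + ?m) ?b) = rmap V ME * Lm"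
          by (rule hcat_mult_first[OF VM Lq(1)])
        then show ?thesis using ME by (simp add: l_def syz_maps)
      qed (use lc[of "tgt a"] lc[of "src a"] is_repD[OF V, of a] in
          \<open>auto simp: syz_maps intro!: eq_mat_no_cols[of _ "rdim V (tgt a)"]\<close>)
    qed
  qed
qed

text \<open>
  Write a morphism on the cover as \<open>(h1, h2)\<close> with \<open>h2\<close> a family on \<open>A\<close>. The family \<open>h2\<close> lifts vertex by
  vertex to some \<open>L\<close>, which fails to commute with the arrows by \<open>D\<close>. Since the cocycle of the cover is
  universal, there is exactly one morphism from the syzygy that takes it to \<open>D\<close>, and together with \<open>L\<close> it
  is the required lift.
\<close>

lemma projective_cover:
  assumes A: "is_rep A"
  shows "projective (cover A)"
  unfolding projective_def
proof (intro conjI allI ballI impI)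
  show "is_rep (cover A)" by (rule cover_is_rep[OF A])
  fix V W :: "'a rep" and g h
  assume g: "g \<in> rhom V W" and h: "h \<in> rhom (cover A) W" and V: "is_rep V" and W: "is_rep W" and s: "msurj V W g"
  let ?b = "rdim A Vb" let ?m = "rdim A Vmid" let ?e = "rdim A Ve"
  note fam = A syz_is_rep[of A] cover_cocycle_family[of A]
  obtain h1 h2 where h12: "h1 \<in> mor_family (syz A) W" "h2 \<in> mor_family A W" "h = (\<lambda>v. hcat (h1 v) (h2 v))"
    by (rule mor_family_split_cols[OF rhom_mor_family[OF h, unfolded cover_def]])
  have h1: "h1 \<in> rhom (syz A) W"
    and h2: "\<And>a. h1 (tgt a) * cover_cocycle A a + h2 (tgt a) * rmap A a = rmap W a * h2 (src a)"
    using rhom_from_ext_rep[OF fam W h12(1,2)] h h12(3) by (auto simp: cover_def)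
  have "\<exists>L. \<forall>v. L v \<in> carrier_mat (rdim V v) (rdim A v) \<and> g v * L v = h2 v"
    by (rule choice, rule allI) (metis msurj_lift[OF g s mor_familyD[OF h12(2)]])
  then obtain L where L: "\<And>v. L v \<in> carrier_mat (rdim V v) (rdim A v)" "\<And>v. g v * L v = h2 v" by blast
  define D where "D a = rmap V a * L (src a) - L (tgt a) * rmap A a" for a
  have Dc: "D a \<in> carrier_mat (rdim V (tgt a)) (rdim A (src a))" for a
    using is_repD[OF V, of a] is_repD[OF A, of a] L(1)[of "src a"] L(1)[of "tgt a"]
    by (simp add: D_def minus_carrier_mat)
  have gD: "g (tgt a) * D a = h1 (tgt a) * cover_cocycle A a" for a
  proof -
    note c = is_repD[OF V, of a] is_repD[OF A, of a] is_repD[OF W, of a] L(1)[of "src a"] L(1)[of "tgt a"]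
      rhomD[OF g, of "tgt a"] rhomD[OF g, of "src a"] mor_familyD[OF h12(1), of "tgt a"] mor_familyD[OF h12(2), of "tgt a"]
      arrow_familyD[OF fam(3), of a]
    have "g (tgt a) * D a = g (tgt a) * rmap V a * L (src a) - g (tgt a) * L (tgt a) * rmap A a"
      using c by (simp add: D_def mat_dist mat_assoc)
    also have "\<dots> = rmap W a * h2 (src a) - h2 (tgt a) * rmap A a"
      using c by (simp add: rhom_comm[OF g] L(2) mat_assoc)
    also have "\<dots> = h1 (tgt a) * cover_cocycle A a"
      unfolding h2[symmetric] using c by (intro eq_matI) auto
    finally show ?thesis .
  qed
  have Vc: "rmap V ME * D BM \<in> carrier_mat (rdim V Ve) ?b" using is_repD[OF V, of ME] Dc[of BM] by simp
  note DE = Dc[of BE, simplified] Dc[of ME, simplified] Dc[of BM, simplified]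
  have Dq: "hcat (D BE) (D ME) \<in> carrier_mat (rdim V Ve) (?b + ?m)" using DE by auto
  define l1 where "l1 = case_vertex (0\<^sub>m (rdim V Vb) 0) (D BM) (hcat (rmap V ME * D BM) (hcat (D BE) (D ME)))"
  have l1c: "l1 v \<in> carrier_mat (rdim V v) (rdim (syz A) v)" for v
    by (cases v) (use DE Dq Vc in \<open>auto simp: l1_def\<close>)
  have l1: "l1 \<in> rhom (syz A) V"
  proof (rule rhomI[OF l1c])
    fix a
    show "l1 (tgt a) * rmap (syz A) a = rmap V a * l1 (src a)"
    proof (cases a)
      case ME
      have "hcat (rmap V ME * D BM) (hcat (D BE) (D ME)) * vcat (1\<^sub>m ?b) (0\<^sub>m (?b + ?m) ?b) = rmap V ME * D BM"
        by (rule hcat_mult_first[OF Vc Dq])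
      then show ?thesis using ME by (simp add: l1_def syz_maps)
    qed (use l1c[of "tgt a"] l1c[of "src a"] is_repD[OF V, of a] in
        \<open>auto simp: syz_maps intro!: eq_mat_no_cols[of _ "rdim V (tgt a)"]\<close>)
  qed
  have lD: "l1 (tgt a) * cover_cocycle A a = D a" for a
  proof (cases a)
    case BE
    have "hcat (rmap V ME * D BM) (hcat (D BE) (D ME)) * cover_cocycle A BE
      = (rmap V ME * D BM) * 0\<^sub>m ?b ?b + hcat (D BE) (D ME) * vcat (1\<^sub>m ?b) (0\<^sub>m ?m ?b)"
      unfolding cover_cocycle.simps by (rule hcat_mult_vcat[OF Vc Dq]) auto
    also have "hcat (D BE) (D ME) * vcat (1\<^sub>m ?b) (0\<^sub>m ?m ?b) = D BE"
      by (rule hcat_mult_first[OF DE(1,2)])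
    finally show ?thesis using BE DE by (simp add: l1_def right_mult_zero_mat[OF Vc])
  next
    case BM then show ?thesis using DE by (simp add: l1_def mat_dist)
  next
    case ME
    have "hcat (rmap V ME * D BM) (hcat (D BE) (D ME)) * cover_cocycle A ME
      = (rmap V ME * D BM) * 0\<^sub>m ?b ?m + hcat (D BE) (D ME) * vcat (0\<^sub>m ?b ?m) (1\<^sub>m ?m)"
      unfolding cover_cocycle.simps by (rule hcat_mult_vcat[OF Vc Dq]) auto
    also have "hcat (D BE) (D ME) * vcat (0\<^sub>m ?b ?m) (1\<^sub>m ?m) = D ME"
      by (rule hcat_mult_second[OF DE(1,2)])
    finally show ?thesis using ME DE by (simp add: l1_def right_mult_zero_mat[OF Vc])
  qed
  have "l1 (tgt a) * cover_cocycle A a + L (tgt a) * rmap A a = rmap V a * L (src a)" for a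
    unfolding lD D_def using is_repD[OF V, of a] is_repD[OF A, of a] L(1)[of "src a"] L(1)[of "tgt a"]
    by (intro eq_matI) auto
  then have "(\<lambda>v. hcat (l1 v) (L v)) \<in> rhom (cover A) V"
    unfolding cover_def using l1 L(1) by (subst rhom_from_ext_rep[OF fam V]) (auto simp: mor_family_def rhomD)
  moreover have "g \<star> (\<lambda>v. hcat (l1 v) (L v)) = h"
  proof
    fix v
    have "g v * l1 v = h1 v"
    proof (cases v)
      case Vb
      then show ?thesis using rhomD[OF g, of Vb] rhomD[OF h1, of Vb] l1c[of Vb]
        by (intro eq_mat_no_cols[of _ "rdim W Vb"]) auto
    next
      case Vmid
      then show ?thesis using gD[of BM] rhomD[OF h1, of Vmid] by (simp add: l1_def mat_dist)
    next
      case Ve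
      have he: "h1 Ve \<in> carrier_mat (rdim W Ve) (?b + (?b + ?m))" using rhomD[OF h1, of Ve] by simp
      obtain p q where pq: "p \<in> carrier_mat (rdim W Ve) ?b" "q \<in> carrier_mat (rdim W Ve) (?b + ?m)" "h1 Ve = hcat p q"
        using split_cols[OF he] .
      obtain q1 q2 where q: "q1 \<in> carrier_mat (rdim W Ve) ?b" "q2 \<in> carrier_mat (rdim W Ve) ?m" "q = hcat q1 q2"
        using split_cols[OF pq(2)] .
      have "h1 Ve * rmap (syz A) ME = p"
        unfolding syz_maps pq(3) by (rule hcat_mult_first[OF pq(1,2)])
      then have p: "p = rmap W ME * h1 Vmid" using rhom_comm[OF h1, of ME] by simp
      have "h1 Ve * cover_cocycle A BE = p * 0\<^sub>m ?b ?b + q * vcat (1\<^sub>m ?b) (0\<^sub>m ?m ?b)"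
        unfolding cover_cocycle.simps pq(3) by (rule hcat_mult_vcat[OF pq(1,2)]) auto
      moreover have "h1 Ve * cover_cocycle A ME = p * 0\<^sub>m ?b ?m + q * vcat (0\<^sub>m ?b ?m) (1\<^sub>m ?m)"
        unfolding cover_cocycle.simps pq(3) by (rule hcat_mult_vcat[OF pq(1,2)]) auto
      ultimately have "h1 Ve * cover_cocycle A BE = q1" "h1 Ve * cover_cocycle A ME = q2"
        using pq(1) q(1,2) by (simp_all add: q(3) hcat_mult_first[OF q(1,2)] hcat_mult_second[OF q(1,2)])
      then have gq: "g Ve * D BE = q1" "g Ve * D ME = q2" using gD[of BE] gD[of ME] by simp_all
      have "g Ve * (rmap V ME * D BM) = g Ve * rmap V ME * D BM"
        using rhomD[OF g, of Ve] is_repD[OF V, of ME] DE by simp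
      also have "\<dots> = rmap W ME * (g Vmid * D BM)"
        using rhom_comm[OF g, of ME] rhomD[OF g, of Vmid] is_repD[OF W, of ME] DE by simp
      also have "g Vmid * D BM = h1 Vmid" using gD[of BM] rhomD[OF h1, of Vmid] by (simp add: mat_dist)
      finally have "g Ve * (rmap V ME * D BM) = p" using p by simp
      then show ?thesis using Ve rhomD[OF g, of Ve]
        by (simp add: l1_def pq(3) q(3) mult_hcat[OF _ Vc Dq] mult_hcat[OF _ DE(1,2)] gq)
    qed
    then show "(g \<star> (\<lambda>v. hcat (l1 v) (L v))) v = h v"
      by (simp add: mcomp_def h12(3) mult_hcat[OF rhomD[OF g] l1c L(1)] L(2))
  qed
  ultimately show "\<exists>l\<in>rhom (cover A) V. g \<star> l = h" by blast
qed

lemma rzero_dims[simp]: "rdim rzero v = 0" "rmap rzero a = 0\<^sub>m 0 0" by (simp_all add: rzero_def)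

lemma rzero_is_rep: "is_rep rzero" by (simp add: is_rep_def)

lemma rhom_from_zero: "(\<And>v. rdim Z v = 0) \<Longrightarrow> f \<in> rhom Z W \<Longrightarrow> f = mzero Z W"
proof (rule ext)
  fix v assume Z: "\<And>v. rdim Z v = 0" and f: "f \<in> rhom Z W"
  show "f v = mzero Z W v"
    by (rule eq_mat_no_cols[of _ "rdim W v"]) (use rhomD[OF f, of v] Z in \<open>auto simp: mzero_def\<close>)
qed

lemma projective_rzero: "projective rzero"
  unfolding projective_def
proof (intro conjI allI ballI impI)
  fix V W :: "'a rep" and g h
  assume a: "g \<in> rhom V W" "h \<in> rhom rzero W" "is_rep V" "is_rep W"
  have "g \<star> mzero rzero V = mzero rzero W"
    by (rule rhom_from_zero[OF _ rhom_comp[OF rzero_is_rep a(3,4) mzero_rhom[OF rzero_is_rep a(3)] a(1)]]) simp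
  then show "\<exists>l\<in>rhom rzero V. g \<star> l = h"
    using rhom_from_zero[OF _ a(2)] mzero_rhom[OF rzero_is_rep a(3)] by auto
qed (rule rzero_is_rep)

definition std_P :: "'k::field rep \<Rightarrow> nat \<Rightarrow> 'k rep" where
  "std_P A n = (if n = 0 then cover A else if n = 1 then syz A else rzero)"
definition std_d :: "'k::field rep \<Rightarrow> nat \<Rightarrow> 'k mor" where
  "std_d A n = (if n = 0 then (\<lambda>v. vcat (1\<^sub>m (rdim (syz A) v)) (0\<^sub>m (rdim A v) (rdim (syz A) v)))
     else mzero (std_P A (Suc n)) (std_P A n))"
definition std_e :: "'k::field rep \<Rightarrow> 'k mor" where
  "std_e A = (\<lambda>v. hcat (0\<^sub>m (rdim A v) (rdim (syz A) v)) (1\<^sub>m (rdim A v)))"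

lemma std_P_is_rep: "is_rep A \<Longrightarrow> is_rep (std_P A n)"
  by (simp add: std_P_def cover_is_rep syz_is_rep rzero_is_rep)

lemma std_d_rhom: assumes A: "is_rep A" shows "std_d A n \<in> rhom (std_P A (Suc n)) (std_P A n)"
proof (cases "n = 0")
  case True
  have "(\<lambda>v. vcat (1\<^sub>m (rdim (syz A) v)) (0\<^sub>m (rdim A v) (rdim (syz A) v))) \<in> rhom (syz A) (cover A)"
    unfolding cover_def
  proof (subst rhom_to_ext_rep[OF A syz_is_rep cover_cocycle_family syz_is_rep])
    have c: "dim_col (cover_cocycle A a) = rdim A (src a)" "dim_row (cover_cocycle A a) = rdim (syz A) (tgt a)" for a
      using arrow_familyD[OF cover_cocycle_family, of A a] by auto
    show "(\<lambda>v. 0\<^sub>m (rdim A v) (rdim (syz A) v)) \<in> rhom (syz A) A \<and>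
      (\<forall>a. 1\<^sub>m (rdim (syz A) (tgt a)) * rmap (syz A) a =
         rmap (syz A) a * 1\<^sub>m (rdim (syz A) (src a)) + cover_cocycle A a * 0\<^sub>m (rdim A (src a)) (rdim (syz A) (src a)))"
      using mzero_rhom[OF syz_is_rep A] is_repD[OF syz_is_rep, of A] by (simp add: mzero_def mat_dist syz_is_rep c)
  qed (auto simp: mor_family_def)
  then show ?thesis using True by (simp add: std_P_def std_d_def)
next
  case False
  then show ?thesis using mzero_rhom[OF std_P_is_rep[OF A] std_P_is_rep[OF A]] by (simp add: std_d_def)
qed

lemma std_resolution:
  assumes A: "is_rep A"
  shows "projective_resolution A (std_P A) (std_d A) (std_e A)"
proof -
  have ex0: "mexact (syz A) (cover A) A (std_d A 0) (std_e A)"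
    unfolding mexact_def
  proof (intro allI ballI)
    fix v and x :: "'a vec" assume "x \<in> carrier_vec (rdim (cover A) v)"
    then obtain y z where yz: "y \<in> carrier_vec (rdim (syz A) v)" "z \<in> carrier_vec (rdim A v)" "x = y @\<^sub>v z"
      using split_vec by (metis cover_def rdim_ext_rep)
    have "std_e A v *\<^sub>v x = z" using yz
      by (simp add: std_e_def hcat_mult_append_vec[of _ "rdim A v" "rdim (syz A) v" _ "rdim A v"] zero_mat_mult_vec)
    moreover have "std_d A 0 v *\<^sub>v u = u @\<^sub>v 0\<^sub>v (rdim A v)" if "u \<in> carrier_vec (rdim (syz A) v)" for u
      using that by (simp add: std_d_def vcat_mult_vec[of _ "rdim (syz A) v" "rdim (syz A) v" _ "rdim A v"] zero_mat_mult_vec)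
    ultimately show "std_e A v *\<^sub>v x = 0\<^sub>v (rdim A v) \<longleftrightarrow> (\<exists>u\<in>carrier_vec (rdim (syz A) v). x = std_d A 0 v *\<^sub>v u)"
      using yz by (auto simp: append_vec_eq)
  qed
  have ex1: "mexact rzero (syz A) (cover A) (std_d A 1) (std_d A 0)"
    unfolding mexact_def
  proof (intro allI ballI)
    fix v and x :: "'a vec" assume x: "x \<in> carrier_vec (rdim (syz A) v)"
    have "std_d A 0 v *\<^sub>v x = x @\<^sub>v 0\<^sub>v (rdim A v)"
      using x by (simp add: std_d_def vcat_mult_vec[of _ "rdim (syz A) v" "rdim (syz A) v" _ "rdim A v"] zero_mat_mult_vec)
    moreover have "0\<^sub>v (rdim (cover A) v) = 0\<^sub>v (rdim (syz A) v) @\<^sub>v (0\<^sub>v (rdim A v) :: 'a vec)"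
      by (intro eq_vecI) (auto simp: cover_def)
    moreover have "std_d A 1 v *\<^sub>v u = 0\<^sub>v (rdim (syz A) v)" if "u \<in> carrier_vec 0" for u :: "'a vec"
      using that by (simp add: std_d_def mzero_def std_P_def zero_mat_mult_vec)
    ultimately show "std_d A 0 v *\<^sub>v x = 0\<^sub>v (rdim (cover A) v) \<longleftrightarrow> (\<exists>u\<in>carrier_vec (rdim rzero v). x = std_d A 1 v *\<^sub>v u)"
      using x by (auto simp: append_vec_eq[OF x zero_carrier_vec] intro!: exI[of _ "0\<^sub>v 0"] bexI[of _ "0\<^sub>v 0"])
  qed
  have ex2: "mexact rzero rzero W f g" if "\<And>v. f v \<in> carrier_mat 0 0" "\<And>v. g v \<in> carrier_mat (rdim W v) 0" for W :: "'a rep" and f g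
    unfolding mexact_def
  proof (intro allI ballI)
    fix v and x :: "'a vec" assume x: "x \<in> carrier_vec (rdim rzero v)"
    have "g v *\<^sub>v x = 0\<^sub>v (rdim W v)" using x that(2)[of v] by (intro eq_vecI) (auto simp: scalar_prod_def)
    moreover have "x = f v *\<^sub>v 0\<^sub>v 0" using x that(1)[of v] by (intro eq_vecI) auto
    ultimately show "g v *\<^sub>v x = 0\<^sub>v (rdim W v) \<longleftrightarrow> (\<exists>u\<in>carrier_vec (rdim rzero v). x = f v *\<^sub>v u)"
      by (auto intro!: bexI[of _ "0\<^sub>v 0"])
  qed
  have "mexact (std_P A (Suc (Suc n))) (std_P A (Suc n)) (std_P A n) (std_d A (Suc n)) (std_d A n)" for n
  proof (cases "n = 0")
    case True then show ?thesis using ex1 by (simp add: std_P_def)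
  next
    case False
    then show ?thesis using ex2[of "std_d A (Suc n)" "std_d A n" "std_P A n"]
      by (simp add: std_P_def std_d_def mzero_def)
  qed
  moreover have "projective (std_P A n)" for n
    by (simp add: std_P_def projective_cover[OF A] projective_syz projective_rzero)
  moreover have "std_e A \<in> rhom (std_P A 0) A" "msurj (std_P A 0) A (std_e A)"
    using ext_rep_projection[OF A syz_is_rep cover_cocycle_family] by (simp_all add: std_P_def std_e_def cover_def)
  ultimately show ?thesis using ex0 std_d_rhom[OF A] by (simp add: projective_resolution_def std_P_def)
qed

text \<open>
  Composition with the augmentation \<open>e\<close> embeds \<open>Hom(A,B)\<close> into the cocycles of degree \<open>0\<close>.
\<close>

lemma rhom_zero_of_ext_vanishes:
  assumes A: "is_rep A" and B: "is_rep B" and van: "ext_vanishes 0 A B"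
  shows "rhom A B = {mzero A B}"
proof -
  obtain P d e where res: "projective_resolution A P d e" and coc: "ext_cocycles P d B 0 = ext_coboundaries P d B 0"
    using van by (auto simp: ext_vanishes_def)
  have P: "\<And>n. is_rep (P n)" and d: "d 0 \<in> rhom (P 1) (P 0)"
    and e: "e \<in> rhom (P 0) A" "msurj (P 0) A e" and ex: "mexact (P 1) (P 0) A (d 0) e"
    using res by (auto simp: projective_resolution_def projective_def)
  have "h = mzero A B" if h: "h \<in> rhom A B" for h
  proof -
    have "h \<star> e \<in> rhom (P 0) B" by (rule rhom_comp[OF P A B e(1) h])
    moreover have "(h \<star> e) \<star> d 0 = mzero (P (Suc 0)) B"
    proof
      fix v
      note c = rhomD[OF h, of v] rhomD[OF e(1), of v] rhomD[OF d, of v]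
      show "((h \<star> e) \<star> d 0) v = mzero (P (Suc 0)) B v"
        using c mexact_comp_zero[OF ex c(3,2)] by (simp add: mcomp_def mat_assoc mat_dist mzero_def)
    qed
    ultimately have "h \<star> e \<in> ext_cocycles P d B 0" by (simp add: ext_cocycles_def)
    then have he: "h \<star> e = mzero (P 0) B" using coc by simp
    show ?thesis
    proof
      fix v
      show "h v = mzero A B v"
      proof (rule mat_cancel_surjective[OF rhomD[OF e(1)]])
        show "\<exists>x\<in>carrier_vec (rdim (P 0) v). y = e v *\<^sub>v x" if "y \<in> carrier_vec (rdim A v)" for y
          using e(2) that by (auto simp: msurj_def)
        show "h v * e v = mzero A B v * e v"
          using fun_cong[OF he, of v] rhomD[OF e(1), of v] by (simp add: mcomp_def mzero_def mat_dist)
        show "h v \<in> carrier_mat (rdim B v) (rdim A v)" by (rule rhomD[OF h])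
        show "mzero A B v \<in> carrier_mat (rdim B v) (rdim A v)" by (simp add: mzero_def)
      qed
    qed
  qed
  then show ?thesis using mzero_rhom[OF A B] by blast
qed

text \<open>
  A morphism on the cover that vanishes on the syzygy is a morphism on \<open>A\<close>.
\<close>

lemma ext_vanishes_0I:
  assumes A: "is_rep A" and B: "is_rep B" and hom: "rhom A B = {mzero A B}"
  shows "ext_vanishes 0 A B"
proof -
  have "f = mzero (cover A) B" if f: "f \<in> rhom (cover A) B" "f \<star> std_d A 0 = mzero (syz A) B" for f
  proof -
    obtain f1 f2 where f12: "f1 \<in> mor_family (syz A) B" "f2 \<in> mor_family A B" "f = (\<lambda>v. hcat (f1 v) (f2 v))"
      by (rule mor_family_split_cols[OF rhom_mor_family[OF f(1), unfolded cover_def]])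
    have f1: "f1 = mzero (syz A) B"
    proof
      fix v
      note c = mor_familyD[OF f12(1), of v] mor_familyD[OF f12(2), of v]
      have "f v * std_d A 0 v = f1 v" unfolding f12(3) std_d_def by (simp add: hcat_mult_first[OF c])
      then show "f1 v = mzero (syz A) B v" using fun_cong[OF f(2), of v] by (simp add: mcomp_def)
    qed
    have "f2 \<in> rhom A B"
    proof (rule rhomI[OF mor_familyD[OF f12(2)]])
      fix a
      have "f1 (tgt a) * cover_cocycle A a + f2 (tgt a) * rmap A a = rmap B a * f2 (src a)"
        using rhom_from_ext_rep[OF A syz_is_rep cover_cocycle_family B f12(1,2)] f(1) f12(3) by (simp add: cover_def)
      then show "f2 (tgt a) * rmap A a = rmap B a * f2 (src a)"
        using arrow_familyD[OF cover_cocycle_family, of A a] mor_familyD[OF f12(2), of "tgt a"] is_repD[OF A, of a]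
        by (simp add: f1 mzero_def mat_dist)
    qed
    then have "f2 = mzero A B" using hom by auto
    then show ?thesis unfolding f12(3) f1 by (intro ext eq_matI) (auto simp: mzero_def hcat_def cover_def)
  qed
  moreover have "mzero (cover A) B \<star> std_d A 0 = mzero (syz A) B"
  proof
    fix v
    show "(mzero (cover A) B \<star> std_d A 0) v = mzero (syz A) B v"
      using rhomD[OF std_d_rhom[OF A, of 0], of v] by (simp add: std_P_def mcomp_def mzero_def mat_dist)
  qed
  ultimately have "{f \<in> rhom (cover A) B. f \<star> std_d A 0 = mzero (syz A) B} = {mzero (cover A) B}"
    using mzero_rhom[OF cover_is_rep[OF A] B] by blast
  then have "ext_cocycles (std_P A) (std_d A) B 0 = ext_coboundaries (std_P A) (std_d A) B 0"
    by (simp add: ext_cocycles_def std_P_def)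
  then show ?thesis using std_resolution[OF A] by (auto simp: ext_vanishes_def)
qed

text \<open>
  A morphism \<open>f\<close> from the syzygy extends to the cover as soon as the push-out of the universal cocycle along
  \<open>f\<close> splits; the splitting is the second component of the extension.
\<close>

lemma ext_vanishes_1I:
  assumes A: "is_rep A" and B: "is_rep B" and free: "ext_free A B"
  shows "ext_vanishes 1 A B"
proof -
  have "\<exists>g\<in>rhom (cover A) B. f = g \<star> std_d A 0" if f: "f \<in> rhom (syz A) B" for f
  proof -
    define C where "C a = - (f (tgt a) * cover_cocycle A a)" for a
    have cc: "f (tgt a) * cover_cocycle A a \<in> carrier_mat (rdim B (tgt a)) (rdim A (src a))" for a
      using rhomD[OF f, of "tgt a"] arrow_familyD[OF cover_cocycle_family, of A a] by simp
    have "C \<in> arrow_family A B" using cc by (auto simp: C_def arrow_family_def)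
    then obtain \<phi> where \<phi>: "\<phi> \<in> mor_family A B" "\<And>a. C a = \<phi> (tgt a) * rmap A a - rmap B a * \<phi> (src a)"
      using free by (auto simp: ext_free_def)
    have eq: "f (tgt a) * cover_cocycle A a + \<phi> (tgt a) * rmap A a = rmap B a * \<phi> (src a)" for a
    proof -
      have gen: "X + Y = Z" if "X \<in> carrier_mat n m" "Y \<in> carrier_mat n m" "Z \<in> carrier_mat n m" "- X = Y - Z"
        for X Y Z :: "'a mat" and n m
      proof (rule eq_matI)
        fix i j assume "i < dim_row Z" "j < dim_col Z"
        moreover have "(- X) $$ (i, j) = (Y - Z) $$ (i, j)" using that(4) by simp
        ultimately have "- X $$ (i, j) = Y $$ (i, j) - Z $$ (i, j)" using that(1-3) by simp
        then show "(X + Y) $$ (i, j) = Z $$ (i, j)" using that \<open>i < dim_row Z\<close> \<open>j < dim_col Z\<close>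
          by (simp add: algebra_simps)
      qed (use that in auto)
      note c = mor_familyD[OF \<phi>(1), of "tgt a"] mor_familyD[OF \<phi>(1), of "src a"] is_repD[OF A, of a] is_repD[OF B, of a]
      show ?thesis
        by (rule gen[OF cc[of a]]) (use c \<phi>(2)[of a] in \<open>auto simp: C_def\<close>)
    qed
    have "(\<lambda>v. hcat (f v) (\<phi> v)) \<in> rhom (cover A) B"
      using rhom_from_ext_rep[OF A syz_is_rep cover_cocycle_family B rhom_mor_family[OF f] \<phi>(1)] f eq by (simp add: cover_def)
    moreover have "f = (\<lambda>v. hcat (f v) (\<phi> v)) \<star> std_d A 0"
    proof
      fix v
      note c = rhomD[OF f, of v] mor_familyD[OF \<phi>(1), of v]
      show "f v = ((\<lambda>v. hcat (f v) (\<phi> v)) \<star> std_d A 0) v"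
        by (simp add: mcomp_def std_d_def hcat_mult_first[OF c])
    qed
    ultimately show ?thesis by blast
  qed
  moreover have "g \<star> std_d A 0 \<in> rhom (syz A) B" if "g \<in> rhom (cover A) B" for g
    using rhom_comp[OF syz_is_rep cover_is_rep[OF A] B _ that] std_d_rhom[OF A, of 0] by (simp add: std_P_def)
  moreover have "f \<star> std_d A (Suc 0) = mzero rzero B" if "f \<in> rhom (syz A) B" for f
  proof
    fix v
    show "(f \<star> std_d A (Suc 0)) v = mzero rzero B v"
      using rhomD[OF that, of v] by (simp add: mcomp_def std_d_def std_P_def mzero_def mat_dist)
  qed
  ultimately have "{f \<in> rhom (syz A) B. f \<star> std_d A (Suc 0) = mzero rzero B} = {g \<star> std_d A 0 |g. g \<in> rhom (cover A) B}"
    by blast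
  then have "ext_cocycles (std_P A) (std_d A) B (Suc 0) = ext_coboundaries (std_P A) (std_d A) B (Suc 0)"
    by (simp add: ext_cocycles_def std_P_def)
  then show ?thesis using std_resolution[OF A] by (auto simp: ext_vanishes_def)
qed

lemma ext_vanishes_ge_2:
  assumes A: "is_rep A" and B: "is_rep B"
  shows "ext_vanishes (Suc (Suc q)) A B"
proof -
  have 1: "f = mzero rzero B" if "f \<in> rhom rzero B" for f
    by (rule rhom_from_zero) (use that in auto)
  have 2: "f \<star> std_d A (Suc q) = mzero rzero B" if "f \<in> rhom (std_P A (Suc q)) B" for f
    by (rule 1, rule rhom_comp[OF rzero_is_rep std_P_is_rep[OF A, of "Suc q"] B _ that])
      (use std_d_rhom[OF A, of "Suc q"] in \<open>simp add: std_P_def\<close>)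
  have 3: "f \<star> std_d A (Suc (Suc q)) = mzero rzero B" if "f \<in> rhom rzero B" for f
    by (rule 1, rule rhom_comp[OF rzero_is_rep rzero_is_rep B _ that])
      (use std_d_rhom[OF A, of "Suc (Suc q)"] in \<open>simp add: std_P_def\<close>)
  have "{f \<in> rhom rzero B. f \<star> std_d A (Suc (Suc q)) = mzero rzero B} = {mzero rzero B}"
    using 1 3 mzero_rhom[OF rzero_is_rep B] by blast
  then have "ext_cocycles (std_P A) (std_d A) B (Suc (Suc q)) = {mzero rzero B}"
    by (simp add: ext_cocycles_def std_P_def)
  moreover have "{g \<star> std_d A (Suc q) |g. g \<in> rhom (std_P A (Suc q)) B} = {mzero rzero B}"
    using 2 2[OF mzero_rhom[OF std_P_is_rep[OF A, of "Suc q"] B], symmetric]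
      mzero_rhom[OF std_P_is_rep[OF A, of "Suc q"] B] by blast
  then have "ext_coboundaries (std_P A) (std_d A) B (Suc (Suc q)) = {mzero rzero B}"
    by simp
  ultimately show ?thesis unfolding ext_vanishes_def using std_resolution[OF A] by metis
qed

lemma all_ext_vanish_iff:
  assumes "is_rep A" "is_rep B"
  shows "(\<forall>p. ext_vanishes p A B) \<longleftrightarrow> rhom A B = {mzero A B} \<and> ext_free A B"
proof
  assume "\<forall>p. ext_vanishes p A B"
  then show "rhom A B = {mzero A B} \<and> ext_free A B"
    using ext_free_of_ext_vanishes[OF assms] rhom_zero_of_ext_vanishes[OF assms] by blast
next
  assume R: "rhom A B = {mzero A B} \<and> ext_free A B"
  show "\<forall>p. ext_vanishes p A B"
  proof
    fix p show "ext_vanishes p A B"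
    proof (cases p)
      case 0 then show ?thesis using ext_vanishes_0I[OF assms] R by simp
    next
      case (Suc q) then show ?thesis using ext_vanishes_1I[OF assms] ext_vanishes_ge_2[OF assms] R by (cases q) auto
    qed
  qed
qed

lemma positive_ext_vanish_iff:
  assumes "is_rep A" "is_rep B"
  shows "(\<forall>p. p \<noteq> 0 \<longrightarrow> ext_vanishes p A B) \<longleftrightarrow> ext_free A B"
proof
  assume "\<forall>p. p \<noteq> 0 \<longrightarrow> ext_vanishes p A B"
  then show "ext_free A B" using ext_free_of_ext_vanishes[OF assms] by blast
next
  assume R: "ext_free A B"
  show "\<forall>p. p \<noteq> 0 \<longrightarrow> ext_vanishes p A B"
  proof (intro allI impI)
    fix p :: nat assume "p \<noteq> 0"
    then obtain q where "p = Suc q" by (cases p) auto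
    then show "ext_vanishes p A B" using ext_vanishes_1I[OF assms] ext_vanishes_ge_2[OF assms] R by (cases q) auto
  qed
qed

section \<open>The Euler form\<close>

text \<open>
  The Euler form of dimension vectors: a term for each vertex minus a term for each arrow.
\<close>

definition euler :: "'k::field rep \<Rightarrow> 'k rep \<Rightarrow> int" where
  "euler V W = int (rdim V Vb) * int (rdim W Vb) + int (rdim V Vmid) * int (rdim W Vmid) + int (rdim V Ve) * int (rdim W Ve)
     - int (rdim V Vb) * int (rdim W Ve) - int (rdim V Vb) * int (rdim W Vmid) - int (rdim V Vmid) * int (rdim W Ve)"

definition brick :: "'k::field rep \<Rightarrow> bool" where
  "brick A \<longleftrightarrow> rhom A A = range (\<lambda>c. mscale c (mid A)) \<and> (\<exists>v. rdim A v \<noteq> 0)"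

lemma UNIV_vertex: "(UNIV :: vertex set) = {Vb, Vmid, Ve}" using vertex.exhaust by auto
lemma UNIV_arrow: "(UNIV :: arrow set) = {BE, BM, ME}" using arrow.exhaust by auto

text \<open>
  The unknowns and the equations of the system that defines morphisms: entries of the matrices at the
  vertices, and entries of the commutator at the arrows.
\<close>

definition mor_index :: "'k::field rep \<Rightarrow> 'k rep \<Rightarrow> (vertex \<times> nat \<times> nat) set" where
  "mor_index V W = (SIGMA v:UNIV. {..<rdim W v} \<times> {..<rdim V v})"

definition arrow_index :: "'k::field rep \<Rightarrow> 'k rep \<Rightarrow> (arrow \<times> nat \<times> nat) set" where
  "arrow_index V W = (SIGMA a:UNIV. {..<rdim W (tgt a)} \<times> {..<rdim V (src a)})"

fun cobd_coeff :: "'k::field rep \<Rightarrow> 'k rep \<Rightarrow> arrow \<times> nat \<times> nat \<Rightarrow> vertex \<times> nat \<times> nat \<Rightarrow> 'k" where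
  "cobd_coeff V W (a, r, c) (v, i, j) =
     (if v = tgt a \<and> i = r then rmap V a $$ (j, c) else 0) - (if v = src a \<and> j = c then rmap W a $$ (r, i) else 0)"

lemma finite_index: "finite (mor_index V W)" "finite (arrow_index V W)"
  unfolding mor_index_def arrow_index_def by (auto intro!: finite_SigmaI simp: UNIV_vertex UNIV_arrow)

lemma card_index: "int (card (mor_index V W)) - int (card (arrow_index V W)) = euler V W"
proof -
  have "card (mor_index V W) = (\<Sum>v\<in>UNIV. rdim W v * rdim V v)"
    unfolding mor_index_def by (subst card_SigmaI) (auto simp: UNIV_vertex card_cartesian_product)
  moreover have "card (arrow_index V W) = (\<Sum>a\<in>UNIV. rdim W (tgt a) * rdim V (src a))"
    unfolding arrow_index_def by (subst card_SigmaI) (auto simp: UNIV_arrow card_cartesian_product)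
  ultimately show ?thesis by (simp add: UNIV_vertex UNIV_arrow euler_def algebra_simps)
qed

lemma coboundary_entry:
  assumes V: "is_rep V" and W: "is_rep W" and f: "f \<in> mor_family V W" and j: "(a, r, c) \<in> arrow_index V W"
  shows "(f (tgt a) * rmap V a - rmap W a * f (src a)) $$ (r, c) =
     (\<Sum>p\<in>mor_index V W. cobd_coeff V W (a, r, c) p * f (fst p) $$ snd p)"
proof -
  have rc: "r < rdim W (tgt a)" "c < rdim V (src a)" using j by (auto simp: arrow_index_def)
  note cc = mor_familyD[OF f, of "tgt a"] mor_familyD[OF f, of "src a"] is_repD[OF V, of a] is_repD[OF W, of a]
  define g1 where "g1 p = (case p of (v, i, k) \<Rightarrow> if v = tgt a \<and> i = r then rmap V a $$ (k, c) * f v $$ (i, k) else 0)" for p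
  define g2 where "g2 p = (case p of (v, i, k) \<Rightarrow> if v = src a \<and> k = c then rmap W a $$ (r, i) * f v $$ (i, k) else 0)" for p
  have "(\<Sum>p\<in>mor_index V W. g1 p) = (\<Sum>p\<in>(\<lambda>k. (tgt a, r, k)) ` {..<rdim V (tgt a)}. g1 p)"
    by (rule sum.mono_neutral_right[OF finite_index(1)]) (use rc in \<open>auto simp: mor_index_def g1_def image_iff\<close>)
  also have "\<dots> = (\<Sum>k<rdim V (tgt a). rmap V a $$ (k, c) * f (tgt a) $$ (r, k))"
    by (subst sum.reindex) (auto simp: inj_on_def g1_def)
  also have "\<dots> = (f (tgt a) * rmap V a) $$ (r, c)"
    using cc rc by (simp add: scalar_prod_def atLeast0LessThan mult.commute)
  finally have 1: "(\<Sum>p\<in>mor_index V W. g1 p) = (f (tgt a) * rmap V a) $$ (r, c)" .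
  have "(\<Sum>p\<in>mor_index V W. g2 p) = (\<Sum>p\<in>(\<lambda>i. (src a, i, c)) ` {..<rdim W (src a)}. g2 p)"
    by (rule sum.mono_neutral_right[OF finite_index(1)]) (use rc in \<open>auto simp: mor_index_def g2_def image_iff\<close>)
  also have "\<dots> = (\<Sum>i<rdim W (src a). rmap W a $$ (r, i) * f (src a) $$ (i, c))"
    by (subst sum.reindex) (auto simp: inj_on_def g2_def)
  also have "\<dots> = (rmap W a * f (src a)) $$ (r, c)"
    using cc rc by (simp add: scalar_prod_def atLeast0LessThan)
  finally have 2: "(\<Sum>p\<in>mor_index V W. g2 p) = (rmap W a * f (src a)) $$ (r, c)" .
  have "(\<Sum>p\<in>mor_index V W. cobd_coeff V W (a, r, c) p * f (fst p) $$ snd p) = (\<Sum>p\<in>mor_index V W. g1 p - g2 p)"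
    by (rule sum.cong) (auto simp: g1_def g2_def algebra_simps)
  then show ?thesis using 1 2 cc rc by (simp add: sum_subtractf)
qed

definition family_of :: "'k::field rep \<Rightarrow> 'k rep \<Rightarrow> (vertex \<times> nat \<times> nat \<Rightarrow> 'k) \<Rightarrow> 'k mor" where
  "family_of V W x = (\<lambda>v. mat (rdim W v) (rdim V v) (\<lambda>(i, j). x (v, i, j)))"

lemma family_of_family: "family_of V W x \<in> mor_family V W" by (simp add: family_of_def mor_family_def)

lemma family_of_carrier[simp]: "family_of V W x v \<in> carrier_mat (rdim W v) (rdim V v)"
  and family_of_dims[simp]: "dim_row (family_of V W x v) = rdim W v" "dim_col (family_of V W x v) = rdim V v"
  by (simp_all add: family_of_def)

lemma family_of_entry: "(v, i, j) \<in> mor_index V W \<Longrightarrow> family_of V W x v $$ (i, j) = x (v, i, j)"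
  by (auto simp: family_of_def mor_index_def)

lemma coboundary_entry_of:
  assumes "is_rep V" "is_rep W" "(a, r, c) \<in> arrow_index V W"
  shows "(family_of V W x (tgt a) * rmap V a - rmap W a * family_of V W x (src a)) $$ (r, c) =
     (\<Sum>p\<in>mor_index V W. cobd_coeff V W (a, r, c) p * x p)"
proof -
  have "(\<Sum>p\<in>mor_index V W. cobd_coeff V W (a, r, c) p * family_of V W x (fst p) $$ snd p) =
     (\<Sum>p\<in>mor_index V W. cobd_coeff V W (a, r, c) p * x p)"
  proof (rule sum.cong)
    fix p assume p: "p \<in> mor_index V W"
    obtain v i k where "p = (v, i, k)" by (cases p) auto
    then show "cobd_coeff V W (a, r, c) p * family_of V W x (fst p) $$ snd p = cobd_coeff V W (a, r, c) p * x p"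
      using p by (simp add: family_of_entry)
  qed simp
  then show ?thesis using coboundary_entry[OF assms(1,2) family_of_family assms(3)] by simp
qed

lemma family_of_rhom_iff:
  assumes V: "is_rep V" and W: "is_rep W"
  shows "family_of V W x \<in> rhom V W \<longleftrightarrow>
    (\<forall>q\<in>arrow_index V W. (\<Sum>p\<in>mor_index V W. cobd_coeff V W q p * x p) = 0)" (is "?L \<longleftrightarrow> ?R")
proof -
  let ?f = "family_of V W x"
  have c: "?f (tgt a) * rmap V a \<in> carrier_mat (rdim W (tgt a)) (rdim V (src a))"
      "rmap W a * ?f (src a) \<in> carrier_mat (rdim W (tgt a)) (rdim V (src a))" for a
    using is_repD[OF V, of a] is_repD[OF W, of a] by auto
  have e: "(?f (tgt a) * rmap V a - rmap W a * ?f (src a)) $$ (r, s) =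
      (?f (tgt a) * rmap V a) $$ (r, s) - (rmap W a * ?f (src a)) $$ (r, s)"
    if "(a, r, s) \<in> arrow_index V W" for a r s
    using that by (intro index_minus_mat(1)) (use carrier_matD[OF c(2)[of a]] in \<open>auto simp: arrow_index_def simp del: index_mult_mat\<close>)
  show ?thesis
  proof
    assume L: ?L
    show ?R
    proof
      fix q assume q: "q \<in> arrow_index V W"
      obtain a r s where "q = (a, r, s)" by (cases q) auto
      then show "(\<Sum>p\<in>mor_index V W. cobd_coeff V W q p * x p) = 0"
        using coboundary_entry_of[OF V W, of a r s x] e[of a r s] q rhom_comm[OF L, of a] by simp
    qed
  next
    assume R: ?R
    show ?L
    proof (rule rhomI[OF family_of_carrier])
      fix a
      show "?f (tgt a) * rmap V a = rmap W a * ?f (src a)"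
      proof (rule eq_matI)
        fix i j assume "i < dim_row (rmap W a * ?f (src a))" "j < dim_col (rmap W a * ?f (src a))"
        then have "(a, i, j) \<in> arrow_index V W" using carrier_matD[OF c(2)[of a]] by (auto simp: arrow_index_def)
        then show "(?f (tgt a) * rmap V a) $$ (i, j) = (rmap W a * ?f (src a)) $$ (i, j)"
          using coboundary_entry_of[OF V W, of a i j x] e[of a i j] R by auto
      qed (use carrier_matD[OF c(1)[of a]] carrier_matD[OF c(2)[of a]] in auto)
    qed
  qed
qed

lemma ext_free_iff_system:
  assumes V: "is_rep V" and W: "is_rep W"
  shows "ext_free V W \<longleftrightarrow> (\<forall>b. \<exists>x. \<forall>q\<in>arrow_index V W. (\<Sum>p\<in>mor_index V W. cobd_coeff V W q p * x p) = b q)"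
    (is "?L \<longleftrightarrow> ?R")
proof
  assume L: ?L
  show ?R
  proof
    fix b :: "arrow \<times> nat \<times> nat \<Rightarrow> 'a"
    define C where "C a = mat (rdim W (tgt a)) (rdim V (src a)) (\<lambda>(i, j). b (a, i, j))" for a
    have "C \<in> arrow_family V W" by (simp add: C_def arrow_family_def)
    then obtain f where f: "f \<in> mor_family V W" "\<And>a. C a = f (tgt a) * rmap V a - rmap W a * f (src a)"
      using L by (auto simp: ext_free_def)
    show "\<exists>x. \<forall>q\<in>arrow_index V W. (\<Sum>p\<in>mor_index V W. cobd_coeff V W q p * x p) = b q"
    proof (intro exI[of _ "\<lambda>p. f (fst p) $$ snd p"] ballI)
      fix q assume q: "q \<in> arrow_index V W"
      obtain a r s where q': "q = (a, r, s)" by (cases q) auto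
      have "C a $$ (r, s) = b q" using q by (auto simp: q' C_def arrow_index_def)
      then show "(\<Sum>p\<in>mor_index V W. cobd_coeff V W q p * f (fst p) $$ snd p) = b q"
        using coboundary_entry[OF V W f(1), of a r s] q f(2)[of a] by (simp add: q')
    qed
  qed
next
  assume R: ?R
  show ?L unfolding ext_free_def
  proof
    fix C assume C: "C \<in> arrow_family V W"
    obtain x where x: "\<And>q. q \<in> arrow_index V W \<Longrightarrow>
        (\<Sum>p\<in>mor_index V W. cobd_coeff V W q p * x p) = C (fst q) $$ snd q"
      using R[rule_format, of "\<lambda>q. C (fst q) $$ snd q"] by blast
    show "\<exists>f\<in>mor_family V W. \<forall>a. C a = f (tgt a) * rmap V a - rmap W a * f (src a)"
    proof (intro bexI[of _ "family_of V W x"] allI family_of_family)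
      fix a
      have c: "rmap W a * family_of V W x (src a) \<in> carrier_mat (rdim W (tgt a)) (rdim V (src a))"
        using is_repD[OF W, of a] by auto
      show "C a = family_of V W x (tgt a) * rmap V a - rmap W a * family_of V W x (src a)" (is "_ = ?D")
      proof (rule eq_matI)
        fix i j assume "i < dim_row ?D" "j < dim_col ?D"
        then have "(a, i, j) \<in> arrow_index V W" using carrier_matD[OF c] by (auto simp: arrow_index_def)
        then show "C a $$ (i, j) = ?D $$ (i, j)" using x coboundary_entry_of[OF V W] by simp
      qed (use carrier_matD[OF c] arrow_familyD[OF C, of a] in auto)
    qed
  qed
qed

text \<open>
  \<open>ext_free\<close> says that the system of the commutators is surjective, and the assumption that it is
  injective. An injective system is surjective exactly if it has as many equations as unknowns.
\<close>

lemma ext_free_iff_euler_zero: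
  assumes V: "is_rep V" and W: "is_rep W" and hom: "rhom V W = {mzero V W}"
  shows "ext_free V W \<longleftrightarrow> euler V W = 0"
proof -
  let ?I = "mor_index V W" let ?J = "arrow_index V W"
  have inj: "x p = 0" if "\<And>q. q \<in> ?J \<Longrightarrow> (\<Sum>p\<in>?I. cobd_coeff V W q p * x p) = 0" "p \<in> ?I" for x p
  proof -
    have "family_of V W x \<in> rhom V W" using that(1) family_of_rhom_iff[OF V W, of x] by blast
    then have eq: "family_of V W x = mzero V W" using hom by blast
    obtain v i j where p: "p = (v, i, j)" by (cases p) auto
    have "family_of V W x v $$ (i, j) = 0" unfolding eq using that(2) by (auto simp: mzero_def p mor_index_def)
    then show ?thesis using family_of_entry[of v i j V W x] that(2) by (simp add: p)
  qed
  have le: "card ?I \<le> card ?J"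
    by (rule injective_system_card_le[OF finite_index, where a = "cobd_coeff V W"]) (rule inj)
  have "ext_free V W" if "card ?J \<le> card ?I"
    unfolding ext_free_iff_system[OF V W]
  proof
    fix b show "\<exists>x. \<forall>q\<in>?J. (\<Sum>p\<in>?I. cobd_coeff V W q p * x p) = b q"
      by (rule injective_system_surjective[OF finite_index that, where a = "cobd_coeff V W"]) (rule inj)
  qed
  moreover have "card ?J \<le> card ?I" if "ext_free V W"
    by (rule surjective_system_card_le[OF finite_index, where a = "cobd_coeff V W"])
      (use that ext_free_iff_system[OF V W] in blast)
  ultimately show ?thesis using le card_index[of V W] by linarith
qed

text \<open>
  The same count for a system whose kernel is the line of the scalar endomorphisms.
\<close>

lemma ext_free_iff_euler_one:
  assumes A: "is_rep A" and b: "brick A"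
  shows "ext_free A A \<longleftrightarrow> euler A A = 1"
proof -
  let ?I = "mor_index A A" let ?J = "arrow_index A A"
  obtain v0 where v0: "rdim A v0 \<noteq> 0" using b by (auto simp: brick_def)
  define z :: "vertex \<times> nat \<times> nat \<Rightarrow> 'a" where "z p = (if fst (snd p) = snd (snd p) then 1 else 0)" for p
  have fz: "family_of A A (\<lambda>p. c * z p) = mscale c (mid A)" for c
    by (intro ext eq_matI) (auto simp: family_of_def z_def mscale_def mid_def)
  have "card ?I = Suc (card ?J) \<longleftrightarrow> (\<forall>b. \<exists>x. \<forall>q\<in>?J. (\<Sum>p\<in>?I. cobd_coeff A A q p * x p) = b q)"
  proof (rule one_dim_kernel_system[OF finite_index])
    show "(v0, 0, 0) \<in> ?I" using v0 by (simp add: mor_index_def)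
    show "z (v0, 0, 0) \<noteq> 0" by (simp add: z_def)
    show "(\<Sum>p\<in>?I. cobd_coeff A A q p * z p) = 0" if "q \<in> ?J" for q
    proof -
      have "family_of A A z \<in> rhom A A" using fz[of 1] b by (auto simp: brick_def)
      then show ?thesis using family_of_rhom_iff[OF A A] that by blast
    qed
    fix x assume "\<And>q. q \<in> ?J \<Longrightarrow> (\<Sum>p\<in>?I. cobd_coeff A A q p * x p) = 0"
    then have "family_of A A x \<in> rhom A A" using family_of_rhom_iff[OF A A] by blast
    then obtain c where c: "family_of A A x = family_of A A (\<lambda>p. c * z p)" using b by (auto simp: brick_def fz)
    have "x p = c * z p" if p: "p \<in> ?I" for p
    proof -
      obtain v i j where p': "p = (v, i, j)" by (cases p) auto
      have "family_of A A x v $$ (i, j) = family_of A A (\<lambda>p. c * z p) v $$ (i, j)" by (simp add: c)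
      then show ?thesis using p by (simp add: family_of_entry p')
    qed
    then show "\<exists>c. \<forall>p\<in>?I. x p = c * z p" by blast
  qed
  then have "ext_free A A \<longleftrightarrow> card ?I = Suc (card ?J)" using ext_free_iff_system[OF A A] by blast
  then show ?thesis using card_index[of A A] by auto
qed

lemma exceptional_iff: "exceptional A \<longleftrightarrow> is_rep A \<and> brick A \<and> ext_free A A"
proof -
  have "inj (\<lambda>c. mscale c (mid A)) \<longleftrightarrow> (\<exists>v. rdim A v \<noteq> 0)"
  proof
    assume inj: "inj (\<lambda>c. mscale c (mid A))"
    show "\<exists>v. rdim A v \<noteq> 0"
    proof (rule ccontr)
      assume "\<not> ?thesis"
      then have "mscale 0 (mid A) = mscale 1 (mid A)"
        by (intro ext eq_matI) (auto simp: mscale_def mid_def)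
      with inj show False by (auto dest: injD)
    qed
  next
    assume "\<exists>v. rdim A v \<noteq> 0"
    then obtain v where v: "0 < rdim A v" by auto
    show "inj (\<lambda>c. mscale c (mid A))"
    proof (rule injI)
      fix c d :: 'a assume "mscale c (mid A) = mscale d (mid A)"
      then have "mscale c (mid A) v $$ (0, 0) = mscale d (mid A) v $$ (0, 0)" by simp
      then show "c = d" using v by (simp add: mscale_def mid_def)
    qed
  qed
  then show ?thesis
    using positive_ext_vanish_iff[of A A] unfolding exceptional_def brick_def bij_betw_def by auto
qed

section \<open>The representations of the list\<close>

lemma rhom_iff:
  "f \<in> rhom V W \<longleftrightarrow> f Vb \<in> carrier_mat (rdim W Vb) (rdim V Vb) \<and> f Vmid \<in> carrier_mat (rdim W Vmid) (rdim V Vmid) \<and>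
     f Ve \<in> carrier_mat (rdim W Ve) (rdim V Ve) \<and>
     f Ve * rmap V BE = rmap W BE * f Vb \<and> f Vmid * rmap V BM = rmap W BM * f Vb \<and> f Ve * rmap V ME = rmap W ME * f Vmid"
  by (auto simp: rhom_def all_vertex all_arrow)

lemma pi_carrier[simp]: "pi_plus m \<in> carrier_mat m (Suc m)" "pi_minus m \<in> carrier_mat m (Suc m)"
    "j_plus m \<in> carrier_mat (Suc m) m" "j_minus m \<in> carrier_mat (Suc m) m"
  and pi_dims[simp]: "dim_row (pi_plus m) = m" "dim_col (pi_plus m) = Suc m" "dim_row (pi_minus m) = m" "dim_col (pi_minus m) = Suc m"
    "dim_row (j_plus m) = Suc m" "dim_col (j_plus m) = m" "dim_row (j_minus m) = Suc m" "dim_col (j_minus m) = m"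
  by (simp_all add: pi_plus_def pi_minus_def j_plus_def j_minus_def)

lemma E_simps[simp]:
  "rdim (E1 m) Vb = Suc m" "rdim (E1 m) Vmid = m" "rdim (E1 m) Ve = m"
  "rmap (E1 m) BE = pi_plus m" "rmap (E1 m) BM = pi_minus m" "rmap (E1 m) ME = 1\<^sub>m m"
  "rdim (E2 m) Vb = m" "rdim (E2 m) Vmid = Suc m" "rdim (E2 m) Ve = Suc m"
  "rmap (E2 m) BE = j_plus m" "rmap (E2 m) BM = j_minus m" "rmap (E2 m) ME = 1\<^sub>m (Suc m)"
  "rdim (E3 m) Vb = m" "rdim (E3 m) Vmid = m" "rdim (E3 m) Ve = Suc m"
  "rmap (E3 m) BE = j_plus m" "rmap (E3 m) BM = 1\<^sub>m m" "rmap (E3 m) ME = j_minus m"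
  "rdim (E4 m) Vb = Suc m" "rdim (E4 m) Vmid = Suc m" "rdim (E4 m) Ve = m"
  "rmap (E4 m) BE = pi_plus m" "rmap (E4 m) BM = 1\<^sub>m (Suc m)" "rmap (E4 m) ME = pi_minus m"
  "rdim M Vb = 0" "rdim M Vmid = 1" "rdim M Ve = 0"
  "rmap M BE = 0\<^sub>m 0 0" "rmap M BM = 0\<^sub>m 1 0" "rmap M ME = 0\<^sub>m 0 1"
  "rdim M' Vb = 1" "rdim M' Vmid = 0" "rdim M' Ve = 1"
  "rmap M' BE = 1\<^sub>m 1" "rmap M' BM = 0\<^sub>m 0 1" "rmap M' ME = 0\<^sub>m 1 0"
  by (simp_all add: E1_def E2_def E3_def E4_def M_def M'_def)

lemma E_is_rep[simp]: "is_rep (E1 m)" "is_rep (E2 m)" "is_rep (E3 m)" "is_rep (E4 m)" "is_rep M" "is_rep M'"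
  by (simp_all add: is_rep_def all_arrow)

section \<open>Duality\<close>

text \<open>
  Transposition is a duality on the representations, because reversing all arrows and exchanging
  \<open>Vb\<close> with \<open>Ve\<close> gives back the quiver. It exchanges \<open>E1\<close> with \<open>E3\<close> and \<open>E2\<close> with \<open>E4\<close>, which halves the
  work below.
\<close>

fun opp_vertex :: "vertex \<Rightarrow> vertex" where
  "opp_vertex Vb = Ve" | "opp_vertex Vmid = Vmid" | "opp_vertex Ve = Vb"
fun opp_arrow :: "arrow \<Rightarrow> arrow" where
  "opp_arrow BE = BE" | "opp_arrow BM = ME" | "opp_arrow ME = BM"

lemma opp_simps[simp]: "opp_vertex (opp_vertex v) = v" "opp_arrow (opp_arrow a) = a"
  "src (opp_arrow a) = opp_vertex (tgt a)" "tgt (opp_arrow a) = opp_vertex (src a)"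
  by (cases v; simp) (cases a; simp)+

definition dual :: "'k::field rep \<Rightarrow> 'k rep" where
  "dual V = \<lparr>rdim = \<lambda>v. rdim V (opp_vertex v), rmap = \<lambda>a. transpose_mat (rmap V (opp_arrow a))\<rparr>"

definition dual_mor :: "'k::field mor \<Rightarrow> 'k mor" where
  "dual_mor f = (\<lambda>v. transpose_mat (f (opp_vertex v)))"

lemma dual_simps[simp]: "rdim (dual V) v = rdim V (opp_vertex v)" "rmap (dual V) a = transpose_mat (rmap V (opp_arrow a))"
  by (simp_all add: dual_def)

lemma dual_dual[simp]: "dual (dual V) = V" by (cases V) (simp add: dual_def)
lemma dual_mor_dual_mor[simp]: "dual_mor (dual_mor f) = f" by (simp add: dual_mor_def)

lemma dual_is_rep: "is_rep V \<Longrightarrow> is_rep (dual V)"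
  using is_repD[of V] by (auto simp: is_rep_def intro!: transpose_carrier_mat[THEN iffD2])

lemma dual_mor_rhom:
  assumes V: "is_rep V" and W: "is_rep W" and f: "f \<in> rhom V W"
  shows "dual_mor f \<in> rhom (dual W) (dual V)"
proof (rule rhomI)
  fix v show "dual_mor f v \<in> carrier_mat (rdim (dual V) v) (rdim (dual W) v)"
    using rhomD[OF f, of "opp_vertex v"] by (simp add: dual_mor_def)
next
  fix a
  let ?b = "opp_arrow a"
  note c = rhomD[OF f, of "tgt ?b"] rhomD[OF f, of "src ?b"] is_repD[OF V, of ?b] is_repD[OF W, of ?b]
  have "transpose_mat (f (tgt ?b) * rmap V ?b) = transpose_mat (rmap W ?b * f (src ?b))"
    using rhom_comm[OF f, of ?b] by simp
  then have "transpose_mat (rmap V ?b) * transpose_mat (f (tgt ?b)) = transpose_mat (f (src ?b)) * transpose_mat (rmap W ?b)"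
    using transpose_mult[OF c(1,3)] transpose_mult[OF c(4,2)] by simp
  then show "dual_mor f (tgt a) * rmap (dual W) a = rmap (dual V) a * dual_mor f (src a)"
    by (simp add: dual_mor_def)
qed

lemma dual_mor_mzero: "dual_mor (mzero V W) = mzero (dual W) (dual V)"
  by (simp add: dual_mor_def mzero_def)

lemma rhom_dual_zero:
  assumes V: "is_rep V" and W: "is_rep W" and hom: "rhom V W = {mzero V W}"
  shows "rhom (dual W) (dual V) = {mzero (dual W) (dual V)}"
proof -
  have "g = mzero (dual W) (dual V)" if "g \<in> rhom (dual W) (dual V)" for g
  proof -
    have "dual_mor g \<in> rhom V W" using dual_mor_rhom[OF dual_is_rep[OF W] dual_is_rep[OF V] that] by simp
    then have "dual_mor g = mzero V W" using hom by blast
    then have "dual_mor (dual_mor g) = mzero (dual W) (dual V)" by (simp only: dual_mor_mzero)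
    then show ?thesis by simp
  qed
  then show ?thesis using mzero_rhom[OF dual_is_rep[OF W] dual_is_rep[OF V]] by blast
qed

lemma dual_mor_scale: "dual_mor (mscale c (mid V)) = mscale c (mid (dual V))"
  by (intro ext eq_matI) (auto simp: dual_mor_def mscale_def mid_def)

lemma brick_dual:
  assumes V: "is_rep V" and b: "brick V"
  shows "brick (dual V)"
proof -
  have "g \<in> range (\<lambda>c. mscale c (mid (dual V)))" if "g \<in> rhom (dual V) (dual V)" for g
  proof -
    have "dual_mor g \<in> rhom V V" using dual_mor_rhom[OF dual_is_rep[OF V] dual_is_rep[OF V] that] by simp
    then obtain c where "dual_mor g = mscale c (mid V)" using b by (auto simp: brick_def)
    then have "dual_mor (dual_mor g) = mscale c (mid (dual V))" by (simp only: dual_mor_scale)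
    then show ?thesis by simp
  qed
  moreover have "mscale c (mid (dual V)) \<in> rhom (dual V) (dual V)" for c
  proof -
    have "mscale c (mid V) \<in> rhom V V" using b by (auto simp: brick_def)
    from dual_mor_rhom[OF V V this] show ?thesis by (simp add: dual_mor_scale)
  qed
  moreover have "\<exists>v. rdim (dual V) v \<noteq> 0" using b by (metis brick_def dual_simps(1) opp_simps(1))
  ultimately show ?thesis unfolding brick_def by blast
qed

lemma euler_dual: "euler (dual W) (dual V) = euler V W"
  by (simp add: euler_def algebra_simps)

lemma transpose_pi[simp]: "transpose_mat (pi_plus m) = j_plus m" "transpose_mat (pi_minus m) = j_minus m"
  "transpose_mat (j_plus m) = pi_plus m" "transpose_mat (j_minus m) = pi_minus m"
  by (auto intro!: eq_matI simp: pi_plus_def pi_minus_def j_plus_def j_minus_def)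

lemma rep_eqI: "(\<And>v. rdim V v = rdim W v) \<Longrightarrow> (\<And>a. rmap V a = rmap W a) \<Longrightarrow> V = (W :: 'k rep)"
  by (cases V; cases W) auto

lemma dual_E[simp]: "dual (E1 m) = E3 m" "dual (E2 m) = E4 m" "dual (E3 m) = E1 m" "dual (E4 m) = E2 m" "dual M = M" "dual M' = M'"
proof -
  show 1: "dual (E1 m) = E3 m" for m
  proof (rule rep_eqI)
    fix v show "rdim (dual (E1 m)) v = rdim (E3 m) v" by (cases v) auto
  next
    fix a show "rmap (dual (E1 m)) a = rmap (E3 m) a" by (cases a) auto
  qed
  show 2: "dual (E2 m) = E4 m" for m
  proof (rule rep_eqI)
    fix v show "rdim (dual (E2 m)) v = rdim (E4 m) v" by (cases v) auto
  next
    fix a show "rmap (dual (E2 m)) a = rmap (E4 m) a" by (cases a) auto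
  qed
  show "dual (E3 m) = E1 m" using 1[of m] by (metis dual_dual)
  show "dual (E4 m) = E2 m" using 2[of m] by (metis dual_dual)
  show "dual M = M"
  proof (rule rep_eqI)
    fix v show "rdim (dual M) v = rdim M v" by (cases v) auto
  next
    fix a show "rmap (dual M) a = rmap M a" by (cases a) auto
  qed
  show "dual M' = M'"
  proof (rule rep_eqI)
    fix v show "rdim (dual M') v = rdim M' v" by (cases v) auto
  next
    fix a show "rmap (dual M') a = rmap M' a" by (cases a) auto
  qed
qed

section \<open>Morphisms between the listed representations\<close>

lemma mult_pi_plus_entry:
  "g \<in> carrier_mat n m \<Longrightarrow> i < n \<Longrightarrow> j < Suc m \<Longrightarrow> (g * pi_plus m) $$ (i, j) = (if j < m then g $$ (i, j) else 0)"
  by (auto simp: pi_plus_def scalar_prod_def if_distrib[of "\<lambda>t. _ * t"] cong: if_cong)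

lemma mult_pi_minus_entry:
  assumes "g \<in> carrier_mat n m" "i < n" "j < Suc m"
  shows "(g * pi_minus m) $$ (i, j) = (if j = 0 then 0 else g $$ (i, j - 1))"
proof -
  have "(g * pi_minus m) $$ (i, j) = (\<Sum>k<m. g $$ (i, k) * (if j = Suc k then 1 else 0))"
    using assms by (simp add: pi_minus_def scalar_prod_def atLeast0LessThan)
  also have "\<dots> = (\<Sum>k<m. if k = j - 1 \<and> j \<noteq> 0 then g $$ (i, k) else 0)" by (rule sum.cong) auto
  also have "\<dots> = (if j = 0 then 0 else g $$ (i, j - 1))" using assms by (cases j) auto
  finally show ?thesis .
qed

lemma pi_plus_mult_entry:
  "f \<in> carrier_mat (Suc m) n \<Longrightarrow> i < m \<Longrightarrow> j < n \<Longrightarrow> (pi_plus m * f) $$ (i, j) = f $$ (i, j)"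
  by (auto simp: pi_plus_def scalar_prod_def if_distrib[of "\<lambda>t. t * _"] cong: if_cong)

lemma pi_minus_mult_entry:
  "f \<in> carrier_mat (Suc m) n \<Longrightarrow> i < m \<Longrightarrow> j < n \<Longrightarrow> (pi_minus m * f) $$ (i, j) = f $$ (Suc i, j)"
  by (auto simp: pi_minus_def scalar_prod_def if_distrib[of "\<lambda>t. t * _"] cong: if_cong)

text \<open>
  Comparing entries, the two relations say that \<open>f\<close> is constant along diagonals, that \<open>g\<close> is a corner of
  \<open>f\<close>, and that \<open>f\<close> vanishes on part of its border.
\<close>

lemma pencil_hom_toeplitz:
  assumes f: "f \<in> carrier_mat (Suc m') (Suc m)" and g: "g \<in> carrier_mat m' m"
    and p: "g * pi_plus m = pi_plus m' * f" and q: "g * pi_minus m = pi_minus m' * f"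
  shows "i < m' \<Longrightarrow> j < m \<Longrightarrow> g $$ (i, j) = f $$ (i, j)"
    and "i < m' \<Longrightarrow> f $$ (i, m) = 0"
    and "i < m' \<Longrightarrow> f $$ (Suc i, 0) = 0"
    and "i < m' \<Longrightarrow> j < m \<Longrightarrow> f $$ (Suc i, Suc j) = f $$ (i, j)"
proof -
  have P: "f $$ (i, j) = (if j < m then g $$ (i, j) else 0)" if "i < m'" "j < Suc m" for i j
    using mult_pi_plus_entry[OF g that] pi_plus_mult_entry[OF f that] p by simp
  have Q: "f $$ (Suc i, j) = (if j = 0 then 0 else g $$ (i, j - 1))" if "i < m'" "j < Suc m" for i j
    using mult_pi_minus_entry[OF g that] pi_minus_mult_entry[OF f that] q by simp
  show "i < m' \<Longrightarrow> j < m \<Longrightarrow> g $$ (i, j) = f $$ (i, j)" using P[of i j] by simp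
  show "i < m' \<Longrightarrow> f $$ (i, m) = 0" using P[of i m] by simp
  show "i < m' \<Longrightarrow> f $$ (Suc i, 0) = 0" using Q[of i 0] by simp
  show "i < m' \<Longrightarrow> j < m \<Longrightarrow> f $$ (Suc i, Suc j) = f $$ (i, j)" using P[of i j] Q[of i "Suc j"] by simp
qed

text \<open>
  Every diagonal of \<open>f\<close> below the main one meets the zero entries of the first column, and the diagonals
  on the other side meet those of the last column. If \<open>m' = m + 1\<close> they cover \<open>f\<close>; if \<open>m' = m\<close> only the main
  diagonal survives.
\<close>

lemma pencil_hom:
  assumes f: "f \<in> carrier_mat (Suc m') (Suc m)" and g: "g \<in> carrier_mat m' m"
    and p: "g * pi_plus m = pi_plus m' * f" and q: "g * pi_minus m = pi_minus m' * f"
  shows "m' = Suc m \<Longrightarrow> f = 0\<^sub>m (Suc m') (Suc m) \<and> g = 0\<^sub>m m' m"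
    and "m' = m \<Longrightarrow> f = f $$ (0, 0) \<cdot>\<^sub>m 1\<^sub>m (Suc m) \<and> g = f $$ (0, 0) \<cdot>\<^sub>m 1\<^sub>m m"
proof -
  note t = pencil_hom_toeplitz[OF f g p q]
  have shift: "f $$ (i + k, j + k) = f $$ (i, j)" if "i + k \<le> m'" "j + k \<le> m" for i j k
    using that
  proof (induction k)
    case (Suc k)
    then show ?case using t(4)[of "i + k" "j + k"] by simp
  qed simp
  have low: "f $$ (i, j) = 0" if "j < i" "i \<le> m'" "j \<le> m" for i j
  proof -
    obtain k where "i = Suc (j + k)" using less_imp_Suc_add[OF \<open>j < i\<close>] by auto
    then show ?thesis using shift[of "Suc k" j 0] t(3)[of k] that by (simp add: add.commute)
  qed
  have up: "f $$ (i, j) = 0" if "i \<le> j" "i + (m - j) < m'" "j \<le> m" for i j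
    using shift[of i "m - j" j] t(2)[of "i + (m - j)"] that by simp
  show "m' = Suc m \<Longrightarrow> f = 0\<^sub>m (Suc m') (Suc m) \<and> g = 0\<^sub>m m' m"
  proof -
    assume m': "m' = Suc m"
    have z: "f $$ (i, j) = 0" if "i \<le> m'" "j \<le> m" for i j
      using low[of j i] up[of i j] that m' by (cases "j < i") auto
    have "f = 0\<^sub>m (Suc m') (Suc m)" by (rule eq_matI) (use f z in auto)
    moreover have "g = 0\<^sub>m m' m" by (rule eq_matI) (use g z t(1) in auto)
    ultimately show ?thesis by blast
  qed
  show "m' = m \<Longrightarrow> f = f $$ (0, 0) \<cdot>\<^sub>m 1\<^sub>m (Suc m) \<and> g = f $$ (0, 0) \<cdot>\<^sub>m 1\<^sub>m m"
  proof -
    assume m': "m' = m"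
    obtain c where c: "c = f $$ (0, 0)" by blast
    have z: "f $$ (i, j) = (if i = j then c else 0)" if "i \<le> m" "j \<le> m" for i j
    proof (cases i j rule: linorder_cases)
      case less then show ?thesis using up[of i j] that m' by simp
    next
      case equal then show ?thesis using shift[of 0 i 0] that m' c by simp
    next
      case greater then show ?thesis using low[of j i] that m' by simp
    qed
    have "f = c \<cdot>\<^sub>m 1\<^sub>m (Suc m)" by (rule eq_matI) (use f z m' in auto)
    moreover have "g = c \<cdot>\<^sub>m 1\<^sub>m m" by (rule eq_matI) (use g z t(1) m' in auto)
    ultimately show ?thesis unfolding c by blast
  qed
qed

lemma rhom_zeroI:
  assumes "is_rep V" "is_rep W" "\<And>f v. f \<in> rhom V W \<Longrightarrow> f v = 0\<^sub>m (rdim W v) (rdim V v)"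
  shows "rhom V W = {mzero V W}"
proof -
  have "f = mzero V W" if "f \<in> rhom V W" for f using assms(3)[OF that] by (auto simp: mzero_def)
  then show ?thesis using mzero_rhom[OF assms(1,2)] by blast
qed

lemma brickI:
  assumes V: "is_rep V" and "\<And>f. f \<in> rhom V V \<Longrightarrow> \<exists>c. \<forall>v. f v = c \<cdot>\<^sub>m 1\<^sub>m (rdim V v)" and "rdim V v0 \<noteq> 0"
  shows "brick V"
proof -
  have "mscale c (mid V) \<in> rhom V V" for c
  proof (rule rhomI)
    show "mscale c (mid V) v \<in> carrier_mat (rdim V v) (rdim V v)" for v by (simp add: mscale_def mid_def)
    fix a
    have "(c \<cdot>\<^sub>m 1\<^sub>m (rdim V (tgt a))) * rmap V a = c \<cdot>\<^sub>m rmap V a" "rmap V a * (c \<cdot>\<^sub>m 1\<^sub>m (rdim V (src a))) = c \<cdot>\<^sub>m rmap V a"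
      using is_repD[OF V, of a] mult_smult_distrib[OF is_repD[OF V, of a], of "1\<^sub>m (rdim V (src a))" "rdim V (src a)" c]
        mult_smult_assoc_mat[OF one_carrier_mat is_repD[OF V, of a], of c] by auto
    then show "mscale c (mid V) (tgt a) * rmap V a = rmap V a * mscale c (mid V) (src a)"
      by (simp add: mscale_def mid_def)
  qed
  moreover have "f \<in> range (\<lambda>c. mscale c (mid V))" if f: "f \<in> rhom V V" for f
  proof -
    obtain c where "\<forall>v. f v = c \<cdot>\<^sub>m 1\<^sub>m (rdim V v)" using assms(2)[OF f] by blast
    then have "f = mscale c (mid V)" by (auto simp: mscale_def mid_def)
    then show ?thesis by blast
  qed
  ultimately show ?thesis unfolding brick_def using assms(3) by blast
qed

lemma hom_E1_E1_next: "rhom (E1 m) (E1 (Suc m)) = {mzero (E1 m) (E1 (Suc m))}"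
proof (rule rhom_zeroI)
  fix f v assume "f \<in> rhom (E1 m) (E1 (Suc m) :: 'a rep)"
  then have f: "f Vb \<in> carrier_mat (Suc (Suc m)) (Suc m)" "f Vmid \<in> carrier_mat (Suc m) m" "f Ve \<in> carrier_mat (Suc m) m"
      "f Ve * pi_plus m = pi_plus (Suc m) * f Vb" "f Vmid * pi_minus m = pi_minus (Suc m) * f Vb" "f Ve = f Vmid"
    by (auto simp: rhom_iff)
  have "f Vb = 0\<^sub>m (Suc (Suc m)) (Suc m) \<and> f Ve = 0\<^sub>m (Suc m) m"
    by (rule pencil_hom(1)[OF f(1,3,4) _ refl]) (use f(5,6) in simp)
  then show "f v = 0\<^sub>m (rdim (E1 (Suc m)) v) (rdim (E1 m) v)" using f(6) by (cases v) auto
qed auto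

lemma hom_E4_E4_next: "rhom (E4 m) (E4 (Suc m)) = {mzero (E4 m) (E4 (Suc m))}"
proof (rule rhom_zeroI)
  fix f v assume "f \<in> rhom (E4 m) (E4 (Suc m) :: 'a rep)"
  then have f: "f Vb \<in> carrier_mat (Suc (Suc m)) (Suc m)" "f Ve \<in> carrier_mat (Suc m) m" "f Vmid = f Vb"
      "f Ve * pi_plus m = pi_plus (Suc m) * f Vb" "f Ve * pi_minus m = pi_minus (Suc m) * f Vmid"
    by (auto simp: rhom_iff)
  have "f Vb = 0\<^sub>m (Suc (Suc m)) (Suc m) \<and> f Ve = 0\<^sub>m (Suc m) m"
    by (rule pencil_hom(1)[OF f(1,2,4) _ refl]) (use f(3,5) in simp)
  then show "f v = 0\<^sub>m (rdim (E4 (Suc m)) v) (rdim (E4 m) v)" using f(3) by (cases v) auto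
qed auto

lemma hom_E1_E4: "rhom (E1 m) (E4 m) = {mzero (E1 m) (E4 m)}"
proof (rule rhom_zeroI)
  fix f v assume "f \<in> rhom (E1 m) (E4 m :: 'a rep)"
  then have f: "f Vb \<in> carrier_mat (Suc m) (Suc m)" "f Vmid \<in> carrier_mat (Suc m) m" "f Ve \<in> carrier_mat m m"
      "f Ve * pi_plus m = pi_plus m * f Vb" "f Vmid * pi_minus m = f Vb" "f Ve = pi_minus m * f Vmid"
    by (auto simp: rhom_iff)
  have "f Ve * pi_minus m = pi_minus m * f Vb"
    unfolding f(6) f(5)[symmetric] using f(2) by (simp add: mat_assoc)
  from pencil_hom(2)[OF f(1,3,4) this refl]
  have c: "f Vb = f Vb $$ (0, 0) \<cdot>\<^sub>m 1\<^sub>m (Suc m)" "f Ve = f Vb $$ (0, 0) \<cdot>\<^sub>m 1\<^sub>m m" by blast+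
  have "f Vb $$ (0, 0) = 0" using mult_pi_minus_entry[OF f(2), of 0 0] f(5) by simp
  then have b0: "f Vb = 0\<^sub>m (Suc m) (Suc m)" and e0: "f Ve = 0\<^sub>m m m" using c by auto
  have "f Vmid = 0\<^sub>m (Suc m) m"
  proof (rule eq_matI)
    fix i j assume ij: "i < dim_row (0\<^sub>m (Suc m) m :: 'a mat)" "j < dim_col (0\<^sub>m (Suc m) m :: 'a mat)"
    then have "f Vmid $$ (i, j) = f Vb $$ (i, Suc j)" using mult_pi_minus_entry[OF f(2), of i "Suc j"] f(5) by simp
    then show "f Vmid $$ (i, j) = 0\<^sub>m (Suc m) m $$ (i, j)" using ij by (simp add: b0)
  qed (use f(2) in auto)
  then show "f v = 0\<^sub>m (rdim (E4 m) v) (rdim (E1 m) v)" using b0 e0 by (cases v) auto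
qed auto

lemma hom_E4_E1_next: "rhom (E4 m) (E1 (Suc m)) = {mzero (E4 m) (E1 (Suc m))}"
proof (rule rhom_zeroI)
  fix f v assume "f \<in> rhom (E4 m) (E1 (Suc m) :: 'a rep)"
  then have f: "f Vb \<in> carrier_mat (Suc (Suc m)) (Suc m)" "f Vmid \<in> carrier_mat (Suc m) (Suc m)" "f Ve \<in> carrier_mat (Suc m) m"
      "f Ve * pi_plus m = pi_plus (Suc m) * f Vb" "f Vmid = pi_minus (Suc m) * f Vb" "f Ve * pi_minus m = f Vmid"
    by (auto simp: rhom_iff)
  have "f Vb = 0\<^sub>m (Suc (Suc m)) (Suc m) \<and> f Ve = 0\<^sub>m (Suc m) m"
    by (rule pencil_hom(1)[OF f(1,3,4) _ refl]) (use f(5,6) in simp)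
  then show "f v = 0\<^sub>m (rdim (E1 (Suc m)) v) (rdim (E4 m) v)" using f(6) by (cases v) (auto simp: mat_dist)
qed auto

lemma hom_M_zero:
  assumes W: "is_rep W" and "rmap W ME = 1\<^sub>m (rdim W Vmid)"
  shows "rhom M W = {mzero M W}"
proof (rule rhom_zeroI[OF _ W])
  fix f v assume "f \<in> rhom M W"
  then have f: "f Vb \<in> carrier_mat (rdim W Vb) 0" "f Vmid \<in> carrier_mat (rdim W Vmid) 1" "f Ve \<in> carrier_mat (rdim W Ve) 0"
      "f Ve * 0\<^sub>m 0 1 = f Vmid"
    using assms(2) by (auto simp: rhom_iff)
  have "f Vmid = 0\<^sub>m (rdim W Ve) 1" using f(3,4) by (simp add: mat_dist)
  then have "f Vmid = 0\<^sub>m (rdim W Vmid) 1" using f(2) by auto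
  then show "f v = 0\<^sub>m (rdim W v) (rdim M v)" using f by (cases v) (auto intro!: eq_mat_no_cols)
qed simp

lemma hom_M'_zero:
  assumes W: "is_rep W" and "rmap W BM = 1\<^sub>m (rdim W Vb)"
  shows "rhom M' W = {mzero M' W}"
proof (rule rhom_zeroI[OF _ W])
  fix f v assume "f \<in> rhom M' W"
  then have f: "f Vb \<in> carrier_mat (rdim W Vb) 1" "f Vmid \<in> carrier_mat (rdim W Vmid) 0" "f Ve \<in> carrier_mat (rdim W Ve) 1"
      "f Ve = rmap W BE * f Vb" "f Vmid * 0\<^sub>m 0 1 = f Vb"
    using assms(2) by (auto simp: rhom_iff)
  have "f Vb = 0\<^sub>m (rdim W Vmid) 1" using f(2,5) by (simp add: mat_dist)
  then have b: "f Vb = 0\<^sub>m (rdim W Vb) 1" using f(1) by auto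
  then have "f Ve = 0\<^sub>m (rdim W Ve) 1" using f(4) W by (simp add: mat_dist)
  then show "f v = 0\<^sub>m (rdim W v) (rdim M' v)" using b f by (cases v) (auto intro!: eq_mat_no_cols)
qed simp

lemma hom_disjoint_zero:
  assumes "is_rep V" "is_rep W" "\<And>v. rdim V v = 0 \<or> rdim W v = 0"
  shows "rhom V W = {mzero V W}"
proof (rule rhom_zeroI[OF assms(1,2)])
  fix f v assume f: "f \<in> rhom V W"
  show "f v = 0\<^sub>m (rdim W v) (rdim V v)"
    by (rule eq_matI) (use rhomD[OF f, of v] assms(3)[of v] in auto)
qed

lemma brick_E1: "brick (E1 m)"
proof (rule brickI[of _ Vb])
  fix f assume "f \<in> rhom (E1 m) (E1 m :: 'a rep)"
  then have f: "f Vb \<in> carrier_mat (Suc m) (Suc m)" "f Vmid \<in> carrier_mat m m" "f Ve \<in> carrier_mat m m"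
      "f Ve * pi_plus m = pi_plus m * f Vb" "f Vmid * pi_minus m = pi_minus m * f Vb" "f Ve = f Vmid"
    by (auto simp: rhom_iff)
  have "f Vb = f Vb $$ (0, 0) \<cdot>\<^sub>m 1\<^sub>m (Suc m) \<and> f Ve = f Vb $$ (0, 0) \<cdot>\<^sub>m 1\<^sub>m m"
    by (rule pencil_hom(2)[OF f(1,3,4) _ refl]) (use f(5,6) in simp)
  then show "\<exists>c. \<forall>v. f v = c \<cdot>\<^sub>m 1\<^sub>m (rdim (E1 m) v)"
    using f(6) by (intro exI[of _ "f Vb $$ (0, 0)"]) (simp add: all_vertex)
qed auto

lemma brick_E4: "brick (E4 m)"
proof (rule brickI[of _ Vb])
  fix f assume "f \<in> rhom (E4 m) (E4 m :: 'a rep)"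
  then have f: "f Vb \<in> carrier_mat (Suc m) (Suc m)" "f Ve \<in> carrier_mat m m" "f Vmid = f Vb"
      "f Ve * pi_plus m = pi_plus m * f Vb" "f Ve * pi_minus m = pi_minus m * f Vmid"
    by (auto simp: rhom_iff)
  have "f Vb = f Vb $$ (0, 0) \<cdot>\<^sub>m 1\<^sub>m (Suc m) \<and> f Ve = f Vb $$ (0, 0) \<cdot>\<^sub>m 1\<^sub>m m"
    by (rule pencil_hom(2)[OF f(1,2,4) _ refl]) (use f(3,5) in simp)
  then show "\<exists>c. \<forall>v. f v = c \<cdot>\<^sub>m 1\<^sub>m (rdim (E4 m) v)"
    using f(3) by (intro exI[of _ "f Vb $$ (0, 0)"]) (simp add: all_vertex)
qed auto

lemma mat_1x1: "X \<in> carrier_mat 1 1 \<Longrightarrow> X = X $$ (0, 0) \<cdot>\<^sub>m 1\<^sub>m 1" for X :: "'k::field mat"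
  by (rule eq_matI) auto

lemma brick_M: "brick M"
proof (rule brickI[of _ Vmid])
  fix f assume "f \<in> rhom M (M :: 'a rep)"
  then have f: "f Vb \<in> carrier_mat 0 0" "f Vmid \<in> carrier_mat 1 1" "f Ve \<in> carrier_mat 0 0" by (auto simp: rhom_iff)
  have "f Vb = f Vmid $$ (0, 0) \<cdot>\<^sub>m 1\<^sub>m 0" "f Ve = f Vmid $$ (0, 0) \<cdot>\<^sub>m 1\<^sub>m 0"
    using f by (auto intro!: eq_mat_no_cols)
  then show "\<exists>c. \<forall>v. f v = c \<cdot>\<^sub>m 1\<^sub>m (rdim M v)"
    using mat_1x1[OF f(2)] by (intro exI[of _ "f Vmid $$ (0, 0)"]) (simp add: all_vertex)
qed auto

lemma brick_M': "brick M'"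
proof (rule brickI[of _ Vb])
  fix f assume "f \<in> rhom M' (M' :: 'a rep)"
  then have f: "f Vb \<in> carrier_mat 1 1" "f Vmid \<in> carrier_mat 0 0" "f Ve = f Vb" by (auto simp: rhom_iff)
  have "f Vmid = f Vb $$ (0, 0) \<cdot>\<^sub>m 1\<^sub>m 0" using f by (auto intro!: eq_mat_no_cols)
  then show "\<exists>c. \<forall>v. f v = c \<cdot>\<^sub>m 1\<^sub>m (rdim M' v)"
    using mat_1x1[OF f(1)] f(3) by (intro exI[of _ "f Vb $$ (0, 0)"]) (simp add: all_vertex)
qed auto

lemma exceptional_of_brick: "is_rep A \<Longrightarrow> brick A \<Longrightarrow> euler A A = 1 \<Longrightarrow> exceptional A"
  using ext_free_iff_euler_one[of A] by (simp add: exceptional_iff)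

lemma brick_E2: "brick (E2 m)" using brick_dual[OF _ brick_E4, of m] by simp
lemma brick_E3: "brick (E3 m)" using brick_dual[OF _ brick_E1, of m] by simp

lemma exceptional_E: "exceptional (E1 m)" "exceptional (E2 m)" "exceptional (E3 m)" "exceptional (E4 m)" "exceptional M" "exceptional M'"
proof -
  show "exceptional (E1 m)" by (rule exceptional_of_brick) (simp_all add: brick_E1 euler_def algebra_simps)
  show "exceptional (E2 m)" by (rule exceptional_of_brick) (simp_all add: brick_E2 euler_def algebra_simps)
  show "exceptional (E3 m)" by (rule exceptional_of_brick) (simp_all add: brick_E3 euler_def algebra_simps)
  show "exceptional (E4 m)" by (rule exceptional_of_brick) (simp_all add: brick_E4 euler_def algebra_simps)
  show "exceptional M" by (rule exceptional_of_brick) (simp_all add: brick_M euler_def algebra_simps)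
  show "exceptional M'" by (rule exceptional_of_brick) (simp_all add: brick_M' euler_def algebra_simps)
qed

section \<open>Isomorphism invariance\<close>

lemma rep_iso_inverse:
  assumes "rep_iso V W"
  shows "\<exists>f g. is_rep V \<and> is_rep W \<and> f \<in> rhom V W \<and> g \<in> rhom W V \<and>
    (\<forall>v. g v * f v = 1\<^sub>m (rdim V v)) \<and> (\<forall>v. f v * g v = 1\<^sub>m (rdim W v))"
proof -
  obtain f g where fg: "is_rep V" "is_rep W" "f \<in> rhom V W" "g \<in> rhom W V" "g \<star> f = mid V" "f \<star> g = mid W"
    using assms by (auto simp: rep_iso_def)
  have "g v * f v = 1\<^sub>m (rdim V v)" "f v * g v = 1\<^sub>m (rdim W v)" for v
    using fun_cong[OF fg(5), of v] fun_cong[OF fg(6), of v] by (simp_all add: mcomp_def mid_def)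
  with fg(1-4) show ?thesis by blast
qed

lemma rep_iso_sym: "rep_iso V W \<Longrightarrow> rep_iso W V" by (auto simp: rep_iso_def)

lemma rep_isoI:
  assumes V: "is_rep V" and W: "is_rep W" and f: "f \<in> rhom V W"
    and g: "\<And>v. g v \<in> carrier_mat (rdim V v) (rdim W v)" "\<And>v. g v * f v = 1\<^sub>m (rdim V v)" "\<And>v. f v * g v = 1\<^sub>m (rdim W v)"
  shows "rep_iso V W"
proof -
  have "g \<in> rhom W V"
  proof (rule rhomI[OF g(1)])
    fix a
    note c = rhomD[OF f, of "tgt a"] rhomD[OF f, of "src a"] g(1)[of "tgt a"] g(1)[of "src a"] is_repD[OF V, of a] is_repD[OF W, of a]
    have "g (tgt a) * rmap W a = g (tgt a) * rmap W a * (f (src a) * g (src a))" using c by (simp add: g(3))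
    also have "\<dots> = g (tgt a) * (rmap W a * f (src a)) * g (src a)" using c by (simp add: mat_assoc)
    also have "\<dots> = (g (tgt a) * f (tgt a)) * rmap V a * g (src a)" using c by (simp add: mat_assoc flip: rhom_comm[OF f])
    also have "\<dots> = rmap V a * g (src a)" using c by (simp add: g(2))
    finally show "g (tgt a) * rmap W a = rmap V a * g (src a)" .
  qed
  moreover have "g \<star> f = mid V" "f \<star> g = mid W" by (auto simp: mcomp_def mid_def g)
  ultimately show ?thesis using V W f unfolding rep_iso_def by blast
qed

lemma rhom_zero_iso:
  assumes A: "rep_iso A A'" and B: "rep_iso B B'" and hom: "rhom A B = {mzero A B}"
  shows "rhom A' B' = {mzero A' B'}"
proof -
  obtain f f' where f: "is_rep A" "is_rep A'" "f \<in> rhom A A'" "f' \<in> rhom A' A" "\<And>v. f' v * f v = 1\<^sub>m (rdim A v)" "\<And>v. f v * f' v = 1\<^sub>m (rdim A' v)"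
    using rep_iso_inverse[OF A] by auto
  obtain q q' where q: "is_rep B" "is_rep B'" "q \<in> rhom B B'" "q' \<in> rhom B' B" "\<And>v. q' v * q v = 1\<^sub>m (rdim B v)" "\<And>v. q v * q' v = 1\<^sub>m (rdim B' v)"
    using rep_iso_inverse[OF B] by auto
  show ?thesis
  proof (rule rhom_zeroI[OF f(2) q(2)])
    fix h v assume h: "h \<in> rhom A' B'"
    have "q' \<star> (h \<star> f) \<in> rhom A B" by (intro rhom_comp[of _ B'] rhom_comp[of _ A'] f q h)
    then have "q' \<star> (h \<star> f) = mzero A B" using hom by blast
    then have z: "q' v * (h v * f v) = 0\<^sub>m (rdim B v) (rdim A v)" by (auto simp: mcomp_def mzero_def dest: fun_cong[of _ _ v])
    note c = rhomD[OF f(3), of v] rhomD[OF f(4), of v] rhomD[OF q(3), of v] rhomD[OF q(4), of v] rhomD[OF h, of v]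
    have "h v = (q v * q' v) * h v * (f v * f' v)" using c by (simp add: f(6) q(6))
    also have "\<dots> = q v * (q' v * (h v * f v)) * f' v" using c by (simp add: mat_assoc)
    also have "\<dots> = 0\<^sub>m (rdim B' v) (rdim A' v)" using c by (simp add: z mat_dist)
    finally show "h v = 0\<^sub>m (rdim B' v) (rdim A' v)" .
  qed
qed

text \<open>
  A cocycle is transported along the isomorphisms, and the splitting is transported back.
\<close>

lemma ext_free_iso:
  assumes A: "rep_iso A A'" and B: "rep_iso B B'" and free: "ext_free A B"
  shows "ext_free A' B'"
  unfolding ext_free_def
proof
  obtain f f' where f: "is_rep A" "is_rep A'" "f \<in> rhom A A'" "f' \<in> rhom A' A" "\<And>v. f' v * f v = 1\<^sub>m (rdim A v)" "\<And>v. f v * f' v = 1\<^sub>m (rdim A' v)"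
    using rep_iso_inverse[OF A] by auto
  obtain q q' where q: "is_rep B" "is_rep B'" "q \<in> rhom B B'" "q' \<in> rhom B' B" "\<And>v. q' v * q v = 1\<^sub>m (rdim B v)" "\<And>v. q v * q' v = 1\<^sub>m (rdim B' v)"
    using rep_iso_inverse[OF B] by auto
  fix C assume C: "C \<in> arrow_family A' B'"
  define C0 where "C0 a = q' (tgt a) * C a * f (src a)" for a
  have "C0 \<in> arrow_family A B" unfolding arrow_family_def
  proof (intro CollectI allI)
    fix a show "C0 a \<in> carrier_mat (rdim B (tgt a)) (rdim A (src a))"
      using arrow_familyD[OF C, of a] rhomD[OF q(4), of "tgt a"] rhomD[OF f(3), of "src a"] by (simp add: C0_def)
  qed
  then obtain p where p: "p \<in> mor_family A B" "\<And>a. C0 a = p (tgt a) * rmap A a - rmap B a * p (src a)"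
    using free by (auto simp: ext_free_def)
  show "\<exists>p\<in>mor_family A' B'. \<forall>a. C a = p (tgt a) * rmap A' a - rmap B' a * p (src a)"
  proof (intro bexI[of _ "\<lambda>v. q v * p v * f' v"] allI)
    show "(\<lambda>v. q v * p v * f' v) \<in> mor_family A' B'" unfolding mor_family_def
    proof (intro CollectI allI)
      fix v show "q v * p v * f' v \<in> carrier_mat (rdim B' v) (rdim A' v)"
        using rhomD[OF q(3), of v] mor_familyD[OF p(1), of v] rhomD[OF f(4), of v] by simp
    qed
    fix a
    note c = rhomD[OF f(3), of "tgt a"] rhomD[OF f(4), of "tgt a"] rhomD[OF q(3), of "tgt a"] rhomD[OF q(4), of "tgt a"]
      rhomD[OF f(3), of "src a"] rhomD[OF f(4), of "src a"] rhomD[OF q(3), of "src a"] rhomD[OF q(4), of "src a"]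
      arrow_familyD[OF C, of a] mor_familyD[OF p(1), of "src a"] mor_familyD[OF p(1), of "tgt a"]
      is_repD[OF f(1), of a] is_repD[OF f(2), of a] is_repD[OF q(1), of a] is_repD[OF q(2), of a]
    have "C a = (q (tgt a) * q' (tgt a)) * C a * (f (src a) * f' (src a))" using c by (simp add: f(6) q(6))
    also have "\<dots> = q (tgt a) * C0 a * f' (src a)" using c by (simp add: C0_def mat_assoc)
    also have "\<dots> = q (tgt a) * p (tgt a) * (rmap A a * f' (src a)) - q (tgt a) * rmap B a * (p (src a) * f' (src a))"
      unfolding p(2) using c by (simp add: mat_dist mat_assoc)
    also have "rmap A a * f' (src a) = f' (tgt a) * rmap A' a" using rhom_comm[OF f(4), of a] by simp
    also have "q (tgt a) * rmap B a = rmap B' a * q (src a)" using rhom_comm[OF q(3), of a] by simp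
    finally show "C a = q (tgt a) * p (tgt a) * f' (tgt a) * rmap A' a - rmap B' a * (q (src a) * p (src a) * f' (src a))"
      using c by (simp add: mat_assoc)
  qed
qed

lemma brick_iso:
  assumes A: "rep_iso A A'" and b: "brick A"
  shows "brick A'"
proof -
  obtain f f' where f: "is_rep A" "is_rep A'" "f \<in> rhom A A'" "f' \<in> rhom A' A" "\<And>v. f' v * f v = 1\<^sub>m (rdim A v)" "\<And>v. f v * f' v = 1\<^sub>m (rdim A' v)"
    using rep_iso_inverse[OF A] by auto
  obtain v where v: "rdim A v \<noteq> 0" using b by (auto simp: brick_def)
  have "rdim A' v \<noteq> 0"
  proof
    assume 0: "rdim A' v = 0"
    have "(f' v * f v) $$ (0, 0) = 0" using rhomD[OF f(3), of v] rhomD[OF f(4), of v] v 0 by (simp add: scalar_prod_def)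
    then show False using v by (simp add: f(5))
  qed
  then show ?thesis
  proof (rule brickI[OF f(2), rotated])
    fix h assume h: "h \<in> rhom A' A'"
    have "f' \<star> (h \<star> f) \<in> rhom A A" by (intro rhom_comp[of _ A'] f h)
    then obtain c where c0: "f' \<star> (h \<star> f) = mscale c (mid A)" using b by (auto simp: brick_def)
    have "h v = c \<cdot>\<^sub>m 1\<^sub>m (rdim A' v)" for v
    proof -
      have z: "f' v * (h v * f v) = c \<cdot>\<^sub>m 1\<^sub>m (rdim A v)" using fun_cong[OF c0, of v] by (simp add: mcomp_def mscale_def mid_def)
      note cc = rhomD[OF f(3), of v] rhomD[OF f(4), of v] rhomD[OF h, of v]
      have "h v = (f v * f' v) * h v * (f v * f' v)" using cc by (simp add: f(6))
      also have "\<dots> = f v * (f' v * (h v * f v)) * f' v" using cc by (simp add: mat_assoc)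
      also have "\<dots> = (c \<cdot>\<^sub>m (f v * 1\<^sub>m (rdim A v))) * f' v" unfolding z by (simp add: mult_smult_distrib[OF cc(1) one_carrier_mat])
      also have "\<dots> = c \<cdot>\<^sub>m 1\<^sub>m (rdim A' v)" using cc by (simp add: mult_smult_assoc_mat[OF cc(1,2)] f(6))
      finally show ?thesis .
    qed
    then show "\<exists>c. \<forall>v. h v = c \<cdot>\<^sub>m 1\<^sub>m (rdim A' v)" by blast
  qed
qed

lemma exceptional_iso: "rep_iso A A' \<Longrightarrow> exceptional A \<Longrightarrow> exceptional A'"
  using brick_iso[of A A'] ext_free_iso[of A A' A A'] unfolding exceptional_iff by (auto simp: rep_iso_def)

lemma all_ext_vanish_iso:
  assumes A: "rep_iso A A'" and B: "rep_iso B B'" and van: "\<forall>p. ext_vanishes p A B"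
  shows "\<forall>p. ext_vanishes p A' B'"
proof -
  have r: "is_rep A" "is_rep B" "is_rep A'" "is_rep B'" using A B by (auto simp: rep_iso_def)
  show ?thesis using van rhom_zero_iso[OF A B] ext_free_iso[OF A B]
    unfolding all_ext_vanish_iff[OF r(1,2)] all_ext_vanish_iff[OF r(3,4)] by blast
qed

section \<open>Matrices of maximal rank\<close>

lemma mat_smult_mult: "dim_col A = dim_row B \<Longrightarrow> (k \<cdot>\<^sub>m A) * B = k \<cdot>\<^sub>m (A * B)"
  and mat_mult_smult: "dim_col A = dim_row B \<Longrightarrow> A * (k \<cdot>\<^sub>m B) = k \<cdot>\<^sub>m (A * B)"
  for A :: "'k::field mat"
  by (rule mult_smult_assoc_mat mult_smult_distrib; auto intro: carrier_matI)+

lemma wide_mat_kernel: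
  fixes T :: "'k::field mat"
  assumes T: "T \<in> carrier_mat n m" and "n < m"
  shows "\<exists>X. X \<in> carrier_mat m 1 \<and> X \<noteq> 0\<^sub>m m 1 \<and> T * X = 0\<^sub>m n 1"
proof -
  have "card {..<n} < card {..<m}" using assms by simp
  from homogeneous_system_nontrivial[OF _ _ this, of "\<lambda>i j. T $$ (i, j)"] obtain x j where
    x: "j < m" "x j \<noteq> 0" "\<forall>i<n. (\<Sum>j<m. T $$ (i, j) * x j) = 0" by auto
  define X where "X = mat m 1 (\<lambda>(i, _). x i)"
  have "X $$ (j, 0) \<noteq> 0\<^sub>m m 1 $$ (j, 0)" using x by (simp add: X_def)
  moreover have "T * X = 0\<^sub>m n 1"
    by (rule eq_matI) (use T x(3) in \<open>auto simp: X_def scalar_prod_def atLeast0LessThan\<close>)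
  ultimately show ?thesis by (intro exI[of _ X]) (auto simp: X_def)
qed

lemma tall_mat_left_kernel:
  fixes T :: "'k::field mat"
  assumes T: "T \<in> carrier_mat n m" and "m < n"
  shows "\<exists>U. U \<in> carrier_mat 1 n \<and> U \<noteq> 0\<^sub>m 1 n \<and> U * T = 0\<^sub>m 1 m"
proof -
  obtain X where X: "X \<in> carrier_mat n 1" "X \<noteq> 0\<^sub>m n 1" "transpose_mat T * X = 0\<^sub>m m 1"
    using wide_mat_kernel[of "transpose_mat T" m n] assms by auto
  have "transpose_mat X * T = transpose_mat (transpose_mat T * X)"
    using transpose_mult[of "transpose_mat T" m n X 1] T X(1) by simp
  then have "transpose_mat X * T = 0\<^sub>m 1 m" by (simp add: X(3))
  moreover have "transpose_mat X \<noteq> 0\<^sub>m 1 n" using X(2) by (metis transpose_transpose zero_transpose_mat)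
  ultimately show ?thesis using X(1) by (intro exI[of _ "transpose_mat X"]) auto
qed

lemma mat_inverse_of_left_kernel:
  fixes T :: "'k::field mat"
  assumes T: "T \<in> carrier_mat n n" and inj: "\<And>U. U \<in> carrier_mat 1 n \<Longrightarrow> U * T = 0\<^sub>m 1 n \<Longrightarrow> U = 0\<^sub>m 1 n"
  obtains S where "S \<in> carrier_mat n n" "S * T = 1\<^sub>m n" "T * S = 1\<^sub>m n"
proof -
  have "det T \<noteq> 0"
  proof
    assume "det T = 0"
    then have "det (transpose_mat T) = 0" using det_transpose[OF T] by simp
    then obtain v where v: "v \<in> carrier_vec n" "v \<noteq> 0\<^sub>v n" "transpose_mat T *\<^sub>v v = 0\<^sub>v n"
      using det_0_iff_vec_prod_zero_field[of "transpose_mat T" n] T by auto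
    define U where "U = mat 1 n (\<lambda>(_, j). v $ j)"
    have "U * T = 0\<^sub>m 1 n"
    proof (rule eq_matI)
      fix i j assume ij: "i < dim_row (0\<^sub>m 1 n :: 'k mat)" "j < dim_col (0\<^sub>m 1 n :: 'k mat)"
      have "(U * T) $$ (i, j) = v \<bullet> col T j"
        using ij T v(1) by (auto simp: U_def scalar_prod_def intro!: sum.cong)
      also have "\<dots> = (transpose_mat T *\<^sub>v v) $ j" using ij T v(1) by (simp add: comm_scalar_prod[of v n])
      also have "\<dots> = 0" using ij v(3) by simp
      finally show "(U * T) $$ (i, j) = 0\<^sub>m 1 n $$ (i, j)" using ij by simp
    qed (use T in \<open>auto simp: U_def\<close>)
    then have U: "U = 0\<^sub>m 1 n" by (rule inj[rotated]) (simp add: U_def)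
    have "v $ j = 0" if "j < n" for j using arg_cong[OF U, of "\<lambda>X. X $$ (0, j)"] that by (simp add: U_def)
    then have "v = 0\<^sub>v n" using v(1) by (intro eq_vecI) auto
    with v(2) show False by simp
  qed
  then have "T \<in> Units (ring_mat TYPE('k) n ())" by (rule det_non_zero_imp_unit[OF T])
  then obtain S where "S \<in> carrier_mat n n" "S * T = 1\<^sub>m n" "T * S = 1\<^sub>m n"
    unfolding Units_def ring_mat_def by auto
  then show thesis using that by blast
qed

lemma mat_inverse_of_kernel:
  fixes T :: "'k::field mat"
  assumes T: "T \<in> carrier_mat n n" and inj: "\<And>X. X \<in> carrier_mat n 1 \<Longrightarrow> T * X = 0\<^sub>m n 1 \<Longrightarrow> X = 0\<^sub>m n 1"
  obtains S where "S \<in> carrier_mat n n" "S * T = 1\<^sub>m n" "T * S = 1\<^sub>m n"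
proof -
  have "U = 0\<^sub>m 1 n" if U: "U \<in> carrier_mat 1 n" "U * transpose_mat T = 0\<^sub>m 1 n" for U
  proof -
    have "T * transpose_mat U = transpose_mat (U * transpose_mat T)"
      using transpose_mult[of U 1 n "transpose_mat T" n] T U(1) by simp
    then have "T * transpose_mat U = 0\<^sub>m n 1" using U(2) by simp
    then have "transpose_mat U = 0\<^sub>m n 1" by (rule inj[rotated]) (use U(1) in simp)
    then show ?thesis by (metis transpose_transpose zero_transpose_mat)
  qed
  moreover have "transpose_mat T \<in> carrier_mat n n" using T by simp
  ultimately obtain S where S: "S \<in> carrier_mat n n" "S * transpose_mat T = 1\<^sub>m n" "transpose_mat T * S = 1\<^sub>m n"
    using mat_inverse_of_left_kernel[of "transpose_mat T" n thesis] by blast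
  have "transpose_mat S * T = transpose_mat (transpose_mat T * S)"
    using transpose_mult[of "transpose_mat T" n n S n] T S(1) by simp
  also have "\<dots> = 1\<^sub>m n" by (simp add: S(3))
  finally have 1: "transpose_mat S * T = 1\<^sub>m n" .
  have "T * transpose_mat S = transpose_mat (S * transpose_mat T)"
    using transpose_mult[of S n n "transpose_mat T" n] T S(1) by simp
  also have "\<dots> = 1\<^sub>m n" by (simp add: S(2))
  finally have "T * transpose_mat S = 1\<^sub>m n" .
  with 1 show thesis using that[of "transpose_mat S"] S(1) by simp
qed

text \<open>
  If \<open>T\<close> had a kernel vector \<open>X\<close> and a left kernel vector \<open>U\<close>, then \<open>U C X = 0\<close> for every \<open>C\<close> of the form
  \<open>F T - T G\<close>. This fails for the elementary matrix \<open>C\<close> at nonzero entries of \<open>U\<close> and \<open>X\<close>.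
\<close>

lemma max_rank_of_commutators:
  fixes T :: "'k::field mat"
  assumes T: "T \<in> carrier_mat n m"
    and C: "\<And>C. C \<in> carrier_mat n m \<Longrightarrow> \<exists>F G. F \<in> carrier_mat n n \<and> G \<in> carrier_mat m m \<and> C = F * T - T * G"
  shows "(\<forall>X\<in>carrier_mat m 1. T * X = 0\<^sub>m n 1 \<longrightarrow> X = 0\<^sub>m m 1) \<or> (\<forall>U\<in>carrier_mat 1 n. U * T = 0\<^sub>m 1 m \<longrightarrow> U = 0\<^sub>m 1 n)"
proof (rule ccontr)
  assume "\<not> ?thesis"
  then obtain X U where X: "X \<in> carrier_mat m 1" "T * X = 0\<^sub>m n 1" "X \<noteq> 0\<^sub>m m 1"
    and U: "U \<in> carrier_mat 1 n" "U * T = 0\<^sub>m 1 m" "U \<noteq> 0\<^sub>m 1 n" by blast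
  obtain j where j: "j < m" "X $$ (j, 0) \<noteq> 0"
  proof -
    have "\<exists>j<m. X $$ (j, 0) \<noteq> 0"
    proof (rule ccontr)
      assume "\<not> ?thesis"
      then have "X = 0\<^sub>m m 1" using X(1) by (intro eq_matI) auto
      with X(3) show False by simp
    qed
    with that show thesis by blast
  qed
  obtain i where i: "i < n" "U $$ (0, i) \<noteq> 0"
  proof -
    have "\<exists>i<n. U $$ (0, i) \<noteq> 0"
    proof (rule ccontr)
      assume "\<not> ?thesis"
      then have "U = 0\<^sub>m 1 n" using U(1) by (intro eq_matI) auto
      with U(3) show False by simp
    qed
    with that show thesis by blast
  qed
  define D where "D = mat n m (\<lambda>(r, s). if r = i \<and> s = j then 1 else (0::'k))"
  obtain F G where FG: "F \<in> carrier_mat n n" "G \<in> carrier_mat m m" "D = F * T - T * G"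
    using C[of D] by (auto simp: D_def)
  have "U * D * X = U * F * (T * X) - (U * T) * (G * X)"
    unfolding FG(3) using FG(1,2) U(1) X(1) T by (simp add: mat_dist mat_assoc)
  also have "\<dots> = 0\<^sub>m 1 1" using FG(1,2) U(1) X(1) by (simp add: U(2) X(2) mat_dist)
  finally have z: "U * D * X = 0\<^sub>m 1 1" .
  have UD: "(U * D) $$ (0, s) = (if s = j then U $$ (0, i) else 0)" if "s < m" for s
  proof -
    have "(U * D) $$ (0, s) = (\<Sum>r<n. U $$ (0, r) * (if r = i \<and> s = j then 1 else 0))"
      using U(1) that by (simp add: D_def scalar_prod_def atLeast0LessThan)
    also have "\<dots> = (\<Sum>r<n. if r = i then (if s = j then U $$ (0, i) else 0) else 0)" by (rule sum.cong) auto
    also have "\<dots> = (if s = j then U $$ (0, i) else 0)" using i(1) by simp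
    finally show ?thesis .
  qed
  have UDc: "U * D \<in> carrier_mat 1 m" using U(1) by (simp add: D_def)
  have "(U * D * X) $$ (0, 0) = (\<Sum>s<m. (U * D) $$ (0, s) * X $$ (s, 0))"
  proof -
    have "(A * B) $$ (0, 0) = (\<Sum>s<m. A $$ (0, s) * B $$ (s, 0))" if "A \<in> carrier_mat 1 m" "B \<in> carrier_mat m 1" for A B :: "'k mat"
      using that by (simp add: scalar_prod_def atLeast0LessThan)
    from this[OF UDc X(1)] show ?thesis .
  qed
  also have "\<dots> = (\<Sum>s<m. if s = j then U $$ (0, i) * X $$ (j, 0) else 0)" by (rule sum.cong) (auto simp: UD)
  also have "\<dots> = U $$ (0, i) * X $$ (j, 0)" using j(1) by simp
  finally show False using z i(2) j(2) by simp
qed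

section \<open>Kronecker pencils and their normal form\<close>

text \<open>
  Every nonzero linear combination of the two matrices is surjective, expressed by a vanishing left
  kernel. Over an algebraically closed field this leaves a single equivalence class in the size
  \<open>n \<times> (n + 1)\<close>.
\<close>

definition surjective_pencil :: "nat \<Rightarrow> 'k::field mat \<Rightarrow> 'k mat \<Rightarrow> bool" where
  "surjective_pencil n \<alpha> \<beta> \<longleftrightarrow> (\<forall>l m. \<forall>U\<in>carrier_mat 1 n. (l \<noteq> 0 \<or> m \<noteq> 0) \<longrightarrow>
     U * (l \<cdot>\<^sub>m \<alpha> + m \<cdot>\<^sub>m \<beta>) = 0\<^sub>m 1 (dim_col \<alpha>) \<longrightarrow> U = 0\<^sub>m 1 n)"

definition inverse_mats :: "nat \<Rightarrow> 'k::field mat \<Rightarrow> 'k mat \<Rightarrow> bool" where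
  "inverse_mats n P P' \<longleftrightarrow> P \<in> carrier_mat n n \<and> P' \<in> carrier_mat n n \<and> P * P' = 1\<^sub>m n \<and> P' * P = 1\<^sub>m n"

lemma inverse_mats_mult:
  assumes "inverse_mats n P P'" "inverse_mats n R R'"
  shows "inverse_mats n (R * P) (P' * R')"
proof -
  have c: "P \<in> carrier_mat n n" "P' \<in> carrier_mat n n" "R \<in> carrier_mat n n" "R' \<in> carrier_mat n n"
    using assms by (auto simp: inverse_mats_def)
  have "R * P * (P' * R') = R * (P * P') * R'" "P' * R' * (R * P) = P' * (R' * R) * P" using c by (simp_all add: mat_assoc)
  then show ?thesis using assms c by (simp add: inverse_mats_def)
qed

definition pencil_equiv :: "nat \<Rightarrow> nat \<Rightarrow> 'k::field mat \<Rightarrow> 'k mat \<Rightarrow> 'k mat \<Rightarrow> 'k mat \<Rightarrow> bool" where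
  "pencil_equiv n m \<alpha> \<beta> \<alpha>' \<beta>' \<longleftrightarrow> (\<exists>P P' Q Q'. inverse_mats n P P' \<and> inverse_mats m Q Q' \<and> P * \<alpha> * Q = \<alpha>' \<and> P * \<beta> * Q = \<beta>')"

lemma pencil_equiv_trans:
  assumes c: "\<alpha> \<in> carrier_mat n m" "\<beta> \<in> carrier_mat n m"
    and "pencil_equiv n m \<alpha> \<beta> \<alpha>' \<beta>'" "pencil_equiv n m \<alpha>' \<beta>' \<alpha>'' \<beta>''"
  shows "pencil_equiv n m \<alpha> \<beta> \<alpha>'' \<beta>''"
proof -
  obtain P P' Q Q' where 1: "inverse_mats n P P'" "inverse_mats m Q Q'" "P * \<alpha> * Q = \<alpha>'" "P * \<beta> * Q = \<beta>'"
    using assms(3) by (auto simp: pencil_equiv_def)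
  obtain R R' S S' where 2: "inverse_mats n R R'" "inverse_mats m S S'" "R * \<alpha>' * S = \<alpha>''" "R * \<beta>' * S = \<beta>''"
    using assms(4) by (auto simp: pencil_equiv_def)
  have "P \<in> carrier_mat n n" "Q \<in> carrier_mat m m" "R \<in> carrier_mat n n" "S \<in> carrier_mat m m"
    using 1(1,2) 2(1,2) by (simp_all add: inverse_mats_def)
  then have "(R * P) * \<alpha> * (Q * S) = \<alpha>''" "(R * P) * \<beta> * (Q * S) = \<beta>''"
    using c unfolding 2(3,4)[symmetric] 1(3,4)[symmetric] by (simp_all add: mat_assoc)
  moreover have "inverse_mats m (Q * S) (S' * Q')" by (rule inverse_mats_mult[OF 2(2) 1(2)])
  ultimately show ?thesis using inverse_mats_mult[OF 1(1) 2(1)] unfolding pencil_equiv_def by blast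
qed

lemma surjective_pencil_equiv:
  assumes c: "\<alpha> \<in> carrier_mat n m" "\<beta> \<in> carrier_mat n m"
    and eq: "pencil_equiv n m \<alpha> \<beta> \<alpha>' \<beta>'" and s: "surjective_pencil n \<alpha> \<beta>"
  shows "surjective_pencil n \<alpha>' \<beta>'"
  unfolding surjective_pencil_def
proof (intro allI ballI impI)
  obtain P P' Q Q' where 1: "inverse_mats n P P'" "inverse_mats m Q Q'" "P * \<alpha> * Q = \<alpha>'" "P * \<beta> * Q = \<beta>'"
    using eq by (auto simp: pencil_equiv_def)
  have PQ: "P \<in> carrier_mat n n" "P' \<in> carrier_mat n n" "Q \<in> carrier_mat m m" "Q' \<in> carrier_mat m m"
    "P * P' = 1\<^sub>m n" "Q * Q' = 1\<^sub>m m" using 1 by (auto simp: inverse_mats_def)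
  fix l k :: 'a and U assume U: "U \<in> carrier_mat 1 n" and lk: "l \<noteq> 0 \<or> k \<noteq> 0"
    and z: "U * (l \<cdot>\<^sub>m \<alpha>' + k \<cdot>\<^sub>m \<beta>') = 0\<^sub>m 1 (dim_col \<alpha>')"
  have dc: "dim_col \<alpha>' = m" using 1(3) PQ by auto
  define T where "T = l \<cdot>\<^sub>m \<alpha> + k \<cdot>\<^sub>m \<beta>"
  have T: "T \<in> carrier_mat n m" using c by (simp add: T_def)
  have "l \<cdot>\<^sub>m \<alpha>' + k \<cdot>\<^sub>m \<beta>' = P * T * Q"
    unfolding 1(3,4)[symmetric] T_def using c PQ by (simp add: mat_dist mat_smult_mult mat_mult_smult)
  then have "U * P * T * Q = 0\<^sub>m 1 m" using z PQ U T dc by (simp add: mat_assoc)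
  then have "U * P * T * Q * Q' = 0\<^sub>m 1 m" using PQ by (simp add: mat_dist)
  moreover have "U * P * T * Q * Q' = U * P * T * (Q * Q')" using PQ(1-4) U T by (simp add: mat_assoc)
  moreover have UPT: "U * P * T \<in> carrier_mat 1 m" using U PQ T by simp
  ultimately have "U * P * T = 0\<^sub>m 1 m" unfolding PQ(6) by (metis right_mult_one_mat)
  moreover have "U * P \<in> carrier_mat 1 n" using U PQ by simp
  ultimately have "U * P = 0\<^sub>m 1 n" using s lk c(1) unfolding surjective_pencil_def T_def by auto
  then have "U * P * P' = 0\<^sub>m 1 n" using PQ by (simp add: mat_dist)
  moreover have "U * P * P' = U * (P * P')" using PQ(1,2) U by (simp add: mat_assoc)
  ultimately show "U = 0\<^sub>m 1 n" using PQ U by simp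
qed

text \<open>
  If \<open>L\<close> is invertible, a left eigenvector of \<open>K L'\<close>, where \<open>L'\<close> is the inverse of \<open>L\<close>, to the eigenvalue \<open>t\<close> is
  a left kernel vector of \<open>K - t L\<close>.
\<close>

lemma singular_pencil_member:
  fixes K :: "'k::alg_closed_field mat"
  assumes K: "K \<in> carrier_mat N N" and L: "L \<in> carrier_mat N N" and N: "0 < N"
  shows "\<exists>l m U. (l \<noteq> 0 \<or> m \<noteq> 0) \<and> U \<in> carrier_mat 1 N \<and> U \<noteq> 0\<^sub>m 1 N \<and> U * (l \<cdot>\<^sub>m K + m \<cdot>\<^sub>m L) = 0\<^sub>m 1 N"
proof (cases "\<exists>U\<in>carrier_mat 1 N. U \<noteq> 0\<^sub>m 1 N \<and> U * L = 0\<^sub>m 1 N")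
  case True
  then obtain U where U: "U \<in> carrier_mat 1 N" "U \<noteq> 0\<^sub>m 1 N" "U * L = 0\<^sub>m 1 N" by blast
  have "0 \<cdot>\<^sub>m K + 1 \<cdot>\<^sub>m L = L" using K L by (intro eq_matI) auto
  with U show ?thesis by (intro exI[of _ 0] exI[of _ 1] exI[of _ U]) auto
next
  case False
  then obtain L' where L': "L' \<in> carrier_mat N N" "L' * L = 1\<^sub>m N" using mat_inverse_of_left_kernel[OF L] by metis
  define Z where "Z = transpose_mat (K * L')"
  have KL: "K * L' \<in> carrier_mat N N" using K L' by simp
  then have Z: "Z \<in> carrier_mat N N" by (simp add: Z_def)
  have "degree (char_poly Z) > 0" using degree_monic_char_poly[OF Z] N by simp
  then obtain t where "poly (char_poly Z) t = 0" using alg_closed_imp_poly_has_root by blast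
  then obtain v where v: "v \<in> carrier_vec N" "v \<noteq> 0\<^sub>v N" "Z *\<^sub>v v = t \<cdot>\<^sub>v v"
    using eigenvalue_root_char_poly[OF Z] Z by (auto simp: eigenvalue_def eigenvector_def)
  define U where "U = mat 1 N (\<lambda>(_, j). v $ j)"
  have U: "U \<in> carrier_mat 1 N" by (simp add: U_def)
  have "U * (K * L') = t \<cdot>\<^sub>m U"
  proof (rule eq_matI)
    fix i j assume "i < dim_row (t \<cdot>\<^sub>m U)" "j < dim_col (t \<cdot>\<^sub>m U)"
    then have ij: "i = 0" "j < N" using U by auto
    have "(U * (K * L')) $$ (i, j) = v \<bullet> col (K * L') j"
      using ij KL v(1) by (subst index_mult_mat) (auto simp: U_def scalar_prod_def simp del: col_mult2 intro!: sum.cong)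
    also have "\<dots> = (Z *\<^sub>v v) $ j" using ij K L' KL v(1) unfolding Z_def by (simp add: comm_scalar_prod[of v N] del: col_mult2)
    also have "\<dots> = t * v $ j" using v ij by simp
    finally show "(U * (K * L')) $$ (i, j) = (t \<cdot>\<^sub>m U) $$ (i, j)" using ij by (simp add: U_def)
  qed (use U KL in auto)
  then have "U * (K * L') * L = t \<cdot>\<^sub>m (U * L)" using U L by (simp add: mat_smult_mult)
  moreover have "U * (K * L') * L = U * K * (L' * L)" using U K L L'(1) by (simp add: mat_assoc)
  ultimately have UK: "U * K = t \<cdot>\<^sub>m (U * L)" using L'(2) U K by simp
  have "U * (1 \<cdot>\<^sub>m K + (- t) \<cdot>\<^sub>m L) = U * K + (- t) \<cdot>\<^sub>m (U * L)"
    using U K L by (simp add: mat_dist mat_mult_smult) (intro eq_matI, auto)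
  also have "\<dots> = 0\<^sub>m 1 N" unfolding UK using U L by (intro eq_matI) auto
  finally have 1: "U * (1 \<cdot>\<^sub>m K + (- t) \<cdot>\<^sub>m L) = 0\<^sub>m 1 N" .
  have "U \<noteq> 0\<^sub>m 1 N"
  proof
    assume z: "U = 0\<^sub>m 1 N"
    have "v $ j = 0" if "j < N" for j using arg_cong[OF z, of "\<lambda>X. X $$ (0, j)"] that by (simp add: U_def)
    then have "v = 0\<^sub>v N" using v(1) by (intro eq_vecI) auto
    with v(2) show False by simp
  qed
  then show ?thesis using 1 U by (intro exI[of _ 1] exI[of _ "- t"] exI[of _ U]) auto
qed

text \<open>
  The unit vectors other than one at which \<open>v\<close> has a nonzero entry complete \<open>v\<close> to a basis.
\<close>

lemma invertible_with_last_column: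
  fixes v :: "'k::field mat"
  assumes v: "v \<in> carrier_mat (Suc n) 1" "v \<noteq> 0\<^sub>m (Suc n) 1"
  shows "\<exists>Q0 S. Q0 \<in> carrier_mat (Suc n) n \<and> inverse_mats (Suc n) (hcat Q0 v) S"
proof -
  obtain i where i: "i < Suc n" "v $$ (i, 0) \<noteq> 0"
  proof -
    have "\<exists>i<Suc n. v $$ (i, 0) \<noteq> 0"
    proof (rule ccontr)
      assume "\<not> ?thesis"
      then have "v = 0\<^sub>m (Suc n) 1" using v(1) by (intro eq_matI) auto
      with v(2) show False by simp
    qed
    with that show thesis by blast
  qed
  define e where "e c = (if c < i then c else Suc c)" for c
  define Q0 where "Q0 = mat (Suc n) n (\<lambda>(r, c). if r = e c then 1 else (0::'k))"
  have Q0: "Q0 \<in> carrier_mat (Suc n) n" by (simp add: Q0_def)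
  have Q: "hcat Q0 v \<in> carrier_mat (Suc n) (Suc n)" using hcat_carrier[OF Q0 v(1)] by simp
  have "X = 0\<^sub>m (Suc n) 1" if X: "X \<in> carrier_mat (Suc n) 1" "hcat Q0 v * X = 0\<^sub>m (Suc n) 1" for X
  proof -
    obtain y t where yt: "y \<in> carrier_mat n 1" "t \<in> carrier_mat 1 1" "X = vcat y t"
      using split_rows[of X n 1 1] X(1) by auto
    have "Q0 * y + v * t = 0\<^sub>m (Suc n) 1" using X(2) hcat_mult_vcat[OF Q0 v(1) yt(1,2)] by (simp add: yt(3))
    then have "(Q0 * y + v * t) $$ (r, 0) = 0" if "r < Suc n" for r using that by simp
    moreover have "(v * t) $$ (r, 0) = v $$ (r, 0) * t $$ (0, 0)" if "r < Suc n" for r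
      using v(1) yt(2) that by (simp add: scalar_prod_def)
    moreover have "(Q0 * y) $$ (r, 0) = (\<Sum>c<n. if r = e c then y $$ (c, 0) else 0)" if "r < Suc n" for r
      using yt(1) that by (auto simp: Q0_def scalar_prod_def atLeast0LessThan intro!: sum.cong)
    ultimately have E: "(\<Sum>c<n. if r = e c then y $$ (c, 0) else 0) + v $$ (r, 0) * t $$ (0, 0) = 0" if "r < Suc n" for r
      using that Q0 v(1) yt(1,2) by fastforce
    have "(\<Sum>c<n. if i = e c then y $$ (c, 0) else 0) = 0" by (rule sum.neutral) (auto simp: e_def)
    then have t: "t $$ (0, 0) = 0" using E[OF i(1)] i(2) by simp
    have "y $$ (c, 0) = 0" if c: "c < n" for c
    proof -
      have "(\<Sum>c'<n. if e c = e c' then y $$ (c', 0) else 0) = (\<Sum>c'<n. if c' = c then y $$ (c', 0) else 0)"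
        by (rule sum.cong) (auto simp: e_def split: if_splits)
      then show ?thesis using E[of "e c"] c t by (auto simp: e_def)
    qed
    then have "y = 0\<^sub>m n 1" using yt(1) by (intro eq_matI) auto
    moreover have "t = 0\<^sub>m 1 1" using t yt(2) by (intro eq_matI) auto
    ultimately show ?thesis unfolding yt(3) by (intro eq_matI) (auto simp: vcat_def)
  qed
  then obtain S where "S \<in> carrier_mat (Suc n) (Suc n)" "S * hcat Q0 v = 1\<^sub>m (Suc n)" "hcat Q0 v * S = 1\<^sub>m (Suc n)"
    using mat_inverse_of_kernel[OF Q] by blast
  then show ?thesis using Q Q0 unfolding inverse_mats_def by blast
qed

lemma block_triangular_inverse:
  fixes A :: "'k::field mat"
  assumes A: "inverse_mats n A A'" and p: "p \<in> carrier_mat 1 n" and c: "c \<noteq> 0"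
  shows "\<exists>S. inverse_mats (Suc n) (four_block_mat A (0\<^sub>m n 1) p (c \<cdot>\<^sub>m 1\<^sub>m 1)) S"
proof -
  have A': "A \<in> carrier_mat n n" "A' \<in> carrier_mat n n" "A * A' = 1\<^sub>m n" "A' * A = 1\<^sub>m n"
    using A by (auto simp: inverse_mats_def)
  define q where "q = (- (1 / c)) \<cdot>\<^sub>m (p * A')"
  define S where "S = four_block_mat A' (0\<^sub>m n 1) q ((1 / c) \<cdot>\<^sub>m 1\<^sub>m 1)"
  have q: "q \<in> carrier_mat 1 n" using p A' by (simp add: q_def)
  have cc: "c \<cdot>\<^sub>m 1\<^sub>m 1 \<in> carrier_mat 1 (1::nat)" "(1 / c) \<cdot>\<^sub>m 1\<^sub>m 1 \<in> carrier_mat 1 (1::nat)" by auto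
  have one: "four_block_mat (1\<^sub>m n) (0\<^sub>m n 1) (0\<^sub>m 1 n) (1\<^sub>m 1) = (1\<^sub>m (Suc n) :: 'k mat)"
    by (rule eq_matI) (auto simp: less_Suc_eq)
  have c1: "c \<cdot>\<^sub>m 1\<^sub>m 1 * ((1 / c) \<cdot>\<^sub>m 1\<^sub>m 1) = (1\<^sub>m 1 :: 'k mat)" "(1 / c) \<cdot>\<^sub>m 1\<^sub>m 1 * (c \<cdot>\<^sub>m 1\<^sub>m 1) = (1\<^sub>m 1 :: 'k mat)"
    using c by (auto intro!: eq_matI simp: scalar_prod_def)
  have pq: "p * A' + c \<cdot>\<^sub>m 1\<^sub>m 1 * q = 0\<^sub>m 1 n"
    using c p A' q by (intro eq_matI) (auto simp: q_def mat_smult_mult mat_mult_smult mat_dist)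
  have "q * A = (- (1 / c)) \<cdot>\<^sub>m p" using p A'(1,2,4) by (simp add: q_def mat_smult_mult mat_assoc mat_dist)
  moreover have "(1 / c) \<cdot>\<^sub>m 1\<^sub>m 1 * p = (1 / c) \<cdot>\<^sub>m p" using p by (simp add: mat_smult_mult mat_dist)
  ultimately have qp: "q * A + (1 / c) \<cdot>\<^sub>m 1\<^sub>m 1 * p = 0\<^sub>m 1 n" using p by (intro eq_matI) auto
  have "four_block_mat A (0\<^sub>m n 1) p (c \<cdot>\<^sub>m 1\<^sub>m 1) * S = 1\<^sub>m (Suc n)"
  proof -
    have e: "A * A' + 0\<^sub>m n 1 * q = 1\<^sub>m n" "A * 0\<^sub>m n 1 + 0\<^sub>m n 1 * ((1 / c) \<cdot>\<^sub>m 1\<^sub>m 1) = 0\<^sub>m n 1"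
      "p * 0\<^sub>m n 1 + c \<cdot>\<^sub>m 1\<^sub>m 1 * ((1 / c) \<cdot>\<^sub>m 1\<^sub>m 1) = 1\<^sub>m 1"
      unfolding c1 using A' q p by (simp_all add: mat_dist)
    show ?thesis unfolding S_def mult_four_block_mat[OF A'(1) zero_carrier_mat p cc(1) A'(2) zero_carrier_mat q cc(2)] e pq
      by (rule one)
  qed
  moreover have "S * four_block_mat A (0\<^sub>m n 1) p (c \<cdot>\<^sub>m 1\<^sub>m 1) = 1\<^sub>m (Suc n)"
  proof -
    have e: "A' * A + 0\<^sub>m n 1 * p = 1\<^sub>m n" "A' * 0\<^sub>m n 1 + 0\<^sub>m n 1 * (c \<cdot>\<^sub>m 1\<^sub>m 1) = 0\<^sub>m n 1"
      "q * 0\<^sub>m n 1 + (1 / c) \<cdot>\<^sub>m 1\<^sub>m 1 * (c \<cdot>\<^sub>m 1\<^sub>m 1) = 1\<^sub>m 1"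
      unfolding c1 using A' q p by (simp_all add: mat_dist)
    show ?thesis unfolding S_def mult_four_block_mat[OF A'(2) zero_carrier_mat q cc(2) A'(1) zero_carrier_mat p cc(1)] e qp
      by (rule one)
  qed
  moreover have "S \<in> carrier_mat (n + 1) (n + 1)" unfolding S_def by (rule four_block_carrier_mat[OF A'(2) cc(2)])
  moreover have "four_block_mat A (0\<^sub>m n 1) p (c \<cdot>\<^sub>m 1\<^sub>m 1) \<in> carrier_mat (n + 1) (n + 1)"
    by (rule four_block_carrier_mat[OF A'(1) cc(1)])
  ultimately show ?thesis unfolding inverse_mats_def by (intro exI[of _ S]) auto
qed

definition last_unit_row :: "nat \<Rightarrow> 'k::field mat" where
  "last_unit_row n = mat 1 (Suc n) (\<lambda>(_, j). if j = n then 1 else 0)"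

lemma pi_plus_Suc: "pi_plus (Suc n) = four_block_mat (pi_plus n) (0\<^sub>m n 1) (last_unit_row n) (0\<^sub>m 1 1)"
  by (rule eq_matI) (auto simp: pi_plus_def last_unit_row_def less_Suc_eq)

lemma pi_minus_Suc: "pi_minus (Suc n) = four_block_mat (pi_minus n) (0\<^sub>m n 1) (0\<^sub>m 1 (Suc n)) (1\<^sub>m 1)"
  by (rule eq_matI) (auto simp: pi_minus_def less_Suc_eq)

text \<open>
  A kernel vector \<open>X\<close> of \<open>\<alpha>\<close> becomes the last basis vector of the source, and \<open>\<beta> X\<close> the last one of the
  target. That \<open>\<beta> X\<close> is not zero uses the surjectivity of all members: otherwise both matrices factor
  through the square quotient by \<open>X\<close>, and a square pencil has a singular member.
\<close>

lemma pencil_split_off_kernel: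
  fixes \<alpha> \<beta> :: "'k::alg_closed_field mat"
  assumes \<alpha>: "\<alpha> \<in> carrier_mat (Suc n) (Suc (Suc n))" and \<beta>: "\<beta> \<in> carrier_mat (Suc n) (Suc (Suc n))"
    and s: "surjective_pencil (Suc n) \<alpha> \<beta>"
  shows "\<exists>\<alpha>' \<beta>' r t. \<alpha>' \<in> carrier_mat n (Suc n) \<and> \<beta>' \<in> carrier_mat n (Suc n) \<and> r \<in> carrier_mat 1 (Suc n) \<and> t \<in> carrier_mat 1 (Suc n) \<and>
    pencil_equiv (Suc n) (Suc (Suc n)) \<alpha> \<beta>
      (four_block_mat \<alpha>' (0\<^sub>m n 1) r (0\<^sub>m 1 1)) (four_block_mat \<beta>' (0\<^sub>m n 1) t (1\<^sub>m 1))"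
proof -
  obtain X where X: "X \<in> carrier_mat (Suc (Suc n)) 1" "X \<noteq> 0\<^sub>m (Suc (Suc n)) 1" "\<alpha> * X = 0\<^sub>m (Suc n) 1"
    using wide_mat_kernel[OF \<alpha>] by auto
  obtain Q0 Q' where Q: "Q0 \<in> carrier_mat (Suc (Suc n)) (Suc n)" "inverse_mats (Suc (Suc n)) (hcat Q0 X) Q'"
    using invertible_with_last_column[OF X(1,2)] by blast
  have QX: "hcat Q0 X \<in> carrier_mat (Suc (Suc n)) (Suc (Suc n))" "Q' \<in> carrier_mat (Suc (Suc n)) (Suc (Suc n))"
    "hcat Q0 X * Q' = 1\<^sub>m (Suc (Suc n))" using Q(2) by (auto simp: inverse_mats_def)
  define w where "w = \<beta> * X"
  have w: "w \<in> carrier_mat (Suc n) 1" using \<beta> X by (simp add: w_def)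
  have "w \<noteq> 0\<^sub>m (Suc n) 1"
  proof
    assume w0: "w = 0\<^sub>m (Suc n) 1"
    have "\<alpha> * Q0 \<in> carrier_mat (Suc n) (Suc n)" "\<beta> * Q0 \<in> carrier_mat (Suc n) (Suc n)" using \<alpha> \<beta> Q(1) by simp_all
    from singular_pencil_member[OF this] obtain l m U where lmU: "l \<noteq> 0 \<or> m \<noteq> 0" "U \<in> carrier_mat 1 (Suc n)" "U \<noteq> 0\<^sub>m 1 (Suc n)"
      "U * (l \<cdot>\<^sub>m (\<alpha> * Q0) + m \<cdot>\<^sub>m (\<beta> * Q0)) = 0\<^sub>m 1 (Suc n)" by auto
    define T where "T = l \<cdot>\<^sub>m \<alpha> + m \<cdot>\<^sub>m \<beta>"
    have T: "T \<in> carrier_mat (Suc n) (Suc (Suc n))" using \<alpha> \<beta> by (simp add: T_def)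
    have TQ: "T * Q0 = l \<cdot>\<^sub>m (\<alpha> * Q0) + m \<cdot>\<^sub>m (\<beta> * Q0)" using \<alpha> \<beta> Q(1) by (simp add: T_def mat_dist mat_smult_mult)
    have "T * X = l \<cdot>\<^sub>m (\<alpha> * X) + m \<cdot>\<^sub>m (\<beta> * X)" using \<alpha> \<beta> X(1) by (simp add: T_def mat_dist mat_smult_mult)
    also have "\<dots> = 0\<^sub>m (Suc n) 1" using X(3) w0 by (simp add: w_def)
    finally have TX: "T * X = 0\<^sub>m (Suc n) 1" .
    have UT: "U * T \<in> carrier_mat 1 (Suc (Suc n))" using lmU(2) T by simp
    have "U * T * hcat Q0 X = hcat (U * T * Q0) (U * T * X)" by (rule mult_hcat[OF UT Q(1) X(1)])
    also have "U * T * Q0 = 0\<^sub>m 1 (Suc n)" using lmU(2,4) T Q(1) by (simp add: mat_assoc TQ)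
    also have "U * T * X = 0\<^sub>m 1 1" using lmU(2) T X(1) by (simp add: mat_assoc TX mat_dist)
    finally have "U * T * hcat Q0 X = 0\<^sub>m 1 (Suc (Suc n))" by (auto simp: hcat_def intro!: eq_matI)
    then have "U * T * hcat Q0 X * Q' = 0\<^sub>m 1 (Suc (Suc n))" using QX by (simp add: mat_dist)
    moreover have "U * T * hcat Q0 X * Q' = U * T * (hcat Q0 X * Q')" using UT QX by (intro assoc_mult_mat) auto
    ultimately have "U * T = 0\<^sub>m 1 (Suc (Suc n))" unfolding QX(3) using UT by (metis right_mult_one_mat)
    then have "U = 0\<^sub>m 1 (Suc n)" using s lmU(1,2) \<alpha> unfolding surjective_pencil_def T_def by auto
    with lmU(3) show False by simp
  qed
  then obtain P0 P where P: "P0 \<in> carrier_mat (Suc n) n" "inverse_mats (Suc n) (hcat P0 w) P"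
    using invertible_with_last_column[OF w] by blast
  have Pw: "hcat P0 w \<in> carrier_mat (Suc n) (Suc n)" "P \<in> carrier_mat (Suc n) (Suc n)" "P * hcat P0 w = 1\<^sub>m (Suc n)"
    and P': "inverse_mats (Suc n) P (hcat P0 w)" using P(2) by (auto simp: inverse_mats_def)
  have Pw1: "P * w = vcat (0\<^sub>m n 1) (1\<^sub>m 1)"
  proof -
    have "hcat (P * P0) (P * w) = 1\<^sub>m (Suc n)" using mult_hcat[OF Pw(2) P(1) w] Pw(3) by simp
    also have "\<dots> = hcat (vcat (1\<^sub>m n) (0\<^sub>m 1 n)) (vcat (0\<^sub>m n 1) (1\<^sub>m 1))"
      by (rule eq_matI) (auto simp: hcat_def vcat_def)
    finally show ?thesis using Pw(2) P(1) w by (subst (asm) hcat_eq_iff[of _ "Suc n" n _ 1]) auto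
  qed
  have "P * \<alpha> * Q0 \<in> carrier_mat (n + 1) (Suc n)" "P * \<beta> * Q0 \<in> carrier_mat (n + 1) (Suc n)"
    using Pw(2) \<alpha> \<beta> Q(1) by simp_all
  then obtain \<alpha>' r \<beta>' t where ab: "\<alpha>' \<in> carrier_mat n (Suc n)" "r \<in> carrier_mat 1 (Suc n)" "P * \<alpha> * Q0 = vcat \<alpha>' r"
    "\<beta>' \<in> carrier_mat n (Suc n)" "t \<in> carrier_mat 1 (Suc n)" "P * \<beta> * Q0 = vcat \<beta>' t"
    using split_rows by metis
  have Pab: "P * \<alpha> \<in> carrier_mat (Suc n) (Suc (Suc n))" "P * \<beta> \<in> carrier_mat (Suc n) (Suc (Suc n))" using Pw(2) \<alpha> \<beta> by simp_all
  have "P * \<alpha> * X = 0\<^sub>m (Suc n) 1" using Pw(2) \<alpha> X(1) by (simp add: mat_assoc X(3) mat_dist)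
  also have "\<dots> = vcat (0\<^sub>m n 1) (0\<^sub>m 1 1)" by (rule eq_matI) (auto simp: vcat_def)
  finally have "P * \<alpha> * hcat Q0 X = hcat (vcat \<alpha>' r) (vcat (0\<^sub>m n 1) (0\<^sub>m 1 1))"
    unfolding mult_hcat[OF Pab(1) Q(1) X(1)] ab(3) by simp
  then have 1: "P * \<alpha> * hcat Q0 X = four_block_mat \<alpha>' (0\<^sub>m n 1) r (0\<^sub>m 1 1)"
    using ab(1,2) by (simp add: four_block_mat_eq_hcat[of _ n "Suc n" _ 1 _ 1])
  have "P * \<beta> * X = P * w" using Pw(2) \<beta> X(1) by (simp add: mat_assoc w_def)
  then have "P * \<beta> * hcat Q0 X = hcat (vcat \<beta>' t) (vcat (0\<^sub>m n 1) (1\<^sub>m 1))"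
    unfolding mult_hcat[OF Pab(2) Q(1) X(1)] ab(6) Pw1 by simp
  then have 2: "P * \<beta> * hcat Q0 X = four_block_mat \<beta>' (0\<^sub>m n 1) t (1\<^sub>m 1)"
    using ab(4,5) by (simp add: four_block_mat_eq_hcat[of _ n "Suc n" _ 1 _ 1])
  have "pencil_equiv (Suc n) (Suc (Suc n)) \<alpha> \<beta>
      (four_block_mat \<alpha>' (0\<^sub>m n 1) r (0\<^sub>m 1 1)) (four_block_mat \<beta>' (0\<^sub>m n 1) t (1\<^sub>m 1))"
    unfolding pencil_equiv_def using P' Q(2) 1 2 by blast
  then show ?thesis using ab(1,2,4,5) by blast
qed

text \<open>
  A left kernel vector of a combination of the upper blocks gives one of the full matrices, with last
  entry zero.
\<close>

lemma surjective_pencil_block: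
  fixes \<alpha>' \<beta>' :: "'k::field mat"
  assumes c: "\<alpha>' \<in> carrier_mat n (Suc n)" "\<beta>' \<in> carrier_mat n (Suc n)" "r \<in> carrier_mat 1 (Suc n)" "t \<in> carrier_mat 1 (Suc n)"
    and s: "surjective_pencil (Suc n) (four_block_mat \<alpha>' (0\<^sub>m n 1) r (0\<^sub>m 1 1)) (four_block_mat \<beta>' (0\<^sub>m n 1) t (1\<^sub>m 1))"
  shows "surjective_pencil n \<alpha>' \<beta>'"
  unfolding surjective_pencil_def
proof (intro allI ballI impI)
  fix l m :: 'k and U assume U: "U \<in> carrier_mat 1 n" and lm: "l \<noteq> 0 \<or> m \<noteq> 0"
    and z: "U * (l \<cdot>\<^sub>m \<alpha>' + m \<cdot>\<^sub>m \<beta>') = 0\<^sub>m 1 (dim_col \<alpha>')"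
  let ?a = "four_block_mat \<alpha>' (0\<^sub>m n 1) r (0\<^sub>m 1 1)" and ?b = "four_block_mat \<beta>' (0\<^sub>m n 1) t (1\<^sub>m 1)"
  define T where "T = l \<cdot>\<^sub>m \<alpha>' + m \<cdot>\<^sub>m \<beta>'"
  define R where "R = vcat (l \<cdot>\<^sub>m r + m \<cdot>\<^sub>m t) (0\<^sub>m 0 (Suc n))"
  have T: "T \<in> carrier_mat n (Suc n)" using c by (simp add: T_def)
  have eq: "l \<cdot>\<^sub>m ?a + m \<cdot>\<^sub>m ?b = hcat (vcat T (l \<cdot>\<^sub>m r + m \<cdot>\<^sub>m t)) (vcat (0\<^sub>m n 1) (m \<cdot>\<^sub>m 1\<^sub>m 1))"
    using c by (intro eq_matI) (auto simp: hcat_def vcat_def T_def)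
  have Uc: "hcat U (0\<^sub>m 1 1) \<in> carrier_mat 1 (n + 1)" using U by auto
  have rc: "l \<cdot>\<^sub>m r + m \<cdot>\<^sub>m t \<in> carrier_mat 1 (Suc n)" using c by simp
  have "hcat U (0\<^sub>m 1 1) * (l \<cdot>\<^sub>m ?a + m \<cdot>\<^sub>m ?b) =
      hcat (hcat U (0\<^sub>m 1 1) * vcat T (l \<cdot>\<^sub>m r + m \<cdot>\<^sub>m t)) (hcat U (0\<^sub>m 1 1) * vcat (0\<^sub>m n 1) (m \<cdot>\<^sub>m 1\<^sub>m 1))"
    unfolding eq by (rule mult_hcat[OF Uc, of _ "Suc n" _ 1]) (use vcat_carrier[OF T rc] in auto)
  also have "hcat U (0\<^sub>m 1 1) * vcat T (l \<cdot>\<^sub>m r + m \<cdot>\<^sub>m t) = U * T + 0\<^sub>m 1 1 * (l \<cdot>\<^sub>m r + m \<cdot>\<^sub>m t)"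
    by (rule hcat_mult_vcat[OF U _ T rc]) simp
  also have "\<dots> = 0\<^sub>m 1 (Suc n)" using z c(1) left_mult_zero_mat[OF rc, of 1] by (simp add: T_def)
  also have "hcat U (0\<^sub>m 1 1) * vcat (0\<^sub>m n 1) (m \<cdot>\<^sub>m 1\<^sub>m 1) = U * 0\<^sub>m n 1 + 0\<^sub>m 1 1 * (m \<cdot>\<^sub>m 1\<^sub>m 1)"
    by (rule hcat_mult_vcat[OF U]) auto
  also have "\<dots> = 0\<^sub>m 1 1" using U by (simp add: mat_dist)
  finally have "hcat U (0\<^sub>m 1 1) * (l \<cdot>\<^sub>m ?a + m \<cdot>\<^sub>m ?b) = 0\<^sub>m 1 (Suc (Suc n))" by (auto simp: hcat_def intro!: eq_matI)
  then have "hcat U (0\<^sub>m 1 1) = 0\<^sub>m 1 (Suc n)"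
    using s lm Uc c(1) unfolding surjective_pencil_def by auto
  also have "\<dots> = hcat (0\<^sub>m 1 n) (0\<^sub>m 1 1)" by (rule eq_matI) (auto simp: hcat_def)
  finally show "U = 0\<^sub>m 1 n" using U by (subst (asm) hcat_eq_iff[of _ 1 n _ 1]) auto
qed

text \<open>
  Induction on \<open>n\<close>. After \<open>pencil_split_off_kernel\<close> the upper blocks form a smaller surjective pencil and can
  be normalised; what remains are the last rows \<open>r\<close> and \<open>t\<close>, which are removed with row and column
  operations that are block triangular.
\<close>

lemma pencil_normal_form:
  fixes \<alpha> \<beta> :: "'k::alg_closed_field mat"
  assumes "\<alpha> \<in> carrier_mat n (Suc n)" "\<beta> \<in> carrier_mat n (Suc n)" "surjective_pencil n \<alpha> \<beta>"
  shows "pencil_equiv n (Suc n) \<alpha> \<beta> (pi_plus n) (pi_minus n)"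
  using assms
proof (induction n arbitrary: \<alpha> \<beta>)
  case 0
  have "1\<^sub>m 0 * \<alpha> * 1\<^sub>m 1 = pi_plus 0" "1\<^sub>m 0 * \<beta> * 1\<^sub>m 1 = pi_minus 0"
    by (rule eq_mat_no_rows[of _ "Suc 0"]; use 0 in auto)+
  moreover have "inverse_mats 0 (1\<^sub>m 0) (1\<^sub>m 0)" "inverse_mats (Suc 0) (1\<^sub>m 1) (1\<^sub>m 1)" by (auto simp: inverse_mats_def)
  ultimately show ?case unfolding pencil_equiv_def by blast
next
  case (Suc n)
  obtain \<alpha>' \<beta>' r t where ab: "\<alpha>' \<in> carrier_mat n (Suc n)" "\<beta>' \<in> carrier_mat n (Suc n)" "r \<in> carrier_mat 1 (Suc n)" "t \<in> carrier_mat 1 (Suc n)"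
    and eq: "pencil_equiv (Suc n) (Suc (Suc n)) \<alpha> \<beta>
      (four_block_mat \<alpha>' (0\<^sub>m n 1) r (0\<^sub>m 1 1)) (four_block_mat \<beta>' (0\<^sub>m n 1) t (1\<^sub>m 1))"
    using pencil_split_off_kernel[OF Suc.prems] by blast
  let ?a = "four_block_mat \<alpha>' (0\<^sub>m n 1) r (0\<^sub>m 1 1)" and ?b = "four_block_mat \<beta>' (0\<^sub>m n 1) t (1\<^sub>m 1)"
  have s: "surjective_pencil (Suc n) ?a ?b" by (rule surjective_pencil_equiv[OF Suc.prems(1,2) eq Suc.prems(3)])
  obtain P P' Q Q' where PQ: "inverse_mats n P P'" "inverse_mats (Suc n) Q Q'" "P * \<alpha>' * Q = pi_plus n" "P * \<beta>' * Q = pi_minus n"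
    using Suc.IH[OF ab(1,2) surjective_pencil_block[OF ab s]] by (auto simp: pencil_equiv_def)
  have c: "P \<in> carrier_mat n n" "Q \<in> carrier_mat (Suc n) (Suc n)" "Q' \<in> carrier_mat (Suc n) (Suc n)" "Q * Q' = 1\<^sub>m (Suc n)"
    using PQ(1,2) by (auto simp: inverse_mats_def)
  define r' where "r' = r * Q"
  define \<rho> where "\<rho> = mat 1 n (\<lambda>(_, j). r' $$ (0, j))"
  define \<gamma> where "\<gamma> = r' $$ (0, n)"
  have r': "r' \<in> carrier_mat 1 (Suc n)" using ab c by (simp add: r'_def)
  have \<rho>: "\<rho> \<in> carrier_mat 1 n" by (simp add: \<rho>_def)
  have \<rho>pi: "\<rho> * pi_plus n \<in> carrier_mat 1 (Suc n)" using \<rho> by (intro mult_carrier_mat) auto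
  \<comment> \<open>Up to a combination of the rows of \<open>\<pi>\<^sub>+\<close>, the transformed row is a multiple of the last unit row.\<close>
  have r'_eq: "r' = \<rho> * pi_plus n + \<gamma> \<cdot>\<^sub>m last_unit_row n"
  proof (rule eq_matI)
    fix i j assume "i < dim_row (\<rho> * pi_plus n + \<gamma> \<cdot>\<^sub>m last_unit_row n)" "j < dim_col (\<rho> * pi_plus n + \<gamma> \<cdot>\<^sub>m last_unit_row n)"
    then have ij: "i = 0" "j < Suc n" by (auto simp: last_unit_row_def)
    then show "r' $$ (i, j) = (\<rho> * pi_plus n + \<gamma> \<cdot>\<^sub>m last_unit_row n) $$ (i, j)"
      using mult_pi_plus_entry[OF \<rho>, of 0 j] by (auto simp: last_unit_row_def \<rho>_def \<gamma>_def less_Suc_eq)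
  qed (use r' in \<open>auto simp: last_unit_row_def\<close>)
  \<comment> \<open>For \<open>\<gamma> = 0\<close> the row \<open>r\<close> would be a combination of the rows of \<open>\<alpha>'\<close>, and the block matrix of \<open>\<alpha>\<close> not surjective.\<close>
  have "\<gamma> \<noteq> 0"
  proof
    assume g: "\<gamma> = 0"
    have rq: "r * Q = \<rho> * pi_plus n" using r'_eq \<rho>pi g by (auto simp: r'_def last_unit_row_def intro!: eq_matI)
    have "r = r * Q * Q'" using ab c by (simp add: mat_assoc)
    also have "\<dots> = \<rho> * (P * \<alpha>' * Q) * Q'" by (simp add: rq PQ(3))
    also have "\<dots> = \<rho> * P * \<alpha>' * (Q * Q')" using \<rho> c(1-3) ab(1) by (simp add: mat_assoc)
    also have "\<dots> = \<rho> * P * \<alpha>'" using \<rho> c ab(1) by simp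
    finally have rr: "r = \<rho> * P * \<alpha>'" .
    define U where "U = hcat (- (\<rho> * P)) (1\<^sub>m 1)"
    have \<rho>P: "\<rho> * P \<in> carrier_mat 1 n" using \<rho> c by simp
    have Uc: "U \<in> carrier_mat 1 (n + 1)" unfolding U_def by (rule hcat_carrier) (use \<rho>P in auto)
    have ac: "?a \<in> carrier_mat (Suc n) (Suc (Suc n))" "?b \<in> carrier_mat (Suc n) (Suc (Suc n))" using ab by auto
    have "U * ?a = hcat (U * vcat \<alpha>' r) (U * vcat (0\<^sub>m n 1) (0\<^sub>m 1 1))"
      unfolding four_block_mat_eq_hcat[OF ab(1) zero_carrier_mat ab(3) zero_carrier_mat]
      by (rule mult_hcat[OF Uc, of _ "Suc n" _ 1]) (use ab in auto)
    also have "U * vcat \<alpha>' r = - (\<rho> * P) * \<alpha>' + 1\<^sub>m 1 * r"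
      unfolding U_def by (rule hcat_mult_vcat) (use \<rho>P ab in auto)
    also have "\<dots> = 0\<^sub>m 1 (Suc n)"
    proof -
      have "- (\<rho> * P) * \<alpha>' = - r" unfolding rr by (rule uminus_mult_left_mat) (use \<rho>P ab c in auto)
      then show ?thesis using ab by (auto intro!: eq_matI)
    qed
    also have "U * vcat (0\<^sub>m n 1) (0\<^sub>m 1 1) = - (\<rho> * P) * 0\<^sub>m n 1 + 1\<^sub>m 1 * 0\<^sub>m 1 1"
      unfolding U_def by (rule hcat_mult_vcat) (use \<rho>P in auto)
    also have "\<dots> = 0\<^sub>m 1 1" using \<rho> c by (auto intro!: eq_matI)
    finally have "U * ?a = 0\<^sub>m 1 (Suc (Suc n))" by (auto simp: hcat_def intro!: eq_matI)
    moreover have "1 \<cdot>\<^sub>m ?a + 0 \<cdot>\<^sub>m ?b = ?a" using ab by (intro eq_matI) auto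
    ultimately have "U * (1 \<cdot>\<^sub>m ?a + 0 \<cdot>\<^sub>m ?b) = 0\<^sub>m 1 (dim_col ?a)" using ac ab by simp
    then have "U = 0\<^sub>m 1 (Suc n)" using s Uc unfolding surjective_pencil_def by (metis Suc_eq_plus1 zero_neq_one)
    then have "U $$ (0, n) = 0" by simp
    then show False using \<rho> c by (simp add: U_def hcat_def)
  qed
  \<comment> \<open>The row \<open>p\<close> subtracts the combination of the rows of \<open>\<pi>\<^sub>+\<close> from \<open>r\<close>, and \<open>q\<close> is chosen to cancel the last row \<open>y\<close> of the second matrix; adding multiples of the last column is harmless for the first matrix, where this column is zero.\<close>
  define c' where "c' = 1 / \<gamma>"
  define p where "p = (- c') \<cdot>\<^sub>m (\<rho> * P)"
  have p: "p \<in> carrier_mat 1 n" using \<rho> c by (simp add: p_def)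
  define y where "y = p * \<beta>' + c' \<cdot>\<^sub>m t"
  have y: "y \<in> carrier_mat 1 (Suc n)" using p ab by (simp add: y_def)
  define q where "q = (- \<gamma>) \<cdot>\<^sub>m (y * Q)"
  have q: "q \<in> carrier_mat 1 (Suc n)" using y c by (simp add: q_def)
  have c'0: "c' \<noteq> 0" "c' * \<gamma> = 1" using \<open>\<gamma> \<noteq> 0\<close> by (simp_all add: c'_def)
  obtain S1 where S1: "inverse_mats (Suc n) (four_block_mat P (0\<^sub>m n 1) p (c' \<cdot>\<^sub>m 1\<^sub>m 1)) S1"
    using block_triangular_inverse[OF PQ(1) p c'0(1)] by blast
  obtain S2 where S2: "inverse_mats (Suc (Suc n)) (four_block_mat Q (0\<^sub>m (Suc n) 1) q (\<gamma> \<cdot>\<^sub>m 1\<^sub>m 1)) S2"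
    using block_triangular_inverse[OF PQ(2) q \<open>\<gamma> \<noteq> 0\<close>] by blast
  let ?P = "four_block_mat P (0\<^sub>m n 1) p (c' \<cdot>\<^sub>m 1\<^sub>m 1)" and ?Q = "four_block_mat Q (0\<^sub>m (Suc n) 1) q (\<gamma> \<cdot>\<^sub>m 1\<^sub>m 1)"
  have cc: "c' \<cdot>\<^sub>m 1\<^sub>m 1 \<in> carrier_mat 1 (1::nat)" "\<gamma> \<cdot>\<^sub>m 1\<^sub>m 1 \<in> carrier_mat 1 (1::nat)" by auto
  have x: "p * \<alpha>' + c' \<cdot>\<^sub>m r \<in> carrier_mat 1 (Suc n)" using p ab by simp
  have Pa: "?P * ?a = four_block_mat (P * \<alpha>') (0\<^sub>m n 1) (p * \<alpha>' + c' \<cdot>\<^sub>m r) (0\<^sub>m 1 1)"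
    unfolding mult_four_block_mat[OF c(1) zero_carrier_mat p cc(1) ab(1) zero_carrier_mat ab(3) zero_carrier_mat]
    using c p ab by (simp add: mat_dist mat_smult_mult)
  have Pb: "?P * ?b = four_block_mat (P * \<beta>') (0\<^sub>m n 1) y (c' \<cdot>\<^sub>m 1\<^sub>m 1)"
    unfolding mult_four_block_mat[OF c(1) zero_carrier_mat p cc(1) ab(2) zero_carrier_mat ab(4) one_carrier_mat]
    using c p ab by (simp add: mat_dist mat_smult_mult y_def)
  have PA: "P * \<alpha>' \<in> carrier_mat n (Suc n)" "P * \<beta>' \<in> carrier_mat n (Suc n)" using c ab by simp_all
  have xQ: "(p * \<alpha>' + c' \<cdot>\<^sub>m r) * Q = last_unit_row n"
  proof -
    have "(p * \<alpha>' + c' \<cdot>\<^sub>m r) * Q = p * \<alpha>' * Q + c' \<cdot>\<^sub>m r'"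
      using p ab c by (simp add: mat_dist mat_smult_mult r'_def)
    also have "p * \<alpha>' * Q = (- c') \<cdot>\<^sub>m (\<rho> * (P * \<alpha>' * Q))"
      unfolding p_def using \<rho> c ab by (simp add: mat_smult_mult mat_assoc)
    also have "\<dots> = (- c') \<cdot>\<^sub>m (\<rho> * pi_plus n)" by (simp add: PQ(3))
    also have "\<dots> + c' \<cdot>\<^sub>m r' = last_unit_row n"
      unfolding r'_eq using \<rho>pi c'0(2) by (intro eq_matI) (auto simp: last_unit_row_def algebra_simps)
    finally show ?thesis .
  qed
  have "?P * ?a * ?Q = four_block_mat (P * \<alpha>' * Q + 0\<^sub>m n 1 * q) (P * \<alpha>' * 0\<^sub>m (Suc n) 1 + 0\<^sub>m n 1 * (\<gamma> \<cdot>\<^sub>m 1\<^sub>m 1))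
      ((p * \<alpha>' + c' \<cdot>\<^sub>m r) * Q + 0\<^sub>m 1 1 * q) ((p * \<alpha>' + c' \<cdot>\<^sub>m r) * 0\<^sub>m (Suc n) 1 + 0\<^sub>m 1 1 * (\<gamma> \<cdot>\<^sub>m 1\<^sub>m 1))"
    unfolding Pa by (rule mult_four_block_mat[OF PA(1) zero_carrier_mat x zero_carrier_mat c(2) zero_carrier_mat q cc(2)])
  also have "\<dots> = pi_plus (Suc n)"
    unfolding pi_plus_Suc xQ PQ(3) right_mult_zero_mat[OF x] right_mult_zero_mat[OF PA(1)]
    using q by (simp add: mat_dist last_unit_row_def)
  finally have A: "?P * ?a * ?Q = pi_plus (Suc n)" .
  have yq: "y * Q + (c' \<cdot>\<^sub>m 1\<^sub>m 1) * q = 0\<^sub>m 1 (Suc n)"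
  proof -
    have "(c' \<cdot>\<^sub>m 1\<^sub>m 1) * q = (- 1) \<cdot>\<^sub>m (y * Q)" using q c'0(2) y c unfolding q_def
      by (simp add: mat_smult_mult mat_dist) (intro eq_matI, auto)
    then show ?thesis using y c by (simp, intro eq_matI) auto
  qed
  have "?P * ?b * ?Q = four_block_mat (P * \<beta>' * Q + 0\<^sub>m n 1 * q) (P * \<beta>' * 0\<^sub>m (Suc n) 1 + 0\<^sub>m n 1 * (\<gamma> \<cdot>\<^sub>m 1\<^sub>m 1))
      (y * Q + (c' \<cdot>\<^sub>m 1\<^sub>m 1) * q) (y * 0\<^sub>m (Suc n) 1 + (c' \<cdot>\<^sub>m 1\<^sub>m 1) * (\<gamma> \<cdot>\<^sub>m 1\<^sub>m 1))"
    unfolding Pb by (rule mult_four_block_mat[OF PA(2) zero_carrier_mat y cc(1) c(2) zero_carrier_mat q cc(2)])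
  also have "(c' \<cdot>\<^sub>m 1\<^sub>m 1) * (\<gamma> \<cdot>\<^sub>m 1\<^sub>m 1) = (1\<^sub>m 1 :: 'k mat)" using c'0(2) by (auto intro!: eq_matI simp: scalar_prod_def)
  also have "four_block_mat (P * \<beta>' * Q + 0\<^sub>m n 1 * q) (P * \<beta>' * 0\<^sub>m (Suc n) 1 + 0\<^sub>m n 1 * (\<gamma> \<cdot>\<^sub>m 1\<^sub>m 1))
      (y * Q + (c' \<cdot>\<^sub>m 1\<^sub>m 1) * q) (y * 0\<^sub>m (Suc n) 1 + 1\<^sub>m 1) = pi_minus (Suc n)"
    unfolding pi_minus_Suc yq PQ(4) right_mult_zero_mat[OF y] right_mult_zero_mat[OF PA(2)]
    using q by (simp add: mat_dist)
  finally have B: "?P * ?b * ?Q = pi_minus (Suc n)" .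
  have "pencil_equiv (Suc n) (Suc (Suc n)) ?a ?b (pi_plus (Suc n)) (pi_minus (Suc n))"
    unfolding pencil_equiv_def using S1 S2 A B by blast
  then show ?case by (rule pencil_equiv_trans[OF Suc.prems(1,2) eq])
qed

section \<open>Classification of the exceptional representations\<close>

lemma ext_free_selfD:
  assumes "ext_free A A" "Cbe \<in> carrier_mat (rdim A Ve) (rdim A Vb)" "Cbm \<in> carrier_mat (rdim A Vmid) (rdim A Vb)"
    "Cme \<in> carrier_mat (rdim A Ve) (rdim A Vmid)"
  shows "\<exists>fb fm fe. fb \<in> carrier_mat (rdim A Vb) (rdim A Vb) \<and> fm \<in> carrier_mat (rdim A Vmid) (rdim A Vmid) \<and>
    fe \<in> carrier_mat (rdim A Ve) (rdim A Ve) \<and> Cbe = fe * rmap A BE - rmap A BE * fb \<and>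
    Cbm = fm * rmap A BM - rmap A BM * fb \<and> Cme = fe * rmap A ME - rmap A ME * fm"
proof -
  have "case_arrow Cbe Cbm Cme \<in> arrow_family A A" using assms by (auto simp: arrow_family_def all_arrow)
  then obtain f where f: "f \<in> mor_family A A" "\<And>a. case_arrow Cbe Cbm Cme a = f (tgt a) * rmap A a - rmap A a * f (src a)"
    using assms(1) unfolding ext_free_def by blast
  show ?thesis
    using mor_familyD[OF f(1)] f(2)[of BE] f(2)[of BM] f(2)[of ME] by (intro exI[of _ "f Vb"] exI[of _ "f Vmid"] exI[of _ "f Ve"]) simp
qed

text \<open>
  By \<open>onto\<close> every matrix \<open>C\<close> is a first-order variation of the product of the two short maps, or of the long
  map, hence of every nonzero member \<open>T\<close> of the pencil. Rigidity turns the variation into a commutator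
  \<open>F T - T G\<close>; so \<open>T\<close> has maximal rank, and as it has more columns than rows it is surjective.
\<close>

lemma rigid_pencil_surjective:
  fixes A :: "'k::field rep"
  assumes A: "is_rep A" and free: "ext_free A A" and d: "rdim A Vb = Suc n" "rdim A Ve = n"
    and onto: "\<And>C. C \<in> carrier_mat n (Suc n) \<Longrightarrow> \<exists>Cbm Cme. Cbm \<in> carrier_mat (rdim A Vmid) (Suc n) \<and> Cme \<in> carrier_mat n (rdim A Vmid) \<and>
       C = rmap A ME * Cbm + Cme * rmap A BM"
  shows "surjective_pencil n (rmap A BE) (rmap A ME * rmap A BM)"
proof -
  let ?x = "rmap A BE" and ?y = "rmap A BM" and ?z = "rmap A ME" let ?k = "rdim A Vmid"
  have x: "?x \<in> carrier_mat n (Suc n)" and y: "?y \<in> carrier_mat ?k (Suc n)" and z: "?z \<in> carrier_mat n ?k"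
    using is_repD[OF A, of BE] is_repD[OF A, of BM] is_repD[OF A, of ME] d by simp_all
  show ?thesis
    unfolding surjective_pencil_def
  proof (intro allI ballI impI)
    fix l m :: 'k and U assume U: "U \<in> carrier_mat 1 n" and lm: "l \<noteq> 0 \<or> m \<noteq> 0"
      and UT: "U * (l \<cdot>\<^sub>m ?x + m \<cdot>\<^sub>m (?z * ?y)) = 0\<^sub>m 1 (dim_col ?x)"
    define T where "T = l \<cdot>\<^sub>m ?x + m \<cdot>\<^sub>m (?z * ?y)"
    have zy: "?z * ?y \<in> carrier_mat n (Suc n)" using y z by simp
    have T: "T \<in> carrier_mat n (Suc n)" using x zy by (simp add: T_def)
    have comm: "\<exists>F G. F \<in> carrier_mat n n \<and> G \<in> carrier_mat (Suc n) (Suc n) \<and> C = F * T - T * G"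
      if C: "C \<in> carrier_mat n (Suc n)" for C
    proof -
      obtain Cbe Cbm Cme where D: "Cbe \<in> carrier_mat n (Suc n)" "Cbm \<in> carrier_mat ?k (Suc n)" "Cme \<in> carrier_mat n ?k"
        "C = l \<cdot>\<^sub>m Cbe + m \<cdot>\<^sub>m (?z * Cbm + Cme * ?y)"
      proof (cases "l = 0")
        case False
        have "C = l \<cdot>\<^sub>m ((1 / l) \<cdot>\<^sub>m C) + m \<cdot>\<^sub>m (?z * 0\<^sub>m ?k (Suc n) + 0\<^sub>m n ?k * ?y)"
          using False C y z by (intro eq_matI) (auto simp: mat_dist)
        then show thesis using that[of "(1 / l) \<cdot>\<^sub>m C" "0\<^sub>m ?k (Suc n)" "0\<^sub>m n ?k"] C by simp
      next
        case True
        then have m: "m \<noteq> 0" using lm by simp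
        have "(1 / m) \<cdot>\<^sub>m C \<in> carrier_mat n (Suc n)" using C by simp
        from onto[OF this] obtain Cbm Cme where E: "Cbm \<in> carrier_mat ?k (Suc n)" "Cme \<in> carrier_mat n ?k"
          "(1 / m) \<cdot>\<^sub>m C = ?z * Cbm + Cme * ?y" by blast
        have "C = l \<cdot>\<^sub>m 0\<^sub>m n (Suc n) + m \<cdot>\<^sub>m ((1 / m) \<cdot>\<^sub>m C)" using m C by (intro eq_matI) auto
        then show thesis using that[of "0\<^sub>m n (Suc n)" Cbm Cme] E by simp
      qed
      obtain fb fm fe where f: "fb \<in> carrier_mat (Suc n) (Suc n)" "fm \<in> carrier_mat ?k ?k" "fe \<in> carrier_mat n n"
        "Cbe = fe * ?x - ?x * fb" "Cbm = fm * ?y - ?y * fb" "Cme = fe * ?z - ?z * fm"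
        using ext_free_selfD[OF free, of Cbe Cbm Cme] D(1-3) unfolding d by blast
      have "?z * Cbm + Cme * ?y = (?z * (fm * ?y) - ?z * (?y * fb)) + (fe * (?z * ?y) - ?z * (fm * ?y))"
        unfolding f(5,6) using f(1-3) y z by (simp add: mat_dist mat_assoc)
      also have "\<dots> = fe * (?z * ?y) - (?z * ?y) * fb"
      proof -
        have "?z * (fm * ?y) \<in> carrier_mat n (Suc n)" "?z * (?y * fb) \<in> carrier_mat n (Suc n)" "fe * (?z * ?y) \<in> carrier_mat n (Suc n)"
          using f(1-3) y z by simp_all
        moreover have "(X - Y) + (W - X) = W - Y" if "X \<in> carrier_mat n (Suc n)" "Y \<in> carrier_mat n (Suc n)" "W \<in> carrier_mat n (Suc n)"
          for X Y W :: "'k mat" using that by (intro eq_matI) auto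
        moreover have "?z * ?y * fb = ?z * (?y * fb)" using f(1) y z by (simp add: mat_assoc)
        ultimately show ?thesis by simp
      qed
      finally have zc: "?z * Cbm + Cme * ?y = fe * (?z * ?y) - (?z * ?y) * fb" .
      have "C = fe * T - T * fb"
      proof -
        have "fe * T - T * fb = (l \<cdot>\<^sub>m (fe * ?x) + m \<cdot>\<^sub>m (fe * (?z * ?y))) - (l \<cdot>\<^sub>m (?x * fb) + m \<cdot>\<^sub>m ((?z * ?y) * fb))"
          unfolding T_def using f(1-3) x zy by (simp add: mat_dist mat_mult_smult mat_smult_mult del: index_mult_mat)
        moreover have "l \<cdot>\<^sub>m (X - Y) + m \<cdot>\<^sub>m (W - Z) = (l \<cdot>\<^sub>m X + m \<cdot>\<^sub>m W) - (l \<cdot>\<^sub>m Y + m \<cdot>\<^sub>m Z)"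
          if "X \<in> carrier_mat n (Suc n)" "Y \<in> carrier_mat n (Suc n)" "W \<in> carrier_mat n (Suc n)" "Z \<in> carrier_mat n (Suc n)"
          for X Y W Z :: "'k mat" using that by (intro eq_matI) (auto simp: algebra_simps)
        moreover have "fe * ?x \<in> carrier_mat n (Suc n)" "?x * fb \<in> carrier_mat n (Suc n)"
          "fe * (?z * ?y) \<in> carrier_mat n (Suc n)" "(?z * ?y) * fb \<in> carrier_mat n (Suc n)" using f(1-3) x zy by simp_all
        ultimately show ?thesis unfolding D(4) zc f(4) by simp
      qed
      then show ?thesis using f(1,3) by blast
    qed
    obtain X where "X \<in> carrier_mat (Suc n) 1" "X \<noteq> 0\<^sub>m (Suc n) 1" "T * X = 0\<^sub>m n 1" using wide_mat_kernel[OF T] by auto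
    then have "\<forall>U\<in>carrier_mat 1 n. U * T = 0\<^sub>m 1 (Suc n) \<longrightarrow> U = 0\<^sub>m 1 n"
      using max_rank_of_commutators[OF T comm] by blast
    then show "U = 0\<^sub>m 1 n" using U UT x by (simp add: T_def)
  qed
qed

text \<open>
  Vary a single map and leave the others fixed.
\<close>

lemma rigid_map_max_rank:
  fixes A :: "'k::field rep"
  assumes A: "is_rep A" and free: "ext_free A A"
  shows "(\<forall>X\<in>carrier_mat (rdim A (src a)) 1. rmap A a * X = 0\<^sub>m (rdim A (tgt a)) 1 \<longrightarrow> X = 0\<^sub>m (rdim A (src a)) 1) \<or>
    (\<forall>U\<in>carrier_mat 1 (rdim A (tgt a)). U * rmap A a = 0\<^sub>m 1 (rdim A (src a)) \<longrightarrow> U = 0\<^sub>m 1 (rdim A (tgt a)))"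
proof (rule max_rank_of_commutators[OF is_repD[OF A]])
  fix C :: "'k mat" assume C: "C \<in> carrier_mat (rdim A (tgt a)) (rdim A (src a))"
  define D where "D b = (if b = a then C else 0\<^sub>m (rdim A (tgt b)) (rdim A (src b)))" for b
  have "D \<in> arrow_family A A" using C by (auto simp: D_def arrow_family_def)
  then obtain f where f: "f \<in> mor_family A A" "\<And>b. D b = f (tgt b) * rmap A b - rmap A b * f (src b)"
    using free unfolding ext_free_def by blast
  then show "\<exists>F G. F \<in> carrier_mat (rdim A (tgt a)) (rdim A (tgt a)) \<and> G \<in> carrier_mat (rdim A (src a)) (rdim A (src a)) \<and>
      C = F * rmap A a - rmap A a * G"
    using mor_familyD[OF f(1)] f(2)[of a] by (auto simp: D_def)
qed

lemma rigid_square_map_inverse: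
  fixes A :: "'k::field rep"
  assumes A: "is_rep A" and free: "ext_free A A" and d: "rdim A (src a) = n" "rdim A (tgt a) = n"
  obtains S where "S \<in> carrier_mat n n" "S * rmap A a = 1\<^sub>m n" "rmap A a * S = 1\<^sub>m n"
proof -
  have T: "rmap A a \<in> carrier_mat n n" using is_repD[OF A, of a] d by simp
  have "\<exists>S. S \<in> carrier_mat n n \<and> S * rmap A a = 1\<^sub>m n \<and> rmap A a * S = 1\<^sub>m n"
    using rigid_map_max_rank[OF A free, of a] unfolding d
  proof
    assume *: "\<forall>X\<in>carrier_mat n 1. rmap A a * X = 0\<^sub>m n 1 \<longrightarrow> X = 0\<^sub>m n 1"
    show ?thesis by (rule mat_inverse_of_kernel[OF T]) (use * in blast)+
  next
    assume *: "\<forall>U\<in>carrier_mat 1 n. U * rmap A a = 0\<^sub>m 1 n \<longrightarrow> U = 0\<^sub>m 1 n"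
    show ?thesis by (rule mat_inverse_of_left_kernel[OF T]) (use * in blast)+
  qed
  then show thesis using that by blast
qed

text \<open>
  The map \<open>z\<close> of the arrow \<open>ME\<close> is invertible, so \<open>A\<close> amounts to the pencil of the long map and the composite
  of the short ones, both from \<open>Vb\<close> to \<open>Ve\<close>.
\<close>

lemma rigid_iso_E1:
  fixes A :: "'k::alg_closed_field rep"
  assumes A: "is_rep A" and free: "ext_free A A" and d: "rdim A Vb = Suc n" "rdim A Vmid = n" "rdim A Ve = n"
  shows "rep_iso A (E1 n)"
proof -
  let ?x = "rmap A BE" and ?y = "rmap A BM" and ?z = "rmap A ME"
  have x: "?x \<in> carrier_mat n (Suc n)" and y: "?y \<in> carrier_mat n (Suc n)" and z: "?z \<in> carrier_mat n n"
    using is_repD[OF A, of BE] is_repD[OF A, of BM] is_repD[OF A, of ME] d by simp_all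
  obtain z' where z': "z' \<in> carrier_mat n n" "z' * ?z = 1\<^sub>m n" "?z * z' = 1\<^sub>m n"
    by (rule rigid_square_map_inverse[OF A free, of ME n]) (simp_all add: d)
  have "surjective_pencil n ?x (?z * ?y)"
  proof (rule rigid_pencil_surjective[OF A free d(1,3)])
    fix C :: "'k mat" assume C: "C \<in> carrier_mat n (Suc n)"
    have "?z * (z' * C) = ?z * z' * C" using z z'(1) C by (simp add: mat_assoc)
    then have "C = ?z * (z' * C) + 0\<^sub>m n n * ?y" using C y by (simp add: z'(3) mat_dist)
    then show "\<exists>Cbm Cme. Cbm \<in> carrier_mat (rdim A Vmid) (Suc n) \<and> Cme \<in> carrier_mat n (rdim A Vmid) \<and> C = ?z * Cbm + Cme * ?y"
      using z' C d by (intro exI[of _ "z' * C"] exI[of _ "0\<^sub>m n n"]) auto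
  qed
  then obtain P P' Q Q' where PQ: "inverse_mats n P P'" "inverse_mats (Suc n) Q Q'" "P * ?x * Q = pi_plus n" "P * (?z * ?y) * Q = pi_minus n"
    using pencil_normal_form[of ?x n "?z * ?y"] x y z unfolding pencil_equiv_def by auto
  have c: "P \<in> carrier_mat n n" "P' \<in> carrier_mat n n" "Q \<in> carrier_mat (Suc n) (Suc n)" "Q' \<in> carrier_mat (Suc n) (Suc n)"
    "P * P' = 1\<^sub>m n" "P' * P = 1\<^sub>m n" "Q * Q' = 1\<^sub>m (Suc n)" "Q' * Q = 1\<^sub>m (Suc n)"
    using PQ(1,2) by (auto simp: inverse_mats_def)
  define f where "f = case_vertex Q' (P * ?z) P"
  define g where "g = case_vertex Q (z' * P') P'"
  have "pi_plus n * Q' = P * ?x * (Q * Q')" using c(1-4) x unfolding PQ(3)[symmetric] by (simp add: mat_assoc)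
  then have 1: "P * ?x = pi_plus n * Q'" using c(1) x by (simp add: c(7) mat_dist)
  have "pi_minus n * Q' = P * (?z * ?y) * (Q * Q')" using c(1-4) y z unfolding PQ(4)[symmetric] by (simp add: mat_assoc)
  then have 2: "P * ?z * ?y = pi_minus n * Q'" using c(1) y z by (simp add: c(7) mat_dist mat_assoc)
  have f: "f \<in> rhom A (E1 n)" unfolding rhom_iff f_def using c(1-4) z d 1 2 by simp
  have zz: "z' * P' * (P * ?z) = 1\<^sub>m n" "P * ?z * (z' * P') = 1\<^sub>m n"
  proof -
    have "z' * P' * (P * ?z) = z' * (P' * P) * ?z" "P * ?z * (z' * P') = P * (?z * z') * P'"
      using c(1,2) z z'(1) by (simp_all add: mat_assoc)
    then show "z' * P' * (P * ?z) = 1\<^sub>m n" "P * ?z * (z' * P') = 1\<^sub>m n"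
      using c z' z by simp_all
  qed
  show ?thesis
  proof (rule rep_isoI[OF A _ f, of g])
    show "g v \<in> carrier_mat (rdim A v) (rdim (E1 n) v)" for v by (cases v) (use c z' d in \<open>auto simp: g_def\<close>)
    show "g v * f v = 1\<^sub>m (rdim A v)" for v by (cases v) (use c zz d in \<open>auto simp: g_def f_def\<close>)
    show "f v * g v = 1\<^sub>m (rdim (E1 n) v)" for v by (cases v) (use c zz d in \<open>auto simp: g_def f_def\<close>)
  qed simp
qed

text \<open>
  As for \<open>rigid_iso_E1\<close>, with the map of \<open>BM\<close> invertible.
\<close>

lemma rigid_iso_E4:
  fixes A :: "'k::alg_closed_field rep"
  assumes A: "is_rep A" and free: "ext_free A A" and d: "rdim A Vb = Suc n" "rdim A Vmid = Suc n" "rdim A Ve = n"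
  shows "rep_iso A (E4 n)"
proof -
  let ?x = "rmap A BE" and ?y = "rmap A BM" and ?z = "rmap A ME"
  have x: "?x \<in> carrier_mat n (Suc n)" and y: "?y \<in> carrier_mat (Suc n) (Suc n)" and z: "?z \<in> carrier_mat n (Suc n)"
    using is_repD[OF A, of BE] is_repD[OF A, of BM] is_repD[OF A, of ME] d by simp_all
  obtain y' where y': "y' \<in> carrier_mat (Suc n) (Suc n)" "y' * ?y = 1\<^sub>m (Suc n)" "?y * y' = 1\<^sub>m (Suc n)"
    by (rule rigid_square_map_inverse[OF A free, of BM "Suc n"]) (simp_all add: d)
  have "surjective_pencil n ?x (?z * ?y)"
  proof (rule rigid_pencil_surjective[OF A free d(1,3)])
    fix C :: "'k mat" assume C: "C \<in> carrier_mat n (Suc n)"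
    have "C * y' * ?y = C * (y' * ?y)" using y y'(1) C by (simp add: mat_assoc)
    then have "C = ?z * 0\<^sub>m (Suc n) (Suc n) + C * y' * ?y" using C z by (simp add: y'(2) mat_dist)
    then show "\<exists>Cbm Cme. Cbm \<in> carrier_mat (rdim A Vmid) (Suc n) \<and> Cme \<in> carrier_mat n (rdim A Vmid) \<and> C = ?z * Cbm + Cme * ?y"
      using y' C d by (intro exI[of _ "0\<^sub>m (Suc n) (Suc n)"] exI[of _ "C * y'"]) auto
  qed
  then obtain P P' Q Q' where PQ: "inverse_mats n P P'" "inverse_mats (Suc n) Q Q'" "P * ?x * Q = pi_plus n" "P * (?z * ?y) * Q = pi_minus n"
    using pencil_normal_form[of ?x n "?z * ?y"] x y z unfolding pencil_equiv_def by auto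
  have c: "P \<in> carrier_mat n n" "P' \<in> carrier_mat n n" "Q \<in> carrier_mat (Suc n) (Suc n)" "Q' \<in> carrier_mat (Suc n) (Suc n)"
    "P * P' = 1\<^sub>m n" "P' * P = 1\<^sub>m n" "Q * Q' = 1\<^sub>m (Suc n)" "Q' * Q = 1\<^sub>m (Suc n)"
    using PQ(1,2) by (auto simp: inverse_mats_def)
  define f where "f = case_vertex Q' (Q' * y') P"
  define g where "g = case_vertex Q (?y * Q) P'"
  have "pi_plus n * Q' = P * ?x * (Q * Q')" using c(1-4) x unfolding PQ(3)[symmetric] by (simp add: mat_assoc)
  then have 1: "P * ?x = pi_plus n * Q'" using c(1) x by (simp add: c(7) mat_dist)
  have "pi_minus n * (Q' * y') = P * ?z * (?y * (Q * Q') * y')" using c(1-4) y z y'(1) unfolding PQ(4)[symmetric] by (simp add: mat_assoc)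
  also have "\<dots> = P * ?z" using c(1) y z by (simp add: c(7) y'(3))
  finally have 2: "P * ?z = pi_minus n * (Q' * y')" by simp
  have "Q' * y' * ?y = Q' * (y' * ?y)" using c(4) y y'(1) by (simp add: mat_assoc)
  then have 3: "Q' * y' * ?y = Q'" using c(4) by (simp add: y'(2))
  have f: "f \<in> rhom A (E4 n)" unfolding rhom_iff f_def using c(1-4) y' d 1 2 3 by simp
  have zz: "?y * Q * (Q' * y') = 1\<^sub>m (Suc n)" "Q' * y' * (?y * Q) = 1\<^sub>m (Suc n)"
  proof -
    have "?y * Q * (Q' * y') = ?y * (Q * Q') * y'" "Q' * y' * (?y * Q) = Q' * (y' * ?y) * Q"
      using c(3,4) y y'(1) by (simp_all add: mat_assoc)
    then show "?y * Q * (Q' * y') = 1\<^sub>m (Suc n)" "Q' * y' * (?y * Q) = 1\<^sub>m (Suc n)"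
      using c y' y by simp_all
  qed
  show ?thesis
  proof (rule rep_isoI[OF A _ f, of g])
    show "g v \<in> carrier_mat (rdim A v) (rdim (E4 n) v)" for v by (cases v) (use c y d in \<open>auto simp: g_def\<close>)
    show "g v * f v = 1\<^sub>m (rdim A v)" for v by (cases v) (use c zz d in \<open>auto simp: g_def f_def\<close>)
    show "f v * g v = 1\<^sub>m (rdim (E4 n) v)" for v by (cases v) (use c zz d in \<open>auto simp: g_def f_def\<close>)
  qed simp
qed

text \<open>
  The long map \<open>x\<close> is a square matrix, hence invertible, and the composite of its inverse with the short
  maps \<open>y\<close> and \<open>z\<close>, taken in cyclic order from each vertex, is an endomorphism of \<open>A\<close>, so it is a scalar
  \<open>c\<close>. As the dimension at \<open>Vmid\<close> differs from \<open>n\<close>, it factors at one of the vertices through a smaller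
  space, which gives \<open>c = 0\<close>. Both short maps have maximal
  rank, so one is injective and the other surjective; then a vanishing composite forces the smaller of
  the two dimensions to be zero.
\<close>

lemma exceptional_regular_dims:
  fixes A :: "'k::field rep"
  assumes A: "is_rep A" and b: "brick A" and free: "ext_free A A" and d: "rdim A Vb = n" "rdim A Ve = n"
    and k: "rdim A Vmid = Suc n \<or> n = Suc (rdim A Vmid)"
  shows "rdim A Vmid = Suc 0 \<and> n = 0 \<or> rdim A Vmid = 0 \<and> n = Suc 0"
proof -
  let ?x = "rmap A BE" and ?y = "rmap A BM" and ?z = "rmap A ME" let ?k = "rdim A Vmid"
  have x: "?x \<in> carrier_mat n n" and y: "?y \<in> carrier_mat ?k n" and z: "?z \<in> carrier_mat n ?k"
    using is_repD[OF A, of BE] is_repD[OF A, of BM] is_repD[OF A, of ME] d by simp_all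
  obtain x' where x': "x' \<in> carrier_mat n n" "x' * ?x = 1\<^sub>m n" "?x * x' = 1\<^sub>m n"
    by (rule rigid_square_map_inverse[OF A free, of BE n]) (simp_all add: d)
  define f where "f = case_vertex (x' * (?z * ?y)) (?y * (x' * ?z)) (?z * (?y * x'))"
  have "?x * (x' * (?z * ?y)) = ?x * x' * (?z * ?y)" using x x'(1) y z by (simp add: mat_assoc)
  then have 1: "?x * (x' * (?z * ?y)) = ?z * ?y" using y z by (simp add: x'(3) mat_dist)
  have "?z * (?y * x') * ?x = ?z * ?y * (x' * ?x)" using x x'(1) y z by (simp add: mat_assoc)
  then have 2: "?z * (?y * x') * ?x = ?z * ?y" using y z by (simp add: x'(2) mat_dist)
  have "f \<in> rhom A A" unfolding rhom_iff f_def using x x'(1) y z d 1 2 by (simp add: mat_assoc)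
  then obtain c where c: "f = mscale c (mid A)" using b by (auto simp: brick_def)
  have fb: "x' * (?z * ?y) = c \<cdot>\<^sub>m 1\<^sub>m n" and fm: "?y * (x' * ?z) = c \<cdot>\<^sub>m 1\<^sub>m ?k"
    using fun_cong[OF c, of Vb] fun_cong[OF c, of Vmid] by (simp_all add: f_def mscale_def mid_def d)
  have xz: "x' * ?z \<in> carrier_mat n ?k" using x' z by simp
  \<comment> \<open>A scalar matrix that factors through a matrix with a kernel vector is zero.\<close>
  have scal: "c = 0" if "T * X = 0\<^sub>m p 1" "X \<in> carrier_mat q 1" "X \<noteq> 0\<^sub>m q 1" "T \<in> carrier_mat p q" "S * T = c \<cdot>\<^sub>m 1\<^sub>m q" "S \<in> carrier_mat q p"
    for S T X :: "'k mat" and p q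
  proof (rule ccontr)
    assume "c \<noteq> 0"
    have "c \<cdot>\<^sub>m X = c \<cdot>\<^sub>m 1\<^sub>m q * X" using that(2) by (simp add: mat_smult_mult mat_dist)
    also have "\<dots> = S * (T * X)" using that by (simp add: mat_assoc flip: that(5))
    also have "\<dots> = 0\<^sub>m q 1" using that(6) by (simp add: that(1) mat_dist)
    finally have e: "c \<cdot>\<^sub>m X = 0\<^sub>m q 1" .
    have "X = 0\<^sub>m q 1"
    proof (rule eq_matI)
      fix i j assume ij: "i < dim_row (0\<^sub>m q 1 :: 'k mat)" "j < dim_col (0\<^sub>m q 1 :: 'k mat)"
      then have "(c \<cdot>\<^sub>m X) $$ (i, j) = 0" by (simp add: e)
      then show "X $$ (i, j) = 0\<^sub>m q 1 $$ (i, j)" using ij that(2) \<open>c \<noteq> 0\<close> by simp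
    qed (use that(2) in auto)
    with that(3) show False by simp
  qed
  from k show ?thesis
  proof
    assume k: "?k = Suc n"
    obtain X where X: "X \<in> carrier_mat ?k 1" "X \<noteq> 0\<^sub>m ?k 1" "?z * X = 0\<^sub>m n 1" using wide_mat_kernel[OF z] k by auto
    have "?y * x' \<in> carrier_mat ?k n" using y x' by simp
    moreover have "?y * x' * ?z = c \<cdot>\<^sub>m 1\<^sub>m ?k" using y x' z fm by (simp add: mat_assoc)
    ultimately have c0: "c = 0" using scal[OF X(3,1,2) z] by blast
    obtain U where U: "U \<in> carrier_mat 1 ?k" "U \<noteq> 0\<^sub>m 1 ?k" "U * ?y = 0\<^sub>m 1 n" using tall_mat_left_kernel[OF y] k by auto
    have yinj: "\<forall>X\<in>carrier_mat n 1. ?y * X = 0\<^sub>m ?k 1 \<longrightarrow> X = 0\<^sub>m n 1"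
      using rigid_map_max_rank[OF A free, of BM] U d by auto
    have zsur: "\<forall>U\<in>carrier_mat 1 n. U * ?z = 0\<^sub>m 1 ?k \<longrightarrow> U = 0\<^sub>m 1 n"
      using rigid_map_max_rank[OF A free, of ME] X d by auto
    have "n = 0"
    proof (rule ccontr)
      assume n: "n \<noteq> 0"
      have "x' * ?z * W = 0\<^sub>m n 1" if W: "W \<in> carrier_mat ?k 1" for W
      proof -
        have "?y * (x' * ?z * W) = ?y * (x' * ?z) * W" using y xz W by simp
        also have "\<dots> = 0\<^sub>m ?k 1" using W unfolding fm c0 by (intro eq_matI) (auto simp: scalar_prod_def)
        finally show ?thesis using yinj xz W by auto
      qed
      have xz0: "x' * ?z = 0\<^sub>m n ?k"
      proof (rule eq_matI)
        fix i j assume ij: "i < dim_row (0\<^sub>m n ?k :: 'k mat)" "j < dim_col (0\<^sub>m n ?k :: 'k mat)"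
        define W where "W = mat ?k 1 (\<lambda>(r, _). if r = j then 1 else (0::'k))"
        have "(x' * ?z * W) $$ (i, 0) = 0" using \<open>\<And>W. W \<in> carrier_mat ?k 1 \<Longrightarrow> x' * ?z * W = 0\<^sub>m n 1\<close>[of W] ij by (simp add: W_def)
        moreover have "(Y * W) $$ (i, 0) = Y $$ (i, j)" if "Y \<in> carrier_mat n ?k" for Y
          using that ij by (simp add: W_def scalar_prod_def if_distrib[of "\<lambda>t. _ * t"] cong: if_cong)
        ultimately show "(x' * ?z) $$ (i, j) = 0\<^sub>m n ?k $$ (i, j)" using xz ij by (metis index_zero_mat)
      qed (use xz in auto)
      have "?z = ?x * (x' * ?z)" using x x' z by (simp flip: assoc_mult_mat)
      then have z0: "?z = 0\<^sub>m n ?k" using x by (simp add: xz0)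
      define U where "U = mat 1 n (\<lambda>_. 1::'k)"
      have "U * ?z = 0\<^sub>m 1 ?k" "U \<in> carrier_mat 1 n" by (auto simp: z0 U_def mat_dist)
      then have "U = 0\<^sub>m 1 n" using zsur by blast
      then have "U $$ (0, 0) = 0" using n by simp
      then show False using n by (simp add: U_def)
    qed
    then show ?thesis using k by simp
  next
    assume k: "n = Suc ?k"
    obtain X where X: "X \<in> carrier_mat n 1" "X \<noteq> 0\<^sub>m n 1" "?y * X = 0\<^sub>m ?k 1" using wide_mat_kernel[OF y] k by auto
    have "x' * ?z * ?y = c \<cdot>\<^sub>m 1\<^sub>m n" using y x' z fb by (simp add: mat_assoc)
    then have c0: "c = 0" using scal[OF X(3,1,2) y] xz by blast
    obtain U where U: "U \<in> carrier_mat 1 n" "U \<noteq> 0\<^sub>m 1 n" "U * ?z = 0\<^sub>m 1 ?k" using tall_mat_left_kernel[OF z] k by auto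
    have zinj: "\<forall>X\<in>carrier_mat ?k 1. ?z * X = 0\<^sub>m n 1 \<longrightarrow> X = 0\<^sub>m ?k 1"
      using rigid_map_max_rank[OF A free, of ME] U d by auto
    have ysur: "\<forall>U\<in>carrier_mat 1 ?k. U * ?y = 0\<^sub>m 1 n \<longrightarrow> U = 0\<^sub>m 1 ?k"
      using rigid_map_max_rank[OF A free, of BM] X d by auto
    have zy0: "?z * ?y = 0\<^sub>m n n"
    proof -
      have "?z * ?y = ?x * (c \<cdot>\<^sub>m 1\<^sub>m n)" using 1 fb by simp
      also have "\<dots> = 0\<^sub>m n n" unfolding c0 using x by (intro eq_matI) (auto simp: scalar_prod_def)
      finally show ?thesis .
    qed
    have "?k = 0"
    proof (rule ccontr)
      assume n: "?k \<noteq> 0"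
      have yW: "?y * W = 0\<^sub>m ?k 1" if W: "W \<in> carrier_mat n 1" for W
      proof -
        have "?z * (?y * W) = ?z * ?y * W" using y z W by simp
        also have "\<dots> = 0\<^sub>m n 1" using W by (simp add: zy0 mat_dist)
        finally show ?thesis using zinj y W by auto
      qed
      have y0: "?y = 0\<^sub>m ?k n"
      proof (rule eq_matI)
        fix i j assume ij: "i < dim_row (0\<^sub>m ?k n :: 'k mat)" "j < dim_col (0\<^sub>m ?k n :: 'k mat)"
        define W where "W = mat n 1 (\<lambda>(r, _). if r = j then 1 else (0::'k))"
        have "(?y * W) $$ (i, 0) = 0" using yW[of W] ij by (simp add: W_def)
        moreover have "(Y * W) $$ (i, 0) = Y $$ (i, j)" if "Y \<in> carrier_mat ?k n" for Y
          using that ij by (simp add: W_def scalar_prod_def if_distrib[of "\<lambda>t. _ * t"] cong: if_cong)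
        ultimately show "?y $$ (i, j) = 0\<^sub>m ?k n $$ (i, j)" using y ij by (metis index_zero_mat)
      qed (use y in auto)
      define U where "U = mat 1 ?k (\<lambda>_. 1::'k)"
      have "U * ?y = 0\<^sub>m 1 n" "U \<in> carrier_mat 1 ?k" by (auto simp: y0 U_def mat_dist)
      then have "U = 0\<^sub>m 1 ?k" using ysur by blast
      then have "U $$ (0, 0) = 0" using n by simp
      then show False using n by (simp add: U_def)
    qed
    then show ?thesis using k by simp
  qed
qed

lemma rep_iso_M:
  assumes A: "is_rep A" and d: "rdim A Vb = 0" "rdim A Vmid = Suc 0" "rdim A Ve = 0"
  shows "rep_iso A M"
proof -
  have "rmap A BE = rmap M BE" "rmap A BM = rmap M BM" "rmap A ME = rmap M ME"
    using d is_repD[OF A, of BE] is_repD[OF A, of BM] is_repD[OF A, of ME]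
    by (simp_all add: eq_mat_no_cols[of _ 0] eq_mat_no_cols[of _ "Suc 0"] eq_mat_no_rows[of _ "Suc 0"])
  then have "mid A \<in> rhom A M" unfolding rhom_iff using d by (simp add: mid_def mat_dist)
  then show ?thesis
  proof (rule rep_isoI[OF A, rotated, where g = "mid A"])
    fix v
    show "mid A v \<in> carrier_mat (rdim A v) (rdim M v)" "mid A v * mid A v = 1\<^sub>m (rdim A v)" "mid A v * mid A v = 1\<^sub>m (rdim M v)"
      by (cases v; simp add: mid_def d)+
  qed simp
qed

lemma rep_iso_M':
  assumes A: "is_rep A" and free: "ext_free A A" and d: "rdim A Vb = Suc 0" "rdim A Vmid = 0" "rdim A Ve = Suc 0"
  shows "rep_iso A M'"
proof -
  obtain x' where x': "x' \<in> carrier_mat 1 1" "x' * rmap A BE = 1\<^sub>m 1" "rmap A BE * x' = 1\<^sub>m 1"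
    by (rule rigid_square_map_inverse[OF A free, of BE 1]) (simp_all add: d)
  have x: "rmap A BE \<in> carrier_mat 1 1" using is_repD[OF A, of BE] d by simp
  define f where "f = case_vertex (rmap A BE) (1\<^sub>m 0) (1\<^sub>m 1)"
  define g where "g = case_vertex x' (1\<^sub>m 0) (1\<^sub>m 1)"
  have "rmap A BM = rmap M' BM" "rmap A ME = rmap M' ME"
    using d is_repD[OF A, of BM] is_repD[OF A, of ME]
    by (simp_all add: eq_mat_no_cols[of _ "Suc 0"] eq_mat_no_rows[of _ "Suc 0"])
  then have "f \<in> rhom A M'" unfolding rhom_iff f_def using d x by (simp add: mat_dist)
  then show ?thesis
  proof (rule rep_isoI[OF A, rotated, where g = g])
    show "g v \<in> carrier_mat (rdim A v) (rdim M' v)" for v using x' d by (cases v) (auto simp: g_def)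
    show "g v * f v = 1\<^sub>m (rdim A v)" for v using x' d by (cases v) (auto simp: g_def f_def)
    show "f v * g v = 1\<^sub>m (rdim M' v)" for v using x' d by (cases v) (auto simp: g_def f_def)
  qed simp
qed

lemma rep_iso_dual:
  assumes "rep_iso A B"
  shows "rep_iso (dual A) (dual B)"
proof -
  obtain f g where fg: "is_rep A" "is_rep B" "f \<in> rhom A B" "g \<in> rhom B A" "\<And>v. g v * f v = 1\<^sub>m (rdim A v)" "\<And>v. f v * g v = 1\<^sub>m (rdim B v)"
    using rep_iso_inverse[OF assms] by auto
  show ?thesis
  proof (rule rep_isoI[OF dual_is_rep[OF fg(1)] dual_is_rep[OF fg(2)] dual_mor_rhom[OF fg(2,1,4)], of "dual_mor f"])
    fix v let ?w = "opp_vertex v"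
    note c = rhomD[OF fg(3), of ?w] rhomD[OF fg(4), of ?w]
    show "dual_mor f v \<in> carrier_mat (rdim (dual A) v) (rdim (dual B) v)" using c by (simp add: dual_mor_def)
    have "transpose_mat (f ?w) * transpose_mat (g ?w) = transpose_mat (g ?w * f ?w)" using transpose_mult[OF c(2,1)] by simp
    then show "dual_mor f v * dual_mor g v = 1\<^sub>m (rdim (dual A) v)" by (simp add: dual_mor_def fg(5))
    have "transpose_mat (g ?w) * transpose_mat (f ?w) = transpose_mat (f ?w * g ?w)" using transpose_mult[OF c(1,2)] by simp
    then show "dual_mor g v * dual_mor f v = 1\<^sub>m (rdim (dual B) v)" by (simp add: dual_mor_def fg(6))
  qed
qed

lemma exceptional_dual: "exceptional A \<Longrightarrow> exceptional (dual A)"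
  using ext_free_iff_euler_one[of A] ext_free_iff_euler_one[of "dual A"]
  by (simp add: exceptional_iff euler_dual dual_is_rep brick_dual)

text \<open>
  With \<open>p = b - m\<close> and \<open>q = m - e\<close> the form is \<open>p^2 + p q + q^2\<close>, and
  \<open>(2 p + q)^2 + 3 q^2 = 4\<close> bounds \<open>q\<close>, likewise \<open>p\<close>, by \<open>1\<close>.
\<close>

lemma real_root_dims:
  fixes b m e :: nat
  assumes "int b * int b + int m * int m + int e * int e - int b * int e - int b * int m - int m * int e = 1"
  shows "b = Suc m \<and> m = e \<or> m = Suc b \<and> m = e \<or> b = m \<and> e = Suc b \<or> b = m \<and> b = Suc e \<or> b = e \<and> m = Suc b \<or> b = e \<and> b = Suc m"
proof -
  define p q where "p = int b - int m" and "q = int m - int e"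
  have pq: "p * p + p * q + q * q = 1" using assms by (simp add: p_def q_def algebra_simps)
  have 1: "(2 * p + q)^2 + 3 * (q * q) = 4" "(2 * q + p)^2 + 3 * (p * p) = 4"
    using pq by (simp_all add: power2_eq_square algebra_simps)
  have "q * q \<le> 1" "p * p \<le> 1" using 1 zero_le_power2[of "2 * p + q"] zero_le_power2[of "2 * q + p"] by linarith+
  then have "\<bar>q\<bar> \<le> 1" "\<bar>p\<bar> \<le> 1" using abs_le_square_iff[of q 1] abs_le_square_iff[of p 1] by (simp_all add: power2_eq_square)
  then have "(p = -1 \<or> p = 0 \<or> p = 1) \<and> (q = -1 \<or> q = 0 \<or> q = 1)" by linarith
  then have "p = 1 \<and> q = 0 \<or> p = -1 \<and> q = 0 \<or> p = 0 \<and> q = 1 \<or> p = 0 \<and> q = -1 \<or> p = 1 \<and> q = -1 \<or> p = -1 \<and> q = 1"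
    using pq by (elim conjE disjE) simp_all
  then show ?thesis unfolding p_def q_def by presburger
qed

text \<open>
  The families of \<open>E2\<close> and \<open>E3\<close> are reduced by duality to those of \<open>E4\<close> and \<open>E1\<close>.
\<close>

lemma exceptional_classification:
  fixes A :: "'k::alg_closed_field rep"
  assumes "exceptional A"
  shows "\<exists>X. rep_iso A X \<and> (\<exists>m. X \<in> {E1 m, E2 m, E3 m, E4 m, M, M'})"
proof -
  have A: "is_rep A" "brick A" "ext_free A A" using assms by (auto simp: exceptional_iff)
  have D: "is_rep (dual A)" "ext_free (dual A) (dual A)" using exceptional_dual[OF assms] by (auto simp: exceptional_iff)
  let ?b = "rdim A Vb" and ?m = "rdim A Vmid" and ?e = "rdim A Ve"
  have "euler A A = 1" using ext_free_iff_euler_one[OF A(1,2)] A(3) by simp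
  then have "?b = Suc ?m \<and> ?m = ?e \<or> ?m = Suc ?b \<and> ?m = ?e \<or> ?b = ?m \<and> ?e = Suc ?b \<or> ?b = ?m \<and> ?b = Suc ?e \<or>
      ?b = ?e \<and> ?m = Suc ?b \<or> ?b = ?e \<and> ?b = Suc ?m"
    by (intro real_root_dims) (simp add: euler_def)
  then consider (1) "?b = Suc ?m" "?m = ?e" | (2) "?m = Suc ?b" "?m = ?e" | (3) "?b = ?m" "?e = Suc ?b" | (4) "?b = ?m" "?b = Suc ?e"
    | (5) "?b = ?e" "?m = Suc ?b" | (6) "?b = ?e" "?b = Suc ?m" by blast
  then show ?thesis
  proof cases
    case 1
    then have "rep_iso A (E1 ?e)" by (intro rigid_iso_E1[OF A(1,3)]) simp_all
    then show ?thesis by blast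
  next
    case 2
    then have "rep_iso (dual A) (E4 ?b)" by (intro rigid_iso_E4[OF D]) simp_all
    from rep_iso_dual[OF this] have "rep_iso A (E2 ?b)" by simp
    then show ?thesis by blast
  next
    case 3
    then have "rep_iso (dual A) (E1 ?b)" by (intro rigid_iso_E1[OF D]) simp_all
    from rep_iso_dual[OF this] have "rep_iso A (E3 ?b)" by simp
    then show ?thesis by blast
  next
    case 4
    then have "rep_iso A (E4 ?e)" by (intro rigid_iso_E4[OF A(1,3)]) simp_all
    then show ?thesis by blast
  next
    case 5
    then have "?m = Suc 0 \<and> ?b = 0" using exceptional_regular_dims[OF A refl] by auto
    then have "rep_iso A M" using 5 by (intro rep_iso_M[OF A(1)]) simp_all
    then show ?thesis by blast
  next
    case 6
    then have "?m = 0 \<and> ?b = Suc 0" using exceptional_regular_dims[OF A refl] by auto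
    then have "rep_iso A M'" using 6 by (intro rep_iso_M'[OF A(1,3)]) simp_all
    then show ?thesis by blast
  qed
qed

section \<open>Bounded complexes and quasi-isomorphisms\<close>

lemma bcomplexD:
  assumes "bcomplex X"
  shows "is_rep (ob X n)" "df X n \<in> rhom (ob X n) (ob X (n + 1))"
    "df X n v \<in> carrier_mat (rdim (ob X (n + 1)) v) (rdim (ob X n) v)"
    "df X (n + 1) v * df X n v = 0\<^sub>m (rdim (ob X (n + 2)) v) (rdim (ob X n) v)"
proof -
  show "is_rep (ob X n)" "df X n \<in> rhom (ob X n) (ob X (n + 1))" using assms by (auto simp: bcomplex_def)
  then show "df X n v \<in> carrier_mat (rdim (ob X (n + 1)) v) (rdim (ob X n) v)" by (intro rhomD)
  have "df X (n + 1) \<star> df X n = mzero (ob X n) (ob X (n + 2))" using assms by (auto simp: bcomplex_def)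
  from fun_cong[OF this, of v] show "df X (n + 1) v * df X n v = 0\<^sub>m (rdim (ob X (n + 2)) v) (rdim (ob X n) v)"
    by (simp add: mcomp_def mzero_def)
qed

lemma bcomplex_bounded: "bcomplex X \<Longrightarrow> \<exists>N. \<forall>n v. \<bar>n\<bar> > N \<longrightarrow> rdim (ob X n) v = 0"
  unfolding bcomplex_def by blast

lemma vec_eq_add_of_minus_eq:
  fixes x :: "'k::field vec"
  assumes "x - y = z" "x \<in> carrier_vec n" "y \<in> carrier_vec n"
  shows "x = z + y"
  unfolding assms(1)[symmetric] using assms(2,3) by (intro eq_vecI) auto

lemma vec_eq_uminus_of_add_zero:
  fixes a :: "'k::field vec"
  assumes "a + b = 0\<^sub>v n" "a \<in> carrier_vec n" "b \<in> carrier_vec n"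
  shows "a = - b"
proof (rule eq_vecI)
  fix i assume "i < dim_vec (- b)"
  then have i: "i < n" using assms(3) by simp
  have "(a + b) $ i = 0" unfolding assms(1) using i by simp
  moreover have "(a + b) $ i = a $ i + b $ i" using i assms(2,3) by simp
  ultimately show "a $ i = (- b) $ i" using i assms(3) by (simp add: eq_neg_iff_add_eq_0)
qed (use assms in auto)

lemma chain_mapsD:
  assumes "f \<in> chain_maps X Y"
  shows "f n \<in> rhom (ob X n) (ob Y n)" "f n v \<in> carrier_mat (rdim (ob Y n) v) (rdim (ob X n) v)"
    "f (n + 1) v * df X n v = df Y n v * f n v"
proof -
  show "f n \<in> rhom (ob X n) (ob Y n)" using assms by (auto simp: chain_maps_def)
  then show "f n v \<in> carrier_mat (rdim (ob Y n) v) (rdim (ob X n) v)" by (rule rhomD)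
  have "f (n + 1) \<star> df X n = df Y n \<star> f n" using assms by (auto simp: chain_maps_def)
  from fun_cong[OF this, of v] show "f (n + 1) v * df X n v = df Y n v * f n v" by (simp add: mcomp_def)
qed

lemma chain_mapsI:
  assumes "\<And>n. f n \<in> rhom (ob X n) (ob Y n)" "\<And>n v. f (n + 1) v * df X n v = df Y n v * f n v"
  shows "f \<in> chain_maps X Y"
  using assms by (auto simp: chain_maps_def mcomp_def)

lemma ccomp_chain_maps:
  assumes X: "bcomplex X" and Y: "bcomplex Y" and Z: "bcomplex Z" and f: "f \<in> chain_maps X Y" and g: "g \<in> chain_maps Y Z"
  shows "g \<star>\<^sub>c f \<in> chain_maps X Z"
proof (rule chain_mapsI)
  show "(g \<star>\<^sub>c f) n \<in> rhom (ob X n) (ob Z n)" for n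
    unfolding ccomp_def by (rule rhom_comp[OF bcomplexD(1)[OF X] bcomplexD(1)[OF Y] bcomplexD(1)[OF Z] chain_mapsD(1)[OF f] chain_mapsD(1)[OF g]])
  fix n v
  note c = chain_mapsD(2)[OF f, of n v] chain_mapsD(2)[OF f, of "n + 1" v] chain_mapsD(2)[OF g, of n v] chain_mapsD(2)[OF g, of "n + 1" v]
    bcomplexD(3)[OF X, of n v] bcomplexD(3)[OF Y, of n v] bcomplexD(3)[OF Z, of n v]
  have "g (n + 1) v * f (n + 1) v * df X n v = g (n + 1) v * df Y n v * f n v"
    using c by (simp add: mat_assoc chain_mapsD(3)[OF f])
  also have "\<dots> = df Z n v * (g n v * f n v)" using c by (simp add: mat_assoc chain_mapsD(3)[OF g])
  finally show "(g \<star>\<^sub>c f) (n + 1) v * df X n v = df Z n v * (g \<star>\<^sub>c f) n v" by (simp add: ccomp_def mcomp_def)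
qed

lemma cid_chain_maps: "bcomplex X \<Longrightarrow> cid X \<in> chain_maps X X"
proof (rule chain_mapsI)
  fix n v assume X: "bcomplex X"
  show "cid X n \<in> rhom (ob X n) (ob X n)" by (simp add: cid_def mid_rhom[OF bcomplexD(1)[OF X]])
  show "cid X (n + 1) v * df X n v = df X n v * cid X n v" using bcomplexD(3)[OF X, of n v] by (simp add: cid_def mid_def)
qed

lemma ccomp_cid:
  assumes "f \<in> chain_maps X Y"
  shows "f \<star>\<^sub>c cid X = f" "cid Y \<star>\<^sub>c f = f"
proof -
  have "(f \<star>\<^sub>c cid X) n v = f n v" "(cid Y \<star>\<^sub>c f) n v = f n v" for n v
    using chain_mapsD(2)[OF assms, of n v] by (simp_all add: ccomp_def mcomp_def cid_def mid_def)
  then show "f \<star>\<^sub>c cid X = f" "cid Y \<star>\<^sub>c f = f" by (simp_all add: fun_eq_iff)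
qed

lemma homotopic_refl:
  assumes X: "bcomplex X" and Y: "bcomplex Y" and f: "f \<in> chain_maps X Y"
  shows "homotopic X Y f f"
  unfolding homotopic_def
proof (intro exI[of _ "\<lambda>n. mzero (ob X n) (ob Y (n - 1))"] conjI allI)
  show "mzero (ob X n) (ob Y (n - 1)) \<in> rhom (ob X n) (ob Y (n - 1))" for n
    by (rule mzero_rhom[OF bcomplexD(1)[OF X] bcomplexD(1)[OF Y]])
  fix n v
  show "f n v = f n v + ((df Y (n - 1) \<star> mzero (ob X n) (ob Y (n - 1))) v + (mzero (ob X (n + 1)) (ob Y (n + 1 - 1)) \<star> df X n) v)"
    using chain_mapsD(2)[OF f, of n v] bcomplexD(3)[OF X, of n v] bcomplexD(3)[OF Y, of "n - 1" v]
    by (simp add: mcomp_def mzero_def mat_dist)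
qed

lemma zero_coboundary:
  assumes "bcomplex X"
  shows "0\<^sub>v (rdim (ob X n) v) \<in> coboundaries X n v"
proof -
  have "df X (n - 1) v *\<^sub>v 0\<^sub>v (rdim (ob X (n - 1)) v) = 0\<^sub>v (rdim (ob X n) v)"
    using bcomplexD(3)[OF assms, of "n - 1" v] by (intro eq_vecI) auto
  then show ?thesis unfolding coboundaries_def by (intro image_eqI[of _ _ "0\<^sub>v (rdim (ob X (n - 1)) v)"]) auto
qed

lemma cid_quasi_iso:
  assumes X: "bcomplex X"
  shows "cid X \<in> quasi_isos X X"
proof -
  have id: "cid X n v *\<^sub>v x = x" if "x \<in> carrier_vec (rdim (ob X n) v)" for n v x
    using that by (simp add: cid_def mid_def)
  have "\<exists>x\<in>cocycles X n v. y - cid X n v *\<^sub>v x \<in> coboundaries X n v" if y: "y \<in> cocycles X n v" for n v y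
  proof (intro bexI[of _ y] y)
    have "y \<in> carrier_vec (rdim (ob X n) v)" using y by (simp add: cocycles_def)
    then show "y - cid X n v *\<^sub>v y \<in> coboundaries X n v" using zero_coboundary[OF X, of n v] id[of y n v] by simp
  qed
  moreover have "x \<in> coboundaries X n v" if "x \<in> cocycles X n v" "cid X n v *\<^sub>v x \<in> coboundaries X n v" for n v x
    using that id[of x n v] by (simp add: cocycles_def)
  ultimately show ?thesis unfolding quasi_isos_def using cid_chain_maps[OF X] by blast
qed

text \<open>
  The roofs \<open>X = X \<rightarrow> Y\<close> and \<open>Y \<leftarrow> X = X\<close> are inverse to each other.
\<close>

lemma quasi_iso_derived_iso:
  assumes X: "bcomplex X" and Y: "bcomplex Y" and f: "f \<in> quasi_isos X Y"
  shows "derived_iso X Y" "derived_iso Y X"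
proof -
  have fc: "f \<in> chain_maps X Y" using f by (simp add: quasi_isos_def)
  note idX = cid_quasi_iso[OF X] cid_chain_maps[OF X]
  note idY = cid_quasi_iso[OF Y] cid_chain_maps[OF Y]
  note comp = ccomp_cid[OF fc] ccomp_cid[OF idX(2)]
  let ?p = "(X, cid X, f)" and ?q = "(X, f, cid X)"
  have p: "?p \<in> roofs X Y" and q: "?q \<in> roofs Y X" using X f fc idX by (simp_all add: roofs_def)
  have 1: "roof_comp Y ?p ?q (X, cid X, cid X)"
    unfolding roof_comp.simps
    by (rule exI[of _ X], rule bexI[of _ "cid X"], rule bexI[of _ "cid X"])
      (use X Y f fc idX homotopic_refl[OF X Y fc] in \<open>simp_all add: comp\<close>)
  have 2: "roof_eq X X (X, cid X, cid X) (roof_id X)"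
    unfolding roof_id_def roof_eq.simps
    by (rule exI[of _ X], rule bexI[of _ "cid X"], rule bexI[of _ "cid X"])
      (use X idX homotopic_refl[OF X X idX(2)] in \<open>simp_all add: comp\<close>)
  have 3: "roof_comp X ?q ?p (X, f, f)"
    unfolding roof_comp.simps
    by (rule exI[of _ X], rule bexI[of _ "cid X"], rule bexI[of _ "cid X"])
      (use X idX homotopic_refl[OF X X idX(2)] in \<open>simp_all add: comp\<close>)
  have 4: "roof_eq Y Y (X, f, f) (roof_id Y)"
    unfolding roof_id_def roof_eq.simps
    by (rule exI[of _ X], rule bexI[of _ "cid X"], rule bexI[of _ f])
      (use X f fc idX homotopic_refl[OF X Y fc] in \<open>simp_all add: comp\<close>)
  show "derived_iso X Y" unfolding derived_iso_def using X Y p q 1 2 3 4 by blast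
  show "derived_iso Y X" unfolding derived_iso_def using X Y p q 1 2 3 4 by blast
qed

lemma derived_iso_refl: "bcomplex X \<Longrightarrow> derived_iso X X"
  using quasi_iso_derived_iso(1) cid_quasi_iso by blast

section \<open>Cones and shifts\<close>

lemma rsum_simps[simp]: "rdim (rsum V W) v = rdim V v + rdim W v"
  "rmap (rsum V W) a = four_block_mat (rmap V a) (0\<^sub>m (rdim V (tgt a)) (rdim W (src a)))
        (0\<^sub>m (rdim W (tgt a)) (rdim V (src a))) (rmap W a)"
  by (simp_all add: rsum_def)

lemma rsum_is_rep: "is_rep V \<Longrightarrow> is_rep W \<Longrightarrow> is_rep (rsum V W)"
  unfolding is_rep_def by (auto intro!: four_block_carrier_mat)

lemma cone_simps[simp]: "ob (mapping_cone X Y f) n = rsum (ob X (n + 1)) (ob Y n)"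
  "df (mapping_cone X Y f) n v = four_block_mat ((- 1) \<cdot>\<^sub>m df X (n + 1) v) (0\<^sub>m (rdim (ob X (n + 2)) v) (rdim (ob Y n) v)) (f (n + 1) v) (df Y n v)"
  by (simp_all add: mapping_cone_def mscale_def)

lemma cone_bcomplex:
  assumes X: "bcomplex X" and Y: "bcomplex Y" and f: "f \<in> chain_maps X Y"
  shows "bcomplex (mapping_cone X Y f)"
proof -
  let ?C = "mapping_cone X Y f"
  have i2: "n + 1 + 1 = n + 2" for n :: int by simp
  have c: "(- 1) \<cdot>\<^sub>m df X (n + 1) v \<in> carrier_mat (rdim (ob X (n + 2)) v) (rdim (ob X (n + 1)) v)"
    "f (n + 1) v \<in> carrier_mat (rdim (ob Y (n + 1)) v) (rdim (ob X (n + 1)) v)"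
    "df Y n v \<in> carrier_mat (rdim (ob Y (n + 1)) v) (rdim (ob Y n) v)" for n v
    using bcomplexD(3)[OF X, of "n + 1" v] bcomplexD(3)[OF Y, of n v] chain_mapsD(2)[OF f, of "n + 1" v] by (simp_all add: i2)
  have rep: "is_rep (ob ?C n)" for n using rsum_is_rep[OF bcomplexD(1)[OF X] bcomplexD(1)[OF Y]] by simp
  have dc: "df ?C n v \<in> carrier_mat (rdim (ob ?C (n + 1)) v) (rdim (ob ?C n) v)" for n v
    using four_block_carrier_mat[OF c(1)[of n v] c(3)[of n v]] by (simp add: i2)
  have hom: "df ?C n \<in> rhom (ob ?C n) (ob ?C (n + 1))" for n
  proof (rule rhomI[OF dc])
    fix a
    note r = is_repD[OF bcomplexD(1)[OF X, of "n + 1"], of a] is_repD[OF bcomplexD(1)[OF Y, of n], of a]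
      is_repD[OF bcomplexD(1)[OF X, of "n + 2"], of a] is_repD[OF bcomplexD(1)[OF Y, of "n + 1"], of a]
    note ct = c[of n "tgt a"] and cs = c[of n "src a"]
    have d: "df X (n + 1) (tgt a) \<in> carrier_mat (rdim (ob X (n + 2)) (tgt a)) (rdim (ob X (n + 1)) (tgt a))"
      "df X (n + 1) (src a) \<in> carrier_mat (rdim (ob X (n + 2)) (src a)) (rdim (ob X (n + 1)) (src a))"
      using bcomplexD(3)[OF X, of "n + 1"] by (simp_all add: i2)
    have e1: "(- 1) \<cdot>\<^sub>m df X (n + 1) (tgt a) * rmap (ob X (n + 1)) a = rmap (ob X (n + 2)) a * ((- 1) \<cdot>\<^sub>m df X (n + 1) (src a))"
      using rhom_comm[OF bcomplexD(2)[OF X, of "n + 1"], of a] d r by (simp add: mat_smult_mult mat_mult_smult i2)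
    have e2: "f (n + 1) (tgt a) * rmap (ob X (n + 1)) a = rmap (ob Y (n + 1)) a * f (n + 1) (src a)"
      by (rule rhom_comm[OF chain_mapsD(1)[OF f]])
    have e3: "df Y n (tgt a) * rmap (ob Y n) a = rmap (ob Y (n + 1)) a * df Y n (src a)"
      by (rule rhom_comm[OF bcomplexD(2)[OF Y]])
    have L: "df ?C n (tgt a) * rmap (ob ?C n) a = four_block_mat ((- 1) \<cdot>\<^sub>m df X (n + 1) (tgt a) * rmap (ob X (n + 1)) a)
       (0\<^sub>m (rdim (ob X (n + 2)) (tgt a)) (rdim (ob Y n) (src a))) (f (n + 1) (tgt a) * rmap (ob X (n + 1)) a) (df Y n (tgt a) * rmap (ob Y n) a)"
      unfolding cone_simps rsum_simps
      by (subst mult_four_block_mat[OF ct(1) zero_carrier_mat ct(2,3) r(1) zero_carrier_mat zero_carrier_mat r(2)])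
        (use ct d r in \<open>simp add: mat_dist mat_smult_mult\<close>)
    have R: "rmap (ob ?C (n + 1)) a * df ?C n (src a) = four_block_mat (rmap (ob X (n + 2)) a * ((- 1) \<cdot>\<^sub>m df X (n + 1) (src a)))
       (0\<^sub>m (rdim (ob X (n + 2)) (tgt a)) (rdim (ob Y n) (src a))) (rmap (ob Y (n + 1)) a * f (n + 1) (src a)) (rmap (ob Y (n + 1)) a * df Y n (src a))"
      unfolding cone_simps rsum_simps i2
      by (subst mult_four_block_mat[OF r(3) zero_carrier_mat zero_carrier_mat r(4) cs(1) zero_carrier_mat cs(2,3)])
        (use cs d r in \<open>simp add: mat_dist mat_mult_smult\<close>)
    show "df ?C n (tgt a) * rmap (ob ?C n) a = rmap (ob ?C (n + 1)) a * df ?C n (src a)" unfolding L R e1 e2 e3 ..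
  qed
  have sq: "df ?C (n + 1) \<star> df ?C n = mzero (ob ?C n) (ob ?C (n + 2))" for n
  proof
    fix v
    note c1 = c[of n v] and c2 = c[of "n + 1" v]
    have i3: "n + 1 + 2 = n + 3" "n + 2 + 1 = n + 3" for n :: int by simp_all
    have d: "df X (n + 1) v \<in> carrier_mat (rdim (ob X (n + 2)) v) (rdim (ob X (n + 1)) v)"
      "df X (n + 2) v \<in> carrier_mat (rdim (ob X (n + 3)) v) (rdim (ob X (n + 2)) v)"
      using bcomplexD(3)[OF X, of "n + 1" v] bcomplexD(3)[OF X, of "n + 2" v] by (simp_all add: i2 i3)
    have e1: "(- 1) \<cdot>\<^sub>m df X (n + 2) v * ((- 1) \<cdot>\<^sub>m df X (n + 1) v) = 0\<^sub>m (rdim (ob X (n + 3)) v) (rdim (ob X (n + 1)) v)"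
      using bcomplexD(4)[OF X, of "n + 1" v] d by (simp add: mat_smult_mult mat_mult_smult i2 i3)
    have e2: "f (n + 2) v * ((- 1) \<cdot>\<^sub>m df X (n + 1) v) + df Y (n + 1) v * f (n + 1) v = 0\<^sub>m (rdim (ob Y (n + 2)) v) (rdim (ob X (n + 1)) v)"
    proof -
      have "f (n + 2) v * df X (n + 1) v = df Y (n + 1) v * f (n + 1) v" using chain_mapsD(3)[OF f, of "n + 1" v] by (simp add: i2)
      moreover have "df Y (n + 1) v * f (n + 1) v \<in> carrier_mat (rdim (ob Y (n + 2)) v) (rdim (ob X (n + 1)) v)" using c1 c2 by (simp add: i2)
      moreover have "(- 1) \<cdot>\<^sub>m W + W = 0\<^sub>m p q" if "W \<in> carrier_mat p q" for W :: "'a mat" and p q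
        using that by (intro eq_matI) auto
      ultimately show ?thesis using d c2(2) by (simp add: mat_mult_smult i2)
    qed
    have e3: "df Y (n + 1) v * df Y n v = 0\<^sub>m (rdim (ob Y (n + 2)) v) (rdim (ob Y n) v)" by (rule bcomplexD(4)[OF Y])
    have "df ?C (n + 1) v * df ?C n v = four_block_mat
       ((- 1) \<cdot>\<^sub>m df X (n + 2) v * ((- 1) \<cdot>\<^sub>m df X (n + 1) v) + 0\<^sub>m (rdim (ob X (n + 3)) v) (rdim (ob Y (n + 1)) v) * f (n + 1) v)
       ((- 1) \<cdot>\<^sub>m df X (n + 2) v * 0\<^sub>m (rdim (ob X (n + 2)) v) (rdim (ob Y n) v) + 0\<^sub>m (rdim (ob X (n + 3)) v) (rdim (ob Y (n + 1)) v) * df Y n v)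
       (f (n + 2) v * ((- 1) \<cdot>\<^sub>m df X (n + 1) v) + df Y (n + 1) v * f (n + 1) v)
       (f (n + 2) v * 0\<^sub>m (rdim (ob X (n + 2)) v) (rdim (ob Y n) v) + df Y (n + 1) v * df Y n v)"
      unfolding cone_simps i2 i3
      by (rule mult_four_block_mat[OF c2(1)[unfolded i2 i3] zero_carrier_mat c2(2,3)[unfolded i2] c1(1) zero_carrier_mat c1(2,3)])
    also have "\<dots> = four_block_mat (0\<^sub>m (rdim (ob X (n + 3)) v) (rdim (ob X (n + 1)) v)) (0\<^sub>m (rdim (ob X (n + 3)) v) (rdim (ob Y n) v))
       (0\<^sub>m (rdim (ob Y (n + 2)) v) (rdim (ob X (n + 1)) v)) (0\<^sub>m (rdim (ob Y (n + 2)) v) (rdim (ob Y n) v))"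
      unfolding e1 e2 e3 using c1 c2(2)[unfolded i2] d by (simp add: mat_dist)
    also have "\<dots> = mzero (ob ?C n) (ob ?C (n + 2)) v" by (rule eq_matI) (auto simp: mzero_def add.assoc)
    finally show "(df ?C (n + 1) \<star> df ?C n) v = mzero (ob ?C n) (ob ?C (n + 2)) v" by (simp add: mcomp_def)
  qed
  obtain N1 where N1: "\<And>n v. \<bar>n\<bar> > N1 \<Longrightarrow> rdim (ob X n) v = 0" using bcomplex_bounded[OF X] by blast
  obtain N2 where N2: "\<And>n v. \<bar>n\<bar> > N2 \<Longrightarrow> rdim (ob Y n) v = 0" using bcomplex_bounded[OF Y] by blast
  have "rdim (ob ?C n) v = 0" if "\<bar>n\<bar> > max (N1 + 1) N2" for n v
  proof -
    have "\<bar>n + 1\<bar> > N1" using that by linarith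
    then show ?thesis using N1[of "n + 1" v] N2[of n v] that by simp
  qed
  then show ?thesis unfolding bcomplex_def using rep hom sq by blast
qed

lemma cone_df_vec:
  assumes X: "bcomplex X" and Y: "bcomplex Y" and f: "f \<in> chain_maps X Y"
    and x: "x \<in> carrier_vec (rdim (ob X (n + 1)) v)" and y: "y \<in> carrier_vec (rdim (ob Y n) v)"
  shows "df (mapping_cone X Y f) n v *\<^sub>v (x @\<^sub>v y) = (- (df X (n + 1) v *\<^sub>v x)) @\<^sub>v (f (n + 1) v *\<^sub>v x + df Y n v *\<^sub>v y)"
proof -
  have i2: "n + 1 + 1 = n + 2" by simp
  have c: "df X (n + 1) v \<in> carrier_mat (rdim (ob X (n + 2)) v) (rdim (ob X (n + 1)) v)"
    "f (n + 1) v \<in> carrier_mat (rdim (ob Y (n + 1)) v) (rdim (ob X (n + 1)) v)"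
    "df Y n v \<in> carrier_mat (rdim (ob Y (n + 1)) v) (rdim (ob Y n) v)"
    using bcomplexD(3)[OF X, of "n + 1" v] bcomplexD(3)[OF Y, of n v] chain_mapsD(2)[OF f, of "n + 1" v] by (simp_all add: i2)
  have "((- 1) \<cdot>\<^sub>m df X (n + 1) v) *\<^sub>v x = - (df X (n + 1) v *\<^sub>v x)" using c x by (intro eq_vecI) (auto simp: scalar_prod_def sum_negf)
  then show ?thesis unfolding cone_simps
    using c x y by (subst four_block_mat_mult_vec[OF smult_carrier_mat[OF c(1)] zero_carrier_mat c(2,3) x y]) (simp add: zero_mat_mult_vec)
qed

lemma shift_simps[simp]: "ob (shift p X) n = ob X (n + p)"
  "df (shift p X) n = (if even p then df X (n + p) else mscale (- 1) (df X (n + p)))"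
  by (simp_all add: shift_def)

lemma shift_bcomplex:
  assumes X: "bcomplex X"
  shows "bcomplex (shift p X)"
proof -
  have hom: "mscale (- 1) (df X n) \<in> rhom (ob X n) (ob X (n + 1))" for n
  proof (rule rhomI)
    show "mscale (- 1) (df X n) v \<in> carrier_mat (rdim (ob X (n + 1)) v) (rdim (ob X n) v)" for v
      using bcomplexD(3)[OF X, of n v] by (simp add: mscale_def)
    fix a show "mscale (- 1) (df X n) (tgt a) * rmap (ob X n) a = rmap (ob X (n + 1)) a * mscale (- 1) (df X n) (src a)"
      using bcomplexD(3)[OF X, of n "tgt a"] bcomplexD(3)[OF X, of n "src a"] is_repD[OF bcomplexD(1)[OF X, of n], of a]
        is_repD[OF bcomplexD(1)[OF X, of "n + 1"], of a] rhom_comm[OF bcomplexD(2)[OF X, of n], of a]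
      by (simp add: mscale_def mat_smult_mult mat_mult_smult)
  qed
  have e: "n + 1 + p = n + p + 1" "n + 2 + p = n + p + 2" for n :: int by simp_all
  have sq: "df (shift p X) (n + 1) \<star> df (shift p X) n = mzero (ob (shift p X) n) (ob (shift p X) (n + 2))" for n
  proof
    fix v
    have i2: "n + p + 1 + 1 = n + p + 2" by simp
    show "(df (shift p X) (n + 1) \<star> df (shift p X) n) v = mzero (ob (shift p X) n) (ob (shift p X) (n + 2)) v"
      using bcomplexD(4)[OF X, of "n + p" v] bcomplexD(3)[OF X, of "n + p" v] bcomplexD(3)[OF X, of "n + p + 1" v]
      by (simp add: mcomp_def mscale_def mzero_def mat_smult_mult mat_mult_smult e i2)
  qed
  obtain N where N: "\<And>n v. \<bar>n\<bar> > N \<Longrightarrow> rdim (ob X n) v = 0" using bcomplex_bounded[OF X] by blast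
  have "rdim (ob (shift p X) n) v = 0" if "\<bar>n\<bar> > N + \<bar>p\<bar>" for n v
    using N[of "n + p" v] that by simp
  moreover have "df (shift p X) n \<in> rhom (ob (shift p X) n) (ob (shift p X) (n + 1))" for n
    using hom[of "n + p"] bcomplexD(2)[OF X, of "n + p"] by (simp add: e)
  ultimately show ?thesis unfolding bcomplex_def using bcomplexD(1)[OF X] sq by (auto simp del: shift_simps(2) intro!: exI[of _ "N + \<bar>p\<bar>"])
qed

lemma shift_back: "shift (- 1) (shift 1 X) = X"
proof -
  have "mscale (- 1) (mscale (- 1) f) = f" for f :: "'a mor" by (intro ext eq_matI) (auto simp: mscale_def)
  then show ?thesis by (cases X) (simp add: shift_def)
qed

section \<open>Short exact sequences of complexes\<close>

text \<open>
  Over a field every short exact sequence of spaces splits. Including the retraction \<open>h\<close> and the section \<open>k\<close>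
  in the notion reduces exactness to identities of matrices, which are inherited by transposes.
\<close>

definition split_exact :: "nat \<Rightarrow> nat \<Rightarrow> nat \<Rightarrow> 'k::field mat \<Rightarrow> 'k mat \<Rightarrow> bool" where
  "split_exact a x b i p \<longleftrightarrow> i \<in> carrier_mat x a \<and> p \<in> carrier_mat b x \<and> (\<exists>h k. h \<in> carrier_mat a x \<and> k \<in> carrier_mat x b \<and>
     h * i = 1\<^sub>m a \<and> p * k = 1\<^sub>m b \<and> p * i = 0\<^sub>m b a \<and> i * h + k * p = 1\<^sub>m x)"

lemma split_exactD:
  assumes "split_exact a x b i p"
  shows "\<And>u. u \<in> carrier_vec a \<Longrightarrow> i *\<^sub>v u = 0\<^sub>v x \<Longrightarrow> u = 0\<^sub>v a"
    and "\<And>w. w \<in> carrier_vec b \<Longrightarrow> \<exists>y\<in>carrier_vec x. w = p *\<^sub>v y"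
    and "\<And>u. u \<in> carrier_vec a \<Longrightarrow> p *\<^sub>v (i *\<^sub>v u) = 0\<^sub>v b"
    and "\<And>y. y \<in> carrier_vec x \<Longrightarrow> p *\<^sub>v y = 0\<^sub>v b \<Longrightarrow> \<exists>u\<in>carrier_vec a. y = i *\<^sub>v u"
    and "p * i = 0\<^sub>m b a"
proof -
  obtain h k where c: "i \<in> carrier_mat x a" "p \<in> carrier_mat b x" "h \<in> carrier_mat a x" "k \<in> carrier_mat x b"
    and e: "h * i = 1\<^sub>m a" "p * k = 1\<^sub>m b" "p * i = 0\<^sub>m b a" "i * h + k * p = 1\<^sub>m x"
    using assms by (auto simp: split_exact_def)
  show "u = 0\<^sub>v a" if u: "u \<in> carrier_vec a" "i *\<^sub>v u = 0\<^sub>v x" for u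
  proof -
    have "u = (h * i) *\<^sub>v u" using u by (simp add: e)
    also have "\<dots> = h *\<^sub>v (i *\<^sub>v u)" using c u by (simp add: assoc_mult_mat_vec[of _ a x])
    also have "\<dots> = 0\<^sub>v a" unfolding u(2) using c by (intro eq_vecI) auto
    finally show ?thesis .
  qed
  show "\<exists>y\<in>carrier_vec x. w = p *\<^sub>v y" if w: "w \<in> carrier_vec b" for w
  proof (intro bexI[of _ "k *\<^sub>v w"])
    have "w = (p * k) *\<^sub>v w" using w by (simp add: e)
    then show "w = p *\<^sub>v (k *\<^sub>v w)" using c w by (simp add: assoc_mult_mat_vec[of p b x k b])
  qed (use c w in auto)
  show "p *\<^sub>v (i *\<^sub>v u) = 0\<^sub>v b" if u: "u \<in> carrier_vec a" for u
  proof -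
    have "p *\<^sub>v (i *\<^sub>v u) = (p * i) *\<^sub>v u" using c u by (simp add: assoc_mult_mat_vec[of p b x i a])
    then show ?thesis using u by (simp add: e zero_mat_mult_vec)
  qed
  show "\<exists>u\<in>carrier_vec a. y = i *\<^sub>v u" if y: "y \<in> carrier_vec x" "p *\<^sub>v y = 0\<^sub>v b" for y
  proof (intro bexI[of _ "h *\<^sub>v y"])
    have "y = (i * h + k * p) *\<^sub>v y" using y by (simp add: e)
    also have "\<dots> = i *\<^sub>v (h *\<^sub>v y) + k *\<^sub>v (p *\<^sub>v y)"
      using c y by (simp add: add_mult_distrib_mat_vec[of _ x x] assoc_mult_mat_vec[of i x a h x] assoc_mult_mat_vec[of k x b p x])
    also have "k *\<^sub>v (p *\<^sub>v y) = 0\<^sub>v x" unfolding y(2) using c by (intro eq_vecI) auto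
    finally show "y = i *\<^sub>v (h *\<^sub>v y)" using c y by simp
  qed (use c y in auto)
  show "p * i = 0\<^sub>m b a" by (rule e)
qed

definition ses :: "'k::field cpx \<Rightarrow> 'k cpx \<Rightarrow> 'k cpx \<Rightarrow> 'k cmor \<Rightarrow> 'k cmor \<Rightarrow> bool" where
  "ses A X B i p \<longleftrightarrow> bcomplex A \<and> bcomplex X \<and> bcomplex B \<and> i \<in> chain_maps A X \<and> p \<in> chain_maps X B \<and>
     (\<forall>n v. split_exact (rdim (ob A n) v) (rdim (ob X n) v) (rdim (ob B n) v) (i n v) (p n v))"

text \<open>
  For a short exact sequence of complexes the projection of the cone of \<open>i\<close> to \<open>B\<close> is a quasi-isomorphism;
  the proof chases a cocycle through the two splittings.
\<close>

lemma ses_cone_quasi_iso: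
  assumes "ses A X B i p"
  shows "(\<lambda>n v. hcat (0\<^sub>m (rdim (ob B n) v) (rdim (ob A (n + 1)) v)) (p n v)) \<in> quasi_isos (mapping_cone A X i) B"
    (is "?q \<in> quasi_isos ?C B")
proof -
  have A: "bcomplex A" and X: "bcomplex X" and B: "bcomplex B" and i: "i \<in> chain_maps A X" and p: "p \<in> chain_maps X B"
    and ex: "\<And>n v. split_exact (rdim (ob A n) v) (rdim (ob X n) v) (rdim (ob B n) v) (i n v) (p n v)"
    using assms by (auto simp: ses_def)
  note ex1 = split_exactD(1)[OF ex] and ex2 = split_exactD(2)[OF ex] and ex3 = split_exactD(3)[OF ex]
    and ex4 = split_exactD(4)[OF ex] and ex5 = split_exactD(5)[OF ex]
  have i2: "n + 1 + 1 = n + 2" for n :: int by simp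
  have chain: "?q \<in> chain_maps ?C B"
  proof (rule chain_mapsI)
    fix n
    show "?q n \<in> rhom (ob ?C n) (ob B n)"
    proof (rule rhomI)
      show "?q n v \<in> carrier_mat (rdim (ob B n) v) (rdim (ob ?C n) v)" for v
        using chain_mapsD(2)[OF p, of n v] by auto
      fix a
      note c = chain_mapsD(2)[OF p, of n "tgt a"] chain_mapsD(2)[OF p, of n "src a"] is_repD[OF bcomplexD(1)[OF A, of "n + 1"], of a]
        is_repD[OF bcomplexD(1)[OF X, of n], of a] is_repD[OF bcomplexD(1)[OF B, of n], of a]
      have "?q n (tgt a) * rmap (ob ?C n) a = hcat
         (?q n (tgt a) * vcat (rmap (ob A (n + 1)) a) (0\<^sub>m (rdim (ob X n) (tgt a)) (rdim (ob A (n + 1)) (src a))))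
         (?q n (tgt a) * vcat (0\<^sub>m (rdim (ob A (n + 1)) (tgt a)) (rdim (ob X n) (src a))) (rmap (ob X n) a))"
        unfolding cone_simps rsum_simps four_block_mat_eq_hcat[OF c(3) zero_carrier_mat zero_carrier_mat c(4)]
        by (rule mult_hcat[of _ "rdim (ob B n) (tgt a)" "rdim (ob A (n + 1)) (tgt a) + rdim (ob X n) (tgt a)"
              _ "rdim (ob A (n + 1)) (src a)" _ "rdim (ob X n) (src a)"]) (use c in auto)
      also have "\<dots> = hcat (0\<^sub>m (rdim (ob B n) (tgt a)) (rdim (ob A (n + 1)) (src a))) (p n (tgt a) * rmap (ob X n) a)"
        using c by (subst (1 2) hcat_mult_vcat[OF zero_carrier_mat c(1)]) (auto simp: mat_dist)
      also have "\<dots> = rmap (ob B n) a * ?q n (src a)"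
        unfolding mult_hcat[OF c(5) zero_carrier_mat c(2)] using c by (simp add: mat_dist rhom_comm[OF chain_mapsD(1)[OF p]])
      finally show "?q n (tgt a) * rmap (ob ?C n) a = rmap (ob B n) a * ?q n (src a)" .
    qed
    fix v
    note c = bcomplexD(3)[OF A, of "n + 1" v, unfolded i2] chain_mapsD(2)[OF i, of "n + 1" v] bcomplexD(3)[OF X, of n v]
      chain_mapsD(2)[OF p, of n v] chain_mapsD(2)[OF p, of "n + 1" v] bcomplexD(3)[OF B, of n v]
    have "?q (n + 1) v * df ?C n v = hcat
         (?q (n + 1) v * vcat ((- 1) \<cdot>\<^sub>m df A (n + 1) v) (i (n + 1) v))
         (?q (n + 1) v * vcat (0\<^sub>m (rdim (ob A (n + 2)) v) (rdim (ob X n) v)) (df X n v))"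
      unfolding cone_simps four_block_mat_eq_hcat[OF smult_carrier_mat[OF c(1)] zero_carrier_mat c(2,3)]
      by (rule mult_hcat[of _ "rdim (ob B (n + 1)) v" "rdim (ob A (n + 2)) v + rdim (ob X (n + 1)) v"
            _ "rdim (ob A (n + 1)) v" _ "rdim (ob X n) v"]) (use c in \<open>auto simp: i2\<close>)
    also have "\<dots> = hcat (p (n + 1) v * i (n + 1) v) (p (n + 1) v * df X n v)"
      unfolding i2 using c by (subst (1 2) hcat_mult_vcat[OF zero_carrier_mat c(5)]) (auto simp: mat_dist)
    also have "\<dots> = df B n v * ?q n v"
      unfolding mult_hcat[OF c(6) zero_carrier_mat c(4)] ex5 chain_mapsD(3)[OF p] using c by (simp add: mat_dist)
    finally show "?q (n + 1) v * df ?C n v = df B n v * ?q n v" .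
  qed
  have qv: "?q n v *\<^sub>v (a @\<^sub>v x) = p n v *\<^sub>v x"
    if "a \<in> carrier_vec (rdim (ob A (n + 1)) v)" "x \<in> carrier_vec (rdim (ob X n) v)" for n v a x
    using that chain_mapsD(2)[OF p, of n v] by (simp add: hcat_mult_append_vec[OF zero_carrier_mat] zero_mat_mult_vec)
  have pd: "p (n + 1) v *\<^sub>v (df X n v *\<^sub>v x) = df B n v *\<^sub>v (p n v *\<^sub>v x)" if "x \<in> carrier_vec (rdim (ob X n) v)" for n v x
    using that chain_mapsD(3)[OF p, of n v] chain_mapsD(2)[OF p, of n v] chain_mapsD(2)[OF p, of "n + 1" v] bcomplexD(3)[OF X, of n v] bcomplexD(3)[OF B, of n v]
    by (metis assoc_mult_mat_vec)
  have idv: "i (n + 1) v *\<^sub>v (df A n v *\<^sub>v x) = df X n v *\<^sub>v (i n v *\<^sub>v x)" if "x \<in> carrier_vec (rdim (ob A n) v)" for n v x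
    using that chain_mapsD(3)[OF i, of n v] chain_mapsD(2)[OF i, of n v] chain_mapsD(2)[OF i, of "n + 1" v] bcomplexD(3)[OF A, of n v] bcomplexD(3)[OF X, of n v]
    by (metis assoc_mult_mat_vec)
  have ddX: "df X (n + 1) v *\<^sub>v (df X n v *\<^sub>v x) = 0\<^sub>v (rdim (ob X (n + 2)) v)" if "x \<in> carrier_vec (rdim (ob X n) v)" for n v x
    using that bcomplexD(4)[OF X, of n v] bcomplexD(3)[OF X, of n v] bcomplexD(3)[OF X, of "n + 1" v]
    by (metis assoc_mult_mat_vec zero_mat_mult_vec)
  have zero: "0\<^sub>v (rdim (ob ?C n) v) = 0\<^sub>v (rdim (ob A (n + 1)) v) @\<^sub>v (0\<^sub>v (rdim (ob X n) v) :: 'a vec)" for n v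
    by (intro eq_vecI) auto
  have inj: "w \<in> coboundaries ?C n v" if w: "w \<in> cocycles ?C n v" "?q n v *\<^sub>v w \<in> coboundaries B n v" for n v w
  proof -
    obtain a x where ax: "a \<in> carrier_vec (rdim (ob A (n + 1)) v)" "x \<in> carrier_vec (rdim (ob X n) v)" "w = a @\<^sub>v x"
      using w(1) split_vec[of w "rdim (ob A (n + 1)) v" "rdim (ob X n) v"] by (auto simp: cocycles_def)
    note cX = bcomplexD(3)[OF X, of n v] and cX' = bcomplexD(3)[OF X, of "n - 1" v, simplified]
      and cA = bcomplexD(3)[OF A, of "n + 1" v] and cA' = bcomplexD(3)[OF A, of n v] and ci = chain_mapsD(2)[OF i, of "n + 1" v] and ci' = chain_mapsD(2)[OF i, of n v]
      and cp = chain_mapsD(2)[OF p, of n v] and cp' = chain_mapsD(2)[OF p, of "n - 1" v]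
    have "df ?C n v *\<^sub>v w = 0\<^sub>v (rdim (ob ?C (n + 1)) v)" using w(1) by (simp add: cocycles_def del: cone_simps)
    then have "(- (df A (n + 1) v *\<^sub>v a)) @\<^sub>v (i (n + 1) v *\<^sub>v a + df X n v *\<^sub>v x) = 0\<^sub>v (rdim (ob A (n + 1 + 1)) v) @\<^sub>v 0\<^sub>v (rdim (ob X (n + 1)) v)"
      unfolding zero ax(3) cone_df_vec[OF A X i ax(1,2)] .
    then have iadx: "i (n + 1) v *\<^sub>v a + df X n v *\<^sub>v x = 0\<^sub>v (rdim (ob X (n + 1)) v)"
      using cA ax(1) by (subst (asm) append_vec_eq[of _ "rdim (ob A (n + 1 + 1)) v"]) auto
    obtain b where b: "b \<in> carrier_vec (rdim (ob B (n - 1)) v)" "p n v *\<^sub>v x = df B (n - 1) v *\<^sub>v b"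
      using w(2) qv[OF ax(1,2)] by (auto simp: coboundaries_def ax(3))
    obtain x' where x': "x' \<in> carrier_vec (rdim (ob X (n - 1)) v)" "b = p (n - 1) v *\<^sub>v x'" using ex2[OF b(1)] by blast
    have dx': "df X (n - 1) v *\<^sub>v x' \<in> carrier_vec (rdim (ob X n) v)" using cX' x'(1) by auto
    have "p n v *\<^sub>v (x - df X (n - 1) v *\<^sub>v x') = p n v *\<^sub>v x - p n v *\<^sub>v (df X (n - 1) v *\<^sub>v x')"
      by (rule mult_minus_distrib_mat_vec[OF cp ax(2) dx'])
    also have "p n v *\<^sub>v (df X (n - 1) v *\<^sub>v x') = p n v *\<^sub>v x" using pd[of x' "n - 1" v] x' b(2) by simp
    also have "p n v *\<^sub>v x - p n v *\<^sub>v x = 0\<^sub>v (rdim (ob B n) v)" using cp ax(2) by auto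
    finally obtain a' where a': "a' \<in> carrier_vec (rdim (ob A n) v)" "x - df X (n - 1) v *\<^sub>v x' = i n v *\<^sub>v a'"
      using ex4[of "x - df X (n - 1) v *\<^sub>v x'" n v] ax(2) dx' by auto
    have ia': "i n v *\<^sub>v a' \<in> carrier_vec (rdim (ob X n) v)" using ci' a'(1) by auto
    have x: "x = i n v *\<^sub>v a' + df X (n - 1) v *\<^sub>v x'"
      by (rule vec_eq_add_of_minus_eq[OF a'(2) ax(2) dx'])
    have "df X n v *\<^sub>v x = df X n v *\<^sub>v (i n v *\<^sub>v a') + df X n v *\<^sub>v (df X (n - 1) v *\<^sub>v x')"
      unfolding x by (rule mult_add_distrib_mat_vec[OF cX ia' dx'])
    also have "df X n v *\<^sub>v (df X (n - 1) v *\<^sub>v x') = 0\<^sub>v (rdim (ob X (n + 1)) v)"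
      using ddX[OF x'(1)] by (simp add: add.commute)
    also have "df X n v *\<^sub>v (i n v *\<^sub>v a') = i (n + 1) v *\<^sub>v (df A n v *\<^sub>v a')" using idv[OF a'(1)] by simp
    finally have dx: "df X n v *\<^sub>v x = i (n + 1) v *\<^sub>v (df A n v *\<^sub>v a')" using ci cA' a'(1) by auto
    have da': "df A n v *\<^sub>v a' \<in> carrier_vec (rdim (ob A (n + 1)) v)" using cA' a'(1) by auto
    have "i (n + 1) v *\<^sub>v (a + df A n v *\<^sub>v a') = 0\<^sub>v (rdim (ob X (n + 1)) v)"
      unfolding mult_add_distrib_mat_vec[OF ci ax(1) da'] using iadx dx by simp
    then have "a + df A n v *\<^sub>v a' = 0\<^sub>v (rdim (ob A (n + 1)) v)" using ex1[of "a + df A n v *\<^sub>v a'" "n + 1" v] ax(1) da' by auto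
    then have a: "a = - (df A n v *\<^sub>v a')" by (rule vec_eq_uminus_of_add_zero[OF _ ax(1) da'])
    have "w = df ?C (n - 1) v *\<^sub>v (a' @\<^sub>v x')"
      using cone_df_vec[OF A X i, of a' "n - 1" v x'] a'(1) x'(1) by (simp add: ax(3) a x del: cone_simps)
    then show ?thesis unfolding coboundaries_def using a'(1) x'(1) by auto
  qed
  have sur: "\<exists>w\<in>cocycles ?C n v. y - ?q n v *\<^sub>v w \<in> coboundaries B n v" if y: "y \<in> cocycles B n v" for n v y
  proof -
    have y': "y \<in> carrier_vec (rdim (ob B n) v)" "df B n v *\<^sub>v y = 0\<^sub>v (rdim (ob B (n + 1)) v)" using y by (auto simp: cocycles_def)
    obtain x where x: "x \<in> carrier_vec (rdim (ob X n) v)" "y = p n v *\<^sub>v x" using ex2[OF y'(1)] by blast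
    note cX = bcomplexD(3)[OF X, of n v] and cA = bcomplexD(3)[OF A, of "n + 1" v, unfolded i2] and ci = chain_mapsD(2)[OF i, of "n + 1" v]
    have dx: "df X n v *\<^sub>v x \<in> carrier_vec (rdim (ob X (n + 1)) v)" using cX x(1) by auto
    have "p (n + 1) v *\<^sub>v (df X n v *\<^sub>v x) = 0\<^sub>v (rdim (ob B (n + 1)) v)" using pd[OF x(1)] x(2) y'(2) by simp
    then obtain a where a: "a \<in> carrier_vec (rdim (ob A (n + 1)) v)" "df X n v *\<^sub>v x = i (n + 1) v *\<^sub>v a" using ex4[OF dx] by blast
    have da: "df A (n + 1) v *\<^sub>v a \<in> carrier_vec (rdim (ob A (n + 2)) v)" using cA a(1) by auto
    have "i (n + 2) v *\<^sub>v (df A (n + 1) v *\<^sub>v a) = 0\<^sub>v (rdim (ob X (n + 2)) v)"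
      using idv[OF a(1)] ddX[OF x(1)] a(2) by (simp add: i2)
    then have da0: "df A (n + 1) v *\<^sub>v a = 0\<^sub>v (rdim (ob A (n + 2)) v)" using ex1[OF da] by blast
    have ma: "- a \<in> carrier_vec (rdim (ob A (n + 1)) v)" using a(1) by simp
    have neg: "Z *\<^sub>v (- u) = - (Z *\<^sub>v u)" if "Z \<in> carrier_mat r s" "u \<in> carrier_vec s" for Z :: "'a mat" and r s u
      using that by (intro eq_vecI) (auto simp: scalar_prod_def sum_negf)
    have "df ?C n v *\<^sub>v ((- a) @\<^sub>v x) = 0\<^sub>v (rdim (ob A (n + 2)) v) @\<^sub>v 0\<^sub>v (rdim (ob X (n + 1)) v)"
    proof -
      have "i (n + 1) v *\<^sub>v (- a) + df X n v *\<^sub>v x = 0\<^sub>v (rdim (ob X (n + 1)) v)"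
        unfolding a(2) neg[OF ci a(1)] using ci a(1) by auto
      moreover have "- (df A (n + 1) v *\<^sub>v (- a)) = 0\<^sub>v (rdim (ob A (n + 2)) v)"
        unfolding neg[OF cA a(1)] da0 by auto
      ultimately show ?thesis unfolding cone_df_vec[OF A X i ma x(1)] by simp
    qed
    then have "(- a) @\<^sub>v x \<in> cocycles ?C n v" using ma x(1) zero[of "n + 1" v] by (simp add: cocycles_def i2 del: cone_simps(2))
    moreover have "y - ?q n v *\<^sub>v ((- a) @\<^sub>v x) \<in> coboundaries B n v"
      using zero_coboundary[OF B, of n v] y'(1) unfolding qv[OF ma x(1)] x(2)[symmetric] by simp
    ultimately show ?thesis by blast
  qed
  show ?thesis unfolding quasi_isos_def using chain inj sur by blast
qed

section \<open>Triangulated subcategories\<close>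

lemma triangulatedD:
  assumes "triangulated_subcategory S"
  shows "X \<in> S \<Longrightarrow> bcomplex X" "stalk rzero \<in> S" "X \<in> S \<Longrightarrow> derived_iso X Y \<Longrightarrow> Y \<in> S" "X \<in> S \<Longrightarrow> shift p X \<in> S"
    "X \<in> S \<Longrightarrow> Y \<in> S \<Longrightarrow> dist_triangle X Y Z \<Longrightarrow> Z \<in> S"
  using assms unfolding triangulated_subcategory_def by blast+

lemma cone_mem:
  assumes S: "triangulated_subcategory S" and "X \<in> S" "Y \<in> S" "f \<in> chain_maps X Y"
  shows "mapping_cone X Y f \<in> S"
proof -
  have X: "bcomplex X" and Y: "bcomplex Y" using triangulatedD(1)[OF S] assms by blast+
  have "dist_triangle X Y (mapping_cone X Y f)"
    unfolding dist_triangle_def using X Y assms(4) derived_iso_refl[OF X] derived_iso_refl[OF Y] derived_iso_refl[OF cone_bcomplex[OF X Y assms(4)]] by blast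
  then show ?thesis using triangulatedD(5)[OF S] assms by blast
qed

lemma ses_cone_derived_iso:
  assumes "ses A X B i p"
  shows "derived_iso (mapping_cone A X i) B" "derived_iso B (mapping_cone A X i)"
proof -
  have c: "bcomplex (mapping_cone A X i)" "bcomplex B" using assms cone_bcomplex unfolding ses_def by blast+
  show "derived_iso (mapping_cone A X i) B" "derived_iso B (mapping_cone A X i)"
    by (rule quasi_iso_derived_iso[OF c ses_cone_quasi_iso[OF assms]])+
qed

lemma ses_quotient_mem:
  assumes S: "triangulated_subcategory S" and e: "ses A X B i p" and "A \<in> S" "X \<in> S"
  shows "B \<in> S"
proof -
  have "i \<in> chain_maps A X" using e by (simp add: ses_def)
  then show ?thesis using triangulatedD(3)[OF S cone_mem[OF S assms(3,4)] ses_cone_derived_iso(1)[OF e]] by blast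
qed

text \<open>
  The rotated triangle in the form of a short exact sequence: the target sits in the cone, and the quotient is
  the shifted source.
\<close>

lemma ses_rotation:
  assumes X: "bcomplex X" and Y: "bcomplex Y" and f: "f \<in> chain_maps X Y"
  shows "ses Y (mapping_cone X Y f) (shift 1 X)
    (\<lambda>n v. vcat (0\<^sub>m (rdim (ob X (n + 1)) v) (rdim (ob Y n) v)) (1\<^sub>m (rdim (ob Y n) v)))
    (\<lambda>n v. hcat (1\<^sub>m (rdim (ob X (n + 1)) v)) (0\<^sub>m (rdim (ob X (n + 1)) v) (rdim (ob Y n) v)))"
    (is "ses Y ?C ?Z ?i ?p")
proof -
  have i2: "n + 1 + 1 = n + 2" for n :: int by simp
  have ic: "?i \<in> chain_maps Y ?C"
  proof (rule chain_mapsI)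
    fix n
    show "?i n \<in> rhom (ob Y n) (ob ?C n)"
    proof (rule rhomI)
      show "?i n v \<in> carrier_mat (rdim (ob ?C n) v) (rdim (ob Y n) v)" for v by auto
      fix a
      note c = is_repD[OF bcomplexD(1)[OF X, of "n + 1"], of a] is_repD[OF bcomplexD(1)[OF Y, of n], of a]
      have "rmap (ob ?C n) a * ?i n (src a) = vcat (rmap (ob X (n + 1)) a) (0\<^sub>m (rdim (ob Y n) (tgt a)) (rdim (ob X (n + 1)) (src a))) * 0\<^sub>m (rdim (ob X (n + 1)) (src a)) (rdim (ob Y n) (src a))
         + vcat (0\<^sub>m (rdim (ob X (n + 1)) (tgt a)) (rdim (ob Y n) (src a))) (rmap (ob Y n) a) * 1\<^sub>m (rdim (ob Y n) (src a))"
        unfolding cone_simps rsum_simps four_block_mat_eq_hcat[OF c(1) zero_carrier_mat zero_carrier_mat c(2)]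
        by (rule hcat_mult_vcat[of _ "rdim (ob X (n + 1)) (tgt a) + rdim (ob Y n) (tgt a)"]) (use c in auto)
      also have "\<dots> = vcat (0\<^sub>m (rdim (ob X (n + 1)) (tgt a)) (rdim (ob Y n) (src a))) (rmap (ob Y n) a)"
        using c by (auto intro!: eq_matI simp: vcat_def mat_dist)
      also have "\<dots> = ?i n (tgt a) * rmap (ob Y n) a"
        using vcat_mult[OF c(2) zero_carrier_mat one_carrier_mat] c by (simp add: mat_dist)
      finally show "?i n (tgt a) * rmap (ob Y n) a = rmap (ob ?C n) a * ?i n (src a)" by simp
    qed
    fix v
    note c = bcomplexD(3)[OF X, of "n + 1" v, unfolded i2] chain_mapsD(2)[OF f, of "n + 1" v] bcomplexD(3)[OF Y, of n v]
    have "df ?C n v * ?i n v = vcat ((- 1) \<cdot>\<^sub>m df X (n + 1) v) (f (n + 1) v) * 0\<^sub>m (rdim (ob X (n + 1)) v) (rdim (ob Y n) v)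
       + vcat (0\<^sub>m (rdim (ob X (n + 2)) v) (rdim (ob Y n) v)) (df Y n v) * 1\<^sub>m (rdim (ob Y n) v)"
      unfolding cone_simps four_block_mat_eq_hcat[OF smult_carrier_mat[OF c(1)] zero_carrier_mat c(2,3)]
      by (rule hcat_mult_vcat[of _ "rdim (ob X (n + 2)) v + rdim (ob Y (n + 1)) v"]) (use c in auto)
    also have "\<dots> = vcat (0\<^sub>m (rdim (ob X (n + 2)) v) (rdim (ob Y n) v)) (df Y n v)"
      using c by (auto intro!: eq_matI simp: vcat_def mat_dist)
    also have "\<dots> = ?i (n + 1) v * df Y n v"
      using vcat_mult[OF c(3) zero_carrier_mat one_carrier_mat] c by (simp add: mat_dist i2)
    finally show "?i (n + 1) v * df Y n v = df ?C n v * ?i n v" by simp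
  qed
  have pc: "?p \<in> chain_maps ?C ?Z"
  proof (rule chain_mapsI)
    fix n
    show "?p n \<in> rhom (ob ?C n) (ob ?Z n)"
    proof (rule rhomI)
      show "?p n v \<in> carrier_mat (rdim (ob ?Z n) v) (rdim (ob ?C n) v)" for v by auto
      fix a
      note c = is_repD[OF bcomplexD(1)[OF X, of "n + 1"], of a] is_repD[OF bcomplexD(1)[OF Y, of n], of a]
      have "?p n (tgt a) * rmap (ob ?C n) a = hcat
         (?p n (tgt a) * vcat (rmap (ob X (n + 1)) a) (0\<^sub>m (rdim (ob Y n) (tgt a)) (rdim (ob X (n + 1)) (src a))))
         (?p n (tgt a) * vcat (0\<^sub>m (rdim (ob X (n + 1)) (tgt a)) (rdim (ob Y n) (src a))) (rmap (ob Y n) a))"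
        unfolding cone_simps rsum_simps four_block_mat_eq_hcat[OF c(1) zero_carrier_mat zero_carrier_mat c(2)]
        by (rule mult_hcat[of _ "rdim (ob X (n + 1)) (tgt a)" "rdim (ob X (n + 1)) (tgt a) + rdim (ob Y n) (tgt a)"
              _ "rdim (ob X (n + 1)) (src a)" _ "rdim (ob Y n) (src a)"]) (use c in auto)
      also have "\<dots> = hcat (rmap (ob X (n + 1)) a) (0\<^sub>m (rdim (ob X (n + 1)) (tgt a)) (rdim (ob Y n) (src a)))"
        using c by (subst (1 2) hcat_mult_vcat[OF one_carrier_mat zero_carrier_mat]) (auto simp: mat_dist)
      also have "\<dots> = rmap (ob ?Z n) a * ?p n (src a)"
        using mult_hcat[OF c(1) one_carrier_mat zero_carrier_mat] c by (simp add: mat_dist)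
      finally show "?p n (tgt a) * rmap (ob ?C n) a = rmap (ob ?Z n) a * ?p n (src a)" .
    qed
    fix v
    note c = bcomplexD(3)[OF X, of "n + 1" v, unfolded i2] chain_mapsD(2)[OF f, of "n + 1" v] bcomplexD(3)[OF Y, of n v]
    have "?p (n + 1) v * df ?C n v = hcat
         (?p (n + 1) v * vcat ((- 1) \<cdot>\<^sub>m df X (n + 1) v) (f (n + 1) v))
         (?p (n + 1) v * vcat (0\<^sub>m (rdim (ob X (n + 2)) v) (rdim (ob Y n) v)) (df Y n v))"
      unfolding cone_simps four_block_mat_eq_hcat[OF smult_carrier_mat[OF c(1)] zero_carrier_mat c(2,3)]
      by (rule mult_hcat[of _ "rdim (ob X (n + 2)) v" "rdim (ob X (n + 2)) v + rdim (ob Y (n + 1)) v"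
            _ "rdim (ob X (n + 1)) v" _ "rdim (ob Y n) v"]) (use c in \<open>auto simp: i2\<close>)
    also have "\<dots> = hcat ((- 1) \<cdot>\<^sub>m df X (n + 1) v) (0\<^sub>m (rdim (ob X (n + 2)) v) (rdim (ob Y n) v))"
      unfolding i2 using c by (subst (1 2) hcat_mult_vcat[OF one_carrier_mat zero_carrier_mat]) (auto simp: mat_dist)
    also have "\<dots> = df ?Z n v * ?p n v"
      using mult_hcat[OF smult_carrier_mat[OF c(1)] one_carrier_mat zero_carrier_mat, of "- 1"] c by (simp add: mat_dist mscale_def)
    finally show "?p (n + 1) v * df ?C n v = df ?Z n v * ?p n v" .
  qed
  have ex: "split_exact b (a + b) a (vcat (0\<^sub>m a b) (1\<^sub>m b)) (hcat (1\<^sub>m a) (0\<^sub>m a b) :: 'a mat)" for a b :: nat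
  proof -
    have c: "vcat (0\<^sub>m a b) (1\<^sub>m b) \<in> carrier_mat (a + b) b" "hcat (1\<^sub>m a) (0\<^sub>m a b) \<in> carrier_mat a (a + b)" by auto
    have 1: "hcat (0\<^sub>m b a) (1\<^sub>m b) * vcat (0\<^sub>m a b) (1\<^sub>m b) = (1\<^sub>m b :: 'a mat)" by (rule hcat_mult_second) auto
    have 2: "hcat (1\<^sub>m a) (0\<^sub>m a b) * vcat (1\<^sub>m a) (0\<^sub>m b a) = (1\<^sub>m a :: 'a mat)" by (rule hcat_mult_first) auto
    have 3: "hcat (1\<^sub>m a) (0\<^sub>m a b) * vcat (0\<^sub>m a b) (1\<^sub>m b) = (0\<^sub>m a b :: 'a mat)" by (rule hcat_mult_second) auto
    have "vcat (0\<^sub>m a b) (1\<^sub>m b) * hcat (0\<^sub>m b a) (1\<^sub>m b) = vcat (0\<^sub>m a (a + b)) (hcat (0\<^sub>m b a) (1\<^sub>m b) :: 'a mat)"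
      by (subst vcat_mult[of _ b "a + b" _ a _ b]) (auto simp: mat_dist)
    moreover have "vcat (1\<^sub>m a) (0\<^sub>m b a) * hcat (1\<^sub>m a) (0\<^sub>m a b) = vcat (hcat (1\<^sub>m a) (0\<^sub>m a b) :: 'a mat) (0\<^sub>m b (a + b))"
      by (subst vcat_mult[of _ a "a + b" _ a _ b]) (auto simp: mat_dist)
    ultimately have 4: "vcat (0\<^sub>m a b) (1\<^sub>m b) * hcat (0\<^sub>m b a) (1\<^sub>m b) + vcat (1\<^sub>m a) (0\<^sub>m b a) * hcat (1\<^sub>m a) (0\<^sub>m a b) = (1\<^sub>m (a + b) :: 'a mat)"
      by (auto intro!: eq_matI simp: hcat_def vcat_def)
    show ?thesis unfolding split_exact_def
      by (intro conjI c, rule exI[of _ "hcat (0\<^sub>m b a) (1\<^sub>m b)"], rule exI[of _ "vcat (1\<^sub>m a) (0\<^sub>m b a)"])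
        (use 1 2 3 4 in auto)
  qed
  show ?thesis unfolding ses_def using X Y cone_bcomplex[OF X Y f] shift_bcomplex[OF X] ic pc ex by simp
qed

text \<open>
  The rotated triangle shows that a shift of \<open>X\<close> belongs to \<open>S\<close>.
\<close>

lemma mem_of_cone:
  assumes S: "triangulated_subcategory S" and X: "bcomplex X" and f: "f \<in> chain_maps X Y" and "Y \<in> S" "mapping_cone X Y f \<in> S"
  shows "X \<in> S"
proof -
  have Y: "bcomplex Y" using triangulatedD(1)[OF S] assms by blast
  have "shift 1 X \<in> S" by (rule ses_quotient_mem[OF S ses_rotation[OF X Y f] assms(4,5)])
  then have "shift (- 1) (shift 1 X) \<in> S" by (rule triangulatedD(4)[OF S])
  then show ?thesis by (simp only: shift_back)
qed

lemma ses_sub_mem: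
  assumes S: "triangulated_subcategory S" and e: "ses A X B i p" and "X \<in> S" "B \<in> S"
  shows "A \<in> S"
proof (rule mem_of_cone[OF S])
  show "bcomplex A" "i \<in> chain_maps A X" using e by (simp_all add: ses_def)
  show "mapping_cone A X i \<in> S" by (rule triangulatedD(3)[OF S assms(4) ses_cone_derived_iso(2)[OF e]])
qed (rule assms(3))

lemma ses_middle_mem:
  assumes S: "triangulated_subcategory S" and e: "ses A X B i p" and "A \<in> S" "B \<in> S"
  shows "X \<in> S"
proof -
  have X: "bcomplex A" "bcomplex X" "i \<in> chain_maps A X" using e by (simp_all add: ses_def)
  have "mapping_cone A X i \<in> S" by (rule triangulatedD(3)[OF S assms(4) ses_cone_derived_iso(2)[OF e]])
  then show ?thesis by (rule ses_sub_mem[OF S ses_rotation[OF X]]) (rule triangulatedD(4)[OF S assms(3)])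
qed

section \<open>Short exact sequences of representations\<close>

lemma stalk_simps[simp]: "ob (stalk A) n = (if n = 0 then A else rzero)"
  "df (stalk A) n = mzero (if n = 0 then A else rzero) (if n + 1 = 0 then A else rzero)"
  by (simp_all add: stalk_def Let_def)

lemma stalk_bcomplex:
  assumes A: "is_rep A"
  shows "bcomplex (stalk A)"
proof -
  have r: "is_rep (ob (stalk A) n)" for n using A by (simp add: rzero_is_rep)
  have "df (stalk A) n \<in> rhom (ob (stalk A) n) (ob (stalk A) (n + 1))" for n
    using mzero_rhom[OF r[of n] r[of "n + 1"]] by simp
  moreover have "df (stalk A) (n + 1) \<star> df (stalk A) n = mzero (ob (stalk A) n) (ob (stalk A) (n + 2))" for n
  proof -
    have i2: "n + 1 + 1 = n + 2" by simp
    show ?thesis unfolding stalk_simps i2 by (intro ext) (simp add: mcomp_def mzero_def)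
  qed
  moreover have "\<exists>N. \<forall>n. \<bar>n\<bar> > N \<longrightarrow> (\<forall>v. rdim (ob (stalk A) n) v = 0)" by (intro exI[of _ 0]) auto
  ultimately show ?thesis unfolding bcomplex_def using r by blast
qed

definition rep_ses :: "'k::field rep \<Rightarrow> 'k rep \<Rightarrow> 'k rep \<Rightarrow> bool" where
  "rep_ses A X B \<longleftrightarrow> is_rep A \<and> is_rep X \<and> is_rep B \<and>
     (\<exists>f\<in>rhom A X. \<exists>g\<in>rhom X B. \<forall>v. split_exact (rdim A v) (rdim X v) (rdim B v) (f v) (g v))"

lemma rep_ses_stalk:
  assumes "rep_ses A X B"
  shows "\<exists>i p. ses (stalk A) (stalk X) (stalk B) i p"
proof -
  obtain f g where r: "is_rep A" "is_rep X" "is_rep B" and f: "f \<in> rhom A X" and g: "g \<in> rhom X B"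
    and ex: "\<And>v. split_exact (rdim A v) (rdim X v) (rdim B v) (f v) (g v)" using assms by (auto simp: rep_ses_def)
  define st where "st h n = (if n = (0::int) then h else mzero rzero rzero)" for h :: "'a mor" and n
  have chain: "st h \<in> chain_maps (stalk U) (stalk V)" if U: "is_rep U" and V: "is_rep V" and h: "h \<in> rhom U V" for U V h
  proof (rule chain_mapsI)
    show hom: "st h n \<in> rhom (ob (stalk U) n) (ob (stalk V) n)" for n
      using h by (simp add: st_def mzero_rhom rzero_is_rep)
    fix n v
    show "st h (n + 1) v * df (stalk U) n v = df (stalk V) n v * st h n v"
      using rhomD[OF hom[of n], of v] rhomD[OF hom[of "n + 1"], of v] unfolding stalk_simps mzero_def
      by (simp add: mat_dist split del: if_split)
  qed
  have z: "split_exact 0 0 0 (0\<^sub>m 0 0) (0\<^sub>m 0 0 :: 'a mat)"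
    unfolding split_exact_def by (intro conjI exI[of _ "0\<^sub>m 0 0"]) auto
  have "ses (stalk A) (stalk X) (stalk B) (st f) (st g)"
    unfolding ses_def using stalk_bcomplex[OF r(1)] stalk_bcomplex[OF r(2)] stalk_bcomplex[OF r(3)]
      chain[OF r(1,2) f] chain[OF r(2,3) g] ex z by (simp add: st_def mzero_def)
  then show ?thesis by blast
qed

lemma rep_ses_mem:
  assumes S: "triangulated_subcategory S" and e: "rep_ses A X B"
  shows "stalk A \<in> S \<Longrightarrow> stalk X \<in> S \<Longrightarrow> stalk B \<in> S" "stalk A \<in> S \<Longrightarrow> stalk B \<in> S \<Longrightarrow> stalk X \<in> S"
    "stalk X \<in> S \<Longrightarrow> stalk B \<in> S \<Longrightarrow> stalk A \<in> S"
  using rep_ses_stalk[OF e] ses_quotient_mem[OF S] ses_middle_mem[OF S] ses_sub_mem[OF S] by blast+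

lemma split_exact_zero_left:
  assumes "p \<in> carrier_mat n n" "k \<in> carrier_mat n n" "p * k = 1\<^sub>m n" "k * p = 1\<^sub>m n"
  shows "split_exact 0 n n (0\<^sub>m n 0) p"
  unfolding split_exact_def using assms by (intro conjI exI[of _ "0\<^sub>m 0 n"] exI[of _ k]) (auto simp: mat_dist)

lemma split_exact_zero_id: "split_exact 0 n n (0\<^sub>m n 0) (1\<^sub>m n)"
  by (rule split_exact_zero_left[of _ _ "1\<^sub>m n"]) auto

lemma split_exact_id_zero: "split_exact n n 0 (1\<^sub>m n) (0\<^sub>m 0 n)"
  unfolding split_exact_def by (intro conjI exI[of _ "1\<^sub>m n"] exI[of _ "0\<^sub>m n 0"]) (auto simp: mat_dist)

lemma rdim_eq_of_iso:
  assumes "rep_iso A B"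
  shows "rdim A v = rdim B v"
proof -
  obtain f g where fg: "f \<in> rhom A B" "g \<in> rhom B A" "\<And>v. g v * f v = 1\<^sub>m (rdim A v)" "\<And>v. f v * g v = 1\<^sub>m (rdim B v)"
    using rep_iso_inverse[OF assms] by auto
  have le: "n \<le> m" if F: "F \<in> carrier_mat m n" and G: "G \<in> carrier_mat n m" and e: "G * F = 1\<^sub>m n" for F G :: "'a mat" and n m
  proof (rule ccontr)
    assume "\<not> n \<le> m"
    then obtain X where X: "X \<in> carrier_mat n 1" "X \<noteq> 0\<^sub>m n 1" "F * X = 0\<^sub>m m 1" using wide_mat_kernel[OF F] by auto
    have "X = G * F * X" using X(1) by (simp add: e)
    also have "\<dots> = G * (F * X)" using F G X(1) by simp
    also have "\<dots> = 0\<^sub>m n 1" using G by (simp add: X(3))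
    finally show False using X(2) by simp
  qed
  show ?thesis using le[OF rhomD[OF fg(1)] rhomD[OF fg(2)] fg(3)] le[OF rhomD[OF fg(2)] rhomD[OF fg(1)] fg(4)] by (metis le_antisym)
qed

text \<open>
  An isomorphism is a short exact sequence with zero kernel term.
\<close>

lemma rep_iso_mem:
  assumes S: "triangulated_subcategory S" and iso: "rep_iso A B" and "stalk A \<in> S"
  shows "stalk B \<in> S"
proof -
  obtain f g where fg: "is_rep A" "is_rep B" "f \<in> rhom A B" "g \<in> rhom B A" "\<And>v. g v * f v = 1\<^sub>m (rdim A v)" "\<And>v. f v * g v = 1\<^sub>m (rdim B v)"
    using rep_iso_inverse[OF iso] by auto
  have "split_exact 0 (rdim A v) (rdim B v) (0\<^sub>m (rdim A v) 0) (f v)" for v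
    unfolding rdim_eq_of_iso[OF iso]
    by (rule split_exact_zero_left[of _ _ "g v"]) (use rhomD[OF fg(3), of v] rhomD[OF fg(4), of v] fg(5)[of v] fg(6)[of v] rdim_eq_of_iso[OF iso, of v] in auto)
  then have "\<forall>v. split_exact (rdim rzero v) (rdim A v) (rdim B v) (mzero rzero A v) (f v)" by (simp add: mzero_def)
  then have "rep_ses rzero A B"
    unfolding rep_ses_def using fg(1-3) rzero_is_rep mzero_rhom[OF rzero_is_rep fg(1)] by blast
  then show ?thesis using rep_ses_mem(1)[OF S] triangulatedD(2)[OF S] assms(3) by blast
qed

lemma split_exact_transpose:
  assumes "split_exact a x b i p"
  shows "split_exact b x a (transpose_mat p) (transpose_mat i)"
proof -
  obtain h k where c: "i \<in> carrier_mat x a" "p \<in> carrier_mat b x" "h \<in> carrier_mat a x" "k \<in> carrier_mat x b"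
    and e: "h * i = 1\<^sub>m a" "p * k = 1\<^sub>m b" "p * i = 0\<^sub>m b a" "i * h + k * p = 1\<^sub>m x"
    using assms by (auto simp: split_exact_def)
  have t: "transpose_mat k * transpose_mat p = 1\<^sub>m b" "transpose_mat i * transpose_mat h = 1\<^sub>m a" "transpose_mat i * transpose_mat p = 0\<^sub>m a b"
    using transpose_mult[OF c(2,4)] transpose_mult[OF c(3,1)] transpose_mult[OF c(2,1)] e by (metis transpose_one zero_transpose_mat)+
  have "transpose_mat (i * h + k * p) = transpose_mat p * transpose_mat k + transpose_mat h * transpose_mat i"
    using transpose_add[of "i * h" x x "k * p"] transpose_mult[OF c(1,3)] transpose_mult[OF c(4,2)] c
    by (simp add: comm_add_mat[of _ x x])
  then have "transpose_mat p * transpose_mat k + transpose_mat h * transpose_mat i = 1\<^sub>m x" by (metis e(4) transpose_one)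
  with t c show ?thesis unfolding split_exact_def
    by (intro conjI exI[of _ "transpose_mat k"] exI[of _ "transpose_mat h"]) auto
qed

lemma rep_ses_dual:
  assumes "rep_ses A X B"
  shows "rep_ses (dual B) (dual X) (dual A)"
proof -
  obtain f g where r: "is_rep A" "is_rep X" "is_rep B" and f: "f \<in> rhom A X" and g: "g \<in> rhom X B"
    and ex: "\<And>v. split_exact (rdim A v) (rdim X v) (rdim B v) (f v) (g v)" using assms by (auto simp: rep_ses_def)
  show ?thesis unfolding rep_ses_def
    using dual_is_rep[OF r(1)] dual_is_rep[OF r(2)] dual_is_rep[OF r(3)] dual_mor_rhom[OF r(2,3) g] dual_mor_rhom[OF r(1,2) f] split_exact_transpose[OF ex]
    by (intro conjI bexI[of _ "dual_mor g"] bexI[of _ "dual_mor f"]) (auto simp: dual_mor_def)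
qed

definition last_col :: "nat \<Rightarrow> 'k::field mat" where
  "last_col n = mat (Suc n) 1 (\<lambda>(i, _). if i = n then 1 else 0)"
definition first_col :: "nat \<Rightarrow> 'k::field mat" where
  "first_col n = mat (Suc n) 1 (\<lambda>(i, _). if i = 0 then 1 else 0)"

lemma col_carrier[simp]: "last_col n \<in> carrier_mat (Suc n) (Suc 0)" "first_col n \<in> carrier_mat (Suc n) (Suc 0)"
  and col_dims[simp]: "dim_row (last_col n) = Suc n" "dim_col (last_col n) = Suc 0" "dim_row (first_col n) = Suc n" "dim_col (first_col n) = Suc 0"
  by (simp_all add: last_col_def first_col_def)

lemma pi_relations:
  "pi_plus n * last_col n = 0\<^sub>m n 1" "pi_minus n * first_col n = 0\<^sub>m n 1"
  "pi_minus (Suc n) * last_col (Suc n) = last_col n" "pi_plus (Suc n) * first_col (Suc n) = first_col n"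
  "pi_plus n * j_plus n = 1\<^sub>m n" "pi_minus n * j_minus n = 1\<^sub>m n"
proof -
  show "pi_plus n * last_col n = 0\<^sub>m n 1"
    by (rule eq_matI) (auto simp: pi_plus_mult_entry[of _ n 1] last_col_def simp del: index_mult_mat(1))
  show "pi_minus n * first_col n = 0\<^sub>m n 1"
    by (rule eq_matI) (auto simp: pi_minus_mult_entry[of _ n 1] first_col_def simp del: index_mult_mat(1))
  show "pi_minus (Suc n) * last_col (Suc n) = last_col n"
    by (rule eq_matI) (auto simp: pi_minus_mult_entry[of _ "Suc n" 1] last_col_def simp del: index_mult_mat(1))
  show "pi_plus (Suc n) * first_col (Suc n) = first_col n"
    by (rule eq_matI) (auto simp: pi_plus_mult_entry[of _ "Suc n" 1] first_col_def simp del: index_mult_mat(1))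
  show "pi_plus n * j_plus n = 1\<^sub>m n"
    by (rule eq_matI) (auto simp: pi_plus_mult_entry[of _ n n] j_plus_def simp del: index_mult_mat(1))
  show "pi_minus n * j_minus n = 1\<^sub>m n"
    by (rule eq_matI) (auto simp: pi_minus_mult_entry[of _ n n] j_minus_def simp del: index_mult_mat(1))
qed

lemma pi_commute: "pi_plus n * pi_minus (Suc n) = (pi_minus n * pi_plus (Suc n) :: 'g::field mat)"
  proof (rule eq_matI)
    fix i j assume "i < dim_row (pi_minus n * pi_plus (Suc n) :: 'g mat)" "j < dim_col (pi_minus n * pi_plus (Suc n) :: 'g mat)"
    then have ij: "i < n" "j < Suc (Suc n)" by auto
    have "(pi_plus n * pi_minus (Suc n)) $$ (i, j) = (pi_minus (Suc n) :: 'g mat) $$ (i, j)" by (rule pi_plus_mult_entry[OF _ ij]) simp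
    also have "\<dots> = pi_plus (Suc n) $$ (Suc i, j)" using ij by (simp add: pi_plus_def pi_minus_def)
    also have "\<dots> = (pi_minus n * pi_plus (Suc n)) $$ (i, j)" by (rule pi_minus_mult_entry[OF _ ij, symmetric]) simp
    finally show "(pi_plus n * pi_minus (Suc n)) $$ (i, j) = (pi_minus n * pi_plus (Suc n) :: 'g mat) $$ (i, j)" .
  qed auto

lemma split_exact_last: "split_exact (Suc 0) (Suc n) n (last_col n) (pi_plus n)"
proof -
  have 1: "last_unit_row n * last_col n = (1\<^sub>m (Suc 0) :: 'a mat)"
    by (rule eq_matI) (auto simp: last_unit_row_def last_col_def scalar_prod_def)
  have "last_col n * last_unit_row n + j_plus n * pi_plus n = (1\<^sub>m (Suc n) :: 'a mat)"
  proof (rule eq_matI)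
    fix i j assume "i < dim_row (1\<^sub>m (Suc n) :: 'a mat)" "j < dim_col (1\<^sub>m (Suc n) :: 'a mat)"
    then have ij: "i < Suc n" "j < Suc n" by auto
    have "(last_col n * last_unit_row n) $$ (i, j) = (if i = n \<and> j = n then 1 else (0::'a))"
      using ij by (auto simp: last_col_def last_unit_row_def scalar_prod_def)
    moreover have "(j_plus n * pi_plus n) $$ (i, j) = (if j < n \<and> i = j then 1 else (0::'a))"
      using ij mult_pi_plus_entry[of "j_plus n :: 'a mat" "Suc n" n i j] by (auto simp: j_plus_def)
    ultimately show "(last_col n * last_unit_row n + j_plus n * pi_plus n) $$ (i, j) = (1\<^sub>m (Suc n) :: 'a mat) $$ (i, j)"
      using ij by (subst index_add_mat(1)) (auto simp del: index_mult_mat(1))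
  qed (auto simp: last_unit_row_def)
  then show ?thesis unfolding split_exact_def using 1 pi_relations(1,5)[of n]
    by (intro conjI exI[of _ "last_unit_row n"] exI[of _ "j_plus n"]) (auto simp: last_unit_row_def)
qed

definition first_unit_row :: "nat \<Rightarrow> 'k::field mat" where
  "first_unit_row n = mat 1 (Suc n) (\<lambda>(_, j). if j = 0 then 1 else 0)"

lemma split_exact_first: "split_exact (Suc 0) (Suc n) n (first_col n) (pi_minus n)"
proof -
  have 1: "first_unit_row n * first_col n = (1\<^sub>m (Suc 0) :: 'a mat)"
    by (rule eq_matI) (simp_all add: first_unit_row_def first_col_def scalar_prod_def if_distrib[of "\<lambda>t. t * _"] cong: if_cong)
  have "first_col n * first_unit_row n + j_minus n * pi_minus n = (1\<^sub>m (Suc n) :: 'a mat)"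
  proof (rule eq_matI)
    fix i j assume "i < dim_row (1\<^sub>m (Suc n) :: 'a mat)" "j < dim_col (1\<^sub>m (Suc n) :: 'a mat)"
    then have ij: "i < Suc n" "j < Suc n" by auto
    have "(first_col n * first_unit_row n) $$ (i, j) = (if i = 0 \<and> j = 0 then 1 else (0::'a))"
      using ij by (auto simp: first_col_def first_unit_row_def scalar_prod_def)
    moreover have "(j_minus n * pi_minus n) $$ (i, j) = (if j \<noteq> 0 \<and> i = j then 1 else (0::'a))"
      using ij mult_pi_minus_entry[of "j_minus n :: 'a mat" "Suc n" n i j] by (auto simp: j_minus_def)
    ultimately show "(first_col n * first_unit_row n + j_minus n * pi_minus n) $$ (i, j) = (1\<^sub>m (Suc n) :: 'a mat) $$ (i, j)"
      using ij by (subst index_add_mat(1)) (auto simp del: index_mult_mat(1))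
  qed (auto simp: first_unit_row_def)
  then show ?thesis unfolding split_exact_def using 1 pi_relations(2,6)[of n]
    by (intro conjI exI[of _ "first_unit_row n"] exI[of _ "j_minus n"]) (auto simp: first_unit_row_def)
qed

text \<open>
  The dimension vector \<open>(1,1,1)\<close> spans the radical of the quadratic form, and consecutive members of each
  family \<open>E_i\<close> differ by it. The choice of this representation, in which the long arrow acts by zero,
  is explained by the sequences below: \<open>\<pi>\<^sub>+\<close> kills the last basis vector whereas \<open>\<pi>\<^sub>-\<close> does not.
\<close>

definition R :: "'k::field rep" where
  "R = mk_rep (1, 1, 1) (0\<^sub>m 1 1, 1\<^sub>m 1, 1\<^sub>m 1)"

lemma R_simps[simp]: "rdim R Vb = Suc 0" "rdim R Vmid = Suc 0" "rdim R Ve = Suc 0"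
  "rmap R BE = 0\<^sub>m (Suc 0) (Suc 0)" "rmap R BM = 1\<^sub>m (Suc 0)" "rmap R ME = 1\<^sub>m (Suc 0)"
  by (simp_all add: R_def)

lemma R_is_rep[simp]: "is_rep R" by (simp add: is_rep_def all_arrow)

lemma dual_R: "dual R = R"
proof (rule rep_eqI)
  fix v show "rdim (dual R) v = rdim R v" by (cases v) auto
next
  fix a show "rmap (dual R) a = rmap R a" by (cases a) auto
qed

lemma pi_zero: "pi_plus 0 = 0\<^sub>m 0 (Suc 0)" "pi_minus 0 = 0\<^sub>m 0 (Suc 0)" "j_plus 0 = 0\<^sub>m (Suc 0) 0" "j_minus 0 = 0\<^sub>m (Suc 0) 0"
  by (auto intro!: eq_matI)

lemma split_exact_zero_zero: "split_exact 0 0 0 (0\<^sub>m 0 0) (0\<^sub>m 0 0 :: 'k::field mat)"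
  by (rule split_exact_zero_left[of _ _ "0\<^sub>m 0 0"]) (auto intro!: eq_matI)

lemma rep_sesI:
  assumes "is_rep A" "is_rep X" "is_rep B" "case_vertex fb fm fe \<in> rhom A X" "case_vertex gb gm ge \<in> rhom X B"
    "split_exact (rdim A Vb) (rdim X Vb) (rdim B Vb) fb gb" "split_exact (rdim A Vmid) (rdim X Vmid) (rdim B Vmid) fm gm"
    "split_exact (rdim A Ve) (rdim X Ve) (rdim B Ve) fe ge"
  shows "rep_ses A X B"
  unfolding rep_ses_def using assms
  by (intro conjI bexI[of _ "case_vertex fb fm fe"] bexI[of _ "case_vertex gb gm ge"]) (auto simp: all_vertex)

text \<open>
  Removal of the last basis vector at each vertex.
\<close>

lemma ses_R_E1: "rep_ses R (E1 (Suc m)) (E1 m)"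
  by (rule rep_sesI[of _ _ _ "last_col (Suc m)" "last_col m" "last_col m" "pi_plus (Suc m)" "pi_plus m" "pi_plus m"])
    (simp_all add: rhom_iff split_exact_last pi_relations pi_commute mat_dist)

lemma ses_R_E4: "rep_ses R (E4 (Suc m)) (E4 m)"
  by (rule rep_sesI[of _ _ _ "last_col (Suc m)" "last_col (Suc m)" "last_col m" "pi_plus (Suc m)" "pi_plus (Suc m)" "pi_plus m"])
    (simp_all add: rhom_iff split_exact_last pi_relations pi_commute mat_dist)

lemma ses_E2_R: "rep_ses (E2 m) (E2 (Suc m)) R"
  using rep_ses_dual[OF ses_R_E4[of m]] by (simp add: dual_R)

lemma ses_E3_R: "rep_ses (E3 m) (E3 (Suc m)) R"
  using rep_ses_dual[OF ses_R_E1[of m]] by (simp add: dual_R)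

lemma ses_E2_R_E1: "rep_ses (E2 0) R (E1 0)"
  by (rule rep_sesI[of _ _ _ "0\<^sub>m 1 0" "1\<^sub>m 1" "1\<^sub>m 1" "1\<^sub>m 1" "0\<^sub>m 0 1" "0\<^sub>m 0 1"])
    (auto simp: rhom_iff split_exact_zero_id split_exact_id_zero split_exact_zero_zero pi_zero mat_dist)

lemma ses_E3_R_E4: "rep_ses (E3 0) R (E4 0)"
  using rep_ses_dual[OF ses_E2_R_E1] by (simp add: dual_R)

text \<open>
  Removal of the first basis vector at \<open>Vmid\<close>, which spans the kernel of \<open>\<pi>\<^sub>-\<close>.
\<close>

lemma ses_M_E4_E1: "rep_ses M (E4 m) (E1 m)"
  by (rule rep_sesI[of _ _ _ "0\<^sub>m (Suc m) 0" "first_col m" "0\<^sub>m m 0" "1\<^sub>m (Suc m)" "pi_minus m" "1\<^sub>m m"])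
    (simp_all add: rhom_iff split_exact_zero_id split_exact_first pi_relations pi_commute mat_dist)

lemma ses_E3_E2_M: "rep_ses (E3 m) (E2 m) M"
  using rep_ses_dual[OF ses_M_E4_E1[of m]] by simp

lemma ses_M'_E1_E4: "rep_ses M' (E1 (Suc m)) (E4 m)"
  by (rule rep_sesI[of _ _ _ "first_col (Suc m)" "0\<^sub>m (Suc m) 0" "first_col m" "pi_minus (Suc m)" "1\<^sub>m (Suc m)" "pi_minus m"])
    (simp_all add: rhom_iff split_exact_zero_id split_exact_first pi_relations pi_commute mat_dist)

lemma ses_E2_E3_M': "rep_ses (E2 m) (E3 (Suc m)) M'"
  using rep_ses_dual[OF ses_M'_E1_E4[of m]] by simp

lemma ses_E3_M'_E1: "rep_ses (E3 0) M' (E1 0)"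
  by (rule rep_sesI[of _ _ _ "0\<^sub>m 1 0" "0\<^sub>m 0 0" "1\<^sub>m 1" "1\<^sub>m 1" "0\<^sub>m 0 0" "0\<^sub>m 0 1"])
    (auto simp: rhom_iff split_exact_zero_id split_exact_id_zero split_exact_zero_zero pi_zero mat_dist)

section \<open>Generation by the simple representations\<close>

lemma zero_size_eq: "X \<in> carrier_mat n m \<Longrightarrow> Y \<in> carrier_mat n m \<Longrightarrow> n = 0 \<or> m = 0 \<Longrightarrow> X = Y"
  by (intro eq_matI) auto

text \<open>
  A degreewise and vertexwise surjection \<open>p\<close> with section \<open>s\<close> is the projection to a quotient complex if its
  kernel is stable under the arrows and the differential. Stability is expressed by \<open>keyR\<close> and \<open>keyD\<close>:
  \<open>s p\<close> is a projector along the kernel, and applying it first does not change the composite of \<open>p\<close> with an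
  arrow or a differential.
\<close>

lemma quotient_bcomplex:
  fixes X :: "'k::field cpx" and d' :: "int \<Rightarrow> vertex \<Rightarrow> nat"
  assumes X: "bcomplex X" and p: "\<And>n v. p n v \<in> carrier_mat (d' n v) (rdim (ob X n) v)"
    and s: "\<And>n v. s n v \<in> carrier_mat (rdim (ob X n) v) (d' n v)" and ps: "\<And>n v. p n v * s n v = 1\<^sub>m (d' n v)"
    and keyR: "\<And>n a. p n (tgt a) * rmap (ob X n) a * (s n (src a) * p n (src a)) = p n (tgt a) * rmap (ob X n) a"
    and keyD: "\<And>n v. p (n + 1) v * df X n v * (s n v * p n v) = p (n + 1) v * df X n v"
    and le: "\<And>n v. d' n v \<le> rdim (ob X n) v"
  shows "\<exists>Q. bcomplex Q \<and> p \<in> chain_maps X Q \<and> (\<forall>n v. rdim (ob Q n) v = d' n v)"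
proof -
  define Q where "Q = \<lparr>ob = \<lambda>n. \<lparr>rdim = d' n, rmap = \<lambda>a. p n (tgt a) * rmap (ob X n) a * s n (src a)\<rparr>,
    df = \<lambda>n v. p (n + 1) v * df X n v * s n v\<rparr>"
  have Qd[simp]: "rdim (ob Q n) v = d' n v" for n v by (simp add: Q_def)
  have Qr: "rmap (ob Q n) a = p n (tgt a) * rmap (ob X n) a * s n (src a)" for n a by (simp add: Q_def)
  have Qf: "df Q n v = p (n + 1) v * df X n v * s n v" for n v by (simp add: Q_def)
  have Qrc: "rmap (ob Q n) a \<in> carrier_mat (d' n (tgt a)) (d' n (src a))" for n a
    unfolding Qr using p[of n "tgt a"] s[of n "src a"] is_repD[OF bcomplexD(1)[OF X, of n], of a] by simp
  have Qfc: "df Q n v \<in> carrier_mat (d' (n + 1) v) (d' n v)" for n v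
    unfolding Qf using p[of "n + 1" v] s[of n v] bcomplexD(3)[OF X, of n v] by simp
  have cancel: "A = B" if "A * p n v = B * p n v" "A \<in> carrier_mat r (d' n v)" "B \<in> carrier_mat r (d' n v)" for A B r n v
  proof -
    have "A = A * (p n v * s n v)" using that(2) by (simp add: ps)
    also have "\<dots> = A * p n v * s n v" using that(2) p[of n v] s[of n v] by (simp add: mat_assoc)
    also have "\<dots> = B * (p n v * s n v)" unfolding that(1) using that(3) p[of n v] s[of n v] by (simp add: mat_assoc)
    also have "\<dots> = B" using that(3) by (simp add: ps)
    finally show ?thesis .
  qed
  have R1: "rmap (ob Q n) a * p n (src a) = p n (tgt a) * rmap (ob X n) a" for n a
    unfolding Qr using p[of n "tgt a"] p[of n "src a"] s[of n "src a"] is_repD[OF bcomplexD(1)[OF X, of n], of a] keyR[of n a]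
    by (simp add: mat_assoc)
  have D1: "df Q n v * p n v = p (n + 1) v * df X n v" for n v
    unfolding Qf using p[of "n + 1" v] p[of n v] s[of n v] bcomplexD(3)[OF X, of n v] keyD[of n v] by (simp add: mat_assoc)
  have rep: "is_rep (ob Q n)" for n using Qrc by (simp add: is_rep_def)
  have hom: "df Q n \<in> rhom (ob Q n) (ob Q (n + 1))" for n
  proof (rule rhomI)
    show "df Q n v \<in> carrier_mat (rdim (ob Q (n + 1)) v) (rdim (ob Q n) v)" for v using Qfc by simp
    fix a
    note c = p[of n "src a"] p[of n "tgt a"] p[of "n + 1" "src a"] p[of "n + 1" "tgt a"] Qrc[of n a] Qrc[of "n + 1" a] Qfc[of n "src a"] Qfc[of n "tgt a"]
      is_repD[OF bcomplexD(1)[OF X, of n], of a] is_repD[OF bcomplexD(1)[OF X, of "n + 1"], of a] bcomplexD(3)[OF X, of n "src a"] bcomplexD(3)[OF X, of n "tgt a"]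
    have "df Q n (tgt a) * rmap (ob Q n) a * p n (src a) = df Q n (tgt a) * p n (tgt a) * rmap (ob X n) a"
      using c by (simp add: mat_assoc R1)
    also have "\<dots> = p (n + 1) (tgt a) * (df X n (tgt a) * rmap (ob X n) a)" using c by (simp add: D1 mat_assoc)
    also have "\<dots> = p (n + 1) (tgt a) * rmap (ob X (n + 1)) a * df X n (src a)"
      using c rhom_comm[OF bcomplexD(2)[OF X, of n], of a] by (simp add: mat_assoc)
    also have "\<dots> = rmap (ob Q (n + 1)) a * (p (n + 1) (src a) * df X n (src a))" using c by (simp add: R1[symmetric] mat_assoc)
    also have "\<dots> = rmap (ob Q (n + 1)) a * df Q n (src a) * p n (src a)" using c by (simp add: D1[symmetric] mat_assoc)
    finally show "df Q n (tgt a) * rmap (ob Q n) a = rmap (ob Q (n + 1)) a * df Q n (src a)"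
      by (rule cancel[of _ n "src a" _ "d' (n + 1) (tgt a)"]) (use c in auto)
  qed
  have sq: "df Q (n + 1) \<star> df Q n = mzero (ob Q n) (ob Q (n + 2))" for n
  proof
    fix v
    have i2: "n + 1 + 1 = n + 2" by simp
    note c = p[of n v] p[of "n + 1" v] p[of "n + 2" v] Qfc[of n v] Qfc[of "n + 1" v, unfolded i2] bcomplexD(3)[OF X, of n v] bcomplexD(3)[OF X, of "n + 1" v, unfolded i2]
    have "df Q (n + 1) v * df Q n v * p n v = df Q (n + 1) v * p (n + 1) v * df X n v" using c by (simp add: mat_assoc D1[of n v])
    also have "\<dots> = p (n + 2) v * (df X (n + 1) v * df X n v)" 
      unfolding D1[of "n + 1" v] i2 by (rule mat_assoc) (use c in auto)
    also have "\<dots> = 0\<^sub>m (d' (n + 2) v) (d' n v) * p n v" using c by (simp add: bcomplexD(4)[OF X] mat_dist)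
    finally have "df Q (n + 1) v * df Q n v = 0\<^sub>m (d' (n + 2) v) (d' n v)"
      by (rule cancel[of _ n v _ "d' (n + 2) v"]) (use c in auto)
    then show "(df Q (n + 1) \<star> df Q n) v = mzero (ob Q n) (ob Q (n + 2)) v" by (simp add: mcomp_def mzero_def)
  qed
  obtain N where N: "\<And>n v. \<bar>n\<bar> > N \<Longrightarrow> rdim (ob X n) v = 0" using bcomplex_bounded[OF X] by blast
  have "rdim (ob Q n) v = 0" if "\<bar>n\<bar> > N" for n v using N[OF that, of v] le[of n v] by simp
  then have "bcomplex Q" unfolding bcomplex_def using rep hom sq by blast
  moreover have "p \<in> chain_maps X Q"
  proof (rule chain_mapsI)
    show "p n \<in> rhom (ob X n) (ob Q n)" for n by (rule rhomI) (use p R1 in auto)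
    show "p (n + 1) v * df X n v = df Q n v * p n v" for n v by (simp add: D1)
  qed
  ultimately show ?thesis using Qd by blast
qed

text \<open>
  In the top degree of \<open>X\<close>, a basis vector at a vertex \<open>v\<close> all of whose out-neighbours carry the zero space is
  killed by the differential and by the arrows, so it spans a subcomplex that is a shifted simple
  representation.
\<close>

lemma peel_simple:
  fixes X :: "'k::field cpx"
  assumes X: "bcomplex X" and d: "rdim (ob X n) v = Suc d" and top: "\<And>w. rdim (ob X (n + 1)) w = 0"
    and sink: "\<And>a. src a = v \<Longrightarrow> rdim (ob X n) (tgt a) = 0" and T: "is_rep T" "\<And>w. rdim T w = (if w = v then 1 else 0)"
  shows "\<exists>Y i p. ses (shift (- n) (stalk T)) X Y i p \<and>
    (\<forall>m w. rdim (ob Y m) w = (if m = n \<and> w = v then d else rdim (ob X m) w))"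
proof -
  let ?A = "shift (- n) (stalk T)"
  define d' where "d' m w = (if m = n \<and> w = v then d else rdim (ob X m) w)" for m w
  define p where "p m w = (if m = n \<and> w = v then pi_plus d else (1\<^sub>m (rdim (ob X m) w) :: 'k mat))" for m w
  define s where "s m w = (if m = n \<and> w = v then j_plus d else (1\<^sub>m (rdim (ob X m) w) :: 'k mat))" for m w
  define i where "i m w = (if m = n \<and> w = v then last_col d else (0\<^sub>m (rdim (ob X m) w) 0 :: 'k mat))" for m w
  have A: "bcomplex ?A" by (rule shift_bcomplex[OF stalk_bcomplex[OF T(1)]])
  have Ad: "rdim (ob ?A m) w = (if m = n \<and> w = v then 1 else 0)" for m w using T(2) by (cases "w = v") simp_all
  have pc: "p m w \<in> carrier_mat (d' m w) (rdim (ob X m) w)" for m w using d by (simp add: p_def d'_def)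
  have sc: "s m w \<in> carrier_mat (rdim (ob X m) w) (d' m w)" for m w using d by (simp add: s_def d'_def)
  have ic: "i m w \<in> carrier_mat (rdim (ob X m) w) (rdim (ob ?A m) w)" for m w using d by (simp add: i_def Ad del: shift_simps)
  have sp: "s m w * p m w = 1\<^sub>m (rdim (ob X m) w)" if "\<not> (m = n \<and> w = v)" for m w
    unfolding p_def s_def if_not_P[OF that] by simp
  have dn: "d' m w = rdim (ob X m) w" if "\<not> (m = n \<and> w = v)" for m w unfolding d'_def if_not_P[OF that] ..
  have "\<exists>Q. bcomplex Q \<and> p \<in> chain_maps X Q \<and> (\<forall>m w. rdim (ob Q m) w = d' m w)"
  proof (rule quotient_bcomplex[OF X pc sc])
    show "p m w * s m w = 1\<^sub>m (d' m w)" for m w by (simp add: p_def s_def d'_def pi_relations)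
    show "d' m w \<le> rdim (ob X m) w" for m w using d by (simp add: d'_def)
    show "p m (tgt a) * rmap (ob X m) a * (s m (src a) * p m (src a)) = p m (tgt a) * rmap (ob X m) a" for m a
    proof (cases "m = n \<and> src a = v")
      case True
      then have t: "rdim (ob X n) (tgt a) = 0" using sink by blast
      then have "\<not> (m = n \<and> tgt a = v)" using d by auto
      then have "d' m (tgt a) = 0" using dn t True by simp
      then show ?thesis
        by (intro zero_size_eq[of _ "d' m (tgt a)" "rdim (ob X m) (src a)"])
          (use pc[of m "tgt a"] pc[of m "src a"] sc[of m "src a"] is_repD[OF bcomplexD(1)[OF X, of m], of a] in auto)
    next
      case False
      then show ?thesis using pc[of m "tgt a"] is_repD[OF bcomplexD(1)[OF X, of m], of a] by (simp add: sp)
    qed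
    show "p (m + 1) w * df X m w * (s m w * p m w) = p (m + 1) w * df X m w" for m w
    proof (cases "m = n \<and> w = v")
      case True
      then have "d' (m + 1) w = 0" using top dn by simp
      then show ?thesis
        by (intro zero_size_eq[of _ "d' (m + 1) w" "rdim (ob X m) w"])
          (use pc[of "m + 1" w] pc[of m w] sc[of m w] bcomplexD(3)[OF X, of m w] in auto)
    next
      case False
      then show ?thesis using pc[of "m + 1" w] bcomplexD(3)[OF X, of m w] by (simp add: sp)
    qed
  qed
  then obtain Q where Q: "bcomplex Q" "p \<in> chain_maps X Q" "\<And>m w. rdim (ob Q m) w = d' m w" by blast
  have ich: "i \<in> chain_maps ?A X"
  proof (rule chain_mapsI)
    fix m
    show "i m \<in> rhom (ob ?A m) (ob X m)"
    proof (rule rhomI[OF ic])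
      fix a
      have "rdim (ob X m) (tgt a) = 0 \<or> rdim (ob ?A m) (src a) = 0" using sink by (auto simp: Ad simp del: shift_simps)
      then show "i m (tgt a) * rmap (ob ?A m) a = rmap (ob X m) a * i m (src a)"
        by (intro zero_size_eq[of _ "rdim (ob X m) (tgt a)" "rdim (ob ?A m) (src a)"])
          (use ic[of m "tgt a"] ic[of m "src a"] is_repD[OF bcomplexD(1)[OF X, of m], of a] is_repD[OF bcomplexD(1)[OF A, of m], of a] in \<open>auto simp del: shift_simps\<close>)
    qed
    fix w
    have "rdim (ob X (m + 1)) w = 0 \<or> rdim (ob ?A m) w = 0" using top by (auto simp: Ad simp del: shift_simps)
    then show "i (m + 1) w * df ?A m w = df X m w * i m w"
      by (intro zero_size_eq[of _ "rdim (ob X (m + 1)) w" "rdim (ob ?A m) w"])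
        (use ic[of "m + 1" w] ic[of m w] bcomplexD(3)[OF X, of m w] bcomplexD(3)[OF A, of m w] in \<open>auto simp del: shift_simps\<close>)
  qed
  have ex: "split_exact (rdim (ob ?A m) w) (rdim (ob X m) w) (rdim (ob Q m) w) (i m w) (p m w)" for m w
    unfolding Ad Q(3) using d by (simp add: i_def p_def d'_def split_exact_last split_exact_zero_id)
  have "ses ?A X Q i p" unfolding ses_def using A X Q(1,2) ich ex by blast
  then show ?thesis using Q(3) by (intro exI[of _ Q] exI[of _ i] exI[of _ p]) (simp add: d'_def)
qed

definition support :: "'k::field cpx \<Rightarrow> (int \<times> vertex) set" where
  "support X = {q. rdim (ob X (fst q)) (snd q) \<noteq> 0}"

definition total_dim :: "'k::field cpx \<Rightarrow> nat" where
  "total_dim X = (\<Sum>q\<in>support X. rdim (ob X (fst q)) (snd q))"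

lemma finite_support:
  assumes "bcomplex X"
  shows "finite (support X)"
proof -
  obtain N where N: "\<And>n v. \<bar>n\<bar> > N \<Longrightarrow> rdim (ob X n) v = 0" using bcomplex_bounded[OF assms] by blast
  have "support X \<subseteq> {- N..N} \<times> UNIV"
  proof
    fix q assume q: "q \<in> support X"
    have "\<not> \<bar>fst q\<bar> > N" using N[of "fst q" "snd q"] q by (auto simp: support_def)
    then show "q \<in> {- N..N} \<times> UNIV" by (cases q) auto
  qed
  then show ?thesis by (rule finite_subset) (auto simp: UNIV_vertex)
qed

lemma total_dim_less:
  assumes X: "bcomplex X" and le: "\<And>n v. rdim (ob Y n) v \<le> rdim (ob X n) v" and less: "rdim (ob Y n0) v0 < rdim (ob X n0) v0"
  shows "total_dim Y < total_dim X"
proof -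
  have sub: "support Y \<subseteq> support X"
  proof
    fix q assume "q \<in> support Y"
    then show "q \<in> support X" using le[of "fst q" "snd q"] by (auto simp: support_def)
  qed
  have "total_dim Y = (\<Sum>q\<in>support X. rdim (ob Y (fst q)) (snd q))"
    unfolding total_dim_def by (rule sum.mono_neutral_left[OF finite_support[OF X] sub]) (auto simp: support_def)
  also have "\<dots> < total_dim X" unfolding total_dim_def
  proof (rule sum_strict_mono_ex1[OF finite_support[OF X]])
    show "\<forall>q\<in>support X. rdim (ob Y (fst q)) (snd q) \<le> rdim (ob X (fst q)) (snd q)" using le by blast
    have "(n0, v0) \<in> support X" using less by (simp add: support_def)
    then show "\<exists>q\<in>support X. rdim (ob Y (fst q)) (snd q) < rdim (ob X (fst q)) (snd q)"
      by (rule bexI[rotated]) (simp add: less)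
  qed
  finally show ?thesis .
qed

text \<open>
  All chain maps between complexes of zero spaces are isomorphisms, and the stalk of the zero
  representation belongs to \<open>S\<close>.
\<close>

lemma zero_complex_mem:
  assumes S: "triangulated_subcategory S" and X: "bcomplex X" and z: "\<And>n v. rdim (ob X n) v = 0"
  shows "X \<in> S"
proof -
  let ?Z = "stalk rzero"
  have Z: "bcomplex ?Z" by (rule stalk_bcomplex[OF rzero_is_rep])
  have zd: "rdim (ob ?Z n) v = 0" for n v by simp
  define h where "h = (\<lambda>(n::int) (v::vertex). 0\<^sub>m 0 0 :: 'a mat)"
  have c: "h \<in> chain_maps U V" if U: "bcomplex U" "\<And>n v. rdim (ob U n) v = 0" and V: "bcomplex V" "\<And>n v. rdim (ob V n) v = 0" for U V
  proof (rule chain_mapsI)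
    fix n
    show "h n \<in> rhom (ob U n) (ob V n)"
    proof (rule rhomI)
      show "h n v \<in> carrier_mat (rdim (ob V n) v) (rdim (ob U n) v)" for v using U(2) V(2) by (simp add: h_def)
      show "h n (tgt a) * rmap (ob U n) a = rmap (ob V n) a * h n (src a)" for a
        by (rule zero_size_eq[of _ 0 0]) (use is_repD[OF bcomplexD(1)[OF U(1), of n], of a] is_repD[OF bcomplexD(1)[OF V(1), of n], of a] U(2) V(2) in \<open>auto simp: h_def\<close>)
    qed
    show "h (n + 1) v * df U n v = df V n v * h n v" for v
      by (rule zero_size_eq[of _ 0 0]) (use bcomplexD(3)[OF U(1), of n v] bcomplexD(3)[OF V(1), of n v] U(2) V(2) in \<open>auto simp: h_def\<close>)
  qed
  have "ses ?Z ?Z X h h"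
    unfolding ses_def using Z X c[OF Z zd Z zd] c[OF Z zd X z] split_exact_zero_zero by (simp add: z h_def)
  then show ?thesis using ses_quotient_mem[OF S] triangulatedD(2)[OF S] by blast
qed

text \<open>
  Induction on the total dimension, with \<open>peel_simple\<close> applied in the highest degree at the first
  vertex with nonzero space in the order \<open>Ve\<close>, \<open>Vmid\<close>, \<open>Vb\<close>. The simple representations are \<open>E3 0\<close>, \<open>M\<close> and
  \<open>E1 0\<close>.
\<close>

lemma simples_generate:
  fixes S :: "'k::field cpx set"
  assumes S: "triangulated_subcategory S" and s: "stalk (E1 0) \<in> S" "stalk M \<in> S" "stalk (E3 0) \<in> S"
  shows "S = Collect bcomplex"
proof -
  have "X \<in> S" if "bcomplex X" for X :: "'k cpx"
    using that
  proof (induction "total_dim X" arbitrary: X rule: less_induct)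
    case less
    note X = less.prems
    show ?case
    proof (cases "support X = {}")
      case True
      then have "rdim (ob X n) v = 0" for n v by (auto simp: support_def)
      then show ?thesis by (rule zero_complex_mem[OF S X])
    next
      case False
      define n where "n = Max (fst ` support X)"
      have fin: "finite (fst ` support X)" and ne: "fst ` support X \<noteq> {}" using finite_support[OF X] False by auto
      have "n \<in> fst ` support X" unfolding n_def by (rule Max_in[OF fin ne])
      then obtain v1 where v1: "rdim (ob X n) v1 \<noteq> 0" by (auto simp: support_def)
      have top: "rdim (ob X (n + 1)) w = 0" for w
      proof (rule ccontr)
        assume "rdim (ob X (n + 1)) w \<noteq> 0"
        then have "n + 1 \<in> fst ` support X" by (intro image_eqI[of _ _ "(n + 1, w)"]) (auto simp: support_def)
        then have "n + 1 \<le> n" unfolding n_def by (rule Max_ge[OF fin])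
        then show False by simp
      qed
      define v where "v = (if rdim (ob X n) Ve \<noteq> 0 then Ve else if rdim (ob X n) Vmid \<noteq> 0 then Vmid else Vb)"
      have v: "rdim (ob X n) v \<noteq> 0" using v1 by (cases v1) (auto simp: v_def)
      have sink: "rdim (ob X n) (tgt a) = 0" if "src a = v" for a using that by (cases a) (auto simp: v_def split: if_splits)
      obtain d where d: "rdim (ob X n) v = Suc d" using v not0_implies_Suc by blast
      define T :: "'k rep" where "T = (case v of Vb \<Rightarrow> E1 0 | Vmid \<Rightarrow> M | Ve \<Rightarrow> E3 0)"
      have T: "is_rep T" "\<And>w. rdim T w = (if w = v then 1 else 0)" "stalk T \<in> S"
      proof -
        show "is_rep T" "stalk T \<in> S" using s by (cases v; simp add: T_def)+
        show "rdim T w = (if w = v then 1 else 0)" for w by (cases v; cases w; simp add: T_def)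
      qed
      obtain Y i p where Y: "ses (shift (- n) (stalk T)) X Y i p" "\<And>m w. rdim (ob Y m) w = (if m = n \<and> w = v then d else rdim (ob X m) w)"
        using peel_simple[OF X d top sink T(1,2)] by blast
      have "total_dim Y < total_dim X" by (rule total_dim_less[OF X, of _ n v]) (use Y(2) d in auto)
      moreover have "bcomplex Y" using Y(1) by (simp add: ses_def)
      ultimately have "Y \<in> S" by (rule less.hyps)
      then show ?thesis by (rule ses_middle_mem[OF S Y(1) triangulatedD(4)[OF S T(3)]])
    qed
  qed
  then show ?thesis using triangulatedD(1)[OF S] by blast
qed

section \<open>Euler characteristic\<close>

definition subspace_dim :: "nat \<Rightarrow> 'k::field vec set \<Rightarrow> nat" where
  "subspace_dim n U = vectorspace.dim class_ring (module_vec TYPE('k) n\<lparr>carrier := U\<rparr>)"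

lemma rank_nullity_mat:
  fixes A :: "'k::field mat"
  assumes A: "A \<in> carrier_mat nr nc"
  shows "subspace_dim nr ((\<lambda>x. A *\<^sub>v x) ` carrier_vec nc) + subspace_dim nc {x \<in> carrier_vec nc. A *\<^sub>v x = 0\<^sub>v nr} = nc"
proof -
  interpret V: vec_space "TYPE('k)" nc .
  interpret W: vec_space "TYPE('k)" nr .
  have "linear_map class_ring (module_vec TYPE('k) nc) (module_vec TYPE('k) nr) (\<lambda>x. A *\<^sub>v x)"
  proof (unfold linear_map_def mod_hom_def mod_hom_axioms_def module_hom_def, intro conjI CollectI)
    show "vectorspace class_ring (module_vec TYPE('k) nc)" "vectorspace class_ring (module_vec TYPE('k) nr)" by (rule vec_vs)+
    show "module class_ring (module_vec TYPE('k) nc)" "module class_ring (module_vec TYPE('k) nr)" by (rule vec_module)+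
  qed (use A in \<open>auto simp: module_vec_simps mult_add_distrib_mat_vec mult_mat_vec\<close>)
  then interpret L: linear_map class_ring "module_vec TYPE('k) nc" "module_vec TYPE('k) nr" "\<lambda>x. A *\<^sub>v x" .
  have "vectorspace.dim class_ring (module_vec TYPE('k) nr\<lparr>carrier := L.im\<rparr>) + vectorspace.dim class_ring (module_vec TYPE('k) nc\<lparr>carrier := L.ker\<rparr>) = V.dim"
    using L.rank_nullity[OF V.fin_dim] by simp
  then show ?thesis unfolding subspace_dim_def L.im_def L.ker_def by (simp add: V.dim_is_n module_vec_simps)
qed

definition deg_sign :: "int \<Rightarrow> int" where
  "deg_sign n = (if even n then 1 else - 1)"

lemma deg_sign_simps[simp]: "deg_sign (n + 1) = - deg_sign n" "deg_sign 0 = 1" "deg_sign (m - n) = deg_sign m * deg_sign n"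
  by (simp_all add: deg_sign_def)

text \<open>
  The sum ranges over the degrees with nonzero space, which are finitely many for a bounded complex, so
  that no bound has to be chosen.
\<close>

definition euler_char :: "'k::field cpx \<Rightarrow> vertex \<Rightarrow> int" where
  "euler_char X v = (\<Sum>n | rdim (ob X n) v \<noteq> 0. deg_sign n * int (rdim (ob X n) v))"

lemma euler_char_bound:
  assumes "bcomplex X"
  obtains N where "N \<ge> 0" "\<And>n v. \<bar>n\<bar> > N \<Longrightarrow> rdim (ob X n) v = 0"
    "\<And>A v. finite A \<Longrightarrow> {- N..N} \<subseteq> A \<Longrightarrow> euler_char X v = (\<Sum>n\<in>A. deg_sign n * int (rdim (ob X n) v))"
proof -
  obtain N0 where N0: "\<And>n v. \<bar>n\<bar> > N0 \<Longrightarrow> rdim (ob X n) v = 0" using bcomplex_bounded[OF assms] by blast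
  define N where "N = max 0 N0"
  have N: "rdim (ob X n) v = 0" if "\<bar>n\<bar> > N" for n v using N0[of n v] that by (simp add: N_def)
  have "euler_char X v = (\<Sum>n\<in>A. deg_sign n * int (rdim (ob X n) v))" if A: "finite A" "{- N..N} \<subseteq> A" for A v
    unfolding euler_char_def
  proof (rule sum.mono_neutral_left[OF A(1)])
    show "{n. rdim (ob X n) v \<noteq> 0} \<subseteq> A"
    proof
      fix n assume "n \<in> {n. rdim (ob X n) v \<noteq> 0}"
      then have "\<not> \<bar>n\<bar> > N" using N[of n v] by auto
      then have "n \<in> {- N..N}" by auto
      then show "n \<in> A" using A(2) by blast
    qed
  qed simp
  moreover have "N \<ge> 0" by (simp add: N_def)
  ultimately show ?thesis using that N by blast
qed

lemma euler_char_shift: "euler_char (shift p X) v = deg_sign p * euler_char X v"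
proof -
  have "euler_char (shift p X) v = (\<Sum>n | rdim (ob X n) v \<noteq> 0. deg_sign (n - p) * int (rdim (ob X n) v))"
    unfolding euler_char_def by (rule sum.reindex_bij_witness[of _ "\<lambda>n. n - p" "\<lambda>n. n + p"]) (auto simp: algebra_simps)
  also have "\<dots> = deg_sign p * euler_char X v"
    unfolding euler_char_def sum_distrib_left by (rule sum.cong) (auto simp: deg_sign_def)
  finally show ?thesis .
qed

lemma euler_char_stalk: "euler_char (stalk A) v = int (rdim A v)"
proof -
  have "euler_char (stalk A) v = (\<Sum>n\<in>{0}. deg_sign n * int (rdim (ob (stalk A) n) v))"
    unfolding euler_char_def by (rule sum.mono_neutral_left) (auto split: if_splits)
  then show ?thesis by simp
qed

lemma euler_char_cone:
  assumes X: "bcomplex X" and Y: "bcomplex Y" and f: "f \<in> chain_maps X Y"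
  shows "euler_char (mapping_cone X Y f) v = euler_char Y v - euler_char X v"
proof -
  let ?C = "mapping_cone X Y f"
  obtain N1 where N1: "\<And>A v. finite A \<Longrightarrow> {- N1..N1} \<subseteq> A \<Longrightarrow> euler_char (shift 1 X) v = (\<Sum>n\<in>A. deg_sign n * int (rdim (ob (shift 1 X) n) v))"
    using euler_char_bound[OF shift_bcomplex[OF X, of 1]] by metis
  obtain N2 where N2: "\<And>A v. finite A \<Longrightarrow> {- N2..N2} \<subseteq> A \<Longrightarrow> euler_char Y v = (\<Sum>n\<in>A. deg_sign n * int (rdim (ob Y n) v))"
    using euler_char_bound[OF Y] by metis
  obtain N3 where N3: "\<And>A v. finite A \<Longrightarrow> {- N3..N3} \<subseteq> A \<Longrightarrow> euler_char ?C v = (\<Sum>n\<in>A. deg_sign n * int (rdim (ob ?C n) v))"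
    using euler_char_bound[OF cone_bcomplex[OF X Y f]] by metis
  let ?A = "{- (max N1 (max N2 N3))..max N1 (max N2 N3)}"
  have "euler_char ?C v = (\<Sum>n\<in>?A. deg_sign n * int (rdim (ob ?C n) v))" by (rule N3) auto
  also have "\<dots> = (\<Sum>n\<in>?A. deg_sign n * int (rdim (ob (shift 1 X) n) v)) + (\<Sum>n\<in>?A. deg_sign n * int (rdim (ob Y n) v))"
    unfolding sum.distrib[symmetric] by (rule sum.cong) (simp_all add: algebra_simps)
  also have "(\<Sum>n\<in>?A. deg_sign n * int (rdim (ob (shift 1 X) n) v)) = euler_char (shift 1 X) v" by (rule N1[symmetric]) auto
  also have "(\<Sum>n\<in>?A. deg_sign n * int (rdim (ob Y n) v)) = euler_char Y v" by (rule N2[symmetric]) auto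
  finally show ?thesis by (simp add: euler_char_shift deg_sign_def)
qed

text \<open>
  By rank and nullity the dimension in degree \<open>n\<close> is \<open>b n + b (n + 1)\<close>, where \<open>b n\<close> is the dimension of the
  coboundaries, and the alternating sum telescopes.
\<close>

lemma euler_char_acyclic:
  assumes X: "bcomplex X" and ac: "\<And>n v. cocycles X n v = coboundaries X n v"
  shows "euler_char X v = 0"
proof -
  define b where "b n = subspace_dim (rdim (ob X n) v) (coboundaries X n v)" for n
  have rb: "rdim (ob X n) v = b (n + 1) + b n" for n
    using rank_nullity_mat[OF bcomplexD(3)[OF X, of n v]] ac[of n v] by (simp add: b_def coboundaries_def cocycles_def)
  obtain N where N: "N \<ge> 0" "\<And>n v. \<bar>n\<bar> > N \<Longrightarrow> rdim (ob X n) v = 0"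
    "\<And>A v. finite A \<Longrightarrow> {- N..N} \<subseteq> A \<Longrightarrow> euler_char X v = (\<Sum>n\<in>A. deg_sign n * int (rdim (ob X n) v))"
    using euler_char_bound[OF X] by metis
  define g where "g n = deg_sign n * int (b n)" for n
  have g0: "g (- N) = 0" "g (N + 1) = 0" using N(1) N(2)[of "- N - 1" v] N(2)[of "N + 1" v] rb[of "- N - 1"] rb[of "N + 1"] by (simp_all add: g_def)
  have "euler_char X v = (\<Sum>n\<in>{- N..N}. g n - g (n + 1))"
    unfolding N(3)[of "{- N..N}", simplified] by (rule sum.cong) (simp_all add: rb g_def algebra_simps)
  also have "\<dots> = (\<Sum>n\<in>{- N..N}. g n) - (\<Sum>n\<in>{- N..N}. g (n + 1))" by (rule sum_subtractf)
  also have "(\<Sum>n\<in>{- N..N}. g (n + 1)) = (\<Sum>n\<in>{- N + 1..N + 1}. g n)"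
    by (rule sum.reindex_bij_witness[of _ "\<lambda>n. n - 1" "\<lambda>n. n + 1"]) auto
  also have "(\<Sum>n\<in>{- N + 1..N + 1}. g n) = (\<Sum>n\<in>{- N..N + 1}. g n)"
  proof (rule sum.mono_neutral_left)
    show "\<forall>i\<in>{- N..N + 1} - {- N + 1..N + 1}. g i = 0"
    proof
      fix i assume "i \<in> {- N..N + 1} - {- N + 1..N + 1}"
      then have "i = - N" by auto
      then show "g i = 0" using g0 by simp
    qed
  qed auto
  also have "(\<Sum>n\<in>{- N..N}. g n) = (\<Sum>n\<in>{- N..N + 1}. g n)"
  proof (rule sum.mono_neutral_left)
    show "\<forall>i\<in>{- N..N + 1} - {- N..N}. g i = 0"
    proof
      fix i assume "i \<in> {- N..N + 1} - {- N..N}"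
      then have "i = N + 1" by auto
      then show "g i = 0" using g0 by simp
    qed
  qed auto
  finally show ?thesis by simp
qed

section \<open>The Euler characteristic under derived isomorphisms\<close>

lemma coboundariesD:
  assumes X: "bcomplex X" and x: "x \<in> coboundaries X n v"
  shows "x \<in> carrier_vec (rdim (ob X n) v)" "x \<in> cocycles X n v"
proof -
  obtain y where y: "y \<in> carrier_vec (rdim (ob X (n - 1)) v)" "x = df X (n - 1) v *\<^sub>v y" using x by (auto simp: coboundaries_def)
  note c = bcomplexD(3)[OF X, of "n - 1" v, simplified] bcomplexD(3)[OF X, of n v]
  have e: "df X n v * df X (n - 1) v = 0\<^sub>m (rdim (ob X (n + 1)) v) (rdim (ob X (n - 1)) v)"
    using bcomplexD(4)[OF X, of "n - 1" v] by (simp add: add.commute)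
  show 1: "x \<in> carrier_vec (rdim (ob X n) v)" using c y by auto
  have "df X n v *\<^sub>v x = df X n v * df X (n - 1) v *\<^sub>v y" unfolding y(2) using c y(1) by simp
  also have "\<dots> = 0\<^sub>v (rdim (ob X (n + 1)) v)" unfolding e using y(1) by (simp add: zero_mat_mult_vec)
  finally show "x \<in> cocycles X n v" using 1 by (simp add: cocycles_def)
qed

lemma coboundaries_add:
  assumes X: "bcomplex X" and x: "x \<in> coboundaries X n v" and y: "y \<in> coboundaries X n v"
  shows "x + y \<in> coboundaries X n v"
proof -
  obtain x' where x': "x' \<in> carrier_vec (rdim (ob X (n - 1)) v)" "x = df X (n - 1) v *\<^sub>v x'" using x by (auto simp: coboundaries_def)
  obtain y' where y': "y' \<in> carrier_vec (rdim (ob X (n - 1)) v)" "y = df X (n - 1) v *\<^sub>v y'" using y by (auto simp: coboundaries_def)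
  have "x + y = df X (n - 1) v *\<^sub>v (x' + y')"
    unfolding x'(2) y'(2) by (rule mult_add_distrib_mat_vec[symmetric, OF bcomplexD(3)[OF X, of "n - 1" v] x'(1) y'(1)])
  then show ?thesis unfolding coboundaries_def using x'(1) y'(1) by (intro image_eqI[of _ _ "x' + y'"]) auto
qed

lemma coboundaries_uminus:
  assumes X: "bcomplex X" and x: "x \<in> coboundaries X n v"
  shows "- x \<in> coboundaries X n v"
proof -
  obtain x' where x': "x' \<in> carrier_vec (rdim (ob X (n - 1)) v)" "x = df X (n - 1) v *\<^sub>v x'" using x by (auto simp: coboundaries_def)
  have "- x = df X (n - 1) v *\<^sub>v (- x')" unfolding x'(2) using x'(1) bcomplexD(3)[OF X, of "n - 1" v] by (intro eq_vecI) (auto simp: scalar_prod_def sum_negf)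
  then show ?thesis unfolding coboundaries_def using x'(1) by (intro image_eqI[of _ _ "- x'"]) auto
qed

lemma coboundary_diff_sym:
  assumes X: "bcomplex X" and "x \<in> carrier_vec (rdim (ob X n) v)" "y \<in> carrier_vec (rdim (ob X n) v)" and d: "x - y \<in> coboundaries X n v"
  shows "y - x \<in> coboundaries X n v"
proof -
  have "y - x = - (x - y)" using assms(2,3) by (intro eq_vecI) auto
  then show ?thesis using coboundaries_uminus[OF X d] by simp
qed

lemma coboundary_diff_trans:
  assumes X: "bcomplex X" and "x \<in> carrier_vec (rdim (ob X n) v)" "y \<in> carrier_vec (rdim (ob X n) v)" "z \<in> carrier_vec (rdim (ob X n) v)"
    and d: "x - y \<in> coboundaries X n v" "y - z \<in> coboundaries X n v"
  shows "x - z \<in> coboundaries X n v"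
proof -
  have "x - z = (x - y) + (y - z)" using assms(2-4) by (intro eq_vecI) auto
  then show ?thesis using coboundaries_add[OF X d] by simp
qed

lemma coboundary_diff_mem:
  assumes X: "bcomplex X" and "x \<in> carrier_vec (rdim (ob X n) v)" "y \<in> carrier_vec (rdim (ob X n) v)" and d: "x - y \<in> coboundaries X n v"
    and y: "y \<in> coboundaries X n v"
  shows "x \<in> coboundaries X n v"
proof -
  have "x = (x - y) + y" using assms(2,3) by (intro eq_vecI) auto
  then show ?thesis using coboundaries_add[OF X d y] by simp
qed

lemma chain_map_vec:
  assumes X: "bcomplex X" and Y: "bcomplex Y" and f: "f \<in> chain_maps X Y" and x: "x \<in> carrier_vec (rdim (ob X n) v)"
  shows "f n v *\<^sub>v x \<in> carrier_vec (rdim (ob Y n) v)" "f (n + 1) v *\<^sub>v (df X n v *\<^sub>v x) = df Y n v *\<^sub>v (f n v *\<^sub>v x)"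
proof -
  note c = chain_mapsD(2)[OF f, of n v] chain_mapsD(2)[OF f, of "n + 1" v] bcomplexD(3)[OF X, of n v] bcomplexD(3)[OF Y, of n v]
  show "f n v *\<^sub>v x \<in> carrier_vec (rdim (ob Y n) v)" using c x by auto
  show "f (n + 1) v *\<^sub>v (df X n v *\<^sub>v x) = df Y n v *\<^sub>v (f n v *\<^sub>v x)"
    using c x chain_mapsD(3)[OF f, of n v] by (metis assoc_mult_mat_vec)
qed

lemma chain_map_cocycle:
  assumes X: "bcomplex X" and Y: "bcomplex Y" and f: "f \<in> chain_maps X Y" and x: "x \<in> cocycles X n v"
  shows "f n v *\<^sub>v x \<in> cocycles Y n v"
proof -
  have c: "x \<in> carrier_vec (rdim (ob X n) v)" "df X n v *\<^sub>v x = 0\<^sub>v (rdim (ob X (n + 1)) v)" using x by (auto simp: cocycles_def)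
  have "f (n + 1) v *\<^sub>v 0\<^sub>v (rdim (ob X (n + 1)) v) = 0\<^sub>v (rdim (ob Y (n + 1)) v)"
    using chain_mapsD(2)[OF f, of "n + 1" v] by (intro eq_vecI) auto
  then show ?thesis using chain_map_vec[OF X Y f c(1)] c(2) by (simp add: cocycles_def)
qed

lemma chain_map_coboundary:
  assumes X: "bcomplex X" and Y: "bcomplex Y" and f: "f \<in> chain_maps X Y" and x: "x \<in> coboundaries X n v"
  shows "f n v *\<^sub>v x \<in> coboundaries Y n v"
proof -
  obtain y where y: "y \<in> carrier_vec (rdim (ob X (n - 1)) v)" "x = df X (n - 1) v *\<^sub>v y" using x by (auto simp: coboundaries_def)
  have "f n v *\<^sub>v x = df Y (n - 1) v *\<^sub>v (f (n - 1) v *\<^sub>v y)" using chain_map_vec(2)[OF X Y f y(1)] by (simp add: y(2))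
  then show ?thesis unfolding coboundaries_def using chain_map_vec(1)[OF X Y f y(1)] by (intro image_eqI) auto
qed

lemma chain_map_diff:
  assumes X: "bcomplex X" and Y: "bcomplex Y" and f: "f \<in> chain_maps X Y" and x: "x \<in> carrier_vec (rdim (ob X n) v)" "y \<in> carrier_vec (rdim (ob X n) v)"
    and d: "x - y \<in> coboundaries X n v"
  shows "f n v *\<^sub>v x - f n v *\<^sub>v y \<in> coboundaries Y n v"
  using chain_map_coboundary[OF X Y f d] unfolding mult_minus_distrib_mat_vec[OF chain_mapsD(2)[OF f] x] .

text \<open>
  On cocycles the summand \<open>h d\<close> of a homotopy vanishes, and the summand \<open>d h\<close> is a coboundary.
\<close>

lemma homotopic_diff:
  assumes X: "bcomplex X" and Y: "bcomplex Y" and g: "g \<in> chain_maps X Y" and h: "homotopic X Y f g" and x: "x \<in> cocycles X n v"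
  shows "f n v *\<^sub>v x - g n v *\<^sub>v x \<in> coboundaries Y n v"
proof -
  obtain k where k: "\<And>n. k n \<in> rhom (ob X n) (ob Y (n - 1))"
    and e: "\<And>n v. f n v = g n v + ((df Y (n - 1) \<star> k n) v + (k (n + 1) \<star> df X n) v)" using h unfolding homotopic_def by blast
  have c: "x \<in> carrier_vec (rdim (ob X n) v)" "df X n v *\<^sub>v x = 0\<^sub>v (rdim (ob X (n + 1)) v)" using x by (auto simp: cocycles_def)
  note d = rhomD[OF k, of n v] rhomD[OF k, of "n + 1" v, simplified] bcomplexD(3)[OF X, of n v] bcomplexD(3)[OF Y, of "n - 1" v, simplified] chain_mapsD(2)[OF g, of n v]
  have kx: "k n v *\<^sub>v x \<in> carrier_vec (rdim (ob Y (n - 1)) v)" using d c(1) by auto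
  have z: "k (n + 1) v *\<^sub>v 0\<^sub>v (rdim (ob X (n + 1)) v) = 0\<^sub>v (rdim (ob Y n) v)" using d(2) by (intro eq_vecI) auto
  have m: "df Y (n - 1) v * k n v \<in> carrier_mat (rdim (ob Y n) v) (rdim (ob X n) v)" "k (n + 1) v * df X n v \<in> carrier_mat (rdim (ob Y n) v) (rdim (ob X n) v)"
    using d by auto
  have "f n v *\<^sub>v x = g n v *\<^sub>v x + ((df Y (n - 1) v * k n v) *\<^sub>v x + (k (n + 1) v * df X n v) *\<^sub>v x)"
    unfolding e[of n v] mcomp_def add_mult_distrib_mat_vec[OF d(5) add_carrier_mat[OF m(2)] c(1)] add_mult_distrib_mat_vec[OF m c(1)] ..
  also have "(df Y (n - 1) v * k n v) *\<^sub>v x = df Y (n - 1) v *\<^sub>v (k n v *\<^sub>v x)" using d c(1) by simp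
  also have "(k (n + 1) v * df X n v) *\<^sub>v x = 0\<^sub>v (rdim (ob Y n) v)"
    unfolding assoc_mult_mat_vec[OF d(2,3) c(1)] c(2) z ..
  finally have "f n v *\<^sub>v x - g n v *\<^sub>v x = df Y (n - 1) v *\<^sub>v (k n v *\<^sub>v x)"
    using d c(1) kx by (intro eq_vecI) auto
  then show ?thesis unfolding coboundaries_def using kx by (intro image_eqI) auto
qed

lemma quasi_isoD:
  assumes "f \<in> quasi_isos X Y"
  shows "f \<in> chain_maps X Y" "x \<in> cocycles X n v \<Longrightarrow> f n v *\<^sub>v x \<in> coboundaries Y n v \<Longrightarrow> x \<in> coboundaries X n v"
    "y \<in> cocycles Y n v \<Longrightarrow> \<exists>x\<in>cocycles X n v. y - f n v *\<^sub>v x \<in> coboundaries Y n v"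
  using assms unfolding quasi_isos_def by blast+

lemma cocycles_carrier: "x \<in> cocycles X n v \<Longrightarrow> x \<in> carrier_vec (rdim (ob X n) v)"
  by (simp add: cocycles_def)

lemma ccomp_vec:
  assumes "bcomplex X" "bcomplex Y" "bcomplex Z" "f \<in> chain_maps X Y" "g \<in> chain_maps Y Z" "x \<in> carrier_vec (rdim (ob X n) v)"
  shows "(g \<star>\<^sub>c f) n v *\<^sub>v x = g n v *\<^sub>v (f n v *\<^sub>v x)"
  unfolding ccomp_def mcomp_def by (rule assoc_mult_mat_vec[OF chain_mapsD(2)[OF assms(5)] chain_mapsD(2)[OF assms(4)] assms(6)])

text \<open>
  The cone of a quasi-isomorphism is acyclic: injectivity on cohomology makes the first component of a cocycle
  of the cone a coboundary, and surjectivity corrects the second one.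
\<close>

lemma euler_char_quasi_iso:
  assumes X: "bcomplex X" and Y: "bcomplex Y" and q: "f \<in> quasi_isos X Y"
  shows "euler_char X v = euler_char Y v"
proof -
  note f = quasi_isoD(1)[OF q]
  let ?C = "mapping_cone X Y f"
  have C: "bcomplex ?C" by (rule cone_bcomplex[OF X Y f])
  have "w \<in> coboundaries ?C n v" if w: "w \<in> cocycles ?C n v" for n v w
  proof -
    obtain x y where xy: "x \<in> carrier_vec (rdim (ob X (n + 1)) v)" "y \<in> carrier_vec (rdim (ob Y n) v)" "w = x @\<^sub>v y"
      using w split_vec[of w "rdim (ob X (n + 1)) v" "rdim (ob Y n) v"] by (auto simp: cocycles_def)
    have zero: "0\<^sub>v (rdim (ob ?C (n + 1)) v) = 0\<^sub>v (rdim (ob X (n + 1 + 1)) v) @\<^sub>v (0\<^sub>v (rdim (ob Y (n + 1)) v) :: 'a vec)"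
      by (intro eq_vecI) auto
    note dX = bcomplexD(3)[OF X, of "n + 1" v] and dX' = bcomplexD(3)[OF X, of n v] and dY = bcomplexD(3)[OF Y, of n v] and dY' = bcomplexD(3)[OF Y, of "n - 1" v, simplified]
    have fx: "f (n + 1) v *\<^sub>v x \<in> carrier_vec (rdim (ob Y (n + 1)) v)" by (rule chain_map_vec(1)[OF X Y f xy(1)])
    have dy: "df Y n v *\<^sub>v y \<in> carrier_vec (rdim (ob Y (n + 1)) v)" using dY xy(2) by auto
    have "df ?C n v *\<^sub>v w = 0\<^sub>v (rdim (ob ?C (n + 1)) v)" using w by (simp add: cocycles_def del: cone_simps)
    then have "(- (df X (n + 1) v *\<^sub>v x)) @\<^sub>v (f (n + 1) v *\<^sub>v x + df Y n v *\<^sub>v y) = 0\<^sub>v (rdim (ob X (n + 1 + 1)) v) @\<^sub>v 0\<^sub>v (rdim (ob Y (n + 1)) v)"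
      unfolding zero xy(3) cone_df_vec[OF X Y f xy(1,2)] .
    then have z: "- (df X (n + 1) v *\<^sub>v x) = 0\<^sub>v (rdim (ob X (n + 1 + 1)) v)" "f (n + 1) v *\<^sub>v x + df Y n v *\<^sub>v y = 0\<^sub>v (rdim (ob Y (n + 1)) v)"
      using dX xy(1) by (subst (asm) append_vec_eq[of _ "rdim (ob X (n + 1 + 1)) v"]; auto)+
    have "df X (n + 1) v *\<^sub>v x = - (- (df X (n + 1) v *\<^sub>v x))" by simp
    then have cx: "x \<in> cocycles X (n + 1) v" using xy(1) unfolding z(1) by (simp add: cocycles_def)
    have "f (n + 1) v *\<^sub>v x = - (df Y n v *\<^sub>v y)" by (rule vec_eq_uminus_of_add_zero[OF z(2) fx dy])
    moreover have "df Y n v *\<^sub>v y \<in> coboundaries Y (n + 1) v" using xy(2) by (auto simp: coboundaries_def)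
    ultimately have "x \<in> coboundaries X (n + 1) v" using quasi_isoD(2)[OF q cx] coboundaries_uminus[OF Y] by simp
    then obtain x' where x': "x' \<in> carrier_vec (rdim (ob X n) v)" "x = df X n v *\<^sub>v x'" by (auto simp: coboundaries_def)
    have fx': "f n v *\<^sub>v x' \<in> carrier_vec (rdim (ob Y n) v)" by (rule chain_map_vec(1)[OF X Y f x'(1)])
    have "df Y n v *\<^sub>v (f n v *\<^sub>v x' + y) = 0\<^sub>v (rdim (ob Y (n + 1)) v)"
      unfolding mult_add_distrib_mat_vec[OF dY fx' xy(2)] using z(2) chain_map_vec(2)[OF X Y f x'(1)] x'(2) by simp
    then have "f n v *\<^sub>v x' + y \<in> cocycles Y n v" using fx' xy(2) by (simp add: cocycles_def)
    then obtain x'' where x'': "x'' \<in> cocycles X n v" "f n v *\<^sub>v x' + y - f n v *\<^sub>v x'' \<in> coboundaries Y n v" using quasi_isoD(3)[OF q] by blast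
    then obtain y' where y': "y' \<in> carrier_vec (rdim (ob Y (n - 1)) v)" "f n v *\<^sub>v x' + y - f n v *\<^sub>v x'' = df Y (n - 1) v *\<^sub>v y'"
      by (auto simp: coboundaries_def)
    have x2: "x'' \<in> carrier_vec (rdim (ob X n) v)" "df X n v *\<^sub>v x'' = 0\<^sub>v (rdim (ob X (n + 1)) v)" using x''(1) by (auto simp: cocycles_def)
    have fx2: "f n v *\<^sub>v x'' \<in> carrier_vec (rdim (ob Y n) v)" by (rule chain_map_vec(1)[OF X Y f x2(1)])
    have d: "x'' - x' \<in> carrier_vec (rdim (ob X n) v)" using x2(1) x'(1) by simp
    have cancel: "P - Q + (Q + y - P) = y"
      if "P \<in> carrier_vec r" "Q \<in> carrier_vec r" "y \<in> carrier_vec r" for P Q y :: "'a vec" and r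
      using that by (intro eq_vecI) auto
    have "f n v *\<^sub>v (x'' - x') + df Y (n - 1) v *\<^sub>v y' = y"
      unfolding mult_minus_distrib_mat_vec[OF chain_mapsD(2)[OF f] x2(1) x'(1)] y'(2)[symmetric]
      by (rule cancel[OF fx2 fx' xy(2)])
    moreover have "- (df X n v *\<^sub>v (x'' - x')) = x"
      unfolding mult_minus_distrib_mat_vec[OF dX' x2(1) x'(1)] x2(2) x'(2)[symmetric] using xy(1) by (intro eq_vecI) auto
    ultimately have "w = df ?C (n - 1) v *\<^sub>v ((x'' - x') @\<^sub>v y')"
      using cone_df_vec[OF X Y f, of "x'' - x'" "n - 1" v y'] d y'(1) by (simp add: xy(3) del: cone_simps)
    then show ?thesis unfolding coboundaries_def using d y'(1) by (intro image_eqI[of _ _ "(x'' - x') @\<^sub>v y'"]) auto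
  qed
  then have "cocycles ?C n v = coboundaries ?C n v" for n v using coboundariesD(2)[OF C] by blast
  then show ?thesis using euler_char_acyclic[OF C, of v] euler_char_cone[OF X Y f, of v] by simp
qed

text \<open>
  Consider the maps on cohomology. Let \<open>s\<close> and \<open>f\<close> be the legs of the roof \<open>\<phi>\<close>, and \<open>t\<close> and \<open>g\<close> those of its
  inverse \<open>\<psi>\<close>. One composite of the roofs gives \<open>f w' a'\<close> homotopic to a quasi-isomorphism, so \<open>f\<close> is surjective.
  In the other one, \<open>g w a\<close> is homotopic to the quasi-isomorphism \<open>s u a\<close>, where \<open>f u\<close> and \<open>t w\<close> are
  homotopic; a class in the kernel of \<open>f\<close> has the form \<open>u a x\<close>, then \<open>w a x\<close> is zero since \<open>t\<close> is injective,
  and so is \<open>x\<close>.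
\<close>

lemma derived_iso_right_leg:
  assumes iso: "derived_iso X Y"
  shows "\<exists>Z s f. bcomplex Z \<and> s \<in> quasi_isos Z X \<and> f \<in> quasi_isos Z Y"
proof -
  have X: "bcomplex X" and Y: "bcomplex Y" using iso by (auto simp: derived_iso_def)
  obtain Z s f W t g \<chi> \<chi>' where r: "(Z, s, f) \<in> roofs X Y" "(W, t, g) \<in> roofs Y X"
    and c: "roof_comp Y (Z, s, f) (W, t, g) \<chi>" "roof_eq X X \<chi> (roof_id X)"
    and c': "roof_comp X (W, t, g) (Z, s, f) \<chi>'" "roof_eq Y Y \<chi>' (roof_id Y)"
    using iso unfolding derived_iso_def by (metis prod_cases3)
  have Z: "bcomplex Z" and s: "s \<in> quasi_isos Z X" and f: "f \<in> chain_maps Z Y"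
    and W: "bcomplex W" and t: "t \<in> quasi_isos W Y" and g: "g \<in> chain_maps W X" using r by (auto simp: roofs_def)
  obtain V u w where V: "bcomplex V" and u: "u \<in> quasi_isos V Z" and w: "w \<in> chain_maps V W"
    and h1: "homotopic V Y (f \<star>\<^sub>c u) (t \<star>\<^sub>c w)" and \<chi>: "\<chi> = (V, s \<star>\<^sub>c u, g \<star>\<^sub>c w)" using c(1) by auto
  obtain U a b where U: "bcomplex U" and a: "a \<in> chain_maps U V" and b: "b \<in> chain_maps U X"
    and q1: "s \<star>\<^sub>c u \<star>\<^sub>c a \<in> quasi_isos U X" and h2: "homotopic U X (s \<star>\<^sub>c u \<star>\<^sub>c a) (cid X \<star>\<^sub>c b)"
    and h3: "homotopic U X (g \<star>\<^sub>c w \<star>\<^sub>c a) (cid X \<star>\<^sub>c b)" using c(2) unfolding \<chi> roof_id_def by auto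
  obtain V' u' w' where V': "bcomplex V'" and u': "u' \<in> quasi_isos V' W" and w': "w' \<in> chain_maps V' Z"
    and \<chi>': "\<chi>' = (V', t \<star>\<^sub>c u', f \<star>\<^sub>c w')" using c'(1) by auto
  obtain U' a' b' where U': "bcomplex U'" and a': "a' \<in> chain_maps U' V'" and b': "b' \<in> chain_maps U' Y"
    and q2: "t \<star>\<^sub>c u' \<star>\<^sub>c a' \<in> quasi_isos U' Y" and h2': "homotopic U' Y (t \<star>\<^sub>c u' \<star>\<^sub>c a') (cid Y \<star>\<^sub>c b')"
    and h3': "homotopic U' Y (f \<star>\<^sub>c w' \<star>\<^sub>c a') (cid Y \<star>\<^sub>c b')" using c'(2) unfolding \<chi>' roof_id_def by auto
  note s' = quasi_isoD(1)[OF s] and t' = quasi_isoD(1)[OF t] and uc = quasi_isoD(1)[OF u]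
  have cb: "cid X \<star>\<^sub>c b \<in> chain_maps U X" "cid Y \<star>\<^sub>c b' \<in> chain_maps U' Y"
    by (rule ccomp_chain_maps[OF U X X b cid_chain_maps[OF X]] ccomp_chain_maps[OF U' Y Y b' cid_chain_maps[OF Y]])+
  have sur: "\<exists>x\<in>cocycles Z n v. y - f n v *\<^sub>v x \<in> coboundaries Y n v" if y: "y \<in> cocycles Y n v" for n v y
  proof -
    obtain x where x: "x \<in> cocycles U' n v" "y - (t \<star>\<^sub>c u' \<star>\<^sub>c a') n v *\<^sub>v x \<in> coboundaries Y n v" using quasi_isoD(3)[OF q2 y] by blast
    note xc = cocycles_carrier[OF x(1)]
    let ?z = "w' n v *\<^sub>v (a' n v *\<^sub>v x)"
    have wa: "w' \<star>\<^sub>c a' \<in> chain_maps U' Z" by (rule ccomp_chain_maps[OF U' V' Z a' w'])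
    have fw: "f \<star>\<^sub>c w' \<in> chain_maps V' Y" by (rule ccomp_chain_maps[OF V' Z Y w' f])
    have fwa: "f \<star>\<^sub>c w' \<star>\<^sub>c a' \<in> chain_maps U' Y" by (rule ccomp_chain_maps[OF U' V' Y a' fw])
    have ac: "a' n v *\<^sub>v x \<in> carrier_vec (rdim (ob V' n) v)" by (rule chain_map_vec(1)[OF U' V' a' xc])
    have e: "(f \<star>\<^sub>c w' \<star>\<^sub>c a') n v *\<^sub>v x = f n v *\<^sub>v ?z" unfolding ccomp_vec[OF U' V' Y a' fw xc] ccomp_vec[OF V' Z Y w' f ac] ..
    have zc: "?z \<in> cocycles Z n v" by (rule chain_map_cocycle[OF V' Z w' chain_map_cocycle[OF U' V' a' x(1)]])
    let ?p = "(t \<star>\<^sub>c u' \<star>\<^sub>c a') n v *\<^sub>v x" and ?q = "(cid Y \<star>\<^sub>c b') n v *\<^sub>v x" and ?r = "(f \<star>\<^sub>c w' \<star>\<^sub>c a') n v *\<^sub>v x"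
    have carr: "?p \<in> carrier_vec (rdim (ob Y n) v)" "?q \<in> carrier_vec (rdim (ob Y n) v)" "?r \<in> carrier_vec (rdim (ob Y n) v)"
      using chain_map_vec(1)[OF U' Y quasi_isoD(1)[OF q2] xc] chain_map_vec(1)[OF U' Y cb(2) xc] chain_map_vec(1)[OF U' Y fwa xc] by blast+
    have "?p - ?q \<in> coboundaries Y n v" by (rule homotopic_diff[OF U' Y cb(2) h2' x(1)])
    moreover have "?q - ?r \<in> coboundaries Y n v" by (rule coboundary_diff_sym[OF Y carr(3,2) homotopic_diff[OF U' Y cb(2) h3' x(1)]])
    ultimately have "?p - ?r \<in> coboundaries Y n v" by (rule coboundary_diff_trans[OF Y carr])
    then have "y - ?r \<in> coboundaries Y n v" by (rule coboundary_diff_trans[OF Y cocycles_carrier[OF y] carr(1,3) x(2)])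
    then show ?thesis using zc unfolding e by blast
  qed
  have inj: "z \<in> coboundaries Z n v" if z: "z \<in> cocycles Z n v" "f n v *\<^sub>v z \<in> coboundaries Y n v" for n v z
  proof -
    note zc = cocycles_carrier[OF z(1)]
    have su: "s \<star>\<^sub>c u \<in> chain_maps V X" by (rule ccomp_chain_maps[OF V Z X uc s'])
    obtain x where x: "x \<in> cocycles U n v" "s n v *\<^sub>v z - (s \<star>\<^sub>c u \<star>\<^sub>c a) n v *\<^sub>v x \<in> coboundaries X n v"
      using quasi_isoD(3)[OF q1 chain_map_cocycle[OF Z X s' z(1)]] by blast
    note xc = cocycles_carrier[OF x(1)]
    let ?a = "a n v *\<^sub>v x"
    have ay: "?a \<in> cocycles V n v" by (rule chain_map_cocycle[OF U V a x(1)])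
    note ac = cocycles_carrier[OF ay]
    have uy: "u n v *\<^sub>v ?a \<in> cocycles Z n v" by (rule chain_map_cocycle[OF V Z uc ay])
    note ucar = cocycles_carrier[OF uy]
    have e: "(s \<star>\<^sub>c u \<star>\<^sub>c a) n v *\<^sub>v x = s n v *\<^sub>v (u n v *\<^sub>v ?a)" unfolding ccomp_vec[OF U V X a su xc] ccomp_vec[OF V Z X uc s' ac] ..
    have "s n v *\<^sub>v (z - u n v *\<^sub>v ?a) \<in> coboundaries X n v"
      unfolding mult_minus_distrib_mat_vec[OF chain_mapsD(2)[OF s'] zc ucar] using x(2) by (simp add: e)
    moreover have "z - u n v *\<^sub>v ?a \<in> cocycles Z n v"
      using z(1) uy unfolding cocycles_def by (auto simp: mult_minus_distrib_mat_vec[OF bcomplexD(3)[OF Z]])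
    ultimately have zu: "z - u n v *\<^sub>v ?a \<in> coboundaries Z n v" by (intro quasi_isoD(2)[OF s])
    have fu: "f n v *\<^sub>v (u n v *\<^sub>v ?a) \<in> coboundaries Y n v"
      by (rule coboundary_diff_mem[OF Y chain_map_vec(1)[OF Z Y f ucar] chain_map_vec(1)[OF Z Y f zc]
            chain_map_diff[OF Z Y f ucar zc coboundary_diff_sym[OF Z zc ucar zu]] z(2)])
    have tw: "t \<star>\<^sub>c w \<in> chain_maps V Y" by (rule ccomp_chain_maps[OF V W Y w t'])
    have fuc: "f \<star>\<^sub>c u \<in> chain_maps V Y" by (rule ccomp_chain_maps[OF V Z Y uc f])
    note hd = homotopic_diff[OF V Y tw h1 ay]
    have wy: "w n v *\<^sub>v ?a \<in> cocycles W n v" by (rule chain_map_cocycle[OF V W w ay])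
    have "(t \<star>\<^sub>c w) n v *\<^sub>v ?a \<in> coboundaries Y n v"
      by (rule coboundary_diff_mem[OF Y chain_map_vec(1)[OF V Y tw ac] chain_map_vec(1)[OF V Y fuc ac]
            coboundary_diff_sym[OF Y chain_map_vec(1)[OF V Y fuc ac] chain_map_vec(1)[OF V Y tw ac] hd]])
        (use fu ccomp_vec[OF V Z Y uc f ac] in simp)
    then have "w n v *\<^sub>v ?a \<in> coboundaries W n v" using quasi_isoD(2)[OF t wy] ccomp_vec[OF V W Y w t' ac] by simp
    then have gw0: "g n v *\<^sub>v (w n v *\<^sub>v ?a) \<in> coboundaries X n v" by (rule chain_map_coboundary[OF W X g])
    have gw: "g \<star>\<^sub>c w \<in> chain_maps V X" by (rule ccomp_chain_maps[OF V W X w g])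
    have gwa: "g \<star>\<^sub>c w \<star>\<^sub>c a \<in> chain_maps U X" by (rule ccomp_chain_maps[OF U V X a gw])
    let ?p = "(s \<star>\<^sub>c u \<star>\<^sub>c a) n v *\<^sub>v x" and ?q = "(cid X \<star>\<^sub>c b) n v *\<^sub>v x" and ?r = "(g \<star>\<^sub>c w \<star>\<^sub>c a) n v *\<^sub>v x"
    have carr: "?p \<in> carrier_vec (rdim (ob X n) v)" "?q \<in> carrier_vec (rdim (ob X n) v)" "?r \<in> carrier_vec (rdim (ob X n) v)"
      using chain_map_vec(1)[OF U X quasi_isoD(1)[OF q1] xc] chain_map_vec(1)[OF U X cb(1) xc] chain_map_vec(1)[OF U X gwa xc] by blast+
    have "?p - ?q \<in> coboundaries X n v" by (rule homotopic_diff[OF U X cb(1) h2 x(1)])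
    moreover have "?q - ?r \<in> coboundaries X n v" by (rule coboundary_diff_sym[OF X carr(3,2) homotopic_diff[OF U X cb(1) h3 x(1)]])
    ultimately have "?p - ?r \<in> coboundaries X n v" by (rule coboundary_diff_trans[OF X carr])
    moreover have "?r \<in> coboundaries X n v" using gw0 ccomp_vec[OF U V X a gw xc] ccomp_vec[OF V W X w g ac] by simp
    ultimately have "?p \<in> coboundaries X n v" by (rule coboundary_diff_mem[OF X carr(1,3)])
    then have "x \<in> coboundaries U n v" by (rule quasi_isoD(2)[OF q1 x(1)])
    then have "u n v *\<^sub>v ?a \<in> coboundaries Z n v" by (intro chain_map_coboundary[OF V Z uc] chain_map_coboundary[OF U V a])
    then show ?thesis by (rule coboundary_diff_mem[OF Z zc ucar zu])
  qed
  have "f \<in> quasi_isos Z Y" unfolding quasi_isos_def using f sur inj by blast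
  then show ?thesis using Z s by blast
qed

lemma euler_char_derived_iso:
  assumes "derived_iso X Y"
  shows "euler_char X v = euler_char Y v"
proof -
  obtain Z s f where "bcomplex Z" "s \<in> quasi_isos Z X" "f \<in> quasi_isos Z Y" using derived_iso_right_leg[OF assms] by blast
  moreover have "bcomplex X" "bcomplex Y" using assms by (auto simp: derived_iso_def)
  ultimately show ?thesis using euler_char_quasi_iso by metis
qed

lemma dist_triangle_bcomplex:
  "dist_triangle X Y Z \<Longrightarrow> bcomplex Z"
  by (auto simp: dist_triangle_def derived_iso_def)

text \<open>
  The Euler characteristic is invariant under derived isomorphisms, changes by a sign under shifts, and is
  additive on triangles.
\<close>

lemma linear_form_subcategory:
  fixes c :: "vertex \<Rightarrow> rat"
  shows "triangulated_subcategory {X :: 'k::field cpx. bcomplex X \<and> (\<Sum>v\<in>UNIV. c v * of_int (euler_char X v)) = 0}"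
    (is "triangulated_subcategory ?S")
proof -
  have tri: "Z \<in> ?S" if XY: "X \<in> ?S" "Y \<in> ?S" and d: "dist_triangle X Y Z" for X Y Z :: "'k cpx"
  proof -
    obtain X' Y' f where f: "bcomplex X'" "bcomplex Y'" "f \<in> chain_maps X' Y'"
      and i: "derived_iso X' X" "derived_iso Y' Y" "derived_iso (mapping_cone X' Y' f) Z" using d unfolding dist_triangle_def by blast
    have e: "euler_char Z v = euler_char Y v - euler_char X v" for v
      using euler_char_cone[OF f, of v] euler_char_derived_iso[OF i(1), of v] euler_char_derived_iso[OF i(2), of v] euler_char_derived_iso[OF i(3), of v] by simp
    have "(\<Sum>v\<in>UNIV. c v * of_int (euler_char Z v)) = (\<Sum>v\<in>UNIV. c v * of_int (euler_char Y v)) - (\<Sum>v\<in>UNIV. c v * of_int (euler_char X v))"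
      by (simp only: e of_int_diff right_diff_distrib sum_subtractf)
    then show ?thesis using XY dist_triangle_bcomplex[OF d] by simp
  qed
  have sh: "shift p X \<in> ?S" if "X \<in> ?S" for p and X :: "'k cpx"
  proof -
    have "(\<Sum>v\<in>UNIV. c v * of_int (euler_char (shift p X) v)) = of_int (deg_sign p) * (\<Sum>v\<in>UNIV. c v * of_int (euler_char X v))"
      by (simp add: euler_char_shift sum_distrib_left mult.left_commute)
    then show ?thesis using that shift_bcomplex[of X p] by simp
  qed
  have di: "Y \<in> ?S" if "X \<in> ?S" "derived_iso X Y" for X Y :: "'k cpx"
    using that euler_char_derived_iso[OF that(2)] by (simp add: derived_iso_def)
  have z: "stalk rzero \<in> ?S" using stalk_bcomplex[OF rzero_is_rep] by (simp add: euler_char_stalk rzero_def)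
  show ?thesis unfolding triangulated_subcategory_def using tri sh di z by blast
qed

section \<open>Generation by the listed triples\<close>

text \<open>
  The sequences \<open>R \<rightarrow> E1 (m+1) \<rightarrow> E1 m\<close>, \<open>E2 0 \<rightarrow> R \<rightarrow> E1 0\<close> and \<open>E2 m \<rightarrow> E2 (m+1) \<rightarrow> R\<close> arrange \<open>E1\<close> and \<open>E2\<close> in one
  chain, in which membership passes to the neighbours in the presence of \<open>R\<close>; dually for \<open>E3\<close> and
  \<open>E4\<close>.
\<close>

lemma chain_mem:
  fixes S :: "'k::field cpx set"
  assumes S: "triangulated_subcategory S" and R: "stalk R \<in> S"
  shows "stalk (E1 m) \<in> S \<longleftrightarrow> stalk (E1 0) \<in> S" "stalk (E2 m) \<in> S \<longleftrightarrow> stalk (E1 0) \<in> S"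
    "stalk (E4 m) \<in> S \<longleftrightarrow> stalk (E4 0) \<in> S" "stalk (E3 m) \<in> S \<longleftrightarrow> stalk (E4 0) \<in> S"
proof -
  show "stalk (E1 m) \<in> S \<longleftrightarrow> stalk (E1 0) \<in> S"
    by (induction m) (use rep_ses_mem[OF S ses_R_E1] R in blast)+
  show "stalk (E4 m) \<in> S \<longleftrightarrow> stalk (E4 0) \<in> S"
    by (induction m) (use rep_ses_mem[OF S ses_R_E4] R in blast)+
  show "stalk (E2 m) \<in> S \<longleftrightarrow> stalk (E1 0) \<in> S"
    by (induction m) (use rep_ses_mem[OF S ses_E2_R] rep_ses_mem[OF S ses_E2_R_E1] R in blast)+
  show "stalk (E3 m) \<in> S \<longleftrightarrow> stalk (E4 0) \<in> S"
    by (induction m) (use rep_ses_mem[OF S ses_E3_R] rep_ses_mem[OF S ses_E3_R_E4] R in blast)+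
qed

lemma rep_ses_mem_iff:
  assumes S: "triangulated_subcategory S" and e: "rep_ses A X B"
  shows "(stalk A \<in> S \<longrightarrow> stalk X \<in> S \<longrightarrow> stalk B \<in> S) \<and> (stalk A \<in> S \<longrightarrow> stalk B \<in> S \<longrightarrow> stalk X \<in> S) \<and>
    (stalk X \<in> S \<longrightarrow> stalk B \<in> S \<longrightarrow> stalk A \<in> S)"
  using rep_ses_mem[OF S e] by metis

text \<open>
  The sequence \<open>M \<rightarrow> E4 0 \<rightarrow> E1 0\<close>, or \<open>M' \<rightarrow> E1 1 \<rightarrow> E4 0\<close>, links the two chains of \<open>chain_mem\<close>; afterwards the
  first of them yields \<open>M\<close>, and all simple representations are present.
\<close>

lemma generation:
  fixes S :: "'k::field cpx set"
  assumes S: "triangulated_subcategory S" and R: "stalk R \<in> S" and m: "stalk M \<in> S \<or> stalk M' \<in> S"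
    and E: "stalk (E1 n) \<in> S \<or> stalk (E2 n) \<in> S \<or> stalk (E3 n) \<in> S \<or> stalk (E4 n) \<in> S"
  shows "S = Collect bcomplex"
proof -
  note c = chain_mem[OF S R] and mem = rep_ses_mem_iff[OF S]
  have e: "stalk (E1 0) \<in> S \<or> stalk (E4 0) \<in> S" using E c by blast
  have both: "stalk (E1 0) \<in> S \<and> stalk (E4 0) \<in> S"
    using m
  proof
    assume "stalk M \<in> S"
    then show ?thesis using e mem[OF ses_M_E4_E1[of 0]] by metis
  next
    assume "stalk M' \<in> S"
    then show ?thesis using e c(1)[of "Suc 0"] mem[OF ses_M'_E1_E4[of 0]] by metis
  qed
  then have "stalk M \<in> S" using mem[OF ses_M_E4_E1[of 0]] by metis
  then show ?thesis using simples_generate[OF S] both c(4)[of 0] by blast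
qed

section \<open>The Euler form on the list\<close>

text \<open>
  Names for the listed representations. Unlike the representations themselves, labels are freely
  generated, so that coincidences between them can be decided by simplification.
\<close>

datatype label = L1 nat | L2 nat | L3 nat | L4 nat | LM | LM'

fun rep_of :: "label \<Rightarrow> 'k::field rep" where
  "rep_of (L1 m) = E1 m"
| "rep_of (L2 m) = E2 m"
| "rep_of (L3 m) = E3 m"
| "rep_of (L4 m) = E4 m"
| "rep_of LM = M"
| "rep_of LM' = M'"

fun label_euler :: "label \<Rightarrow> label \<Rightarrow> int" where
  "label_euler (L1 m) (L1 n) = int m - int n + 1"
| "label_euler (L1 m) (L2 n) = - int m - int n - 2"
| "label_euler (L1 m) (L3 n) = - int m - int n - 1"
| "label_euler (L1 m) (L4 n) = int m - int n"
| "label_euler (L1 m) LM = - 1"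
| "label_euler (L1 m) LM' = 0"
| "label_euler (L2 m) (L1 n) = int m + int n"
| "label_euler (L2 m) (L2 n) = int n - int m + 1"
| "label_euler (L2 m) (L3 n) = int n - int m"
| "label_euler (L2 m) (L4 n) = int m + int n + 1"
| "label_euler (L2 m) LM = 1"
| "label_euler (L2 m) LM' = 0"
| "label_euler (L3 m) (L1 n) = int m + int n"
| "label_euler (L3 m) (L2 n) = int n - int m + 1"
| "label_euler (L3 m) (L3 n) = int n - int m + 1"
| "label_euler (L3 m) (L4 n) = int m + int n"
| "label_euler (L3 m) LM = 0"
| "label_euler (L3 m) LM' = 1"
| "label_euler (L4 m) (L1 n) = int m - int n + 1"
| "label_euler (L4 m) (L2 n) = - int m - int n - 2"
| "label_euler (L4 m) (L3 n) = - int m - int n - 2"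
| "label_euler (L4 m) (L4 n) = int m - int n + 1"
| "label_euler (L4 m) LM = 0"
| "label_euler (L4 m) LM' = - 1"
| "label_euler LM (L1 n) = 0"
| "label_euler LM (L2 n) = 0"
| "label_euler LM (L3 n) = - 1"
| "label_euler LM (L4 n) = 1"
| "label_euler LM LM = 1"
| "label_euler LM LM' = - 1"
| "label_euler LM' (L1 n) = 1"
| "label_euler LM' (L2 n) = - 1"
| "label_euler LM' (L3 n) = 0"
| "label_euler LM' (L4 n) = 0"
| "label_euler LM' LM = - 1"
| "label_euler LM' LM' = 1"

lemma euler_rep_of: "euler (rep_of x) (rep_of y) = label_euler x y"
  by (cases x; cases y) (simp_all add: euler_def algebra_simps)

lemma rep_of_is_rep[simp]: "is_rep (rep_of x)"
  by (cases x) simp_all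

lemma rep_of_exceptional: "exceptional (rep_of x)"
  by (cases x) (simp_all add: exceptional_E)

lemma rhom_zero_of_dual:
  assumes "is_rep V" "is_rep W" "rhom (dual W) (dual V) = {mzero (dual W) (dual V)}"
  shows "rhom V W = {mzero V W}"
  using rhom_dual_zero[OF dual_is_rep[OF assms(2)] dual_is_rep[OF assms(1)] assms(3)] by simp

lemma hom_disjoint_E_zero:
  "rhom (E2 0) (E1 0) = {mzero (E2 0) (E1 0)}" "rhom (E3 0) (E1 0) = {mzero (E3 0) (E1 0)}"
  "rhom (E3 0) (E4 0) = {mzero (E3 0) (E4 0)}"
proof -
  show "rhom (E2 0) (E1 0) = {mzero (E2 0) (E1 0)}"
  proof (rule hom_disjoint_zero)
    show "rdim (E2 0) v = 0 \<or> rdim (E1 0) v = 0" for v by (cases v) simp_all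
  qed simp_all
  show "rhom (E3 0) (E1 0) = {mzero (E3 0) (E1 0)}"
  proof (rule hom_disjoint_zero)
    show "rdim (E3 0) v = 0 \<or> rdim (E1 0) v = 0" for v by (cases v) simp_all
  qed simp_all
  show "rhom (E3 0) (E4 0) = {mzero (E3 0) (E4 0)}"
  proof (rule hom_disjoint_zero)
    show "rdim (E3 0) v = 0 \<or> rdim (E4 0) v = 0" for v by (cases v) simp_all
  qed simp_all
qed

text \<open>
  The pairs on which the Euler form vanishes are checked against the computed spaces of morphisms, many of
  them by duality.
\<close>

lemma hom_zero_of_label_euler_zero:
  assumes "label_euler x y = 0"
  shows "rhom (rep_of x) (rep_of y) = {mzero (rep_of x) (rep_of y :: 'k::field rep)}"
proof -
  have d: "rhom V W = {mzero V W}" if "is_rep V" "is_rep W" "rhom (dual W) (dual V) = {mzero (dual W) (dual V)}" for V W :: "'k rep"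
    using rhom_zero_of_dual that by blast
  show ?thesis
  proof (cases x)
    case x: (L1 m)
    show ?thesis
    proof (cases y)
      case (L1 n)
      with assms x have "n = Suc m" by simp
      then show ?thesis unfolding x L1 by (simp add: hom_E1_E1_next)
    next
      case (L4 n)
      with assms x have "n = m" by simp
      then show ?thesis unfolding x L4 by (simp add: hom_E1_E4)
    next
      case LM' show ?thesis unfolding x LM' by (rule d) (simp_all add: hom_M'_zero)
    qed (use assms x in simp_all)
  next
    case x: (L2 m)
    show ?thesis
    proof (cases y)
      case (L1 n)
      with assms x have "m = 0" "n = 0" by simp_all
      then show ?thesis unfolding x L1 by (simp add: hom_disjoint_E_zero)
    next
      case (L2 n)
      with assms x have "m = Suc n" by simp
      then show ?thesis unfolding x L2 by - (rule d; simp add: hom_E4_E4_next)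
    next
      case (L3 n)
      with assms x have "m = n" by simp
      then show ?thesis unfolding x L3 by - (rule d; simp add: hom_E1_E4)
    next
      case LM' show ?thesis unfolding x LM' by (rule d) (simp_all add: hom_M'_zero)
    qed (use assms x in simp_all)
  next
    case x: (L3 m)
    show ?thesis
    proof (cases y)
      case (L1 n)
      with assms x have "m = 0" "n = 0" by simp_all
      then show ?thesis unfolding x L1 by (simp add: hom_disjoint_E_zero)
    next
      case (L2 n)
      with assms x have "m = Suc n" by simp
      then show ?thesis unfolding x L2 by - (rule d; simp add: hom_E4_E1_next)
    next
      case (L3 n)
      with assms x have "m = Suc n" by simp
      then show ?thesis unfolding x L3 by - (rule d; simp add: hom_E1_E1_next)
    next
      case (L4 n)
      with assms x have "m = 0" "n = 0" by simp_all
      then show ?thesis unfolding x L4 by (simp add: hom_disjoint_E_zero)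
    next
      case LM show ?thesis unfolding x LM by (rule d) (simp_all add: hom_M_zero)
    qed (use assms x in simp_all)
  next
    case x: (L4 m)
    show ?thesis
    proof (cases y)
      case (L1 n)
      with assms x have "n = Suc m" by simp
      then show ?thesis unfolding x L1 by (simp add: hom_E4_E1_next)
    next
      case (L4 n)
      with assms x have "n = Suc m" by simp
      then show ?thesis unfolding x L4 by (simp add: hom_E4_E4_next)
    next
      case LM show ?thesis unfolding x LM by (rule d) (simp_all add: hom_M_zero)
    qed (use assms x in simp_all)
  next
    case LM
    with assms show ?thesis by (cases y) (simp_all add: hom_M_zero)
  next
    case LM'
    with assms show ?thesis by (cases y) (simp_all add: hom_M'_zero)
  qed
qed

lemma all_ext_vanish_labels:
  "(\<forall>p. ext_vanishes p (rep_of x) (rep_of y :: 'k::field rep)) \<longleftrightarrow> label_euler x y = 0"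
proof -
  have "rhom (rep_of x) (rep_of y) = {mzero (rep_of x) (rep_of y :: 'k rep)} \<and> ext_free (rep_of x) (rep_of y :: 'k rep) \<longleftrightarrow> label_euler x y = 0"
    using ext_free_iff_euler_zero[OF rep_of_is_rep rep_of_is_rep, of x y] hom_zero_of_label_euler_zero[of x y] euler_rep_of[of x y]
    by metis
  then show ?thesis using all_ext_vanish_iff[OF rep_of_is_rep rep_of_is_rep] by blast
qed

section \<open>Triples with vanishing Euler form\<close>

definition listed :: "nat \<Rightarrow> label list set" where
  "listed m = {
       [L1 (m+1), L1 m, LM], [L1 (m+1), L4 m, L1 m], [L1 (m+1), LM, L4 m],
       [L1 0, L2 0, LM], [L1 0, L3 0, L2 0], [L1 0, LM, L3 0],
       [L2 m, L2 (m+1), LM], [L2 m, L3 (m+1), L2 (m+1)], [L2 m, LM, L3 (m+1)],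
       [L3 m, L2 m, L3 (m+1)], [L3 m, L3 (m+1), LM'], [L3 m, LM', L2 m],
       [L4 (m+1), L4 m, LM'], [L4 (m+1), L1 (m+1), L4 m], [L4 (m+1), LM', L1 (m+1)],
       [L4 0, L1 0, L3 0], [L4 0, L3 0, LM'], [L4 0, LM', L1 0],
       [LM, L3 m, L3 (m+1)], [LM, L4 (m+1), L4 m], [LM, L4 0, L3 0],
       [LM', L1 (m+1), L1 m], [LM', L2 m, L2 (m+1)], [LM', L1 0, L2 0]}"

lemma listed_orthogonal:
  assumes "Ls \<in> listed m"
  shows "\<exists>x y z. Ls = [x, y, z] \<and> label_euler y x = 0 \<and> label_euler z x = 0 \<and> label_euler z y = 0"
  using assms by (auto simp: listed_def)

text \<open>
  A finite case distinction over the kinds of the three labels; in each case the conditions are linear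
  equations between the parameters.
\<close>

lemma orthogonal_listed:
  assumes "label_euler y x = 0" "label_euler z x = 0" "label_euler z y = 0"
  shows "\<exists>m. [x, y, z] \<in> listed m"
proof -
  have a: "n = Suc m" if "int m - int n + 1 = 0" for m n using that by simp
  have b: "m = n" if "int m - int n = 0" for m n using that by simp
  show ?thesis using assms unfolding listed_def
    by (cases x; cases y; cases z) (auto dest!: a b simp: gr0_conv_Suc)
qed

text \<open>
  Each triple contains two terms of some sequence with \<open>R\<close>, and two terms of some sequence with \<open>M\<close> or
  \<open>M'\<close>, possibly after adjoining the third term of another sequence. The deductions only use the sequences
  with parameters \<open>m\<close>, \<open>m + 1\<close> and \<open>0\<close> and are propositional.
\<close>

lemma listed_generates:
  fixes S :: "'k::field cpx set"
  assumes S: "triangulated_subcategory S" and L: "Ls \<in> listed m" and sub: "stalk ` set (map rep_of Ls) \<subseteq> S"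
  shows "S = Collect bcomplex"
proof -
  define P :: "'k rep \<Rightarrow> bool" where "P A \<longleftrightarrow> stalk A \<in> S" for A
  note rule = rep_ses_mem_iff[OF S, folded P_def]
  note rules = rule[OF ses_R_E1[of m]] rule[OF ses_R_E4[of m]] rule[OF ses_E2_R[of m]] rule[OF ses_E3_R[of m]] rule[OF ses_E2_R_E1] rule[OF ses_E3_R_E4]
    rule[OF ses_M_E4_E1[of m]] rule[OF ses_M_E4_E1[of "Suc m"]] rule[OF ses_M_E4_E1[of 0]]
    rule[OF ses_E3_E2_M[of m]] rule[OF ses_E3_E2_M[of "Suc m"]] rule[OF ses_E3_E2_M[of 0]]
    rule[OF ses_M'_E1_E4[of m]] rule[OF ses_E2_E3_M'[of m]] rule[OF ses_E3_M'_E1]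
  have "\<forall>x\<in>set Ls. P (rep_of x)" using sub by (auto simp: P_def)
  then have "P R \<and> (P M \<or> P M') \<and> (P (E1 (Suc m)) \<or> P (E1 0) \<or> P (E2 m) \<or> P (E3 m) \<or> P (E4 (Suc m)) \<or> P (E4 0))"
    using L unfolding listed_def
    by (elim insertE emptyE; simp only: list.set ball_simps rep_of.simps Suc_eq_plus1[symmetric]) (use rules in sat)+
  then show ?thesis using generation[OF S] unfolding P_def by blast
qed

section \<open>The length of a full exceptional collection\<close>

lemma euler_linear:
  "(of_int (euler V W) :: rat) = of_nat (rdim W Vb) * of_nat (rdim V Vb)
     + of_nat (rdim W Vmid) * (of_nat (rdim V Vmid) - of_nat (rdim V Vb))
     + of_nat (rdim W Ve) * (of_nat (rdim V Ve) - of_nat (rdim V Vb) - of_nat (rdim V Vmid))"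
  by (simp add: euler_def algebra_simps)

text \<open>
  A Gram matrix with ones on the diagonal and zeros on one side of it is invertible, so the dimension
  vectors are independent: pairing a relation with the last vector that occurs in it isolates the
  coefficient of that vector.
\<close>

lemma orthogonal_length_le:
  fixes Bs :: "'k::field rep list"
  assumes one: "\<And>i. i < length Bs \<Longrightarrow> euler (Bs ! i) (Bs ! i) = 1"
    and zero: "\<And>i j. j < i \<Longrightarrow> i < length Bs \<Longrightarrow> euler (Bs ! i) (Bs ! j) = 0"
  shows "length Bs \<le> 3"
proof (rule ccontr)
  let ?I = "{..<length Bs}"
  assume "\<not> length Bs \<le> 3"
  then have card: "card (UNIV :: vertex set) < card ?I" by (simp add: UNIV_vertex)
  have fin: "finite (UNIV :: vertex set)" "finite ?I" by (simp_all add: UNIV_vertex)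
  obtain x :: "nat \<Rightarrow> rat" where x: "\<exists>i\<in>?I. x i \<noteq> 0"
    and lin: "\<And>v. (\<Sum>i\<in>?I. of_nat (rdim (Bs ! i) v) * x i) = 0"
    using homogeneous_system_nontrivial[OF fin card, of "\<lambda>v i. of_nat (rdim (Bs ! i) v) :: rat"] by blast
  define k where "k = Max {i \<in> ?I. x i \<noteq> 0}"
  have fin: "finite {i \<in> ?I. x i \<noteq> 0}" "{i \<in> ?I. x i \<noteq> 0} \<noteq> {}" using x by auto
  have k: "k < length Bs" "x k \<noteq> 0" using Max_in[OF fin] unfolding k_def by auto
  have above: "x i = 0" if "i < length Bs" "k < i" for i
  proof (rule ccontr)
    assume "x i \<noteq> 0"
    then have "i \<le> k" unfolding k_def using that(1) fin(1) by (intro Max_ge) auto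
    then show False using that(2) by simp
  qed
  let ?c = "of_nat (rdim (Bs ! k) Vb) :: rat" and ?d = "of_nat (rdim (Bs ! k) Vmid) - of_nat (rdim (Bs ! k) Vb) :: rat"
    and ?e = "of_nat (rdim (Bs ! k) Ve) - of_nat (rdim (Bs ! k) Vb) - of_nat (rdim (Bs ! k) Vmid) :: rat"
  have "(\<Sum>i\<in>?I. of_int (euler (Bs ! k) (Bs ! i)) * x i) =
      (\<Sum>i\<in>?I. of_nat (rdim (Bs ! i) Vb) * x i) * ?c + (\<Sum>i\<in>?I. of_nat (rdim (Bs ! i) Vmid) * x i) * ?d
      + (\<Sum>i\<in>?I. of_nat (rdim (Bs ! i) Ve) * x i) * ?e"
    unfolding sum_distrib_right sum.distrib[symmetric] euler_linear by (rule sum.cong) (simp_all add: algebra_simps)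
  also have "\<dots> = 0" by (simp add: lin)
  finally have "(\<Sum>i\<in>?I. of_int (euler (Bs ! k) (Bs ! i)) * x i) = 0" .
  moreover have "(\<Sum>i\<in>?I. of_int (euler (Bs ! k) (Bs ! i)) * x i) = (\<Sum>i\<in>?I. if i = k then x k else 0)"
  proof (rule sum.cong)
    fix i assume "i \<in> ?I"
    then show "of_int (euler (Bs ! k) (Bs ! i)) * x i = (if i = k then x k else 0)"
      using one[OF k(1)] zero[of i k] k(1) above[of i] by (cases i k rule: linorder_cases) auto
  qed simp
  ultimately show False using k by simp
qed

text \<open>
  Fewer than three dimension vectors are annihilated by a nonzero linear form. The subcategory of
  \<open>linear_form_subcategory\<close> contains the collection, hence all complexes, so the form vanishes on the simple
  representations.
\<close>

lemma full_collection_length_ge: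
  fixes As :: "'k::field rep list"
  assumes full: "full_exceptional_collection As"
  shows "3 \<le> length As"
proof (rule ccontr)
  assume "\<not> 3 \<le> length As"
  then have "card (set As) < card (UNIV :: vertex set)" using card_length[of As] by (simp add: UNIV_vertex)
  then obtain c :: "vertex \<Rightarrow> rat" where c: "\<exists>v. c v \<noteq> 0" "\<And>A. A \<in> set As \<Longrightarrow> (\<Sum>v\<in>UNIV. of_nat (rdim A v) * c v) = 0"
    using homogeneous_system_nontrivial[of "set As" "UNIV :: vertex set" "\<lambda>A v. of_nat (rdim A v) :: rat"] by (auto simp: UNIV_vertex)
  let ?S = "{X :: 'k cpx. bcomplex X \<and> (\<Sum>v\<in>UNIV. c v * of_int (euler_char X v)) = 0}"
  have "stalk ` set As \<subseteq> ?S"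
  proof
    fix X assume "X \<in> stalk ` set As"
    then obtain A where A: "A \<in> set As" "X = stalk A" by blast
    have "is_rep A" using full A(1) by (auto simp: full_exceptional_collection_def exceptional_collection_def exceptional_def)
    then show "X \<in> ?S" using c(2)[OF A(1)] stalk_bcomplex by (simp add: A(2) euler_char_stalk mult.commute)
  qed
  then have all: "?S = Collect bcomplex" using full linear_form_subcategory[of c] unfolding full_exceptional_collection_def by blast
  have "(\<Sum>v\<in>UNIV. c v * of_nat (rdim A v)) = 0" if "is_rep A" for A :: "'k rep"
  proof -
    have "stalk A \<in> ?S" unfolding all using stalk_bcomplex[OF that] by simp
    then show ?thesis by (simp add: euler_char_stalk)
  qed
  from this[of "E1 0"] this[of M] this[of "E3 0"] have "c v = 0" for v by (cases v) (simp_all add: UNIV_vertex)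
  then show False using c(1) by simp
qed

section \<open>Full exceptional collections\<close>

lemma exceptional_label:
  assumes "exceptional (A :: 'k::alg_closed_field rep)"
  shows "\<exists>x. rep_iso A (rep_of x)"
proof -
  obtain X m where "rep_iso A X" "X \<in> {E1 m, E2 m, E3 m, E4 m, M, M'}" using exceptional_classification[OF assms] by blast
  then show ?thesis using rep_of.simps by (metis insertE singletonD)
qed

text \<open>
  All notions involved are invariant under isomorphism, so that only lists of standard representations have to
  be considered.
\<close>

lemma full_exceptional_collection_iso:
  assumes iso: "list_all2 rep_iso As Bs" and full: "full_exceptional_collection As"
  shows "full_exceptional_collection Bs"
proof -
  have len: "length As = length Bs" and nth: "rep_iso (As ! i) (Bs ! i)" if "i < length Bs" for i
    using iso that by (auto simp: list_all2_conv_all_nth)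
  have len: "length As = length Bs" using iso by (rule list_all2_lengthD)
  have ec: "exceptional_collection As" and gen: "\<And>S. triangulated_subcategory S \<Longrightarrow> stalk ` set As \<subseteq> S \<Longrightarrow> S = Collect bcomplex"
    using full by (auto simp: full_exceptional_collection_def)
  have "Bs \<noteq> []" using ec len by (auto simp: exceptional_collection_def)
  moreover have "exceptional B" if "B \<in> set Bs" for B
  proof -
    obtain i where i: "i < length Bs" "B = Bs ! i" using \<open>B \<in> set Bs\<close> by (auto simp: in_set_conv_nth)
    have "exceptional (As ! i)" using ec i len by (simp add: exceptional_collection_def)
    then show ?thesis unfolding i(2) by (rule exceptional_iso[OF nth[OF i(1)]])
  qed
  moreover have "ext_vanishes p (Bs ! i) (Bs ! j)" if "j < i" "i < length Bs" for i j p
  proof -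
    have "\<forall>p. ext_vanishes p (As ! i) (As ! j)" using ec that len by (simp add: exceptional_collection_def)
    then show ?thesis using all_ext_vanish_iso[OF nth[OF that(2)] nth[of j]] that by (meson less_trans)
  qed
  ultimately have "exceptional_collection Bs" unfolding exceptional_collection_def by blast
  moreover have "S = Collect bcomplex" if S: "triangulated_subcategory S" and sub: "stalk ` set Bs \<subseteq> S" for S
  proof (rule gen[OF S], rule subsetI)
    fix X assume "X \<in> stalk ` set As"
    then obtain i where i: "i < length Bs" "X = stalk (As ! i)" using len by (auto simp: in_set_conv_nth)
    have "stalk (Bs ! i) \<in> S" using sub i(1) by auto
    then show "X \<in> S" unfolding i(2) by (rule rep_iso_mem[OF S rep_iso_sym[OF nth[OF i(1)]]])
  qed
  ultimately show ?thesis unfolding full_exceptional_collection_def by blast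
qed

lemma full_exceptional_labels:
  "full_exceptional_collection (map rep_of Ls :: 'k::field rep list) \<longleftrightarrow> (\<exists>m. Ls \<in> listed m)"
proof
  let ?Bs = "map rep_of Ls :: 'k rep list"
  assume full: "full_exceptional_collection ?Bs"
  have o: "label_euler (Ls ! i) (Ls ! j) = 0" if "j < i" "i < length Ls" for i j
  proof -
    have "ext_vanishes p (?Bs ! i) (?Bs ! j)" for p
      using full that by (simp add: full_exceptional_collection_def exceptional_collection_def del: nth_map)
    then have "\<forall>p. ext_vanishes p (rep_of (Ls ! i)) (rep_of (Ls ! j) :: 'k rep)" using that by simp
    then show ?thesis unfolding all_ext_vanish_labels .
  qed
  have "label_euler x x = 1" for x by (cases x) simp_all
  then have "length ?Bs \<le> 3" by (intro orthogonal_length_le) (simp_all add: euler_rep_of o)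
  then have "length Ls = 3" using full_collection_length_ge[OF full] by simp
  then obtain x y z where xyz: "Ls = [x, y, z]" by (auto simp: length_Suc_conv numeral_3_eq_3)
  show "\<exists>m. Ls \<in> listed m" unfolding xyz
    using o[of 0 1] o[of 0 2] o[of 1 2] by (intro orthogonal_listed) (simp_all add: xyz)
next
  assume "\<exists>m. Ls \<in> listed m"
  then obtain m where m: "Ls \<in> listed m" by blast
  obtain x y z where xyz: "Ls = [x, y, z]" and o: "label_euler y x = 0" "label_euler z x = 0" "label_euler z y = 0"
    using listed_orthogonal[OF m] by blast
  have "ext_vanishes p (map rep_of Ls ! i) (map rep_of Ls ! j :: 'k rep)" if "j < i" "i < length (map rep_of Ls :: 'k rep list)" for i j p
  proof -
    have "i = 1 \<and> j = 0 \<or> i = 2 \<and> j = 0 \<or> i = 2 \<and> j = 1" using that by (simp add: xyz) linarith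
    then have "label_euler (Ls ! i) (Ls ! j) = 0" using o by (auto simp: xyz)
    then show ?thesis using all_ext_vanish_labels that by auto
  qed
  then have "exceptional_collection (map rep_of Ls :: 'k rep list)"
    unfolding exceptional_collection_def by (auto simp: xyz rep_of_exceptional)
  then show "full_exceptional_collection (map rep_of Ls :: 'k rep list)"
    unfolding full_exceptional_collection_def using listed_generates[OF _ m] by blast
qed

theorem corollary2p9:
  fixes As :: "'k::alg_closed_field rep list"
  shows "full_exceptional_collection As \<longleftrightarrow>
    (\<exists>m. \<exists>Bs \<in> {
       [E1 (m+1), E1 m, M], [E1 (m+1), E4 m, E1 m], [E1 (m+1), M, E4 m],
       [E1 0, E2 0, M], [E1 0, E3 0, E2 0], [E1 0, M, E3 0],
       [E2 m, E2 (m+1), M], [E2 m, E3 (m+1), E2 (m+1)], [E2 m, M, E3 (m+1)],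
       [E3 m, E2 m, E3 (m+1)], [E3 m, E3 (m+1), M'], [E3 m, M', E2 m],
       [E4 (m+1), E4 m, M'], [E4 (m+1), E1 (m+1), E4 m], [E4 (m+1), M', E1 (m+1)],
       [E4 0, E1 0, E3 0], [E4 0, E3 0, M'], [E4 0, M', E1 0],
       [M, E3 m, E3 (m+1)], [M, E4 (m+1), E4 m], [M, E4 0, E3 0],
       [M', E1 (m+1), E1 m], [M', E2 m, E2 (m+1)], [M', E1 0, E2 0]}.
     list_all2 rep_iso As Bs)" (is "_ \<longleftrightarrow> (\<exists>m. \<exists>Bs\<in>?B m. _)")
proof -
  have B: "?B m = map rep_of ` listed m" for m by (simp add: listed_def)
  have "full_exceptional_collection As \<longleftrightarrow> (\<exists>Ls. list_all2 rep_iso As (map rep_of Ls) \<and> full_exceptional_collection (map rep_of Ls :: 'k rep list))"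
  proof
    assume full: "full_exceptional_collection As"
    then have "\<forall>A\<in>set As. \<exists>x. rep_iso A (rep_of x)"
      using exceptional_label by (auto simp: full_exceptional_collection_def exceptional_collection_def)
    then obtain l where l: "\<And>A. A \<in> set As \<Longrightarrow> rep_iso A (rep_of (l A))" by metis
    have "list_all2 rep_iso As (map rep_of (map l As))" using l by (auto simp: list_all2_conv_all_nth)
    then show "\<exists>Ls. list_all2 rep_iso As (map rep_of Ls) \<and> full_exceptional_collection (map rep_of Ls :: 'k rep list)"
      using full_exceptional_collection_iso[OF _ full] by blast
  next
    assume "\<exists>Ls. list_all2 rep_iso As (map rep_of Ls) \<and> full_exceptional_collection (map rep_of Ls :: 'k rep list)"
    then obtain Bs where Bs: "list_all2 rep_iso As Bs" "full_exceptional_collection Bs" by blast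
    then have "list_all2 rep_iso Bs As" by (auto simp: list_all2_conv_all_nth intro: rep_iso_sym)
    then show "full_exceptional_collection As" using Bs(2) by (rule full_exceptional_collection_iso)
  qed
  then show ?thesis unfolding B full_exceptional_labels by blast
qed

end
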